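(* (Tangential cone condition for reaction law identification with full data.) In the setting described in the context, suppose $\Pi_\dagger\in X\cap W^{2,\infty}(\mathbb R)$ and that, for all $\Pi$ in some fixed ball of $X$ around $\Pi_\dagger$ and all $u$ in some fixed ball of $\mathcal V$ around $u^\dagger=S(\Pi_\dagger)$, with positive constants $\overline M_S$, $C_{f_u}$ independent of $\Pi,u$, the following hold: the derivative of $S$ is bounded, $\|S'(\Pi)\|_{X\to\mathcal V}\le\overline M_S$; and the solution of the adjoint linearized equation $-\dot z-\nabla\cdot(a\nabla z)+bz+\Pi'(u)z=h$, $z(T)=0$, depends continuously on the source, $\|z\|_{\mathcal U}+\|z(0)\|_H\le C_{f_u}\|h\|_{\mathcal U^*}$. Then, for sufficiently small radius $R>0$, there is a constant $C_{tc}<1$ such that $$\|S(\Pi)-S(\Pi_\dagger)-S'(\Pi)(\Pi-\Pi_\dagger)\|_{\mathcal Y}\le C_{tc}\,\|S(\Pi)-S(\Pi_\dagger)\|_{\mathcal Y}\qquad\text{for all }\Pi\in B_R(\Pi_\dagger),$$ where $B_R(\Pi_\dagger)$ is the ball of radius $R$ in $X$ around $\Pi_\dagger$.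
   Context: $\Omega\subset\mathbb R^d$, $d\in\{1,2,3\}$, is a bounded Lipschitz domain, $T>0$, $U=H^1_0(\Omega)$, $H=L^2(\Omega)$, $\mathcal U=L^2(0,T;U)$, $\mathcal U^*=L^2(0,T;U^* )$, $\mathcal V=\{u\in\mathcal U:\dot u\in\mathcal U^*\}=L^2(0,T;U)\cap H^1(0,T;U^* )$, $\mathcal Y=L^2(0,T;L^2(\Omega))$. The parameter space is $X=H^s(\mathbb R)$ with $s>1$ such that $H^s(\mathbb R)\hookrightarrow W^{1,\infty}(\mathbb R)$ continuously. Data: $0<a\in L^\infty(\Omega)$, $b\in L^2(\Omega)$, $\phi\in\mathcal U^*$, $u_0\in H$. A reaction law $\Pi\in X$ acts as a superposition operator $[\Pi(u)](t,x)=\Pi(u(t,x))$. The parameter-to-state map $S:X\to\mathcal V$, $\Pi\mapsto u$, is given by the solution (assumed to exist) of $$\dot u-\nabla\cdot(a\nabla u)+bu+\Pi(u)=\phi\ \text{ in }(0,T)\times\Omega,\qquad u(0)=u_0,$$ with zero Dirichlet boundary conditions. $S$ is assumed Fréchet differentiable, with $S'(\Pi)\xi=p$, where $p$ solves $\dot p-\nabla\cdot(a\nabla p)+bp+\Pi'(u)p=-\xi(u)$, $p(0)=0$, $u=S(\Pi)$. The observation operator is the identity (full measurement). $\Pi_\dagger$ is the exact reaction law and $u^\dagger=S(\Pi_\dagger)$. *)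

theory Defs
  imports "HOL-Probability.Essential_Supremum" "HOL-Library.Function_Algebras"
begin

text \<open>
  All function spaces are sets of functions (representatives) together with a seminorm; the
  elements of the Banach space in the literature are the classes of functions at distance 0.
\<close>

instantiation "fun" :: (type, real_vector) real_vector
begin

definition scaleR_fun :: "real \<Rightarrow> ('a \<Rightarrow> 'b) \<Rightarrow> 'a \<Rightarrow> 'b"
  where "scaleR_fun c f = (\<lambda>x. c *\<^sub>R f x)"

instance
  by standard (auto simp: scaleR_fun_def plus_fun_def fun_eq_iff scaleR_add_right scaleR_add_left)

end


section \<open>Seminormed spaces given by a carrier and a seminorm\<close>

definition ball_in :: "'v::real_vector set \<Rightarrow> ('v \<Rightarrow> real) \<Rightarrow> 'v \<Rightarrow> real \<Rightarrow> 'v set"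
  where "ball_in X N x r = {y \<in> X. N (y - x) < r}"

definition continuously_embedded ::
    "'v::real_vector set \<Rightarrow> ('v \<Rightarrow> real) \<Rightarrow> 'v set \<Rightarrow> ('v \<Rightarrow> real) \<Rightarrow> bool"
  where "continuously_embedded X NX Y NY \<longleftrightarrow> X \<subseteq> Y \<and> (\<exists>K. \<forall>x\<in>X. NY x \<le> K * NX x)"

definition bounded_linear_between ::
    "'v::real_vector set \<Rightarrow> ('v \<Rightarrow> real) \<Rightarrow> 'w::real_vector set \<Rightarrow> ('w \<Rightarrow> real) \<Rightarrow> ('v \<Rightarrow> 'w) \<Rightarrow> bool"
  where "bounded_linear_between X NX Y NY A \<longleftrightarrow>
    (\<forall>x\<in>X. A x \<in> Y) \<and>
    (\<forall>x\<in>X. \<forall>y\<in>X. NY (A (x + y) - (A x + A y)) = 0) \<and>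
    (\<forall>c. \<forall>x\<in>X. NY (A (c *\<^sub>R x) - c *\<^sub>R A x) = 0) \<and>
    (\<exists>K. \<forall>x\<in>X. NY (A x) \<le> K * NX x)"

definition op_norm ::
    "'v::real_vector set \<Rightarrow> ('v \<Rightarrow> real) \<Rightarrow> ('w \<Rightarrow> real) \<Rightarrow> ('v \<Rightarrow> 'w) \<Rightarrow> real"
  where "op_norm X NX NY A = Sup {NY (A x) | x. x \<in> X \<and> NX x \<le> 1}"

definition has_frechet_derivative_at ::
    "'v::real_vector set \<Rightarrow> ('v \<Rightarrow> real) \<Rightarrow> 'w::real_vector set \<Rightarrow> ('w \<Rightarrow> real) \<Rightarrow>
      ('v \<Rightarrow> 'w) \<Rightarrow> ('v \<Rightarrow> 'w) \<Rightarrow> 'v \<Rightarrow> bool"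
  where "has_frechet_derivative_at X NX Y NY F D x \<longleftrightarrow>
    bounded_linear_between X NX Y NY D \<and>
    (\<forall>\<epsilon>>0. \<exists>\<delta>>0. \<forall>h\<in>X. NX h < \<delta> \<longrightarrow> NY (F (x + h) - F x - D h) \<le> \<epsilon> * NX h)"

definition dual_space :: "'v::real_vector set \<Rightarrow> ('v \<Rightarrow> real) \<Rightarrow> ('v \<Rightarrow> real) set"
  where "dual_space X N = {l. bounded_linear_between X N UNIV abs l}"

definition dual_norm :: "'v::real_vector set \<Rightarrow> ('v \<Rightarrow> real) \<Rightarrow> ('v \<Rightarrow> real) \<Rightarrow> real"
  where "dual_norm X N = op_norm X N abs"


section \<open>The Bochner space \<open>L\<^sup>2(0,T;X)\<close>\<close>

definition simple_on :: "real \<Rightarrow> 'v set \<Rightarrow> (real \<Rightarrow> 'v) \<Rightarrow> bool"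
  where "simple_on T X s \<longleftrightarrow> finite (s ` {0<..<T}) \<and> s ` {0<..<T} \<subseteq> X \<and>
    (\<forall>y. {t \<in> {0<..<T}. s t = y} \<in> sets lebesgue)"

definition strongly_measurable ::
    "real \<Rightarrow> 'v::real_vector set \<Rightarrow> ('v \<Rightarrow> real) \<Rightarrow> (real \<Rightarrow> 'v) \<Rightarrow> bool"
  where "strongly_measurable T X N u \<longleftrightarrow>
    (\<exists>s :: nat \<Rightarrow> real \<Rightarrow> 'v. (\<forall>n. simple_on T X (s n)) \<and>
      (AE t in lebesgue_on {0<..<T}. (\<lambda>n. N (s n t - u t)) \<longlonglongrightarrow> 0))"

definition bochner_L2 ::
    "real \<Rightarrow> 'v::real_vector set \<Rightarrow> ('v \<Rightarrow> real) \<Rightarrow> (real \<Rightarrow> 'v) set"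
  where "bochner_L2 T X N = {u. (AE t in lebesgue_on {0<..<T}. u t \<in> X) \<and>
    strongly_measurable T X N u \<and> integrable (lebesgue_on {0<..<T}) (\<lambda>t. (N (u t))\<^sup>2)}"

definition bochner_L2_norm :: "real \<Rightarrow> ('v \<Rightarrow> real) \<Rightarrow> (real \<Rightarrow> 'v) \<Rightarrow> real"
  where "bochner_L2_norm T N u = sqrt (LINT t|lebesgue_on {0<..<T}. (N (u t))\<^sup>2)"


section \<open>Lipschitz domains, Lebesgue and Sobolev spaces\<close>

text \<open>Near each boundary point the domain is the strict epigraph, in some direction \<open>e\<close>, of a
  Lipschitz function on the hyperplane orthogonal to \<open>e\<close>.\<close>

definition lipschitz_domain :: "'a::euclidean_space set \<Rightarrow> bool"
  where "lipschitz_domain \<Omega> \<longleftrightarrow> \<Omega> \<noteq> {} \<and> open \<Omega> \<and> connected \<Omega> \<and>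
    (\<forall>x0 \<in> frontier \<Omega>. \<exists>e r L \<gamma>. norm e = 1 \<and> r > 0 \<and> L-lipschitz_on {y. y \<bullet> e = 0} \<gamma> \<and>
      (\<forall>x \<in> ball x0 r. x \<in> \<Omega> \<longleftrightarrow> \<gamma> (x - (x \<bullet> e) *\<^sub>R e) < x \<bullet> e))"

primrec Ck :: "nat \<Rightarrow> ('a::euclidean_space \<Rightarrow> real) \<Rightarrow> bool" where
  "Ck 0 = (\<lambda>f. continuous_on UNIV f)"
| "Ck (Suc k) = (\<lambda>f. (\<forall>x. f differentiable (at x)) \<and>
    (\<forall>i\<in>Basis. Ck k (\<lambda>x. frechet_derivative f (at x) i)))"

definition test_functions :: "'a::euclidean_space set \<Rightarrow> ('a \<Rightarrow> real) set"
  where "test_functions \<Omega> = {\<psi>. (\<forall>k. Ck k \<psi>) \<and>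
    compact (closure {x. \<psi> x \<noteq> 0}) \<and> closure {x. \<psi> x \<noteq> 0} \<subseteq> \<Omega>}"

definition L2 :: "'a::euclidean_space set \<Rightarrow> ('a \<Rightarrow> real) set"
  where "L2 \<Omega> = {f \<in> borel_measurable (lebesgue_on \<Omega>). integrable (lebesgue_on \<Omega>) (\<lambda>x. (f x)\<^sup>2)}"

definition L2_norm :: "'a::euclidean_space set \<Rightarrow> ('a \<Rightarrow> real) \<Rightarrow> real"
  where "L2_norm \<Omega> f = sqrt (LINT x|lebesgue_on \<Omega>. (f x)\<^sup>2)"

definition Linf :: "'a::euclidean_space set \<Rightarrow> ('a \<Rightarrow> real) set"
  where "Linf \<Omega> = {f \<in> borel_measurable (lebesgue_on \<Omega>).
    esssup (lebesgue_on \<Omega>) (\<lambda>x. ereal \<bar>f x\<bar>) < \<infinity>}"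

definition Linf_norm :: "'a::euclidean_space set \<Rightarrow> ('a \<Rightarrow> real) \<Rightarrow> real"
  where "Linf_norm \<Omega> f = real_of_ereal (esssup (lebesgue_on \<Omega>) (\<lambda>x. ereal \<bar>f x\<bar>))"

definition is_weak_partial ::
    "'a::euclidean_space set \<Rightarrow> 'a \<Rightarrow> ('a \<Rightarrow> real) \<Rightarrow> ('a \<Rightarrow> real) \<Rightarrow> bool"
  where "is_weak_partial \<Omega> i u g \<longleftrightarrow> (\<forall>\<psi> \<in> test_functions \<Omega>.
    (LINT x|lebesgue_on \<Omega>. u x * frechet_derivative \<psi> (at x) i) =
    - (LINT x|lebesgue_on \<Omega>. g x * \<psi> x))"

definition is_L2_gradient ::
    "'a::euclidean_space set \<Rightarrow> ('a \<Rightarrow> real) \<Rightarrow> ('a \<Rightarrow> 'a) \<Rightarrow> bool"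
  where "is_L2_gradient \<Omega> u G \<longleftrightarrow>
    (\<forall>i\<in>Basis. (\<lambda>x. G x \<bullet> i) \<in> L2 \<Omega> \<and> is_weak_partial \<Omega> i u (\<lambda>x. G x \<bullet> i))"

text \<open>Weak derivatives are unique up to null sets; the choice of representative is immaterial.\<close>

definition weak_grad :: "'a::euclidean_space set \<Rightarrow> ('a \<Rightarrow> real) \<Rightarrow> 'a \<Rightarrow> 'a"
  where "weak_grad \<Omega> u = (SOME G. is_L2_gradient \<Omega> u G)"

definition H1 :: "'a::euclidean_space set \<Rightarrow> ('a \<Rightarrow> real) set"
  where "H1 \<Omega> = {u \<in> L2 \<Omega>. \<exists>G. is_L2_gradient \<Omega> u G}"

definition H1_norm :: "'a::euclidean_space set \<Rightarrow> ('a \<Rightarrow> real) \<Rightarrow> real"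
  where "H1_norm \<Omega> u = sqrt ((L2_norm \<Omega> u)\<^sup>2 + (LINT x|lebesgue_on \<Omega>. (norm (weak_grad \<Omega> u x))\<^sup>2))"

definition H10 :: "'a::euclidean_space set \<Rightarrow> ('a \<Rightarrow> real) set"
  where "H10 \<Omega> = {u \<in> H1 \<Omega>. \<forall>\<epsilon>>0. \<exists>\<psi> \<in> test_functions \<Omega>. H1_norm \<Omega> (u - \<psi>) < \<epsilon>}"

abbreviation H10_dual :: "'a::euclidean_space set \<Rightarrow> (('a \<Rightarrow> real) \<Rightarrow> real) set"
  where "H10_dual \<Omega> \<equiv> dual_space (H10 \<Omega>) (H1_norm \<Omega>)"

abbreviation H10_dual_norm :: "'a::euclidean_space set \<Rightarrow> (('a \<Rightarrow> real) \<Rightarrow> real) \<Rightarrow> real"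
  where "H10_dual_norm \<Omega> \<equiv> dual_norm (H10 \<Omega>) (H1_norm \<Omega>)"


section \<open>Spaces of reaction laws on the real line\<close>

definition is_Linf_deriv :: "(real \<Rightarrow> real) \<Rightarrow> (real \<Rightarrow> real) \<Rightarrow> bool"
  where "is_Linf_deriv f g \<longleftrightarrow> g \<in> Linf UNIV \<and> is_weak_partial UNIV 1 f g"

definition W1inf :: "(real \<Rightarrow> real) set"
  where "W1inf = {f \<in> Linf UNIV. \<exists>g. is_Linf_deriv f g}"

definition W1inf_norm :: "(real \<Rightarrow> real) \<Rightarrow> real"
  where "W1inf_norm f = Linf_norm UNIV f + Linf_norm UNIV (SOME g. is_Linf_deriv f g)"

definition W2inf :: "(real \<Rightarrow> real) set"
  where "W2inf = {f \<in> Linf UNIV. \<exists>g. is_Linf_deriv f g \<and> g \<in> W1inf}"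

text \<open>
  \<open>H\<^sup>s(\<real>)\<close> consists of the functions whose Fourier transform \<open>g\<close> satisfies
  \<open>(1 + \<xi>\<^sup>2)\<^bsup>s/2\<^esup> g \<in> L\<^sup>2\<close>. For \<open>s > 1/2\<close>, the only range in which the definitions below
  are meant to be used, such a \<open>g\<close> is integrable, so the inversion integral converges absolutely and
  gives the continuous representative, which is the one needed for superposition operators.
  The density \<open>g\<close> is unique up to null sets, so the infimum in the norm is over a single value.
\<close>

definition has_Hs_density :: "real \<Rightarrow> (real \<Rightarrow> real) \<Rightarrow> (real \<Rightarrow> complex) \<Rightarrow> bool"
  where "has_Hs_density s f g \<longleftrightarrow> g \<in> borel_measurable lebesgue \<and>
    integrable lebesgue (\<lambda>\<xi>. (1 + \<xi>\<^sup>2) powr s * (norm (g \<xi>))\<^sup>2) \<and>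
    (\<forall>x. complex_of_real (f x) =
      (LINT \<xi>|lebesgue. g \<xi> * cis (\<xi> * x)) / complex_of_real (sqrt (2 * pi)))"

definition Hs :: "real \<Rightarrow> (real \<Rightarrow> real) set"
  where "Hs s = {f. \<exists>g. has_Hs_density s f g}"

definition Hs_norm :: "real \<Rightarrow> (real \<Rightarrow> real) \<Rightarrow> real"
  where "Hs_norm s f =
    Inf {sqrt (LINT \<xi>|lebesgue. (1 + \<xi>\<^sup>2) powr s * (norm (g \<xi>))\<^sup>2) | g. has_Hs_density s f g}"


section \<open>Space-time function spaces\<close>

abbreviation U_space :: "'a::euclidean_space set \<Rightarrow> real \<Rightarrow> (real \<Rightarrow> 'a \<Rightarrow> real) set"
  where "U_space \<Omega> T \<equiv> bochner_L2 T (H10 \<Omega>) (H1_norm \<Omega>)"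

abbreviation U_norm :: "'a::euclidean_space set \<Rightarrow> real \<Rightarrow> (real \<Rightarrow> 'a \<Rightarrow> real) \<Rightarrow> real"
  where "U_norm \<Omega> T \<equiv> bochner_L2_norm T (H1_norm \<Omega>)"

abbreviation Udual_space ::
    "'a::euclidean_space set \<Rightarrow> real \<Rightarrow> (real \<Rightarrow> ('a \<Rightarrow> real) \<Rightarrow> real) set"
  where "Udual_space \<Omega> T \<equiv> bochner_L2 T (H10_dual \<Omega>) (H10_dual_norm \<Omega>)"

abbreviation Udual_norm ::
    "'a::euclidean_space set \<Rightarrow> real \<Rightarrow> (real \<Rightarrow> ('a \<Rightarrow> real) \<Rightarrow> real) \<Rightarrow> real"
  where "Udual_norm \<Omega> T \<equiv> bochner_L2_norm T (H10_dual_norm \<Omega>)"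

abbreviation Y_norm :: "'a::euclidean_space set \<Rightarrow> real \<Rightarrow> (real \<Rightarrow> 'a \<Rightarrow> real) \<Rightarrow> real"
  where "Y_norm \<Omega> T \<equiv> bochner_L2_norm T (L2_norm \<Omega>)"

text \<open>\<open>g\<close> is the distributional derivative of \<open>u\<close> in \<open>U\<^sup>*\<close>, with \<open>H = L\<^sup>2(\<Omega>)\<close> as pivot space.
  The identity \<open>\<integral> \<psi>' u dt = - \<integral> \<psi> g dt\<close> between elements of \<open>U\<^sup>*\<close> is evaluated at each \<open>v\<close>.\<close>

definition is_time_deriv ::
    "'a::euclidean_space set \<Rightarrow> real \<Rightarrow> (real \<Rightarrow> 'a \<Rightarrow> real) \<Rightarrow>
      (real \<Rightarrow> ('a \<Rightarrow> real) \<Rightarrow> real) \<Rightarrow> bool"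
  where "is_time_deriv \<Omega> T u g \<longleftrightarrow> g \<in> Udual_space \<Omega> T \<and>
    (\<forall>\<psi> \<in> test_functions {0<..<T}. \<forall>v \<in> H10 \<Omega>.
      (LINT t|lebesgue_on {0<..<T}. deriv \<psi> t * (LINT x|lebesgue_on \<Omega>. u t x * v x)) =
      - (LINT t|lebesgue_on {0<..<T}. \<psi> t * g t v))"

definition time_deriv ::
    "'a::euclidean_space set \<Rightarrow> real \<Rightarrow> (real \<Rightarrow> 'a \<Rightarrow> real) \<Rightarrow> real \<Rightarrow> ('a \<Rightarrow> real) \<Rightarrow> real"
  where "time_deriv \<Omega> T u = (SOME g. is_time_deriv \<Omega> T u g)"

definition V_space :: "'a::euclidean_space set \<Rightarrow> real \<Rightarrow> (real \<Rightarrow> 'a \<Rightarrow> real) set"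
  where "V_space \<Omega> T = {u \<in> U_space \<Omega> T. \<exists>g. is_time_deriv \<Omega> T u g}"

definition V_norm :: "'a::euclidean_space set \<Rightarrow> real \<Rightarrow> (real \<Rightarrow> 'a \<Rightarrow> real) \<Rightarrow> real"
  where "V_norm \<Omega> T u = sqrt ((U_norm \<Omega> T u)\<^sup>2 + (Udual_norm \<Omega> T (time_deriv \<Omega> T u))\<^sup>2)"

text \<open>\<open>u(t0) = h\<close> in \<open>H\<close> for \<open>t0 \<in> [0,T]\<close>, through the representative of \<open>u\<close> in \<open>C([0,T];H)\<close>.\<close>

definition has_time_value ::
    "'a::euclidean_space set \<Rightarrow> real \<Rightarrow> (real \<Rightarrow> 'a \<Rightarrow> real) \<Rightarrow> real \<Rightarrow> ('a \<Rightarrow> real) \<Rightarrow> bool"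
  where "has_time_value \<Omega> T u t0 h \<longleftrightarrow> (\<exists>w.
    (\<forall>t\<in>{0..T}. w t \<in> L2 \<Omega> \<and> ((\<lambda>\<tau>. L2_norm \<Omega> (w \<tau> - w t)) \<longlongrightarrow> 0) (at t within {0..T})) \<and>
    (AE t in lebesgue_on {0<..<T}. AE x in lebesgue_on \<Omega>. w t x = u t x) \<and>
    (AE x in lebesgue_on \<Omega>. w t0 x = h x))"


section \<open>State, linearized and adjoint equations in weak form\<close>

definition elliptic_form ::
    "'a::euclidean_space set \<Rightarrow> ('a \<Rightarrow> real) \<Rightarrow> ('a \<Rightarrow> real) \<Rightarrow> ('a \<Rightarrow> real) \<Rightarrow> ('a \<Rightarrow> real) \<Rightarrow> real"
  where "elliptic_form \<Omega> a b u v =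
    (LINT x|lebesgue_on \<Omega>. a x * (weak_grad \<Omega> u x \<bullet> weak_grad \<Omega> v x)) +
    (LINT x|lebesgue_on \<Omega>. b x * u x * v x)"

definition solves_state ::
    "'a::euclidean_space set \<Rightarrow> real \<Rightarrow> ('a \<Rightarrow> real) \<Rightarrow> ('a \<Rightarrow> real) \<Rightarrow>
      (real \<Rightarrow> ('a \<Rightarrow> real) \<Rightarrow> real) \<Rightarrow> ('a \<Rightarrow> real) \<Rightarrow> (real \<Rightarrow> real) \<Rightarrow> (real \<Rightarrow> 'a \<Rightarrow> real) \<Rightarrow> bool"
  where "solves_state \<Omega> T a b \<phi> u0 P u \<longleftrightarrow> u \<in> V_space \<Omega> T \<and>
    (AE t in lebesgue_on {0<..<T}. \<forall>v \<in> H10 \<Omega>.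
      time_deriv \<Omega> T u t v + elliptic_form \<Omega> a b (u t) v
        + (LINT x|lebesgue_on \<Omega>. P (u t x) * v x) = \<phi> t v) \<and>
    has_time_value \<Omega> T u 0 u0"

definition solves_linearized ::
    "'a::euclidean_space set \<Rightarrow> real \<Rightarrow> ('a \<Rightarrow> real) \<Rightarrow> ('a \<Rightarrow> real) \<Rightarrow>
      (real \<Rightarrow> real) \<Rightarrow> (real \<Rightarrow> 'a \<Rightarrow> real) \<Rightarrow> (real \<Rightarrow> real) \<Rightarrow> (real \<Rightarrow> 'a \<Rightarrow> real) \<Rightarrow> bool"
  where "solves_linearized \<Omega> T a b P u \<xi> p \<longleftrightarrow> p \<in> V_space \<Omega> T \<and>
    (AE t in lebesgue_on {0<..<T}. \<forall>v \<in> H10 \<Omega>.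
      time_deriv \<Omega> T p t v + elliptic_form \<Omega> a b (p t) v
        + (LINT x|lebesgue_on \<Omega>. deriv P (u t x) * p t x * v x)
      = - (LINT x|lebesgue_on \<Omega>. \<xi> (u t x) * v x)) \<and>
    has_time_value \<Omega> T p 0 (\<lambda>x. 0)"

definition solves_adjoint ::
    "'a::euclidean_space set \<Rightarrow> real \<Rightarrow> ('a \<Rightarrow> real) \<Rightarrow> ('a \<Rightarrow> real) \<Rightarrow>
      (real \<Rightarrow> real) \<Rightarrow> (real \<Rightarrow> 'a \<Rightarrow> real) \<Rightarrow> (real \<Rightarrow> ('a \<Rightarrow> real) \<Rightarrow> real) \<Rightarrow>
      (real \<Rightarrow> 'a \<Rightarrow> real) \<Rightarrow> bool"
  where "solves_adjoint \<Omega> T a b P u h z \<longleftrightarrow> z \<in> V_space \<Omega> T \<and>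
    (AE t in lebesgue_on {0<..<T}. \<forall>v \<in> H10 \<Omega>.
      - time_deriv \<Omega> T z t v + elliptic_form \<Omega> a b (z t) v
        + (LINT x|lebesgue_on \<Omega>. deriv P (u t x) * z t x * v x) = h t v) \<and>
    has_time_value \<Omega> T z T (\<lambda>x. 0)"

end

theory Submission
  imports Defs "HOL-Probability.Characteristic_Functions" "HOL-Probability.Sinc_Integral"
begin

text \<open>The proof is a duality argument. Let \<open>u = S P\<close>, \<open>v = S P0\<close>, \<open>p = S' P (P - P0)\<close> and
  \<open>r = u - v - p\<close>, the error to be estimated, and let \<open>z\<close> solve the adjoint linearized equation at
  \<open>(P, u)\<close> with source \<open>r\<close>. Testing the equations of \<open>u\<close>, \<open>v\<close>, \<open>p\<close> with \<open>z\<close> and the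
  adjoint equation with \<open>u\<close>, \<open>v\<close>, \<open>p\<close>, the elliptic terms cancel by symmetry and the time
  derivatives by integration by parts (\<open>integration_by_parts\<close>). What is left
  (\<open>adjoint_pointwise_identity\<close>, \<open>linearization_error_bound\<close>) is
  \<open>\<parallel>r\<parallel>\<^sup>2 = \<integral>\<integral> (P0(v) - P0(u) + P'(u) (u - v)) z\<close>, with the norm of \<open>Y\<close> on the left and
  an integral over time and space on the right.

  The factor in front of \<open>z\<close> is a Taylor remainder of \<open>P0\<close>, up to \<open>P' - P0'\<close>, which is
  uniformly small because \<open>H\<^sup>s\<close> embeds into \<open>W1inf\<close>. It is \<open>|u - v|\<close> times a quantity that is
  small where \<open>|u - v| \<le> \<delta>\<close>, by the uniform continuity of \<open>P0'\<close> (\<open>Hs_imp_C1\<close>), and bounded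
  elsewhere. Now \<open>u(t) - v(t)\<close> is small in \<open>L\<^sup>2\<close> at every time \<open>t\<close>, since \<open>S\<close> is
  continuous at \<open>P0\<close> and \<open>V\<close> embeds into \<open>C([0,T]; L\<^sup>2)\<close> (\<open>L2_norm_le_V_norm\<close>); hence the
  set where \<open>|u(t) - v(t)| > \<delta>\<close> has small measure, and on sets of small measure the \<open>L\<^sup>2\<close> norm of
  \<open>z(t)\<close> is a small multiple of its \<open>H\<^sup>1\<close> norm (\<open>H10_uniformly_integrable\<close>). Altogether
  (\<open>remainder_pairing_bound\<close>) \<open>\<parallel>r\<parallel>\<^sup>2 \<le> \<eta> \<parallel>u - v\<parallel> \<parallel>z\<parallel>\<close> with the norm of \<open>U\<close> for
  \<open>z\<close> and with \<open>\<eta>\<close> as small as desired. The adjoint estimate \<open>\<parallel>z\<parallel> \<le> C_f \<parallel>r\<parallel>\<close> then gives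
  the cone condition with constant \<open>\<eta> C_f\<close>.

  The embedding of \<open>V\<close> is applied to \<open>u - v\<close>, which starts from 0; continuous representatives are
  part of the hypothesis on initial values, so that only their product rule has to be proved.\<close>

section \<open>Smooth bumps and test functions\<close>

text \<open>The functions \<open>x\<^sup>-\<^sup>n exp (-1/x)\<close> on the positive half-line are closed under
  differentiation up to linear combinations, so that their smoothness is an induction over all
  \<open>n\<close> at once.\<close>

definition flat_exp :: "nat \<Rightarrow> real \<Rightarrow> real"
  where "flat_exp n x = (if x > 0 then inverse x ^ n * exp (- inverse x) else 0)"

lemma flat_exp_nonneg: "0 \<le> flat_exp n x"
  by (simp add: flat_exp_def)

lemma flat_exp_0_le_1: "flat_exp 0 x \<le> 1"
  by (simp add: flat_exp_def)

lemma flat_exp_tendsto_0: "(flat_exp n \<longlongrightarrow> 0) (at_right 0)"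
proof -
  have "((\<lambda>y::real. y ^ n / exp y) \<longlongrightarrow> 0) at_top"
    by (rule tendsto_power_div_exp_0)
  then have "((\<lambda>x::real. inverse x ^ n / exp (inverse x)) \<longlongrightarrow> 0) (at_right 0)"
    by (rule filterlim_compose) (rule filterlim_inverse_at_top_right)
  moreover have "eventually (\<lambda>x. inverse x ^ n / exp (inverse x) = flat_exp n x) (at_right 0)"
    unfolding eventually_at_filter by (simp add: flat_exp_def exp_minus divide_inverse)
  ultimately show ?thesis
    by (rule Lim_transform_eventually)
qed

lemma flat_exp_DERIV:
  "(flat_exp n has_real_derivative flat_exp (n + 2) x - n * flat_exp (n + 1) x) (at x)"
proof -
  consider "x > 0" | "x < 0" | "x = 0" by linarith
  then show ?thesis
  proof cases
    case 1
    define y where "y = inverse x"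
    have D: "(inverse has_real_derivative - (y ^ 2)) (at x)"
      using DERIV_inverse[of x UNIV] 1 by (simp add: y_def power2_eq_square)
    have deriv: "((\<lambda>x. inverse x ^ n * exp (- inverse x)) has_real_derivative
        real n * (- (y ^ 2) * y ^ (n - Suc 0)) * exp (- y) + exp (- y) * (y ^ 2) * y ^ n) (at x)"
      using DERIV_mult[OF DERIV_power[OF D, of n] DERIV_fun_exp[OF DERIV_minus[OF D]]]
      by (simp add: y_def)
    have eq: "real n * (- (y ^ 2) * y ^ (n - Suc 0)) * exp (- y) + exp (- y) * (y ^ 2) * y ^ n =
        y ^ (n + 2) * exp (- y) - n * (y ^ (n + 1) * exp (- y))"
      by (cases n) (simp_all add: power2_eq_square algebra_simps)
    have "((\<lambda>x. inverse x ^ n * exp (- inverse x)) has_real_derivative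
        inverse x ^ (n + 2) * exp (- inverse x) - n * (inverse x ^ (n + 1) * exp (- inverse x))) (at x)"
      using deriv unfolding eq by (simp only: y_def)
    then have "(flat_exp n has_real_derivative
        inverse x ^ (n + 2) * exp (- inverse x) - n * (inverse x ^ (n + 1) * exp (- inverse x))) (at x)"
      by (rule has_field_derivative_transform_within_open[where S = "{0<..}"])
        (use 1 in \<open>auto simp: flat_exp_def\<close>)
    then show ?thesis using 1 by (simp add: flat_exp_def)
  next
    case 2
    have "((\<lambda>x. 0) has_real_derivative 0) (at x)" by simp
    then have "(flat_exp n has_real_derivative 0) (at x)"
      by (rule has_field_derivative_transform_within_open[where S = "{..<0}"])
        (use 2 in \<open>auto simp: flat_exp_def\<close>)
    then show ?thesis using 2 by (simp add: flat_exp_def)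
  next
    case 3
    have "((\<lambda>h. (flat_exp n (0 + h) - flat_exp n 0) / h) \<longlongrightarrow> 0) (at_right 0)"
    proof (rule Lim_transform_eventually[OF flat_exp_tendsto_0[of "Suc n"]])
      show "\<forall>\<^sub>F h in at_right 0. flat_exp (Suc n) h = (flat_exp n (0 + h) - flat_exp n 0) / h"
        unfolding eventually_at_filter by (simp add: flat_exp_def field_simps)
    qed
    moreover have "((\<lambda>h. (flat_exp n (0 + h) - flat_exp n 0) / h) \<longlongrightarrow> 0) (at_left 0)"
      by (rule tendsto_eventually) (simp add: flat_exp_def eventually_at_filter)
    ultimately have "(flat_exp n has_real_derivative 0) (at 0)"
      unfolding has_field_derivative_def DERIV_def[unfolded has_field_derivative_def]
      by (simp add: filterlim_split_at)
    then show ?thesis using 3 by (simp add: flat_exp_def)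
  qed
qed

lemma continuous_flat_exp: "continuous_on A (flat_exp n)"
  by (meson DERIV_isCont continuous_at_imp_continuous_on flat_exp_DERIV)

lemma flat_exp_measurable [measurable]: "flat_exp n \<in> borel_measurable borel"
  by (intro borel_measurable_continuous_onI continuous_flat_exp)

lemma flat_exp_0_tendsto_1:
  fixes c :: real
  assumes "c > 0"
  shows "(\<lambda>n. flat_exp 0 (real (Suc n) * c - d)) \<longlonglongrightarrow> 1"
proof -
  have "filterlim (\<lambda>n. real (Suc n) * c) at_top sequentially"
    using assms by (intro filterlim_at_top_mult_tendsto_pos[OF tendsto_const])
      (auto intro: filterlim_compose[OF filterlim_real_sequentially filterlim_Suc] simp del: of_nat_Suc)
  then have lim: "filterlim (\<lambda>n. real (Suc n) * c - d) at_top sequentially"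
    using filterlim_tendsto_add_at_top[OF tendsto_const[of "-d"]] by (simp add: add.commute)
  then have "(\<lambda>n. exp (- inverse (real (Suc n) * c - d))) \<longlonglongrightarrow> exp (- 0)"
    by (intro tendsto_intros filterlim_compose[OF tendsto_inverse_0_at_top[OF filterlim_ident]])
  moreover have "eventually (\<lambda>n. exp (- inverse (real (Suc n) * c - d)) = flat_exp 0 (real (Suc n) * c - d)) sequentially"
    using filterlim_at_top_dense[THEN iffD1, OF lim, rule_format, of 0]
    by eventually_elim (simp add: flat_exp_def)
  ultimately show ?thesis
    using Lim_transform_eventually by fastforce
qed

text \<open>\<open>flat_exp 2\<close> is the derivative of \<open>flat_exp 0\<close>, which increases from 0 to 1: rescaled, it
  is an approximate identity.\<close>

lemma flat_exp_2_integral: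
  "integrable lborel (flat_exp 2)" "(LINT x|lborel. flat_exp 2 x) = 1"
proof -
  have lim: "(flat_exp 0 \<longlongrightarrow> 1) at_top"
  proof (rule Lim_transform_eventually)
    show "((\<lambda>x::real. exp (- inverse x)) \<longlongrightarrow> 1) at_top"
      by (rule tendsto_eq_intros tendsto_inverse_0_at_top filterlim_ident | simp)+
    show "\<forall>\<^sub>F x in at_top. exp (- inverse x) = flat_exp 0 x"
      using eventually_gt_at_top[of 0] by eventually_elim (simp add: flat_exp_def)
  qed
  have "(\<integral>\<^sup>+x. ennreal (flat_exp 2 x) * indicator {0..} x \<partial>lborel) = 1 - flat_exp 0 0"
    using flat_exp_DERIV[of 0]
    by (intro nn_integral_FTC_atLeast lim) (auto simp: flat_exp_nonneg numeral_2_eq_2)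
  also have "(\<integral>\<^sup>+x. ennreal (flat_exp 2 x) * indicator {0..} x \<partial>lborel) = (\<integral>\<^sup>+x. ennreal (flat_exp 2 x) \<partial>lborel)"
    by (intro nn_integral_cong) (auto simp: flat_exp_def indicator_def)
  finally have *: "(\<integral>\<^sup>+x. ennreal (flat_exp 2 x) \<partial>lborel) = ennreal 1"
    by (simp add: flat_exp_def)
  show "integrable lborel (flat_exp 2)"
    by (rule integrableI_nonneg) (auto simp: flat_exp_nonneg *)
  show "(LINT x|lborel. flat_exp 2 x) = 1"
    by (rule integral_eq_nn_integral[THEN trans]) (auto simp: flat_exp_nonneg *)
qed

lemma Ck_SucI:
  assumes "\<And>x. (f has_derivative D x) (at x)" "\<And>i. i \<in> Basis \<Longrightarrow> Ck k (\<lambda>x. D x i)"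
  shows "Ck (Suc k) f"
proof -
  have "frechet_derivative f (at x) = D x" for x
    using assms(1) frechet_derivative_at by metis
  then show ?thesis using assms by (auto simp: differentiable_def)
qed

lemma Ck_SucD:
  assumes "Ck (Suc k) f"
  shows "(f has_derivative frechet_derivative f (at x)) (at x)"
    "i \<in> Basis \<Longrightarrow> Ck k (\<lambda>x. frechet_derivative f (at x) i)"
  using assms frechet_derivative_works by auto

lemma Ck_Suc_imp: "Ck (Suc k) f \<Longrightarrow> Ck k f"
proof (induction k arbitrary: f)
  case 0
  then show ?case
    using differentiable_imp_continuous_within continuous_at_imp_continuous_on by (metis Ck.simps)
next
  case (Suc k)
  show ?case
    by (rule Ck_SucI[OF Ck_SucD(1)[OF Suc.prems]]) (intro Suc.IH Ck_SucD(2)[OF Suc.prems])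
qed

lemma Ck_imp_continuous: "Ck k f \<Longrightarrow> continuous_on A f"
proof -
  assume "Ck k f"
  then have "Ck 0 f" by (induction k) (simp_all only: Ck_Suc_imp)
  then show ?thesis using continuous_on_subset by auto
qed

lemma Ck_const: "Ck k (\<lambda>x. c)"
proof (induction k arbitrary: c)
  case (Suc k)
  show ?case by (rule Ck_SucI[where D = "\<lambda>x h. 0"]) (auto intro: Suc)
qed simp

lemma Ck_add: "Ck k f \<Longrightarrow> Ck k g \<Longrightarrow> Ck k (\<lambda>x. f x + g x)"
proof (induction k arbitrary: f g)
  case 0 then show ?case by (auto intro: continuous_intros)
next
  case (Suc k)
  show ?case
    by (rule Ck_SucI[where D = "\<lambda>x h. frechet_derivative f (at x) h + frechet_derivative g (at x) h"])
      (auto intro!: derivative_intros Suc.IH Ck_SucD[OF Suc.prems(1)] Ck_SucD[OF Suc.prems(2)]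
        simp del: Ck.simps)
qed

lemma Ck_mult: "Ck k f \<Longrightarrow> Ck k g \<Longrightarrow> Ck k (\<lambda>x. f x * g x)"
proof (induction k arbitrary: f g)
  case 0 then show ?case by (auto intro: continuous_intros)
next
  case (Suc k)
  show ?case
    by (rule Ck_SucI[where D = "\<lambda>x h. f x * frechet_derivative g (at x) h + frechet_derivative f (at x) h * g x"])
      (auto intro!: has_derivative_mult Ck_add Suc.IH Ck_SucD[OF Suc.prems(1)] Ck_SucD[OF Suc.prems(2)]
        Ck_Suc_imp[OF Suc.prems(1)] Ck_Suc_imp[OF Suc.prems(2)]
        simp del: Ck.simps)
qed

lemma Ck_prod: "finite I \<Longrightarrow> (\<And>i. i \<in> I \<Longrightarrow> Ck k (f i)) \<Longrightarrow> Ck k (\<lambda>x. \<Prod>i\<in>I. f i x)"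
  by (induction I rule: finite_induct) (auto intro: Ck_const Ck_mult simp del: Ck.simps)

lemma Ck_flat_exp: "Ck k (\<lambda>x::'a::euclidean_space. flat_exp n (c + x \<bullet> v))"
proof (induction k arbitrary: n)
  case 0
  have "continuous_on UNIV (flat_exp n \<circ> (\<lambda>x::'a. c + x \<bullet> v))"
    by (intro continuous_on_compose continuous_intros continuous_flat_exp)
  then show ?case by (simp add: o_def)
next
  case (Suc k)
  have "((\<lambda>x. flat_exp n (c + x \<bullet> v)) has_derivative
      (\<lambda>h. (h \<bullet> v) * (flat_exp (n + 2) (c + x \<bullet> v) + (- real n) * flat_exp (n + 1) (c + x \<bullet> v)))) (at x)"
    for x :: 'a
    by (rule has_derivative_eq_rhs[OF has_derivative_compose[OF _ flat_exp_DERIV[unfolded has_field_derivative_def]]])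
      (auto intro!: derivative_eq_intros simp: algebra_simps)
  then show ?case
    by (rule Ck_SucI) (intro Ck_mult Ck_add Ck_const Suc.IH)
qed

text \<open>Smooth functions with support in a box that increase, with \<open>n\<close>, to the indicator of its
  interior.\<close>

definition box_bump :: "'a::euclidean_space \<Rightarrow> 'a \<Rightarrow> nat \<Rightarrow> 'a \<Rightarrow> real"
  where "box_bump a b n x = (\<Prod>i\<in>Basis.
    flat_exp 0 (real (Suc n) * (x \<bullet> i - a \<bullet> i)) * flat_exp 0 (real (Suc n) * (b \<bullet> i - x \<bullet> i)))"

lemma Ck_box_bump: "Ck k (box_bump a b n)"
proof -
  have "box_bump a b n = (\<lambda>x. \<Prod>i\<in>Basis.
    flat_exp 0 (- real (Suc n) * (a \<bullet> i) + x \<bullet> (real (Suc n) *\<^sub>R i)) *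
    flat_exp 0 (real (Suc n) * (b \<bullet> i) + x \<bullet> (- real (Suc n) *\<^sub>R i)))"
    by (simp add: box_bump_def fun_eq_iff algebra_simps)
  then show ?thesis
    by (simp only:) (intro Ck_prod Ck_mult Ck_flat_exp finite_Basis)
qed

lemma box_bump_eq_0: "x \<notin> box a b \<Longrightarrow> box_bump a b n x = 0"
  by (auto simp: box_bump_def mem_box flat_exp_def zero_less_mult_iff)

lemma box_bump_bounds: "0 \<le> box_bump a b n x" "box_bump a b n x \<le> 1"
  unfolding box_bump_def
  by (auto intro!: prod_nonneg prod_le_1 mult_le_one simp: flat_exp_nonneg flat_exp_0_le_1)

lemma box_bump_tendsto: "(\<lambda>n. box_bump a b n x) \<longlonglongrightarrow> indicator (box a b) x"
proof (cases "x \<in> box a b")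
  case True
  have "(\<lambda>n. box_bump a b n x) \<longlonglongrightarrow> (\<Prod>i\<in>(Basis::'a set). 1 * 1)"
    unfolding box_bump_def
    using True flat_exp_0_tendsto_1[of _ 0]
    by (intro tendsto_prod tendsto_mult) (auto simp: mem_box)
  then show ?thesis using True by simp
next
  case False then show ?thesis by (simp add: box_bump_eq_0)
qed

lemma box_bump_test_function:
  assumes "cbox a b \<subseteq> \<Omega>"
  shows "box_bump a b n \<in> test_functions \<Omega>"
proof -
  have "closure {x. box_bump a b n x \<noteq> 0} \<subseteq> cbox a b"
    using box_bump_eq_0[of _ a b n] box_subset_cbox[of a b] by (intro closure_minimal closed_cbox) auto
  then show ?thesis
    using assms compact_cbox[of a b] bounded_subset[OF bounded_cbox]
    by (auto simp: test_functions_def Ck_box_bump compact_eq_bounded_closed simp del: Ck.simps)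
qed

lemma box_bump_measurable [measurable]: "box_bump a b n \<in> borel_measurable borel"
  by (intro borel_measurable_continuous_onI Ck_imp_continuous[OF Ck_box_bump])

section \<open>Weak derivatives\<close>

text \<open>Approximating indicators by bumps shows that the integrals over all small cubes vanish;
  Lebesgue's differentiation theorem recovers the function from these integrals.\<close>

lemma test_orthogonal_imp_AE_0:
  fixes G :: "'a::euclidean_space \<Rightarrow> real"
  assumes \<Omega>: "open \<Omega>"
    and int: "\<And>a b. set_integrable lebesgue (cbox a b) (\<lambda>x. indicator \<Omega> x * G x)"
    and orth: "\<And>\<psi>. \<psi> \<in> test_functions \<Omega> \<Longrightarrow> (LINT x|lebesgue_on \<Omega>. G x * \<psi> x) = 0"
  shows "AE x in lebesgue_on \<Omega>. G x = 0"
proof -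
  define f where "f x = indicator \<Omega> x * G x" for x
  have \<Omega>s [simp]: "\<Omega> \<in> sets lebesgue" using \<Omega> by auto
  have zero: "integral (cbox a b) f = 0" if ab: "cbox a b \<subseteq> \<Omega>" for a b
  proof -
    have fint: "integrable lebesgue (\<lambda>x. indicator (cbox a b) x *\<^sub>R f x)"
      using int[of a b] by (simp add: set_integrable_def f_def)
    have "(\<lambda>n. LINT x|lebesgue. indicator (cbox a b) x *\<^sub>R f x * box_bump a b n x) \<longlonglongrightarrow>
      (LINT x|lebesgue. indicator (cbox a b) x *\<^sub>R f x * indicator (box a b) x)"
    proof (rule integral_dominated_convergence)
      show "integrable lebesgue (\<lambda>x. norm (indicator (cbox a b) x *\<^sub>R f x))"
        using fint by (rule integrable_norm)
      show "(\<lambda>x. indicator (cbox a b) x *\<^sub>R f x * indicator (box a b) x) \<in> borel_measurable lebesgue"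
        by (rule borel_measurable_times[OF borel_measurable_integrable[OF fint]
          borel_measurable_indicator[OF fmeasurableD[OF lmeasurable_box]]])
      have "box_bump a b n \<in> borel_measurable lebesgue" for n
        by (rule measurable_completion) simp
      then show "(\<lambda>x. indicator (cbox a b) x *\<^sub>R f x * box_bump a b n x) \<in> borel_measurable lebesgue" for n
        by (rule borel_measurable_times[OF borel_measurable_integrable[OF fint]])
      show "AE x in lebesgue. (\<lambda>n. indicator (cbox a b) x *\<^sub>R f x * box_bump a b n x)
          \<longlonglongrightarrow> indicator (cbox a b) x *\<^sub>R f x * indicator (box a b) x"
        by (intro AE_I2 tendsto_mult tendsto_const box_bump_tendsto)
      show "AE x in lebesgue. norm (indicator (cbox a b) x *\<^sub>R f x * box_bump a b n x)
          \<le> norm (indicator (cbox a b) x *\<^sub>R f x)" for n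
        using box_bump_bounds[of a b n] by (auto simp: abs_mult intro!: mult_left_le)
    qed
    moreover have "(LINT x|lebesgue. indicator (cbox a b) x *\<^sub>R f x * box_bump a b n x) = 0" for n
    proof -
      have "(LINT x|lebesgue. indicator (cbox a b) x *\<^sub>R f x * box_bump a b n x) =
        (LINT x|lebesgue. indicator \<Omega> x *\<^sub>R (G x * box_bump a b n x))"
        using ab box_bump_eq_0[of _ a b n] box_subset_cbox[of a b]
        by (intro Bochner_Integration.integral_cong refl) (auto simp: f_def indicator_def)
      also have "\<dots> = (LINT x|lebesgue_on \<Omega>. G x * box_bump a b n x)"
        by (rule integral_restrict_space[symmetric]) simp
      finally show ?thesis using orth[OF box_bump_test_function[OF ab, of n]] by simp
    qed
    ultimately have "(LINT x|lebesgue. indicator (cbox a b) x *\<^sub>R f x * indicator (box a b) x) = 0"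
      by (simp add: LIMSEQ_const_iff)
    moreover have "(LINT x|lebesgue. indicator (cbox a b) x *\<^sub>R f x * indicator (box a b) x)
      = (LINT x:box a b|lebesgue. f x)"
      unfolding set_lebesgue_integral_def using box_subset_cbox[of a b]
      by (intro Bochner_Integration.integral_cong refl) (auto simp: indicator_def)
    moreover have "set_integrable lebesgue (box a b) f"
      using set_integrable_subset[OF int[of a b, folded f_def], of "box a b"] box_subset_cbox by auto
    ultimately have "integral (box a b) f = 0"
      by (metis set_lebesgue_integral_eq_integral(2))
    then show ?thesis by (simp add: integral_open_interval)
  qed
  have "f integrable_on cbox a b" for a b
    using int[of a b] set_lebesgue_integral_eq_integral(1) unfolding f_def by blast
  then obtain N where N: "negligible N"
    and lim: "\<And>x e. x \<notin> N \<Longrightarrow> 0 < e \<Longrightarrow>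
       \<exists>d>0. \<forall>h. 0 < h \<and> h < d \<longrightarrow> norm(integral (cbox x (x + h *\<^sub>R One)) f /\<^sub>R h ^ DIM('a) - f x) < e"
    using integrable_ccontinuous_explicit[of f] by metis
  have "f x = 0" if x: "x \<in> \<Omega>" "x \<notin> N" for x
  proof (rule ccontr)
    assume "f x \<noteq> 0"
    then obtain d where d: "d > 0"
      "\<And>h. 0 < h \<Longrightarrow> h < d \<Longrightarrow> norm(integral (cbox x (x + h *\<^sub>R One)) f /\<^sub>R h ^ DIM('a) - f x) < norm (f x)"
      using lim[OF x(2), of "norm (f x)"] by auto
    obtain e where e: "e > 0" "ball x e \<subseteq> \<Omega>"
      using \<Omega> x(1) openE by blast
    define h where "h = min (d / 2) (e / (2 * DIM('a)))"
    have h: "0 < h" "h < d" using d e by (auto simp: h_def)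
    have "cbox x (x + h *\<^sub>R One) \<subseteq> ball x e"
    proof
      fix y assume y: "y \<in> cbox x (x + h *\<^sub>R One)"
      have "norm (y - x) \<le> (\<Sum>i\<in>Basis. \<bar>(y - x) \<bullet> i\<bar>)" by (rule norm_le_l1)
      also have "\<dots> \<le> (\<Sum>i\<in>(Basis::'a set). h)"
        using y by (intro sum_mono) (auto simp: mem_box inner_diff_left inner_add_left)
      also have "\<dots> < e" using e h by (simp add: h_def min_def field_simps split: if_splits)
      finally show "y \<in> ball x e" by (simp add: dist_norm norm_minus_commute)
    qed
    then have "integral (cbox x (x + h *\<^sub>R One)) f = 0"
      using e(2) by (intro zero) auto
    then show False using d(2)[OF h] by simp
  qed
  then have "AE x in lebesgue. x \<in> \<Omega> \<longrightarrow> G x = 0"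
    using N by (intro AE_I'[of N]) (auto simp: f_def negligible_iff_null_sets)
  then show ?thesis by (subst AE_restrict_space_iff) auto
qed

lemma box_bump_real: "box_bump a b n (x::real) =
    flat_exp 0 (real (Suc n) * (x - a)) * flat_exp 0 (real (Suc n) * (b - x))"
  by (simp add: box_bump_def)

lemma box_bump_deriv:
  "deriv (box_bump a b n) (x::real) =
    real (Suc n) * flat_exp 2 (real (Suc n) * (x - a)) * flat_exp 0 (real (Suc n) * (b - x))
    - real (Suc n) * flat_exp 0 (real (Suc n) * (x - a)) * flat_exp 2 (real (Suc n) * (b - x))"
proof -
  have D: "((\<lambda>x. flat_exp 0 (g x)) has_real_derivative flat_exp 2 (g x) * g') (at x)"
    if "(g has_real_derivative g') (at x)" for g g' x
    using DERIV_chain2[OF flat_exp_DERIV[of 0] that] by (simp add: numeral_2_eq_2)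
  have "(box_bump a b n has_real_derivative
      flat_exp 0 (real (Suc n) * (x - a)) * (flat_exp 2 (real (Suc n) * (b - x)) * (- real (Suc n))) +
      (flat_exp 2 (real (Suc n) * (x - a)) * real (Suc n)) * flat_exp 0 (real (Suc n) * (b - x))) (at x)"
    unfolding box_bump_real
    by (rule DERIV_mult'[OF D D]) (auto intro!: derivative_eq_intros)
  then show ?thesis by (simp add: DERIV_imp_deriv algebra_simps)
qed

text \<open>The left-hand edge of the derivative of \<open>box_bump s t n\<close>, which concentrates at \<open>s\<close> with
  total mass 1. Reflection gives the right-hand edge.\<close>

lemma approximate_delta:
  fixes f :: "real \<Rightarrow> real"
  assumes f [measurable]: "f \<in> borel_measurable borel" and bnd: "\<And>x. \<bar>f x\<bar> \<le> M"
    and cont: "isCont f s" and st: "s < t"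
  shows "(\<lambda>n. LINT x|lborel. f x * (real (Suc n) * flat_exp 2 (real (Suc n) * (x - s)) *
      flat_exp 0 (real (Suc n) * (t - x)))) \<longlonglongrightarrow> f s"
proof -
  have eq: "(LINT x|lborel. f x * (real (Suc n) * flat_exp 2 (real (Suc n) * (x - s)) *
      flat_exp 0 (real (Suc n) * (t - x)))) =
    (LINT x|lborel. f (s + inverse (real (Suc n)) * x) * flat_exp 2 x * flat_exp 0 (real (Suc n) * (t - s) - x))" for n
  proof -
    define N where "N = real (Suc n)"
    have N: "N > 0" by (simp add: N_def)
    have "(LINT x|lborel. f x * (N * flat_exp 2 (N * (x - s)) * flat_exp 0 (N * (t - x)))) =
      \<bar>inverse N\<bar> *\<^sub>R (LINT x|lborel. f (s + inverse N * x) *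
        (N * flat_exp 2 (N * ((s + inverse N * x) - s)) * flat_exp 0 (N * (t - (s + inverse N * x)))))"
      by (rule lborel_integral_real_affine) (use N in simp)
    also have "\<dots> = (LINT x|lborel. inverse N * (f (s + inverse N * x) *
        (N * flat_exp 2 (N * ((s + inverse N * x) - s)) * flat_exp 0 (N * (t - (s + inverse N * x))))))"
      using N by simp
    also have "\<dots> = (LINT x|lborel. f (s + inverse N * x) * flat_exp 2 x * flat_exp 0 (N * (t - s) - x))"
    proof (intro Bochner_Integration.integral_cong refl)
      fix x
      have "N * ((s + inverse N * x) - s) = x" "N * (t - (s + inverse N * x)) = N * (t - s) - x"
        using N by (simp_all add: field_simps)
      note eqs = this
      show "inverse N * (f (s + inverse N * x) *
        (N * flat_exp 2 (N * ((s + inverse N * x) - s)) * flat_exp 0 (N * (t - (s + inverse N * x)))))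
        = f (s + inverse N * x) * flat_exp 2 x * flat_exp 0 (N * (t - s) - x)"
        unfolding eqs using N by simp
    qed
    finally show ?thesis unfolding N_def .
  qed
  have "(\<lambda>n. LINT x|lborel. f (s + inverse (real (Suc n)) * x) * flat_exp 2 x * flat_exp 0 (real (Suc n) * (t - s) - x))
    \<longlonglongrightarrow> (LINT x|lborel. f s * flat_exp 2 x)"
  proof (rule integral_dominated_convergence)
    show "integrable lborel (\<lambda>x. M * flat_exp 2 x)"
      by (intro integrable_mult_right flat_exp_2_integral)
    show "AE x in lborel. (\<lambda>n. f (s + inverse (real (Suc n)) * x) * flat_exp 2 x * flat_exp 0 (real (Suc n) * (t - s) - x))
      \<longlonglongrightarrow> f s * flat_exp 2 x"
    proof (rule AE_I2)
      fix x
      have "(\<lambda>n. s + inverse (real (Suc n)) * x) \<longlonglongrightarrow> s"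
        using tendsto_add[OF tendsto_const[of s] tendsto_mult_left_zero[OF LIMSEQ_inverse_real_of_nat, of x]]
        by simp
      then have "(\<lambda>n. f (s + inverse (real (Suc n)) * x)) \<longlonglongrightarrow> f s"
        by (rule isCont_tendsto_compose[OF cont])
      then have "(\<lambda>n. f (s + inverse (real (Suc n)) * x) * flat_exp 2 x * flat_exp 0 (real (Suc n) * (t - s) - x))
        \<longlonglongrightarrow> f s * flat_exp 2 x * 1"
        using st by (intro tendsto_mult tendsto_const flat_exp_0_tendsto_1) auto
      then show "(\<lambda>n. f (s + inverse (real (Suc n)) * x) * flat_exp 2 x * flat_exp 0 (real (Suc n) * (t - s) - x))
        \<longlonglongrightarrow> f s * flat_exp 2 x" by simp
    qed
    show "AE x in lborel. norm (f (s + inverse (real (Suc n)) * x) * flat_exp 2 x * flat_exp 0 (real (Suc n) * (t - s) - x))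
      \<le> M * flat_exp 2 x" for n
    proof (rule AE_I2)
      fix x
      have "\<bar>f (s + inverse (real (Suc n)) * x)\<bar> * flat_exp 2 x * flat_exp 0 (real (Suc n) * (t - s) - x)
        \<le> M * flat_exp 2 x * 1"
        using bnd[of "s + inverse (real (Suc n)) * x"]
        by (intro mult_mono flat_exp_0_le_1) (auto intro!: mult_nonneg_nonneg simp: flat_exp_nonneg)
      then show "norm (f (s + inverse (real (Suc n)) * x) * flat_exp 2 x * flat_exp 0 (real (Suc n) * (t - s) - x))
        \<le> M * flat_exp 2 x" by (simp add: abs_mult flat_exp_nonneg)
    qed
  qed measurable
  then show ?thesis unfolding eq using flat_exp_2_integral by simp
qed

text \<open>Testing with the bumps of the interval \<open>(s, t)\<close>: their derivatives tend to the difference of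
  the point masses at \<open>s\<close> and \<open>t\<close>, which may be evaluated because \<open>f\<close> is continuous. The
  end points of \<open>[0, T]\<close> are reached by continuity on both sides.\<close>

lemma weak_derivative_imp_integral:
  fixes f g :: "real \<Rightarrow> real"
  assumes f: "continuous_on {0..T} f" and g: "integrable (lebesgue_on {0<..<T}) g"
    and weak: "\<And>\<psi>. \<psi> \<in> test_functions {0<..<T} \<Longrightarrow>
      (LINT t|lebesgue_on {0<..<T}. deriv \<psi> t * f t) = - (LINT t|lebesgue_on {0<..<T}. \<psi> t * g t)"
    and st: "0 \<le> s" "s \<le> t" "t \<le> T"
  shows "f t - f s = (LINT r|lebesgue_on {0<..<T}. indicator {s<..<t} r * g r)"
proof -
  define F where "F x = indicator {0<..<T} x * f x" for x
  obtain M where M: "\<And>x. x \<in> {0..T} \<Longrightarrow> \<bar>f x\<bar> \<le> M"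
    using compact_imp_bounded[OF compact_continuous_image[OF f compact_Icc]]
    unfolding bounded_iff by (metis image_eqI real_norm_def)
  have F_bnd: "\<bar>F x\<bar> \<le> max M 0" for x
    using M[of x] by (auto simp: F_def indicator_def)
  have F_meas [measurable]: "F \<in> borel_measurable borel"
    unfolding F_def
    using borel_measurable_continuous_on_indicator[OF _ continuous_on_subset[OF f], of "{0<..<T}"]
    by (simp add: subset_iff)
  have F_cont: "isCont F x" if "x \<in> {0<..<T}" for x
  proof -
    have "isCont f x"
      using continuous_on_interior[OF f] that by (simp add: interior_atLeastAtMost_real)
    moreover have "eventually (\<lambda>y. F y = f y) (nhds x)"
      using that by (intro eventually_nhds_in_open[of "{0<..<T}", THEN eventually_mono]) (auto simp: F_def)
    ultimately show ?thesis using isCont_cong by blast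
  qed
  have key: "f t - f s = (LINT r|lebesgue_on {0<..<T}. indicator {s<..<t} r * g r)"
    if st: "0 < s" "s < t" "t < T" for s t
  proof -
    have lim1: "(\<lambda>n. LINT x|lborel. F x * (real (Suc n) * flat_exp 2 (real (Suc n) * (x - s)) *
      flat_exp 0 (real (Suc n) * (t - x)))) \<longlonglongrightarrow> F s"
      using st by (intro approximate_delta[OF F_meas F_bnd] F_cont) auto
    have "isCont (\<lambda>x. F (- x)) (- t)"
      using st F_cont[of t] by (intro isCont_o2[of _ uminus F]) auto
    then have lim2: "(\<lambda>n. LINT x|lborel. F (- x) * (real (Suc n) * flat_exp 2 (real (Suc n) * (x - (- t))) *
      flat_exp 0 (real (Suc n) * (- s - x)))) \<longlonglongrightarrow> F (- (- t))"
      using st F_bnd by (intro approximate_delta[of "\<lambda>x. F (- x)" "max M 0"]) auto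
    have refl: "(LINT x|lborel. F (- x) * (real (Suc n) * flat_exp 2 (real (Suc n) * (x - (- t))) *
      flat_exp 0 (real (Suc n) * (- s - x)))) =
      (LINT x|lborel. F x * (real (Suc n) * flat_exp 0 (real (Suc n) * (x - s)) *
      flat_exp 2 (real (Suc n) * (t - x))))" for n
      by (subst lborel_integral_real_affine[of "-1" _ 0])
        (auto intro!: Bochner_Integration.integral_cong simp: algebra_simps)
    have int: "integrable lborel (\<lambda>x. F x * (real (Suc n) * flat_exp k (real (Suc n) * (x - s)) *
        flat_exp l (real (Suc n) * (t - x))))" for n k l
    proof -
      have "continuous_on {s..t} (\<lambda>x. f x * (real (Suc n) * flat_exp k (real (Suc n) * (x - s)) *
        flat_exp l (real (Suc n) * (t - x))))"
        by (intro continuous_intros continuous_on_subset[OF f]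
            continuous_on_compose2[OF continuous_flat_exp[of UNIV]]) (use st in auto)
      then have "integrable lborel (\<lambda>x. indicator {s..t} x *\<^sub>R (f x * (real (Suc n) * flat_exp k (real (Suc n) * (x - s)) *
        flat_exp l (real (Suc n) * (t - x)))))"
        using borel_integrable_atLeastAtMost'[unfolded set_integrable_def] by blast
      then show ?thesis
        using st by (elim Bochner_Integration.integrable_cong[THEN iffD1, rotated -1])
          (auto simp: F_def indicator_def flat_exp_def mult_less_0_iff zero_less_mult_iff)
    qed
    have "(\<lambda>n. LINT r|lebesgue_on {0<..<T}. box_bump s t n r * g r)
      \<longlonglongrightarrow> (LINT r|lebesgue_on {0<..<T}. indicator (box s t) r * g r)"
    proof (rule integral_dominated_convergence)
      have gm [measurable]: "g \<in> borel_measurable (lebesgue_on {0<..<T})"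
        using g by (rule borel_measurable_integrable)
      show "integrable (lebesgue_on {0<..<T}) (\<lambda>r. norm (g r))"
        using g by (rule integrable_norm)
      have "box_bump s t n \<in> borel_measurable lebesgue" for n
        by (rule measurable_completion) simp
      then show "(\<lambda>r. box_bump s t n r * g r) \<in> borel_measurable (lebesgue_on {0<..<T})" for n
        by (intro borel_measurable_times gm measurable_restrict_space1)
      have "indicator (box s t) \<in> borel_measurable lebesgue"
        by (rule borel_measurable_indicator[OF fmeasurableD[OF lmeasurable_box]])
      then show "(\<lambda>r. indicator (box s t) r * g r) \<in> borel_measurable (lebesgue_on {0<..<T})"
        by (intro borel_measurable_times gm measurable_restrict_space1)
      show "AE r in lebesgue_on {0<..<T}. (\<lambda>n. box_bump s t n r * g r) \<longlonglongrightarrow> indicator (box s t) r * g r"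
        by (intro AE_I2 tendsto_mult tendsto_const box_bump_tendsto)
      show "AE r in lebesgue_on {0<..<T}. norm (box_bump s t n r * g r) \<le> norm (g r)" for n
        using box_bump_bounds[of s t n] by (auto simp: abs_mult intro!: mult_left_le_one_le)
    qed
    moreover have "(LINT r|lebesgue_on {0<..<T}. box_bump s t n r * g r) =
      (LINT x|lborel. F x * (real (Suc n) * flat_exp 0 (real (Suc n) * (x - s)) *
        flat_exp 2 (real (Suc n) * (t - x)))) -
      (LINT x|lborel. F x * (real (Suc n) * flat_exp 2 (real (Suc n) * (x - s)) *
        flat_exp 0 (real (Suc n) * (t - x))))" for n
    proof -
      have "(LINT r|lebesgue_on {0<..<T}. box_bump s t n r * g r) =
         - (LINT r|lebesgue_on {0<..<T}. deriv (box_bump s t n) r * f r)"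
      proof -
        have "cbox s t \<subseteq> {0<..<T}" using st by auto
        then show ?thesis using weak[OF box_bump_test_function, of s t n] by simp
      qed
      also have "(LINT r|lebesgue_on {0<..<T}. deriv (box_bump s t n) r * f r) =
        (LINT r|lebesgue. indicator {0<..<T} r *\<^sub>R (deriv (box_bump s t n) r * f r))"
        by (rule integral_restrict_space) simp
      also have "\<dots> = (LINT r|lebesgue. deriv (box_bump s t n) r * F r)"
        by (intro Bochner_Integration.integral_cong) (auto simp: F_def)
      also have "\<dots> = (LINT r|lborel. deriv (box_bump s t n) r * F r)"
        unfolding box_bump_deriv by (rule integral_completion) measurable
      also have "\<dots> = (LINT x|lborel. F x * (real (Suc n) * flat_exp 2 (real (Suc n) * (x - s)) *
          flat_exp 0 (real (Suc n) * (t - x))) -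
        F x * (real (Suc n) * flat_exp 0 (real (Suc n) * (x - s)) * flat_exp 2 (real (Suc n) * (t - x))))"
        unfolding box_bump_deriv by (intro Bochner_Integration.integral_cong) (auto simp: algebra_simps)
      finally show ?thesis by (simp only: Bochner_Integration.integral_diff[OF int int])
    qed
    ultimately have "(\<lambda>n. (LINT x|lborel. F x * (real (Suc n) * flat_exp 0 (real (Suc n) * (x - s)) *
        flat_exp 2 (real (Suc n) * (t - x)))) -
      (LINT x|lborel. F x * (real (Suc n) * flat_exp 2 (real (Suc n) * (x - s)) *
        flat_exp 0 (real (Suc n) * (t - x))))) \<longlonglongrightarrow> (LINT r|lebesgue_on {0<..<T}. indicator (box s t) r * g r)"
      by simp
    moreover note tendsto_diff[OF lim2[unfolded refl] lim1]
    ultimately have "(LINT r|lebesgue_on {0<..<T}. indicator (box s t) r * g r) = F (- (- t)) - F s"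
      by (rule LIMSEQ_unique)
    then show ?thesis using st by (simp add: F_def box_real)
  qed
  show ?thesis
  proof (cases "s = t")
    case False
    with st have st': "s < t" by simp
    define \<delta> where "\<delta> n = (t - s) / 3 * inverse (real (Suc n))" for n
    define s' t' where "s' n = s + \<delta> n" and "t' n = t - \<delta> n" for n
    have "inverse (real (Suc n)) \<le> 1" for n
      by (rule inverse_le_1_iff[THEN iffD2]) simp
    then have small: "0 < \<delta> n" "\<delta> n \<le> (t - s) / 3" for n
      unfolding \<delta>_def using st' by (simp, intro mult_left_le) auto
    have bounds: "s < s' n" "s' n < t' n" "t' n < t" for n
      using small[of n] st' by (auto simp: s'_def t'_def)
    have lim0: "\<delta> \<longlonglongrightarrow> 0"
      unfolding \<delta>_def using tendsto_mult_right_zero[OF LIMSEQ_inverse_real_of_nat, of "(t - s) / 3"] .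
    have s': "s' \<longlonglongrightarrow> s"
      using tendsto_add[OF tendsto_const lim0, of s] by (simp add: s'_def[abs_def])
    have t': "t' \<longlonglongrightarrow> t"
      using tendsto_diff[OF tendsto_const lim0, of t] by (simp add: t'_def[abs_def])
    have mem: "s' n \<in> {0..T}" "t' n \<in> {0..T}" for n
      using bounds[of n] st by auto
    have "(\<lambda>n. f (t' n) - f (s' n)) \<longlonglongrightarrow> f t - f s"
      using st by (intro tendsto_diff continuous_on_tendsto_compose[OF f] s' t' always_eventually allI mem) auto
    moreover have "(\<lambda>n. LINT r|lebesgue_on {0<..<T}. indicator {s' n<..<t' n} r * g r)
      \<longlonglongrightarrow> (LINT r|lebesgue_on {0<..<T}. indicator {s<..<t} r * g r)"
    proof (rule integral_dominated_convergence)
      have gm [measurable]: "g \<in> borel_measurable (lebesgue_on {0<..<T})"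
        using g by (rule borel_measurable_integrable)
      show "integrable (lebesgue_on {0<..<T}) (\<lambda>r. norm (g r))"
        using g by (rule integrable_norm)
      have im: "(indicator {a<..<b} :: real \<Rightarrow> real) \<in> borel_measurable (lebesgue_on {0<..<T})" for a b :: real
        by (intro measurable_restrict_space1 borel_measurable_indicator) simp
      show "(\<lambda>r. indicator {s' n<..<t' n} r * g r) \<in> borel_measurable (lebesgue_on {0<..<T})" for n
        by (intro borel_measurable_times gm im)
      show "(\<lambda>r. indicator {s<..<t} r * g r) \<in> borel_measurable (lebesgue_on {0<..<T})"
        by (intro borel_measurable_times gm im)
      show "AE r in lebesgue_on {0<..<T}. norm (indicator {s' n<..<t' n} r * g r) \<le> norm (g r)" for n
        by (auto simp: indicator_def)
      have "(\<lambda>n. indicator {s' n<..<t' n} r * g r) \<longlonglongrightarrow> indicator {s<..<t} r * g r" for r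
      proof (cases "r \<in> {s<..<t}")
        case True
        then have rst: "s < r" "r < t" by auto
        have "\<forall>\<^sub>F n in sequentially. indicator {s' n<..<t' n} r * g r = indicator {s<..<t} r * g r"
          using eventually_conj[OF order_tendstoD(2)[OF s' rst(1)] order_tendstoD(1)[OF t' rst(2)]]
          by (rule eventually_mono) (use rst in \<open>simp add: indicator_def\<close>)
        then show ?thesis by (rule tendsto_eventually)
      next
        case False
        then have "r \<notin> {s' n<..<t' n}" for n
          using bounds[of n] by auto
        then show ?thesis using False by simp
      qed
      then show "AE r in lebesgue_on {0<..<T}. (\<lambda>n. indicator {s' n<..<t' n} r * g r) \<longlonglongrightarrow> indicator {s<..<t} r * g r"
        by (intro AE_I2)
    qed
    moreover have "f (t' n) - f (s' n) = (LINT r|lebesgue_on {0<..<T}. indicator {s' n<..<t' n} r * g r)" for n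
      using st bounds[of n] by (intro key) auto
    ultimately show ?thesis using LIMSEQ_unique by force
  qed simp
qed

text \<open>The integral of a difference quotient vanishes by translation invariance, and the difference
  quotients converge boundedly on a common bounded set.\<close>

lemma integral_partial_eq_0:
  fixes k :: "'a::euclidean_space \<Rightarrow> real"
  assumes D: "\<And>x. (k has_derivative D x) (at x)" and cont: "continuous_on UNIV (\<lambda>x. D x v)"
    and supp: "\<And>x. x \<notin> cbox a b \<Longrightarrow> k x = 0"
  shows "integrable lborel (\<lambda>x. D x v)" "(LINT x|lborel. D x v) = 0"
proof -
  have D0: "D x v = 0" if "x \<notin> cbox a b" for x
  proof -
    have "((\<lambda>x. 0) has_derivative D x) (at x)"
      by (rule has_derivative_transform_within_open[OF D[of x] _ , of "- cbox a b"])
        (use that supp in \<open>auto intro: open_Compl\<close>)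
    then have "D x = (\<lambda>h. 0)"
      using has_derivative_unique has_derivative_const by blast
    then show ?thesis by simp
  qed
  have "compact ((\<lambda>x. D x v) ` cbox a b)"
    by (intro compact_continuous_image continuous_on_subset[OF cont]) auto
  then obtain C where C: "\<And>x. x \<in> cbox a b \<Longrightarrow> \<bar>D x v\<bar> \<le> C"
    unfolding compact_eq_bounded_closed bounded_iff by (metis image_eqI real_norm_def)
  have bnd: "\<bar>D x v\<bar> \<le> max C 0" for x
    using C[of x] D0[of x] by (cases "x \<in> cbox a b") auto
  have kcont: "continuous_on A k" for A
    using D has_derivative_continuous by (metis continuous_at_imp_continuous_on)
  have kint: "integrable lborel k"
  proof -
    have "integrable lborel (\<lambda>x. indicator (cbox a b) x *\<^sub>R k x)"
      by (rule borel_integrable_compact) (auto intro: kcont)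
    moreover have "(\<lambda>x. indicator (cbox a b) x *\<^sub>R k x) = k"
      using supp by (auto simp: fun_eq_iff indicator_def)
    ultimately show ?thesis by simp
  qed
  have "integrable lborel (\<lambda>x. indicator (cbox a b) x *\<^sub>R D x v)"
    by (rule borel_integrable_compact) (auto intro: continuous_on_subset[OF cont])
  moreover have "(\<lambda>x. indicator (cbox a b) x *\<^sub>R D x v) = (\<lambda>x. D x v)"
    using D0 by (auto simp: fun_eq_iff indicator_def)
  ultimately show "integrable lborel (\<lambda>x. D x v)" by simp
  define q where "q n x = (k (x + inverse (real (Suc n)) *\<^sub>R v) - k x) / inverse (real (Suc n))" for n x
  have shift: "integrable lborel (\<lambda>x. k (x + c))" "(LINT x|lborel. k (x + c)) = (LINT x|lborel. k x)" for c
    using kint integrable_distr[of "(+) c" lborel borel k] integral_distr[of "(+) c" lborel borel k]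
      kcont[THEN borel_measurable_continuous_onI]
    by (simp_all add: lborel_distr_plus add.commute cong: measurable_cong_sets)
  have q0: "(LINT x|lborel. q n x) = 0" for n
    unfolding q_def using shift[of "inverse (real (Suc n)) *\<^sub>R v"] kint by simp
  have qbnd: "\<bar>q n x\<bar> \<le> max C 0" for n x
  proof -
    define e where "e = inverse (real (Suc n))"
    have e: "e > 0" by (simp add: e_def)
    have "((\<lambda>r. k (x + r *\<^sub>R v)) has_real_derivative D (x + r *\<^sub>R v) v) (at r)" for r
    proof -
      have "((\<lambda>r. k (x + r *\<^sub>R v)) has_derivative (\<lambda>h. D (x + r *\<^sub>R v) (h *\<^sub>R v))) (at r)"
        by (rule has_derivative_compose[OF _ D]) (auto intro!: derivative_eq_intros)
      moreover have "D (x + r *\<^sub>R v) (h *\<^sub>R v) = D (x + r *\<^sub>R v) v * h" for h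
        using linear_scale[OF has_derivative_linear[OF D]] by simp
      ultimately show ?thesis by (simp add: has_field_derivative_def)
    qed
    then obtain z where "k (x + e *\<^sub>R v) - k (x + 0 *\<^sub>R v) = (e - 0) * D (x + z *\<^sub>R v) v"
      using MVT2[OF e, of "\<lambda>r. k (x + r *\<^sub>R v)" "\<lambda>r. D (x + r *\<^sub>R v) v"] by blast
    then have "q n x = D (x + z *\<^sub>R v) v"
      unfolding q_def e_def[symmetric] using e by simp
    then show ?thesis using bnd by simp
  qed
  obtain R where R: "\<And>x. x \<in> cbox a b \<Longrightarrow> norm x \<le> R"
    using bounded_cbox[of a b] by (auto simp: bounded_iff)
  have "(\<lambda>n. LINT x|lborel. q n x) \<longlonglongrightarrow> (LINT x|lborel. D x v)"
  proof (rule integral_dominated_convergence)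
    show "(\<lambda>x. D x v) \<in> borel_measurable lborel"
      using cont by (simp add: borel_measurable_continuous_onI)
    show "q n \<in> borel_measurable lborel" for n
      unfolding q_def using shift(1) kint by (intro borel_measurable_divide borel_measurable_diff borel_measurable_integrable) auto
    show "integrable lborel (\<lambda>x. max C 0 * indicator (cball 0 (R + norm v)) x)"
      by (intro integrable_mult_right integrable_real_indicator) (use emeasure_lborel_cball_finite[of 0 "R + norm v"] in auto)
    show "AE x in lborel. norm (q n x) \<le> max C 0 * indicator (cball 0 (R + norm v)) x" for n
    proof (rule AE_I2)
      fix x
      show "norm (q n x) \<le> max C 0 * indicator (cball 0 (R + norm v)) x"
      proof (cases "x \<in> cball 0 (R + norm v)")
        case True then show ?thesis using qbnd by simp
      next
        case False
        then have big: "norm x > R + norm v" by simp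
        have "norm (inverse (real (Suc n)) *\<^sub>R v) \<le> norm v"
          by (simp add: inverse_le_1_iff mult_left_le_one_le)
        moreover have "norm x \<le> norm (x + inverse (real (Suc n)) *\<^sub>R v) + norm (inverse (real (Suc n)) *\<^sub>R v)"
          using norm_triangle_ineq4[of "x + inverse (real (Suc n)) *\<^sub>R v" "inverse (real (Suc n)) *\<^sub>R v"] by simp
        ultimately have "norm (x + inverse (real (Suc n)) *\<^sub>R v) > R" "norm x > R"
          using big norm_ge_zero[of v] by linarith+
        then have "x + inverse (real (Suc n)) *\<^sub>R v \<notin> cbox a b" "x \<notin> cbox a b"
          using R by (meson not_less)+
        then show ?thesis by (simp add: q_def supp)
      qed
    qed
    show "AE x in lborel. (\<lambda>n. q n x) \<longlonglongrightarrow> D x v"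
    proof (rule AE_I2)
      fix x
      have "((\<lambda>r. k (x + r *\<^sub>R v)) has_derivative (\<lambda>h. D (x + 0 *\<^sub>R v) (h *\<^sub>R v))) (at 0)"
        by (rule has_derivative_compose[OF _ D]) (auto intro!: derivative_eq_intros)
      moreover have "D x (h *\<^sub>R v) = D x v * h" for h
        using linear_scale[OF has_derivative_linear[OF D]] by simp
      ultimately have "((\<lambda>r. k (x + r *\<^sub>R v)) has_real_derivative D x v) (at 0)"
        by (simp add: has_field_derivative_def)
      then have "((\<lambda>h. (k (x + h *\<^sub>R v) - k x) / h) \<longlongrightarrow> D x v) (at 0)"
        by (simp add: DERIV_def)
      moreover have "filterlim (\<lambda>n. inverse (real (Suc n))) (at 0) sequentially"
        unfolding filterlim_at using LIMSEQ_inverse_real_of_nat by simp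
      ultimately show "(\<lambda>n. q n x) \<longlonglongrightarrow> D x v"
        unfolding q_def by (rule filterlim_compose)
    qed
  qed
  then show "(LINT x|lborel. D x v) = 0" by (simp add: q0 LIMSEQ_const_iff)
qed

lemma test_functionD:
  assumes "\<psi> \<in> test_functions \<Omega>"
  shows "(\<psi> has_derivative frechet_derivative \<psi> (at x)) (at x)"
    "continuous_on A \<psi>" "\<exists>a. \<forall>x. x \<notin> cbox (- a) a \<longrightarrow> \<psi> x = 0" "x \<notin> \<Omega> \<Longrightarrow> \<psi> x = 0"
    "i \<in> Basis \<Longrightarrow> Ck k (\<lambda>x. frechet_derivative \<psi> (at x) i)"
    "i \<in> Basis \<Longrightarrow> (\<lambda>x. frechet_derivative \<psi> (at x) i) \<in> test_functions \<Omega>"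
proof -
  have Ck: "Ck k \<psi>" for k
    using assms by (auto simp: test_functions_def)
  have comp: "compact (closure {x. \<psi> x \<noteq> 0})" and sub: "closure {x. \<psi> x \<noteq> 0} \<subseteq> \<Omega>"
    using assms by (auto simp: test_functions_def)
  show D: "(\<psi> has_derivative frechet_derivative \<psi> (at x)) (at x)" for x
    using Ck_SucD(1)[OF Ck] .
  show "continuous_on A \<psi>" using Ck_imp_continuous[OF Ck] .
  have "bounded {x. \<psi> x \<noteq> 0}"
    using comp by (meson bounded_closure_image bounded_subset closure_subset compact_imp_bounded)
  then obtain a where "{x. \<psi> x \<noteq> 0} \<subseteq> cbox (- a) a"
    using bounded_subset_cbox_symmetric by blast
  then show "\<exists>a. \<forall>x. x \<notin> cbox (- a) a \<longrightarrow> \<psi> x = 0" by blast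
  show "x \<notin> \<Omega> \<Longrightarrow> \<psi> x = 0" using order_trans[OF closure_subset sub] by auto
  show C: "i \<in> Basis \<Longrightarrow> Ck k (\<lambda>x. frechet_derivative \<psi> (at x) i)" for k
    using Ck_SucD(2)[OF Ck] .
  assume i: "i \<in> Basis"
  have "frechet_derivative \<psi> (at x) i = 0" if "x \<notin> closure {x. \<psi> x \<noteq> 0}" for x
  proof -
    have "((\<lambda>x. 0) has_derivative frechet_derivative \<psi> (at x)) (at x)"
      by (rule has_derivative_transform_within_open[OF D[of x] _ , of "- closure {x. \<psi> x \<noteq> 0}"])
        (use that closure_subset[of "{x. \<psi> x \<noteq> 0}"] in \<open>auto intro: open_Compl\<close>)
    then have "frechet_derivative \<psi> (at x) = (\<lambda>h. 0)"
      using has_derivative_unique has_derivative_const by blast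
    then show ?thesis by simp
  qed
  then have "closure {x. frechet_derivative \<psi> (at x) i \<noteq> 0} \<subseteq> closure {x. \<psi> x \<noteq> 0}"
    by (intro closure_minimal) auto
  moreover from this have "compact (closure {x. frechet_derivative \<psi> (at x) i \<noteq> 0})"
    using comp by (metis closed_closure compact_Int_closed inf.absorb2)
  ultimately show "(\<lambda>x. frechet_derivative \<psi> (at x) i) \<in> test_functions \<Omega>"
    using C[OF i] sub by (auto simp: test_functions_def)
qed

lemma continuous_imp_lebesgue_measurable:
  fixes f :: "'a::euclidean_space \<Rightarrow> real"
  assumes "continuous_on UNIV f"
  shows "f \<in> borel_measurable lebesgue" "f \<in> borel_measurable (lebesgue_on S)"
proof -
  show *: "f \<in> borel_measurable lebesgue"
    by (rule measurable_completion) (simp add: assms borel_measurable_continuous_onI)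
  show "f \<in> borel_measurable (lebesgue_on S)"
    by (rule measurable_restrict_space1[OF *])
qed

lemma integral_by_parts_test:
  fixes f :: "'a::euclidean_space \<Rightarrow> real"
  assumes \<psi>: "\<psi> \<in> test_functions \<Omega>" and i: "i \<in> Basis"
    and D: "\<And>x. (f has_derivative D x) (at x)" and cont: "continuous_on UNIV (\<lambda>x. D x i)"
  shows "(LINT x|lborel. f x * frechet_derivative \<psi> (at x) i) = - (LINT x|lborel. D x i * \<psi> x)"
    "integrable lborel (\<lambda>x. f x * frechet_derivative \<psi> (at x) i)" "integrable lborel (\<lambda>x. D x i * \<psi> x)"
proof -
  obtain a where a: "\<And>x. x \<notin> cbox (- a) a \<Longrightarrow> \<psi> x = 0"
    using test_functionD(3)[OF \<psi>] by blast
  obtain b where b: "\<And>x. x \<notin> cbox (- b) b \<Longrightarrow> frechet_derivative \<psi> (at x) i = 0"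
    using test_functionD(3)[OF test_functionD(6)[OF \<psi> i]] by blast
  have fc: "continuous_on A f" for A
    using D has_derivative_continuous by (metis continuous_at_imp_continuous_on)
  have cf: "continuous_on A (\<lambda>x. f x * frechet_derivative \<psi> (at x) i)" for A
    by (intro continuous_intros fc test_functionD(2)[OF test_functionD(6)[OF \<psi> i]])
  have cg: "continuous_on A (\<lambda>x. D x i * \<psi> x)" for A
    by (intro continuous_intros test_functionD(2)[OF \<psi>] continuous_on_subset[OF cont]) auto
  show i1: "integrable lborel (\<lambda>x. f x * frechet_derivative \<psi> (at x) i)"
  proof -
    have "integrable lborel (\<lambda>x. indicator (cbox (- b) b) x *\<^sub>R (f x * frechet_derivative \<psi> (at x) i))"
      by (rule borel_integrable_compact) (auto intro: cf)
    moreover have "(\<lambda>x. indicator (cbox (- b) b) x *\<^sub>R (f x * frechet_derivative \<psi> (at x) i))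
      = (\<lambda>x. f x * frechet_derivative \<psi> (at x) i)"
      using b by (auto simp: fun_eq_iff indicator_def)
    ultimately show ?thesis by simp
  qed
  show i2: "integrable lborel (\<lambda>x. D x i * \<psi> x)"
  proof -
    have "integrable lborel (\<lambda>x. indicator (cbox (- a) a) x *\<^sub>R (D x i * \<psi> x))"
      by (rule borel_integrable_compact) (auto intro: cg)
    moreover have "(\<lambda>x. indicator (cbox (- a) a) x *\<^sub>R (D x i * \<psi> x)) = (\<lambda>x. D x i * \<psi> x)"
      using a by (auto simp: fun_eq_iff indicator_def)
    ultimately show ?thesis by simp
  qed
  have "(LINT x|lborel. f x * frechet_derivative \<psi> (at x) i + D x i * \<psi> x) = 0"
    by (rule integral_partial_eq_0(2)[where k = "\<lambda>x. f x * \<psi> x" and v = i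
          and D = "\<lambda>x h. f x * frechet_derivative \<psi> (at x) h + D x h * \<psi> x" and a = "- a" and b = a])
      (auto intro!: has_derivative_mult D test_functionD(1)[OF \<psi>] continuous_on_add cf cg simp: a)
  then show "(LINT x|lborel. f x * frechet_derivative \<psi> (at x) i) = - (LINT x|lborel. D x i * \<psi> x)"
    by (simp add: Bochner_Integration.integral_add[OF i1 i2])
qed

section \<open>Reaction laws in \<open>H\<^sup>s\<close>\<close>

definition Hs_weight :: "real \<Rightarrow> real \<Rightarrow> real"
  where "Hs_weight s \<xi> = (1 + \<xi>\<^sup>2) powr s"

definition Hs_L2 :: "real \<Rightarrow> (real \<Rightarrow> complex) set"
  where "Hs_L2 s = {g \<in> borel_measurable lebesgue. integrable lebesgue (\<lambda>\<xi>. Hs_weight s \<xi> * (norm (g \<xi>))\<^sup>2)}"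

definition Hs_L2_norm :: "real \<Rightarrow> (real \<Rightarrow> complex) \<Rightarrow> real"
  where "Hs_L2_norm s g = sqrt (LINT \<xi>|lebesgue. Hs_weight s \<xi> * (norm (g \<xi>))\<^sup>2)"

definition inv_fourier :: "(real \<Rightarrow> complex) \<Rightarrow> real \<Rightarrow> complex"
  where "inv_fourier g x = (LINT \<xi>|lebesgue. g \<xi> * cis (\<xi> * x)) / complex_of_real (sqrt (2 * pi))"

lemma has_Hs_density_iff:
  "has_Hs_density s f g \<longleftrightarrow> g \<in> Hs_L2 s \<and> (\<forall>x. complex_of_real (f x) = inv_fourier g x)"
  by (auto simp: has_Hs_density_def Hs_L2_def Hs_weight_def inv_fourier_def)

lemma Hs_weight_pos: "Hs_weight s \<xi> > 0"
  using sum_power2_gt_zero_iff[of 1 \<xi>] by (auto simp: Hs_weight_def)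

lemma Hs_weight_measurable [measurable]: "Hs_weight s \<in> borel_measurable borel"
  unfolding Hs_weight_def by measurable

lemma Hs_weight_measurable_lebesgue: "Hs_weight s \<in> borel_measurable lebesgue"
  by (rule measurable_completion) simp

lemma Hs_L2_add_scale:
  assumes "g \<in> Hs_L2 s" "h \<in> Hs_L2 s"
  shows "(\<lambda>\<xi>. g \<xi> + c * h \<xi>) \<in> Hs_L2 s"
proof -
  have m: "g \<in> borel_measurable lebesgue" "h \<in> borel_measurable lebesgue"
    and i: "integrable lebesgue (\<lambda>\<xi>. Hs_weight s \<xi> * (norm (g \<xi>))\<^sup>2)"
      "integrable lebesgue (\<lambda>\<xi>. Hs_weight s \<xi> * (norm (h \<xi>))\<^sup>2)"
    using assms by (auto simp: Hs_L2_def)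
  have "integrable lebesgue (\<lambda>\<xi>. Hs_weight s \<xi> * (norm (g \<xi> + c * h \<xi>))\<^sup>2)"
  proof (rule Bochner_Integration.integrable_bound)
    show "integrable lebesgue (\<lambda>\<xi>. 2 * (Hs_weight s \<xi> * (norm (g \<xi>))\<^sup>2)
        + 2 * (norm c)\<^sup>2 * (Hs_weight s \<xi> * (norm (h \<xi>))\<^sup>2))"
      by (intro Bochner_Integration.integrable_add integrable_mult_right i)
    show "(\<lambda>\<xi>. Hs_weight s \<xi> * (norm (g \<xi> + c * h \<xi>))\<^sup>2) \<in> borel_measurable lebesgue"
      using m Hs_weight_measurable_lebesgue[of s] by measurable
    show "AE \<xi> in lebesgue. norm (Hs_weight s \<xi> * (norm (g \<xi> + c * h \<xi>))\<^sup>2) \<le>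
        norm (2 * (Hs_weight s \<xi> * (norm (g \<xi>))\<^sup>2) + 2 * (norm c)\<^sup>2 * (Hs_weight s \<xi> * (norm (h \<xi>))\<^sup>2))"
    proof (rule AE_I2)
      fix \<xi> :: real
      have "(norm (g \<xi> + c * h \<xi>))\<^sup>2 \<le> (norm (g \<xi>) + norm c * norm (h \<xi>))\<^sup>2"
        by (intro power_mono) (metis norm_mult norm_triangle_ineq, simp)
      also have "\<dots> \<le> 2 * (norm (g \<xi>))\<^sup>2 + 2 * (norm c * norm (h \<xi>))\<^sup>2"
        using sum_squares_bound[of "norm (g \<xi>)" "norm c * norm (h \<xi>)"] by (simp add: power2_sum)
      finally have "Hs_weight s \<xi> * (norm (g \<xi> + c * h \<xi>))\<^sup>2 \<le>
          Hs_weight s \<xi> * (2 * (norm (g \<xi>))\<^sup>2 + 2 * (norm c * norm (h \<xi>))\<^sup>2)"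
        using Hs_weight_pos[of s \<xi>] by (intro mult_left_mono) auto
      also have "\<dots> = 2 * (Hs_weight s \<xi> * (norm (g \<xi>))\<^sup>2) + 2 * (norm c)\<^sup>2 * (Hs_weight s \<xi> * (norm (h \<xi>))\<^sup>2)"
        by (simp add: power_mult_distrib algebra_simps)
      finally show "norm (Hs_weight s \<xi> * (norm (g \<xi> + c * h \<xi>))\<^sup>2) \<le>
        norm (2 * (Hs_weight s \<xi> * (norm (g \<xi>))\<^sup>2) + 2 * (norm c)\<^sup>2 * (Hs_weight s \<xi> * (norm (h \<xi>))\<^sup>2))"
        using Hs_weight_pos[of s \<xi>] by (simp add: abs_mult)
    qed
  qed
  then show ?thesis using m by (simp add: Hs_L2_def)
qed

text \<open>From \<open>a \<le> w a\<^sup>2 + 1/w\<close> with \<open>w = 1 + \<xi>\<^sup>2\<close>, where \<open>w \<le> w\<^sup>s\<close>.\<close>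

lemma Hs_L2_integrable:
  assumes s: "s > 1" and g: "g \<in> Hs_L2 s"
  shows "integrable lebesgue g"
proof (rule Bochner_Integration.integrable_bound)
  have "integrable lborel (\<lambda>x::real. inverse (1 + x^2))"
    using integrable_inverse_1_plus_square by (simp add: set_integrable_def)
  then have "integrable lebesgue (\<lambda>x::real. inverse (1 + x^2))"
    by (subst integrable_completion) auto
  then show "integrable lebesgue (\<lambda>\<xi>. Hs_weight s \<xi> * (norm (g \<xi>))\<^sup>2 + inverse (1 + \<xi>^2))"
    using g by (intro Bochner_Integration.integrable_add) (auto simp: Hs_L2_def)
  show "g \<in> borel_measurable lebesgue" using g by (simp add: Hs_L2_def)
  show "AE \<xi> in lebesgue. norm (g \<xi>) \<le> norm (Hs_weight s \<xi> * (norm (g \<xi>))\<^sup>2 + inverse (1 + \<xi>^2))"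
  proof (rule AE_I2)
    fix \<xi> :: real
    define w where "w = 1 + \<xi>\<^sup>2"
    define a where "a = norm (g \<xi>)"
    have w: "w \<ge> 1" by (simp add: w_def)
    have "w powr 1 \<le> w powr s" using w s by (intro powr_mono) auto
    then have "w * a\<^sup>2 \<le> Hs_weight s \<xi> * a\<^sup>2" using w by (intro mult_right_mono) (auto simp: Hs_weight_def w_def)
    moreover have "a \<le> w * a\<^sup>2 + inverse w"
    proof -
      have "0 \<le> (w * a - 1)\<^sup>2 + w * a" using w by (simp add: a_def)
      then have "w * a \<le> (w * a)\<^sup>2 + 1" by (simp add: power2_eq_square algebra_simps)
      then show ?thesis using w by (simp add: field_simps power2_eq_square)
    qed
    ultimately have "a \<le> Hs_weight s \<xi> * a\<^sup>2 + inverse w" by simp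
    then show "norm (g \<xi>) \<le> norm (Hs_weight s \<xi> * (norm (g \<xi>))\<^sup>2 + inverse (1 + \<xi>^2))"
      by (simp add: a_def w_def)
  qed
qed

lemma cis_lebesgue_measurable: "(\<lambda>\<xi>. cis (\<xi> * x)) \<in> borel_measurable lebesgue"
  by (rule measurable_completion) (auto simp: cis_conv_exp intro!: borel_measurable_continuous_onI continuous_intros)

lemma integrable_mult_cis:
  assumes "integrable lebesgue g"
  shows "integrable lebesgue (\<lambda>\<xi>. g \<xi> * cis (\<xi> * x))"
proof (rule Bochner_Integration.integrable_bound[OF assms])
  show "(\<lambda>\<xi>. g \<xi> * cis (\<xi> * x)) \<in> borel_measurable lebesgue"
    by (intro borel_measurable_times borel_measurable_integrable[OF assms] cis_lebesgue_measurable)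
qed (simp add: norm_mult)

lemma inv_fourier_add_scale:
  assumes "integrable lebesgue g" "integrable lebesgue h"
  shows "inv_fourier (\<lambda>\<xi>. g \<xi> + c * h \<xi>) x = inv_fourier g x + c * inv_fourier h x"
proof -
  have "(LINT \<xi>|lebesgue. (g \<xi> + c * h \<xi>) * cis (\<xi> * x)) =
    (LINT \<xi>|lebesgue. g \<xi> * cis (\<xi> * x) + c * (h \<xi> * cis (\<xi> * x)))"
    by (simp add: algebra_simps)
  also have "\<dots> = (LINT \<xi>|lebesgue. g \<xi> * cis (\<xi> * x)) + c * (LINT \<xi>|lebesgue. h \<xi> * cis (\<xi> * x))"
    by (simp add: integrable_mult_cis assms)
  finally show ?thesis by (simp add: inv_fourier_def add_divide_distrib)
qed

lemma Hs_add_scale: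
  assumes s: "s > 1" and f: "f \<in> Hs s" and g: "g \<in> Hs s"
  shows "(\<lambda>x. f x + c * g x) \<in> Hs s"
proof -
  obtain u v where u: "u \<in> Hs_L2 s" "\<And>x. complex_of_real (f x) = inv_fourier u x"
    and v: "v \<in> Hs_L2 s" "\<And>x. complex_of_real (g x) = inv_fourier v x"
    using f g by (auto simp: Hs_def has_Hs_density_iff)
  have "has_Hs_density s (\<lambda>x. f x + c * g x) (\<lambda>\<xi>. u \<xi> + complex_of_real c * v \<xi>)"
    using u v by (simp add: has_Hs_density_iff Hs_L2_add_scale inv_fourier_add_scale Hs_L2_integrable[OF s])
  then show ?thesis by (auto simp: Hs_def)
qed

lemma Hs_diff: "s > 1 \<Longrightarrow> f \<in> Hs s \<Longrightarrow> g \<in> Hs s \<Longrightarrow> f - g \<in> Hs s"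
  using Hs_add_scale[of s f g "-1"] by (simp add: fun_diff_def)

lemma lebesgue_uminus: "distr lebesgue lebesgue uminus = (lebesgue :: real measure)"
  using lebesgue_real_affine[of "-1" 0] by (simp add: density_1)

lemma uminus_lebesgue_measurable: "(uminus :: real \<Rightarrow> real) \<in> lebesgue \<rightarrow>\<^sub>M lebesgue"
  using lebesgue_affine_measurable[of "\<lambda>_. -1 :: real" 0] by (simp add: sum_negf euclidean_representation)

lemma lebesgue_reflect:
  fixes f :: "real \<Rightarrow> 'b::{banach, second_countable_topology}"
  assumes "f \<in> borel_measurable lebesgue"
  shows "(\<lambda>x. f (- x)) \<in> borel_measurable lebesgue"
    "integrable lebesgue (\<lambda>x. f (- x)) = integrable lebesgue f"
    "(LINT x|lebesgue. f (- x)) = (LINT x|lebesgue. f x)"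
proof -
  show "(\<lambda>x. f (- x)) \<in> borel_measurable lebesgue"
    using measurable_compose[OF uminus_lebesgue_measurable assms] .
  show "integrable lebesgue (\<lambda>x. f (- x)) = integrable lebesgue f"
    using integrable_distr_eq[OF uminus_lebesgue_measurable assms] by (simp add: lebesgue_uminus)
  show "(LINT x|lebesgue. f (- x)) = (LINT x|lebesgue. f x)"
    using integral_distr[OF uminus_lebesgue_measurable assms] by (simp add: lebesgue_uminus)
qed

lemma Hs_norm_nonneg: "0 \<le> Hs_norm s f" if "f \<in> Hs s"
  unfolding Hs_norm_def using that
  by (intro cInf_greatest) (auto simp: Hs_def intro!: real_sqrt_ge_zero integral_nonneg_AE)

lemma Hs_norm_le:
  assumes "has_Hs_density s f g"
  shows "Hs_norm s f \<le> Hs_L2_norm s g"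
  unfolding Hs_norm_def
  by (rule cInf_lower) (use assms in \<open>auto simp: Hs_L2_norm_def Hs_weight_def
      intro!: bdd_belowI[of _ 0] integral_nonneg_AE real_sqrt_ge_zero\<close>)

text \<open>\<open>Hs\<close> consists of real functions, but a truncated density need not be Hermitian, since densities
  are determined only up to null sets. The Hermitian part \<open>(h(\<xi>) + cnj h(-\<xi>)) / 2\<close> is a density of
  the real part, and passing to it does not increase the weighted norm.\<close>

lemma Re_inv_fourier_Hs:
  assumes s: "s > 1" and h: "h \<in> Hs_L2 s"
  shows "(\<lambda>x. Re (inv_fourier h x)) \<in> Hs s"
    "Hs_norm s (\<lambda>x. Re (inv_fourier h x)) \<le> Hs_L2_norm s h"
proof -
  define k where "k \<xi> = (h \<xi> + cnj (h (- \<xi>))) / 2" for \<xi>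
  have hm: "h \<in> borel_measurable lebesgue"
    and hi2: "integrable lebesgue (\<lambda>\<xi>. Hs_weight s \<xi> * (norm (h \<xi>))\<^sup>2)"
    using h by (auto simp: Hs_L2_def)
  have hi: "integrable lebesgue h" using Hs_L2_integrable[OF s h] .
  have hm': "(\<lambda>\<xi>. h (- \<xi>)) \<in> borel_measurable lebesgue" by (rule lebesgue_reflect(1)[OF hm])
  have w: "Hs_weight s (- \<xi>) = Hs_weight s \<xi>" for \<xi> by (simp add: Hs_weight_def)
  have wm: "(\<lambda>\<xi>. Hs_weight s \<xi> * (norm (h \<xi>))\<^sup>2) \<in> borel_measurable lebesgue"
    using hi2 by (rule borel_measurable_integrable)
  have hi2': "integrable lebesgue (\<lambda>\<xi>. Hs_weight s \<xi> * (norm (h (- \<xi>)))\<^sup>2)"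
    "(LINT \<xi>|lebesgue. Hs_weight s \<xi> * (norm (h (- \<xi>)))\<^sup>2) = (LINT \<xi>|lebesgue. Hs_weight s \<xi> * (norm (h \<xi>))\<^sup>2)"
    using lebesgue_reflect(2,3)[OF wm] hi2 by (simp_all add: w)
  have cm: "(\<lambda>\<xi>. cnj (h (- \<xi>))) \<in> borel_measurable lebesgue"
    using hm' borel_measurable_continuous_onI[of cnj] continuous_on_cnj[OF continuous_on_id]
    by (auto intro: measurable_compose)
  have km: "k \<in> borel_measurable lebesgue"
    unfolding k_def using hm cm by measurable
  have k2: "Hs_weight s \<xi> * (norm (k \<xi>))\<^sup>2 \<le>
      (Hs_weight s \<xi> * (norm (h \<xi>))\<^sup>2 + Hs_weight s \<xi> * (norm (h (- \<xi>)))\<^sup>2) / 2" for \<xi>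
  proof -
    define a b where "a = norm (h \<xi>)" and "b = norm (h (- \<xi>))"
    have "norm (k \<xi>) \<le> (a + b) / 2"
      using norm_triangle_ineq[of "h \<xi>" "cnj (h (- \<xi>))"] by (simp add: k_def norm_divide a_def b_def)
    then have "(norm (k \<xi>))\<^sup>2 \<le> ((a + b) / 2)\<^sup>2" by (intro power_mono) auto
    also have "\<dots> \<le> (a\<^sup>2 + b\<^sup>2) / 2"
      using zero_le_power2[of "a - b"] by (simp add: power2_eq_square algebra_simps)
    finally have "Hs_weight s \<xi> * (norm (k \<xi>))\<^sup>2 \<le> Hs_weight s \<xi> * ((a\<^sup>2 + b\<^sup>2) / 2)"
      using Hs_weight_pos[of s \<xi>] by (intro mult_left_mono) auto
    then show ?thesis by (simp add: a_def b_def algebra_simps)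
  qed
  have dom: "integrable lebesgue (\<lambda>\<xi>. (Hs_weight s \<xi> * (norm (h \<xi>))\<^sup>2 + Hs_weight s \<xi> * (norm (h (- \<xi>)))\<^sup>2) / 2)"
    by (intro integrable_divide Bochner_Integration.integrable_add hi2 hi2')
  have ki2: "integrable lebesgue (\<lambda>\<xi>. Hs_weight s \<xi> * (norm (k \<xi>))\<^sup>2)"
  proof (rule Bochner_Integration.integrable_bound[OF dom])
    show "(\<lambda>\<xi>. Hs_weight s \<xi> * (norm (k \<xi>))\<^sup>2) \<in> borel_measurable lebesgue"
      using km Hs_weight_measurable_lebesgue[of s] by measurable
    show "AE \<xi> in lebesgue. norm (Hs_weight s \<xi> * (norm (k \<xi>))\<^sup>2) \<le>
      norm ((Hs_weight s \<xi> * (norm (h \<xi>))\<^sup>2 + Hs_weight s \<xi> * (norm (h (- \<xi>)))\<^sup>2) / 2)"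
      using k2 Hs_weight_pos[of s] by (intro AE_I2) (simp add: abs_mult less_imp_le)
  qed
  have kL: "k \<in> Hs_L2 s" using km ki2 by (simp add: Hs_L2_def)
  have kn: "Hs_L2_norm s k \<le> Hs_L2_norm s h"
  proof -
    have "(LINT \<xi>|lebesgue. Hs_weight s \<xi> * (norm (k \<xi>))\<^sup>2) \<le>
      (LINT \<xi>|lebesgue. (Hs_weight s \<xi> * (norm (h \<xi>))\<^sup>2 + Hs_weight s \<xi> * (norm (h (- \<xi>)))\<^sup>2) / 2)"
      by (intro integral_mono ki2 dom k2)
    also have "\<dots> = (LINT \<xi>|lebesgue. Hs_weight s \<xi> * (norm (h \<xi>))\<^sup>2)"
      using hi2'(2) by (simp add: Bochner_Integration.integral_add[OF hi2 hi2'(1)])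
    finally show ?thesis by (simp add: Hs_L2_norm_def)
  qed
  have "inv_fourier k x = complex_of_real (Re (inv_fourier h x))" for x
  proof -
    have hc: "(\<lambda>\<xi>. h \<xi> * cis (\<xi> * x)) \<in> borel_measurable lebesgue"
      using integrable_mult_cis[OF hi] by (rule borel_measurable_integrable)
    have i1: "integrable lebesgue (\<lambda>\<xi>. h \<xi> * cis (\<xi> * x))" using integrable_mult_cis[OF hi] .
    then have i2: "integrable lebesgue (\<lambda>\<xi>. h (- \<xi>) * cis (- \<xi> * x))"
      using lebesgue_reflect(2)[OF hc] by simp
    then have i3: "integrable lebesgue (\<lambda>\<xi>. cnj (h (- \<xi>) * cis (- \<xi> * x)))"
      by (simp only: integrable_cnj)
    have cnj_int_h: "(LINT \<xi>|lebesgue. cnj (h (- \<xi>) * cis (- \<xi> * x))) =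
        cnj (LINT \<xi>|lebesgue. h (- \<xi>) * cis (- \<xi> * x))"
      using integral_bounded_linear[OF bounded_linear_cnj i2] .
    have "(LINT \<xi>|lebesgue. k \<xi> * cis (\<xi> * x)) =
      (LINT \<xi>|lebesgue. (h \<xi> * cis (\<xi> * x) + cnj (h (- \<xi>) * cis (- \<xi> * x))) / 2)"
      by (intro Bochner_Integration.integral_cong refl) (simp add: k_def cis_cnj algebra_simps add_divide_distrib)
    also have "\<dots> = ((LINT \<xi>|lebesgue. h \<xi> * cis (\<xi> * x)) + cnj (LINT \<xi>|lebesgue. h (- \<xi>) * cis (- \<xi> * x))) / 2"
      by (simp only: Bochner_Integration.integral_add[OF i1 i3] integral_divide_zero cnj_int_h)
    also have "(LINT \<xi>|lebesgue. h (- \<xi>) * cis (- \<xi> * x)) = (LINT \<xi>|lebesgue. h \<xi> * cis (\<xi> * x))"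
      using lebesgue_reflect(3)[OF hc] by simp
    finally have "(LINT \<xi>|lebesgue. k \<xi> * cis (\<xi> * x)) = complex_of_real (Re (LINT \<xi>|lebesgue. h \<xi> * cis (\<xi> * x)))"
      by (simp add: complex_add_cnj)
    then show ?thesis unfolding inv_fourier_def by (simp add: Re_divide_of_real)
  qed
  then have "has_Hs_density s (\<lambda>x. Re (inv_fourier h x)) k"
    using kL by (simp add: has_Hs_density_iff)
  then show "(\<lambda>x. Re (inv_fourier h x)) \<in> Hs s" "Hs_norm s (\<lambda>x. Re (inv_fourier h x)) \<le> Hs_L2_norm s h"
    using Hs_norm_le kn by (auto simp: Hs_def intro: order_trans)
qed

lemma DERIV_quadratic:
  fixes f :: "real \<Rightarrow> real"
  assumes "\<And>h. \<bar>f (x + h) - f x - h * D\<bar> \<le> C * h\<^sup>2"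
  shows "(f has_real_derivative D) (at x)"
proof -
  have "((\<lambda>h. (f (x + h) - f x) / h - D) \<longlongrightarrow> 0) (at 0)"
  proof (rule Lim_null_comparison)
    have "norm ((f (x + h) - f x) / h - D) \<le> C * \<bar>h\<bar>" if "h \<noteq> 0" for h
    proof -
      have "\<bar>(f (x + h) - f x) / h - D\<bar> * \<bar>h\<bar> = \<bar>f (x + h) - f x - h * D\<bar>"
        using that by (simp flip: abs_mult add: field_simps)
      also have "\<dots> \<le> (C * \<bar>h\<bar>) * \<bar>h\<bar>"
        using assms[of h] by (simp add: power2_eq_square)
      finally show ?thesis using that by simp
    qed
    then show "\<forall>\<^sub>F h in at 0. norm ((f (x + h) - f x) / h - D) \<le> C * \<bar>h\<bar>"
      by (simp add: eventually_at_filter)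
    show "((\<lambda>h. C * \<bar>h\<bar>) \<longlongrightarrow> 0) (at 0)"
      by (rule tendsto_eq_intros | simp)+
  qed
  then have "((\<lambda>h. (f (x + h) - f x) / h) \<longlongrightarrow> D) (at 0)" by (rule LIM_zero_cancel)
  then show ?thesis by (simp add: DERIV_def)
qed

lemma norm_cis_minus_1: "norm (cis t - 1) \<le> \<bar>t\<bar>"
  using iexp_approx1[of t 0] by (simp add: cis_conv_exp)

lemma norm_cis_minus_linear: "norm (cis t - 1 - \<i> * t) \<le> t\<^sup>2 / 2"
  using iexp_approx1[of t 1] by (simp add: cis_conv_exp power2_eq_square diff_diff_eq)

text \<open>Differentiation under the integral sign; the second moment of \<open>h\<close> controls the remainder, and
  also the Lipschitz constant of the derivative.\<close>

lemma band_limited_smooth: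
  assumes h: "integrable lebesgue h" and h2: "integrable lebesgue (\<lambda>\<xi>. \<xi>\<^sup>2 * norm (h \<xi>))"
  obtains f' L where "\<And>x. ((\<lambda>x. Re (inv_fourier h x)) has_real_derivative f' x) (at x)"
    "\<And>x y. \<bar>f' x - f' y\<bar> \<le> L * \<bar>x - y\<bar>"
proof
  define k where "k \<xi> = \<i> * complex_of_real \<xi> * h \<xi>" for \<xi>
  define c where "c = sqrt (2 * pi)"
  have c: "c > 0" by (simp add: c_def)
  have hm: "h \<in> borel_measurable lebesgue" using h by (rule borel_measurable_integrable)
  have idm: "(\<lambda>\<xi>::real. complex_of_real \<xi>) \<in> borel_measurable lebesgue"
    by (rule measurable_completion) simp
  have km: "k \<in> borel_measurable lebesgue"
    unfolding k_def by (intro borel_measurable_times hm idm) simp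
  have k: "integrable lebesgue k"
  proof (rule Bochner_Integration.integrable_bound[OF Bochner_Integration.integrable_add[OF h2 integrable_norm[OF h]] km])
    show "AE \<xi> in lebesgue. norm (k \<xi>) \<le> norm (\<xi>\<^sup>2 * norm (h \<xi>) + norm (h \<xi>))"
    proof (rule AE_I2)
      fix \<xi> :: real
      have "0 \<le> (\<bar>\<xi>\<bar> - 1)\<^sup>2 + \<bar>\<xi>\<bar>" by simp
      then have "\<bar>\<xi>\<bar> \<le> \<xi>\<^sup>2 + 1" by (simp add: power2_eq_square algebra_simps)
      then have "\<bar>\<xi>\<bar> * norm (h \<xi>) \<le> (\<xi>\<^sup>2 + 1) * norm (h \<xi>)" by (intro mult_right_mono) auto
      then show "norm (k \<xi>) \<le> norm (\<xi>\<^sup>2 * norm (h \<xi>) + norm (h \<xi>))"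
        by (simp add: k_def norm_mult algebra_simps)
    qed
  qed
  define L where "L = (LINT \<xi>|lebesgue. \<xi>\<^sup>2 * norm (h \<xi>)) / c"
  have Lc: "(LINT \<xi>|lebesgue. u * (\<xi>\<^sup>2 * norm (h \<xi>))) = u * (L * c)" for u :: real
    using c by (simp add: L_def)
  show "((\<lambda>x. Re (inv_fourier h x)) has_real_derivative Re (inv_fourier k x)) (at x)" for x
  proof (rule DERIV_quadratic)
    fix t :: real
    have i: "integrable lebesgue (\<lambda>\<xi>. h \<xi> * cis (\<xi> * (x + t)))" "integrable lebesgue (\<lambda>\<xi>. h \<xi> * cis (\<xi> * x))"
      "integrable lebesgue (\<lambda>\<xi>. of_real t * (k \<xi> * cis (\<xi> * x)))"
      using integrable_mult_cis[OF h] integrable_mult_right[OF integrable_mult_cis[OF k]] by auto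
    have "inv_fourier h (x + t) - inv_fourier h x - of_real t * inv_fourier k x =
      ((LINT \<xi>|lebesgue. h \<xi> * cis (\<xi> * (x + t))) - (LINT \<xi>|lebesgue. h \<xi> * cis (\<xi> * x))
        - (LINT \<xi>|lebesgue. of_real t * (k \<xi> * cis (\<xi> * x)))) / of_real c"
      by (simp add: inv_fourier_def c_def diff_divide_distrib)
    also have "\<dots> = (LINT \<xi>|lebesgue. h \<xi> * cis (\<xi> * (x + t)) - h \<xi> * cis (\<xi> * x) - of_real t * (k \<xi> * cis (\<xi> * x))) / of_real c"
      using i by simp
    also have "(LINT \<xi>|lebesgue. h \<xi> * cis (\<xi> * (x + t)) - h \<xi> * cis (\<xi> * x) - of_real t * (k \<xi> * cis (\<xi> * x)))
       = (LINT \<xi>|lebesgue. h \<xi> * cis (\<xi> * x) * (cis (\<xi> * t) - 1 - \<i> * of_real (\<xi> * t)))"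
      by (intro Bochner_Integration.integral_cong refl)
        (simp add: k_def cis_mult[symmetric] distrib_left algebra_simps)
    finally have eq: "inv_fourier h (x + t) - inv_fourier h x - of_real t * inv_fourier k x =
       (LINT \<xi>|lebesgue. h \<xi> * cis (\<xi> * x) * (cis (\<xi> * t) - 1 - \<i> * of_real (\<xi> * t))) / of_real c" .
    have "norm (LINT \<xi>|lebesgue. h \<xi> * cis (\<xi> * x) * (cis (\<xi> * t) - 1 - \<i> * of_real (\<xi> * t)))
      \<le> (LINT \<xi>|lebesgue. t\<^sup>2 * (\<xi>\<^sup>2 * norm (h \<xi>)))"
    proof (rule Bochner_Integration.integral_norm_bound_integral)
      show "integrable lebesgue (\<lambda>\<xi>. h \<xi> * cis (\<xi> * x) * (cis (\<xi> * t) - 1 - \<i> * of_real (\<xi> * t)))"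
      proof -
        have "integrable lebesgue (\<lambda>\<xi>. h \<xi> * cis (\<xi> * (x + t)) - h \<xi> * cis (\<xi> * x) - of_real t * (k \<xi> * cis (\<xi> * x)))"
          by (intro Bochner_Integration.integrable_diff i)
        then show ?thesis
          by (elim Bochner_Integration.integrable_cong[THEN iffD1, rotated -1])
            (simp_all add: k_def cis_mult[symmetric] distrib_left algebra_simps)
      qed
      show "integrable lebesgue (\<lambda>\<xi>. t\<^sup>2 * (\<xi>\<^sup>2 * norm (h \<xi>)))" using h2 by simp
      fix \<xi> :: real
      have "norm (cis (\<xi> * t) - 1 - \<i> * of_real (\<xi> * t)) \<le> (\<xi> * t)\<^sup>2"
        using norm_cis_minus_linear[of "\<xi> * t"] zero_le_power2[of "\<xi> * t"] by linarith
      then have "norm (h \<xi>) * norm (cis (\<xi> * t) - 1 - \<i> * of_real (\<xi> * t)) \<le> norm (h \<xi>) * (\<xi> * t)\<^sup>2"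
        by (intro mult_left_mono) auto
      then show "norm (h \<xi> * cis (\<xi> * x) * (cis (\<xi> * t) - 1 - \<i> * of_real (\<xi> * t))) \<le> t\<^sup>2 * (\<xi>\<^sup>2 * norm (h \<xi>))"
        by (simp add: norm_mult power_mult_distrib mult_ac)
    qed
    then have n: "norm (inv_fourier h (x + t) - inv_fourier h x - of_real t * inv_fourier k x) \<le> L * t\<^sup>2"
      unfolding eq Lc norm_divide using c by (simp add: pos_divide_le_eq mult_ac)
    have "\<bar>Re (inv_fourier h (x + t) - inv_fourier h x - of_real t * inv_fourier k x)\<bar> \<le> L * t\<^sup>2"
      using abs_Re_le_cmod n order_trans by blast
    then show "\<bar>Re (inv_fourier h (x + t)) - Re (inv_fourier h x) - t * Re (inv_fourier k x)\<bar> \<le> L * t\<^sup>2"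
      by simp
  qed
  show "\<bar>Re (inv_fourier k x) - Re (inv_fourier k y)\<bar> \<le> L * \<bar>x - y\<bar>" for x y
  proof -
    have i: "integrable lebesgue (\<lambda>\<xi>. k \<xi> * cis (\<xi> * x))" "integrable lebesgue (\<lambda>\<xi>. k \<xi> * cis (\<xi> * y))"
      using integrable_mult_cis[OF k] by auto
    have eq: "inv_fourier k x - inv_fourier k y = (LINT \<xi>|lebesgue. k \<xi> * cis (\<xi> * x) - k \<xi> * cis (\<xi> * y)) / of_real c"
      using i by (simp add: inv_fourier_def c_def diff_divide_distrib)
    have "norm (LINT \<xi>|lebesgue. k \<xi> * cis (\<xi> * x) - k \<xi> * cis (\<xi> * y)) \<le> (LINT \<xi>|lebesgue. \<bar>x - y\<bar> * (\<xi>\<^sup>2 * norm (h \<xi>)))"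
    proof (rule Bochner_Integration.integral_norm_bound_integral)
      show "integrable lebesgue (\<lambda>\<xi>. k \<xi> * cis (\<xi> * x) - k \<xi> * cis (\<xi> * y))" using i by simp
      show "integrable lebesgue (\<lambda>\<xi>. \<bar>x - y\<bar> * (\<xi>\<^sup>2 * norm (h \<xi>)))" using h2 by simp
      fix \<xi> :: real
      have "k \<xi> * cis (\<xi> * x) - k \<xi> * cis (\<xi> * y) = k \<xi> * cis (\<xi> * y) * (cis (\<xi> * (x - y)) - 1)"
        by (simp add: algebra_simps cis_mult)
      then have "norm (k \<xi> * cis (\<xi> * x) - k \<xi> * cis (\<xi> * y)) = \<bar>\<xi>\<bar> * norm (h \<xi>) * norm (cis (\<xi> * (x - y)) - 1)"
        by (simp add: k_def norm_mult)
      also have "\<dots> \<le> \<bar>\<xi>\<bar> * norm (h \<xi>) * \<bar>\<xi> * (x - y)\<bar>"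
        by (intro mult_left_mono norm_cis_minus_1) auto
      also have "\<dots> = \<bar>x - y\<bar> * (\<xi>\<^sup>2 * norm (h \<xi>))"
        by (simp add: abs_mult power2_eq_square)
      finally show "norm (k \<xi> * cis (\<xi> * x) - k \<xi> * cis (\<xi> * y)) \<le> \<bar>x - y\<bar> * (\<xi>\<^sup>2 * norm (h \<xi>))" .
    qed
    then have n: "norm (inv_fourier k x - inv_fourier k y) \<le> L * \<bar>x - y\<bar>"
      unfolding eq Lc norm_divide using c by (simp add: pos_divide_le_eq mult_ac)
    have "\<bar>Re (inv_fourier k x - inv_fourier k y)\<bar> \<le> L * \<bar>x - y\<bar>"
      using abs_Re_le_cmod n order_trans by blast
    then show ?thesis by simp
  qed
qed

lemma Linf_normD:
  fixes f :: "'a::euclidean_space \<Rightarrow> real"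
  assumes "f \<in> Linf UNIV"
  shows "AE x in lebesgue. \<bar>f x\<bar> \<le> Linf_norm UNIV f" "0 \<le> Linf_norm UNIV f"
proof -
  define e where "e = esssup (lebesgue :: 'a measure) (\<lambda>x. ereal \<bar>f x\<bar>)"
  have fin: "e < \<infinity>" using assms by (simp add: Linf_def e_def lebesgue_on_UNIV_eq)
  have ae: "AE x in lebesgue. ereal \<bar>f x\<bar> \<le> e" unfolding e_def by (rule esssup_AE)
  have "e \<ge> 0"
  proof (rule ccontr)
    assume "\<not> e \<ge> 0"
    from ae have "AE x in (lebesgue :: 'a measure). False"
    proof (rule eventually_mono)
      fix x assume "ereal \<bar>f x\<bar> \<le> e"
      moreover have "0 \<le> ereal \<bar>f x\<bar>" by simp
      ultimately show False using \<open>\<not> e \<ge> 0\<close> order_trans by blast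
    qed
    then show False by (simp add: AE_iff_measurable[of "UNIV", simplified])
  qed
  then obtain r where r: "e = ereal r" "r \<ge> 0" using fin by (cases e) auto
  then show "0 \<le> Linf_norm UNIV f" by (simp add: Linf_norm_def e_def[symmetric] lebesgue_on_UNIV_eq)
  show "AE x in lebesgue. \<bar>f x\<bar> \<le> Linf_norm UNIV f"
    using ae r by (simp add: Linf_norm_def e_def[symmetric] lebesgue_on_UNIV_eq)
qed

lemma AE_le_imp_all_le:
  fixes f :: "'a::euclidean_space \<Rightarrow> real"
  assumes "continuous_on UNIV f" "AE x in lebesgue. f x \<le> M"
  shows "f x \<le> M"
proof (rule ccontr)
  assume "\<not> f x \<le> M"
  then have ne: "{x. f x > M} \<noteq> {}" by (auto simp: not_le intro: exI[of _ x])
  have op: "open {x. f x > M}" using assms(1) by (intro open_Collect_less) auto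
  have "{x. f x > M} \<in> null_sets lebesgue"
    using assms(2) op by (subst AE_iff_null_sets) (auto simp: not_less)
  then show False using open_not_negligible[OF op ne] by (simp add: negligible_iff_null_sets)
qed

text \<open>The norm of \<open>W1inf\<close> refers to some weak derivative. By the uniqueness of weak derivatives this
  is the classical one, and an essential bound on a continuous function is a pointwise bound.\<close>

lemma C1_deriv_le_W1inf_norm:
  assumes f: "f \<in> W1inf" and D: "\<And>x. (f has_real_derivative f' x) (at x)" and cont: "continuous_on UNIV f'"
  shows "\<bar>f' x\<bar> \<le> W1inf_norm f"
proof -
  define g where "g = (SOME g. is_Linf_deriv f g)"
  have g: "is_Linf_deriv f g" using f someI_ex[of "is_Linf_deriv f"] by (auto simp: W1inf_def g_def)
  then have gL: "g \<in> Linf UNIV" and weak: "is_weak_partial UNIV 1 f g" by (auto simp: is_Linf_deriv_def)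
  have gm: "g \<in> borel_measurable lebesgue" using gL by (simp add: Linf_def lebesgue_on_UNIV_eq)
  have fm: "f' \<in> borel_measurable lebesgue" by (rule continuous_imp_lebesgue_measurable[OF cont])
  have bounded_int: "integrable lebesgue (\<lambda>x. k x * u x)"
    if "k \<in> borel_measurable lebesgue" "AE x in lebesgue. \<bar>k x\<bar> \<le> M" "integrable lebesgue u" for k u and M :: real
  proof (rule Bochner_Integration.integrable_bound[OF integrable_mult_right[OF that(3), of M]])
    show "(\<lambda>x. k x * u x) \<in> borel_measurable lebesgue"
      by (intro borel_measurable_times that borel_measurable_integrable)
    show "AE x in lebesgue. norm (k x * u x) \<le> norm (M * u x)"
      using that(2) by eventually_elim (auto simp: abs_mult intro!: mult_right_mono)
  qed
  have "AE x in lebesgue_on UNIV. g x - f' x = 0"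
  proof (rule test_orthogonal_imp_AE_0)
    fix a b :: real
    have "integrable lebesgue (\<lambda>x. g x * indicator (cbox a b) x)"
      by (rule bounded_int[OF gm Linf_normD(1)[OF gL]]) (rule lmeasurable_iff_integrable[THEN iffD1, OF lmeasurable_cbox])
    then have I1: "integrable lebesgue (\<lambda>x. indicator (cbox a b) x *\<^sub>R g x)"
      by (simp add: mult.commute)
    have I2: "integrable lebesgue (\<lambda>x. indicator (cbox a b) x *\<^sub>R f' x)"
    proof -
      have "integrable lborel (\<lambda>x. indicator (cbox a b) x *\<^sub>R f' x)"
        by (rule borel_integrable_compact) (auto intro: continuous_on_subset[OF cont])
      then show ?thesis by (subst integrable_completion) (auto dest: borel_measurable_integrable)
    qed
    show "set_integrable lebesgue (cbox a b) (\<lambda>x. indicator UNIV x * (g x - f' x))"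
      using Bochner_Integration.integrable_diff[OF I1 I2] by (simp add: set_integrable_def right_diff_distrib)
  next
    fix \<psi> :: "real \<Rightarrow> real" assume \<psi>: "\<psi> \<in> test_functions UNIV"
    have fd: "(f has_derivative (\<lambda>h. f' x * h)) (at x)" for x
      using D[of x] by (simp add: has_field_derivative_def)
    have c1: "continuous_on UNIV (\<lambda>x. f' x * 1)" using cont by simp
    note ibp = integral_by_parts_test[OF \<psi> _ fd c1, simplified]
    have \<psi>m: "\<psi> \<in> borel_measurable borel" by (intro borel_measurable_continuous_onI test_functionD(2)[OF \<psi>])
    have i2: "integrable lebesgue (\<lambda>x. f' x * \<psi> x)"
      using ibp(3) by (subst integrable_completion) (auto dest: borel_measurable_integrable)
    have \<psi>i: "integrable lebesgue \<psi>"
    proof -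
      obtain a where a: "\<And>x. x \<notin> cbox (- a) a \<Longrightarrow> \<psi> x = 0" using test_functionD(3)[OF \<psi>] by blast
      have "integrable lborel (\<lambda>x. indicator (cbox (- a) a) x *\<^sub>R \<psi> x)"
        by (rule borel_integrable_compact) (auto intro: test_functionD(2)[OF \<psi>])
      moreover have "(\<lambda>x. indicator (cbox (- a) a) x *\<^sub>R \<psi> x) = \<psi>"
        using a by (auto simp: fun_eq_iff indicator_def)
      ultimately show ?thesis using \<psi>m by (simp add: integrable_completion)
    qed
    have i1: "integrable lebesgue (\<lambda>x. g x * \<psi> x)"
      by (rule bounded_int[OF gm Linf_normD(1)[OF gL] \<psi>i])
    have "(LINT x|lebesgue. g x * \<psi> x) = - (LINT x|lebesgue. f x * frechet_derivative \<psi> (at x) 1)"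
      using weak \<psi> by (simp add: is_weak_partial_def lebesgue_on_UNIV_eq)
    also have "(LINT x|lebesgue. f x * frechet_derivative \<psi> (at x) 1) = (LINT x|lborel. f x * frechet_derivative \<psi> (at x) 1)"
      using ibp(2) by (intro integral_completion) (auto dest: borel_measurable_integrable)
    also have "\<dots> = - (LINT x|lborel. f' x * \<psi> x)" by (rule ibp(1))
    also have "(LINT x|lborel. f' x * \<psi> x) = (LINT x|lebesgue. f' x * \<psi> x)"
      using ibp(3) by (intro integral_completion[symmetric]) (auto dest: borel_measurable_integrable)
    finally show "(LINT x|lebesgue_on UNIV. (g x - f' x) * \<psi> x) = 0"
      using i1 i2 by (simp add: lebesgue_on_UNIV_eq left_diff_distrib)
  qed auto
  then have "AE x in lebesgue. g x = f' x" unfolding lebesgue_on_UNIV_eq by simp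
  with Linf_normD(1)[OF gL] have "AE x in lebesgue. \<bar>f' x\<bar> \<le> Linf_norm UNIV g"
    by eventually_elim simp
  then have "\<bar>f' x\<bar> \<le> Linf_norm UNIV g"
    by (rule AE_le_imp_all_le[rotated]) (intro continuous_intros cont)
  also have "\<dots> \<le> W1inf_norm f"
    using f Linf_normD(2)[of f] by (simp add: W1inf_norm_def g_def[symmetric] W1inf_def)
  finally show ?thesis .
qed

lemma W1inf_norm_nonneg_bound:
  assumes emb: "continuously_embedded (Hs s) (Hs_norm s) W1inf W1inf_norm"
  obtains K where "K \<ge> 0" "\<And>f. f \<in> Hs s \<Longrightarrow> f \<in> W1inf" "\<And>f. f \<in> Hs s \<Longrightarrow> W1inf_norm f \<le> K * Hs_norm s f"
proof -
  obtain K where K: "\<forall>f\<in>Hs s. W1inf_norm f \<le> K * Hs_norm s f" and sub: "Hs s \<subseteq> W1inf"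
    using emb by (auto simp: continuously_embedded_def)
  have "W1inf_norm f \<le> \<bar>K\<bar> * Hs_norm s f" if f: "f \<in> Hs s" for f
    using K f mult_right_mono[OF abs_ge_self Hs_norm_nonneg[OF f], of K] by fastforce
  then show ?thesis using sub by (intro that[of "\<bar>K\<bar>"]) auto
qed

definition band_cut :: "nat \<Rightarrow> (real \<Rightarrow> complex) \<Rightarrow> real \<Rightarrow> complex"
  where "band_cut n h \<xi> = (if \<bar>\<xi>\<bar> \<le> real n then h \<xi> else 0)"

lemma band_cut_Hs_L2:
  assumes "h \<in> Hs_L2 s"
  shows "band_cut n h \<in> Hs_L2 s"
proof -
  have hm: "h \<in> borel_measurable lebesgue"
    and hi: "integrable lebesgue (\<lambda>\<xi>. Hs_weight s \<xi> * (norm (h \<xi>))\<^sup>2)"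
    using assms by (auto simp: Hs_L2_def)
  have "{\<xi>::real. \<bar>\<xi>\<bar> \<le> real n} = {- real n..real n}" by auto
  then have m: "band_cut n h \<in> borel_measurable lebesgue"
    unfolding band_cut_def by (intro measurable_If hm) (auto simp: fmeasurableD)
  moreover have "integrable lebesgue (\<lambda>\<xi>. Hs_weight s \<xi> * (norm (band_cut n h \<xi>))\<^sup>2)"
  proof (rule Bochner_Integration.integrable_bound[OF hi])
    show "(\<lambda>\<xi>. Hs_weight s \<xi> * (norm (band_cut n h \<xi>))\<^sup>2) \<in> borel_measurable lebesgue"
      using m Hs_weight_measurable_lebesgue[of s] by measurable
    show "AE \<xi> in lebesgue. norm (Hs_weight s \<xi> * (norm (band_cut n h \<xi>))\<^sup>2) \<le> norm (Hs_weight s \<xi> * (norm (h \<xi>))\<^sup>2)"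
      by (rule AE_I2) (simp add: band_cut_def)
  qed
  ultimately show ?thesis by (simp add: Hs_L2_def)
qed

lemma Hs_L2_norm_mono:
  assumes "g \<in> Hs_L2 s" "h \<in> Hs_L2 s" "\<And>\<xi>. norm (g \<xi>) \<le> norm (h \<xi>)"
  shows "Hs_L2_norm s g \<le> Hs_L2_norm s h"
  unfolding Hs_L2_norm_def
  using assms Hs_weight_pos[of s]
  by (intro real_sqrt_le_mono integral_mono) (auto simp: Hs_L2_def intro!: mult_left_mono power_mono less_imp_le)

lemma band_cut_tail:
  assumes h: "h \<in> Hs_L2 s"
  shows "(\<lambda>n. Hs_L2_norm s (\<lambda>\<xi>. h \<xi> - band_cut n h \<xi>)) \<longlonglongrightarrow> 0"
proof -
  have hi: "integrable lebesgue (\<lambda>\<xi>. Hs_weight s \<xi> * (norm (h \<xi>))\<^sup>2)"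
    using h by (auto simp: Hs_L2_def)
  have "(\<lambda>n. LINT \<xi>|lebesgue. Hs_weight s \<xi> * (norm (h \<xi> - band_cut n h \<xi>))\<^sup>2) \<longlonglongrightarrow> (LINT \<xi>|(lebesgue::real measure). 0)"
  proof (rule integral_dominated_convergence[OF _ _ hi])
    show "(\<lambda>\<xi>. Hs_weight s \<xi> * (norm (h \<xi> - band_cut n h \<xi>))\<^sup>2) \<in> borel_measurable lebesgue" for n
      using Hs_L2_add_scale[OF h band_cut_Hs_L2[OF h, of n], of "-1"]
      by (auto simp: Hs_L2_def intro: borel_measurable_integrable)
    show "AE \<xi> in lebesgue. norm (Hs_weight s \<xi> * (norm (h \<xi> - band_cut n h \<xi>))\<^sup>2) \<le> Hs_weight s \<xi> * (norm (h \<xi>))\<^sup>2" for n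
      using Hs_weight_pos[of s] by (intro AE_I2) (simp add: band_cut_def less_imp_le)
    show "AE \<xi> in lebesgue. (\<lambda>n. Hs_weight s \<xi> * (norm (h \<xi> - band_cut n h \<xi>))\<^sup>2) \<longlonglongrightarrow> 0"
    proof (rule AE_I2)
      fix \<xi> :: real
      have "eventually (\<lambda>n. \<bar>\<xi>\<bar> \<le> real n) sequentially"
        using real_arch_simple[of "\<bar>\<xi>\<bar>"] by (meson eventually_sequentiallyI of_nat_mono order_trans)
      then show "(\<lambda>n. Hs_weight s \<xi> * (norm (h \<xi> - band_cut n h \<xi>))\<^sup>2) \<longlonglongrightarrow> 0"
        by (intro tendsto_eventually, elim eventually_mono) (simp add: band_cut_def)
    qed
  qed simp
  then have "(\<lambda>n. sqrt (LINT \<xi>|lebesgue. Hs_weight s \<xi> * (norm (h \<xi> - band_cut n h \<xi>))\<^sup>2)) \<longlonglongrightarrow> sqrt 0"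
    by (intro tendsto_real_sqrt) simp
  then show ?thesis by (simp add: Hs_L2_norm_def)
qed

text \<open>The embedding into \<open>W1inf\<close> only gives Lipschitz functions, whereas the Taylor expansion of the
  reaction term and the identification of \<open>deriv P\<close> with the weak derivative need a classical
  derivative. Truncating the density at frequency \<open>n\<close> gives smooth functions that converge in
  \<open>H\<^sup>s\<close>, so by the embedding their derivatives converge uniformly. The last property is a
  quantitative form of the uniform continuity of \<open>f'\<close>: up to \<open>\<epsilon>\<close>, the derivative inherits the
  Lipschitz constant of one of the approximations.\<close>

lemma Hs_imp_C1:
  assumes s: "s > 1" and emb: "continuously_embedded (Hs s) (Hs_norm s) W1inf W1inf_norm"
    and f: "f \<in> Hs s"
  obtains f' where "\<And>x. (f has_real_derivative f' x) (at x)" "continuous_on UNIV f'"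
    "\<And>\<epsilon>. \<epsilon> > 0 \<Longrightarrow> \<exists>L. \<forall>x y. \<bar>f' x - f' y\<bar> \<le> \<epsilon> + L * \<bar>x - y\<bar>"
proof -
  obtain K where K: "K \<ge> 0" "\<And>f. f \<in> Hs s \<Longrightarrow> f \<in> W1inf" "\<And>f. f \<in> Hs s \<Longrightarrow> W1inf_norm f \<le> K * Hs_norm s f"
    using W1inf_norm_nonneg_bound[OF emb] by metis
  obtain h where h: "h \<in> Hs_L2 s" and fh: "\<And>x. complex_of_real (f x) = inv_fourier h x"
    using f by (auto simp: Hs_def has_Hs_density_iff)
  define H where "H n = band_cut n h" for n
  define F where "F n x = Re (inv_fourier (H n) x)" for n x
  have HL: "H n \<in> Hs_L2 s" for n unfolding H_def by (rule band_cut_Hs_L2[OF h])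
  note int = Hs_L2_integrable[OF s]
  have "\<exists>F' L. (\<forall>x. (F n has_real_derivative F' x) (at x)) \<and> (\<forall>x y. \<bar>F' x - F' y\<bar> \<le> L * \<bar>x - y\<bar>)" for n
  proof -
    have Hm: "H n \<in> borel_measurable lebesgue" using HL by (simp add: Hs_L2_def)
    have "integrable lebesgue (\<lambda>\<xi>. \<xi>\<^sup>2 * norm (H n \<xi>))"
    proof (rule Bochner_Integration.integrable_bound[OF integrable_mult_right[OF integrable_norm[OF int[OF HL[of n]]]]])
      have "(\<lambda>\<xi>::real. \<xi>\<^sup>2) \<in> borel_measurable lebesgue" by (rule measurable_completion) simp
      then show "(\<lambda>\<xi>. \<xi>\<^sup>2 * norm (H n \<xi>)) \<in> borel_measurable lebesgue"
        by (intro borel_measurable_times measurable_compose[OF Hm]) auto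
      show "AE \<xi> in lebesgue. norm (\<xi>\<^sup>2 * norm (H n \<xi>)) \<le> norm ((real n)\<^sup>2 * norm (H n \<xi>))"
        by (rule AE_I2) (auto simp: H_def band_cut_def abs_mult intro!: mult_right_mono abs_le_square_iff[THEN iffD1])
    qed
    then show ?thesis
      using band_limited_smooth[OF int[OF HL[of n]]] unfolding F_def by metis
  qed
  then obtain F' L where F': "\<And>n x. (F n has_real_derivative F' n x) (at x)"
    and L: "\<And>n x y. \<bar>F' n x - F' n y\<bar> \<le> L n * \<bar>x - y\<bar>"
    by metis
  have F'c: "continuous_on UNIV (F' n)" for n
  proof -
    have "L n \<ge> 0" using L[of n 1 0] by simp
    then have "(L n)-lipschitz_on UNIV (F' n)" by (rule lipschitz_onI[rotated]) (simp add: L dist_real_def)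
    then show ?thesis by (rule lipschitz_on_continuous_on)
  qed
  define tail where "tail n = Hs_L2_norm s (\<lambda>\<xi>. h \<xi> - band_cut n h \<xi>)" for n
  have tail0: "(\<lambda>n. K * tail n) \<longlonglongrightarrow> 0"
    unfolding tail_def using tendsto_mult_right_zero[OF band_cut_tail[OF h]] .
  have diff: "\<bar>F' m x - F' n x\<bar> \<le> K * tail N" if "N \<le> m" "N \<le> n" for m n N x
  proof -
    define k where "k = (\<lambda>\<xi>. H m \<xi> + (-1) * H n \<xi>)"
    have kL: "k \<in> Hs_L2 s" unfolding k_def by (rule Hs_L2_add_scale[OF HL HL])
    have eq: "(\<lambda>x. Re (inv_fourier k x)) = (\<lambda>x. F m x - F n x)"
      unfolding k_def F_def by (subst inv_fourier_add_scale[OF int[OF HL] int[OF HL]]) simp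
    have inH: "(\<lambda>x. F m x - F n x) \<in> Hs s" and nH: "Hs_norm s (\<lambda>x. F m x - F n x) \<le> Hs_L2_norm s k"
      using Re_inv_fourier_Hs[OF s kL] unfolding eq by auto
    have "\<bar>F' m x - F' n x\<bar> \<le> W1inf_norm (\<lambda>x. F m x - F n x)"
      by (rule C1_deriv_le_W1inf_norm[where f' = "\<lambda>x. F' m x - F' n x"])
        (auto intro!: K(2) inH derivative_intros F' continuous_intros F'c)
    also have "\<dots> \<le> K * Hs_norm s (\<lambda>x. F m x - F n x)" by (rule K(3)[OF inH])
    also have "\<dots> \<le> K * Hs_L2_norm s k" using nH K(1) by (rule mult_left_mono)
    also have "\<dots> \<le> K * tail N"
      unfolding tail_def
    proof (intro mult_left_mono K(1) Hs_L2_norm_mono kL)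
      show "(\<lambda>\<xi>. h \<xi> - band_cut N h \<xi>) \<in> Hs_L2 s"
        using Hs_L2_add_scale[OF h band_cut_Hs_L2[OF h, of N], of "-1"] by simp
      show "norm (k \<xi>) \<le> norm (h \<xi> - band_cut N h \<xi>)" for \<xi>
        using that by (auto simp: k_def H_def band_cut_def)
    qed
    finally show ?thesis .
  qed
  have cauchy: "\<exists>N. \<forall>m n x. N \<le> m \<and> N \<le> n \<and> True \<longrightarrow> dist (F' m x) (F' n x) < e" if "e > 0" for e
  proof -
    have "eventually (\<lambda>N. K * tail N < e) sequentially" using order_tendstoD(2)[OF tail0 that] .
    then obtain N where "K * tail N < e" by (auto simp: eventually_sequentially)
    then show ?thesis using diff[of N] by (intro exI[of _ N]) (auto simp: dist_real_def intro: order.strict_trans1)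
  qed
  then obtain f' where lim: "\<And>e. e > 0 \<Longrightarrow> \<exists>N. \<forall>n x. N \<le> n \<longrightarrow> dist (F' n x) (f' x) < e"
    using uniformly_convergent_eq_cauchy[of "\<lambda>_. True" F'] by auto
  have Flim: "(\<lambda>n. F n x) \<longlonglongrightarrow> f x" for x
  proof -
    have "(\<lambda>n. LINT \<xi>|lebesgue. H n \<xi> * cis (\<xi> * x)) \<longlonglongrightarrow> (LINT \<xi>|lebesgue. h \<xi> * cis (\<xi> * x))"
    proof (rule integral_dominated_convergence[OF _ _ integrable_norm[OF int[OF h]]])
      show "(\<lambda>\<xi>. h \<xi> * cis (\<xi> * x)) \<in> borel_measurable lebesgue"
        "(\<lambda>\<xi>. H n \<xi> * cis (\<xi> * x)) \<in> borel_measurable lebesgue" for n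
        using integrable_mult_cis int h HL by (blast intro: borel_measurable_integrable)+
      show "AE \<xi> in lebesgue. norm (H n \<xi> * cis (\<xi> * x)) \<le> norm (h \<xi>)" for n
        by (rule AE_I2) (simp add: H_def band_cut_def norm_mult)
      show "AE \<xi> in lebesgue. (\<lambda>n. H n \<xi> * cis (\<xi> * x)) \<longlonglongrightarrow> h \<xi> * cis (\<xi> * x)"
      proof (rule AE_I2)
        fix \<xi> :: real
        have "eventually (\<lambda>n. \<bar>\<xi>\<bar> \<le> real n) sequentially"
          using real_arch_simple[of "\<bar>\<xi>\<bar>"] by (meson eventually_sequentiallyI of_nat_mono order_trans)
        then show "(\<lambda>n. H n \<xi> * cis (\<xi> * x)) \<longlonglongrightarrow> h \<xi> * cis (\<xi> * x)"
          by (intro tendsto_eventually, elim eventually_mono) (simp add: H_def band_cut_def)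
      qed
    qed
    then have "(\<lambda>n. inv_fourier (H n) x) \<longlonglongrightarrow> inv_fourier h x"
      unfolding inv_fourier_def by (intro tendsto_divide tendsto_const) auto
    then have "(\<lambda>n. F n x) \<longlonglongrightarrow> Re (inv_fourier h x)" unfolding F_def by (rule tendsto_Re)
    then show ?thesis by (simp flip: fh)
  qed
  have "\<exists>g. \<forall>x\<in>UNIV. (\<lambda>n. F n x) \<longlonglongrightarrow> g x \<and> (g has_derivative (\<lambda>h. f' x * h)) (at x within UNIV)"
  proof (rule has_derivative_sequence)
    show "(F n has_derivative (\<lambda>h. F' n x * h)) (at x within UNIV)" for n x
      using F'[of n x] by (simp add: has_field_derivative_def)
    show "\<forall>\<^sub>F n in sequentially. \<forall>x\<in>UNIV. \<forall>h. norm (F' n x * h - f' x * h) \<le> e * norm h" if e: "e > 0" for e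
    proof -
      obtain N where N: "\<And>n x. N \<le> n \<Longrightarrow> dist (F' n x) (f' x) < e" using lim[OF e] by auto
      have "norm (F' n x * h - f' x * h) \<le> e * norm h" if "N \<le> n" for n x h
        using less_imp_le[OF N[OF that, of x]]
        by (simp add: dist_real_def abs_mult mult_right_mono flip: left_diff_distrib)
      then show ?thesis by (auto simp: eventually_sequentially)
    qed
    show "(\<lambda>n. F n 0) \<longlonglongrightarrow> f 0" by (rule Flim)
  qed auto
  then obtain g where g: "\<And>x. (\<lambda>n. F n x) \<longlonglongrightarrow> g x" "\<And>x. (g has_derivative (\<lambda>h. f' x * h)) (at x)" by auto
  have "g = f" using LIMSEQ_unique[OF g(1) Flim] by auto
  then have D: "(f has_real_derivative f' x) (at x)" for x using g(2) by (simp add: has_field_derivative_def)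
  have L': "\<exists>L. \<forall>x y. \<bar>f' x - f' y\<bar> \<le> \<epsilon> + L * \<bar>x - y\<bar>" if \<epsilon>: "\<epsilon> > 0" for \<epsilon>
  proof -
    obtain N where N: "\<And>n x. N \<le> n \<Longrightarrow> dist (F' n x) (f' x) < \<epsilon> / 2" using lim[of "\<epsilon> / 2"] \<epsilon> by auto
    have "\<bar>f' x - f' y\<bar> \<le> \<epsilon> + L N * \<bar>x - y\<bar>" for x y
      using N[of N x, OF order_refl] N[of N y, OF order_refl] L[of N x y] unfolding dist_real_def by linarith
    then show ?thesis by auto
  qed
  have "continuous_on UNIV f'"
  proof (rule uniform_limit_theorem[where F = sequentially and f = F'])
    show "uniform_limit UNIV F' f' sequentially"
      using lim by (auto simp: uniform_limit_sequentially_iff)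
    show "\<forall>\<^sub>F n in sequentially. continuous_on UNIV (F' n)" using F'c by (simp add: always_eventually)
  qed auto
  then show ?thesis using that D L' by blast
qed

section \<open>Seminormed spaces and Bochner spaces\<close>

lemma lebesgue_on_measurable_AE:
  fixes f g :: "'a::euclidean_space \<Rightarrow> real"
  assumes S: "S \<in> sets lebesgue" and f: "f \<in> borel_measurable (lebesgue_on S)"
    and ae: "AE x in lebesgue_on S. f x = g x"
  shows "g \<in> borel_measurable (lebesgue_on S)"
proof -
  have 1: "(\<lambda>x. if x \<in> S then f x else 0) \<in> borel_measurable lebesgue"
    using f S by (simp add: borel_measurable_if)
  have "AE x in lebesgue. (if x \<in> S then f x else 0) = (if x \<in> S then g x else 0)"
    using ae S by (simp add: AE_restrict_space_iff)
  then have "(\<lambda>x. if x \<in> S then g x else 0) \<in> borel_measurable lebesgue"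
    by (rule borel_measurable_AE[OF 1])
  then show ?thesis using S by (simp add: borel_measurable_if)
qed

lemma Cauchy_Schwarz_integral:
  fixes f g :: "'a \<Rightarrow> real"
  assumes f: "f \<in> borel_measurable M" "integrable M (\<lambda>x. (f x)\<^sup>2)"
    and g: "g \<in> borel_measurable M" "integrable M (\<lambda>x. (g x)\<^sup>2)"
  shows "integrable M (\<lambda>x. f x * g x)"
    "(LINT x|M. \<bar>f x * g x\<bar>) \<le> sqrt (LINT x|M. (f x)\<^sup>2) * sqrt (LINT x|M. (g x)\<^sup>2)"
    "\<bar>LINT x|M. f x * g x\<bar> \<le> sqrt (LINT x|M. (f x)\<^sup>2) * sqrt (LINT x|M. (g x)\<^sup>2)"
proof -
  show int: "integrable M (\<lambda>x. f x * g x)"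
  proof (rule Bochner_Integration.integrable_bound[OF Bochner_Integration.integrable_add[OF f(2) g(2)]])
    show "AE x in M. norm (f x * g x) \<le> norm ((f x)\<^sup>2 + (g x)\<^sup>2)"
    proof (rule AE_I2)
      fix x
      have "2 * (\<bar>f x\<bar> * \<bar>g x\<bar>) \<le> (f x)\<^sup>2 + (g x)\<^sup>2"
        using sum_squares_bound[of "\<bar>f x\<bar>" "\<bar>g x\<bar>"] by simp
      moreover have "0 \<le> \<bar>f x\<bar> * \<bar>g x\<bar>" by simp
      ultimately have "\<bar>f x\<bar> * \<bar>g x\<bar> \<le> (f x)\<^sup>2 + (g x)\<^sup>2" by linarith
      then show "norm (f x * g x) \<le> norm ((f x)\<^sup>2 + (g x)\<^sup>2)" by (simp add: abs_mult)
    qed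
  qed (intro borel_measurable_times f g)
  define A where "A = sqrt (LINT x|M. (f x)\<^sup>2)"
  define B where "B = sqrt (LINT x|M. (g x)\<^sup>2)"
  define I where "I = (LINT x|M. \<bar>f x * g x\<bar>)"
  have A2: "A\<^sup>2 = (LINT x|M. (f x)\<^sup>2)" and B2: "B\<^sup>2 = (LINT x|M. (g x)\<^sup>2)" and nn: "A \<ge> 0" "B \<ge> 0"
    by (simp_all add: A_def B_def)
  have ai: "integrable M (\<lambda>x. \<bar>f x * g x\<bar>)" using int by (rule integrable_abs)
  have key: "2 * (a * b * I) \<le> a\<^sup>2 * A\<^sup>2 + b\<^sup>2 * B\<^sup>2" for a b :: real
  proof -
    have "0 \<le> (LINT x|M. (a * \<bar>f x\<bar> - b * \<bar>g x\<bar>)\<^sup>2)" by (rule integral_nonneg_AE) simp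
    also have "\<dots> = (LINT x|M. a\<^sup>2 * (f x)\<^sup>2 + b\<^sup>2 * (g x)\<^sup>2 - 2 * a * b * \<bar>f x * g x\<bar>)"
      by (intro Bochner_Integration.integral_cong refl) (simp add: power2_diff power_mult_distrib abs_mult)
    also have "\<dots> = a\<^sup>2 * A\<^sup>2 + b\<^sup>2 * B\<^sup>2 - 2 * a * b * I"
      using f(2) g(2) ai by (simp add: A2 B2 I_def)
    finally show ?thesis by simp
  qed
  have "I \<le> A * B"
  proof (cases "A * B = 0")
    case False
    then have AB: "A * B > 0" using nn by (simp add: less_le)
    have "2 * (B * A * I) \<le> B\<^sup>2 * A\<^sup>2 + A\<^sup>2 * B\<^sup>2" by (rule key)
    also have "\<dots> = 2 * (A * B * (A * B))" by (simp add: power2_eq_square)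
    finally have "(A * B) * I \<le> (A * B) * (A * B)" by (simp add: mult.commute)
    then show ?thesis using AB by (simp add: mult_le_cancel_left_pos)
  next
    case True
    have "(AE x in M. f x = 0) \<or> (AE x in M. g x = 0)"
    proof -
      have "A\<^sup>2 = 0 \<or> B\<^sup>2 = 0" using True by auto
      then show ?thesis
        unfolding A2 B2 using integral_nonneg_eq_0_iff_AE[OF f(2)] integral_nonneg_eq_0_iff_AE[OF g(2)] by auto
    qed
    then have "AE x in M. \<bar>f x * g x\<bar> = 0" by (auto elim: eventually_mono)
    then have "I = 0" unfolding I_def by (rule integral_eq_zero_AE)
    then show ?thesis using nn by simp
  qed
  then show 2: "(LINT x|M. \<bar>f x * g x\<bar>) \<le> sqrt (LINT x|M. (f x)\<^sup>2) * sqrt (LINT x|M. (g x)\<^sup>2)"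
    by (simp add: A_def B_def I_def)
  show "\<bar>LINT x|M. f x * g x\<bar> \<le> sqrt (LINT x|M. (f x)\<^sup>2) * sqrt (LINT x|M. (g x)\<^sup>2)"
    by (rule order_trans[OF integral_abs_bound 2])
qed

lemma integrable_add_square:
  fixes f g :: "'a \<Rightarrow> real"
  assumes f: "f \<in> borel_measurable M" "integrable M (\<lambda>x. (f x)\<^sup>2)"
    and g: "g \<in> borel_measurable M" "integrable M (\<lambda>x. (g x)\<^sup>2)"
  shows "integrable M (\<lambda>x. (f x + g x)\<^sup>2)"
  unfolding power2_sum
  using Cauchy_Schwarz_integral(1)[OF f g] f g by (simp add: mult.assoc)

lemma Minkowski_integral:
  fixes f g :: "'a \<Rightarrow> real"
  assumes f: "f \<in> borel_measurable M" "integrable M (\<lambda>x. (f x)\<^sup>2)"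
    and g: "g \<in> borel_measurable M" "integrable M (\<lambda>x. (g x)\<^sup>2)"
  shows "sqrt (LINT x|M. (f x + g x)\<^sup>2) \<le> sqrt (LINT x|M. (f x)\<^sup>2) + sqrt (LINT x|M. (g x)\<^sup>2)"
proof (rule real_le_lsqrt[OF _ ])
  define A where "A = sqrt (LINT x|M. (f x)\<^sup>2)"
  define B where "B = sqrt (LINT x|M. (g x)\<^sup>2)"
  have A2: "A\<^sup>2 = (LINT x|M. (f x)\<^sup>2)" and B2: "B\<^sup>2 = (LINT x|M. (g x)\<^sup>2)"
    by (simp_all add: A_def B_def)
  have "(LINT x|M. (f x + g x)\<^sup>2) = (LINT x|M. (f x)\<^sup>2 + (g x)\<^sup>2 + 2 * (f x * g x))"
    by (simp add: power2_sum mult.assoc)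
  also have "\<dots> = A\<^sup>2 + B\<^sup>2 + 2 * (LINT x|M. f x * g x)"
    using Cauchy_Schwarz_integral(1)[OF f g] f g by (simp add: A2 B2)
  also have "\<dots> \<le> A\<^sup>2 + B\<^sup>2 + 2 * (A * B)"
    using Cauchy_Schwarz_integral(3)[OF f g] by (simp add: A_def B_def)
  finally show "(LINT x|M. (f x + g x)\<^sup>2) \<le> (sqrt (LINT x|M. (f x)\<^sup>2) + sqrt (LINT x|M. (g x)\<^sup>2))\<^sup>2"
    by (simp add: A_def[symmetric] B_def[symmetric] power2_sum)
qed (simp)

text \<open>The Bochner spaces below take values in \<open>L\<^sup>2\<close>, \<open>H\<^sup>1\<^sub>0\<close> and the dual of \<open>H\<^sup>1\<^sub>0\<close>, which are sets
  of functions with a seminorm rather than types.\<close>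

locale seminorm_space =
  fixes X :: "'v::real_vector set" and N :: "'v \<Rightarrow> real"
  assumes zero_mem: "0 \<in> X"
    and add_mem: "x \<in> X \<Longrightarrow> y \<in> X \<Longrightarrow> x + y \<in> X"
    and scale_mem: "x \<in> X \<Longrightarrow> c *\<^sub>R x \<in> X"
    and triangle: "x \<in> X \<Longrightarrow> y \<in> X \<Longrightarrow> N (x + y) \<le> N x + N y"
    and homogeneous: "x \<in> X \<Longrightarrow> N (c *\<^sub>R x) = \<bar>c\<bar> * N x"
begin

lemma uminus_mem: "x \<in> X \<Longrightarrow> - x \<in> X"
  using scale_mem[of x "-1"] by simp

lemma diff_mem: "x \<in> X \<Longrightarrow> y \<in> X \<Longrightarrow> x - y \<in> X"
  using add_mem[OF _ uminus_mem, of x y] by simp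

lemma N_uminus: "x \<in> X \<Longrightarrow> N (- x) = N x"
  using homogeneous[of x "-1"] by simp

lemma N_zero: "N 0 = 0"
  using homogeneous[OF zero_mem, of 0] by simp

lemma N_nonneg: "x \<in> X \<Longrightarrow> 0 \<le> N x"
  using triangle[OF _ uminus_mem, of x x] N_uminus[of x] N_zero by simp

lemma N_commute: "x \<in> X \<Longrightarrow> y \<in> X \<Longrightarrow> N (x - y) = N (y - x)"
  using N_uminus[OF diff_mem, of y x] by simp

lemma N_diff_le: "x \<in> X \<Longrightarrow> y \<in> X \<Longrightarrow> N (x - y) \<le> N x + N y"
  using triangle[OF _ uminus_mem, of x y] N_uminus by simp

lemma N_reverse: "x \<in> X \<Longrightarrow> y \<in> X \<Longrightarrow> \<bar>N x - N y\<bar> \<le> N (x - y)"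
  using triangle[OF diff_mem, of x y y] triangle[OF diff_mem, of y x x] N_commute[of x y] by simp

end

lemma interval_sets: "{0<..<T} \<in> sets (lebesgue :: real measure)"
  by simp

lemma simple_on_measurable:
  fixes F :: "'v \<Rightarrow> real"
  assumes "simple_on T X s"
  shows "(\<lambda>t. F (s t)) \<in> borel_measurable (lebesgue_on {0<..<T})"
proof -
  have fin: "finite (s ` {0<..<T})" and m: "\<And>y. {t \<in> {0<..<T}. s t = y} \<in> sets lebesgue"
    using assms by (auto simp: simple_on_def)
  have 1: "(\<lambda>t. \<Sum>y\<in>s ` {0<..<T}. F y * indicator {t \<in> {0<..<T}. s t = y} t) \<in> borel_measurable (lebesgue_on {0<..<T})"
    by (intro measurable_restrict_space1 borel_measurable_sum borel_measurable_times borel_measurable_const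
        borel_measurable_indicator m)
  have "(\<Sum>y\<in>s ` {0<..<T}. F y * indicator {t \<in> {0<..<T}. s t = y} t) = F (s t)" if "t \<in> {0<..<T}" for t
  proof -
    have "(\<Sum>y\<in>s ` {0<..<T}. F y * indicator {t \<in> {0<..<T}. s t = y} t) =
      (\<Sum>y\<in>s ` {0<..<T}. if y = s t then F y else 0)"
      using that by (intro sum.cong) (auto simp: indicator_def)
    also have "\<dots> = F (s t)" using fin that by simp
    finally show ?thesis .
  qed
  then show ?thesis using 1 by (subst measurable_cong[symmetric]) auto
qed

lemma simple_on_map2:
  assumes "simple_on T X s" "simple_on T Y r" "\<And>x y. x \<in> X \<Longrightarrow> y \<in> Y \<Longrightarrow> f x y \<in> Z"
  shows "simple_on T Z (\<lambda>t. f (s t) (r t))"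
  unfolding simple_on_def
proof (intro conjI allI)
  have fin: "finite (s ` {0<..<T})" "finite (r ` {0<..<T})"
    and m: "\<And>y. {t \<in> {0<..<T}. s t = y} \<in> sets lebesgue" "\<And>y. {t \<in> {0<..<T}. r t = y} \<in> sets lebesgue"
    using assms by (auto simp: simple_on_def)
  have "(\<lambda>t. f (s t) (r t)) ` {0<..<T} \<subseteq> (\<lambda>(x, y). f x y) ` (s ` {0<..<T} \<times> r ` {0<..<T})" by auto
  then show "finite ((\<lambda>t. f (s t) (r t)) ` {0<..<T})"
    by (rule finite_subset) (intro finite_imageI finite_cartesian_product fin)
  show "(\<lambda>t. f (s t) (r t)) ` {0<..<T} \<subseteq> Z"
    using assms unfolding simple_on_def by blast
  show "{t \<in> {0<..<T}. f (s t) (r t) = y} \<in> sets lebesgue" for y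
  proof -
    have "{t \<in> {0<..<T}. f (s t) (r t) = y} =
      (\<Union>p \<in> {p \<in> s ` {0<..<T} \<times> r ` {0<..<T}. f (fst p) (snd p) = y}.
        {t \<in> {0<..<T}. s t = fst p} \<inter> {t \<in> {0<..<T}. r t = snd p})" (is "?L = ?R")
    proof (intro equalityI subsetI)
      fix t assume "t \<in> ?L" then show "t \<in> ?R" by (intro UN_I[of "(s t, r t)"]) auto
    qed auto
    also have "\<dots> \<in> sets lebesgue"
      by (intro sets.finite_UN sets.Int m) (use fin in auto)
    finally show ?thesis .
  qed
qed

lemma simple_on_map:
  assumes "simple_on T X s" "\<And>x. x \<in> X \<Longrightarrow> f x \<in> Z"
  shows "simple_on T Z (\<lambda>t. f (s t))"
  using simple_on_map2[OF assms(1) assms(1), of "\<lambda>x y. f x" Z] assms(2) by simp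

lemma simple_on_mem: "simple_on T X s \<Longrightarrow> AE t in lebesgue_on {0<..<T}. s t \<in> X"
  by (rule AE_I2) (auto simp: simple_on_def)

text \<open>\<open>B\<close> is only required to be sequentially continuous; both norms and duality pairings are
  instances.\<close>

lemma strongly_measurable_pair:
  fixes B :: "'v::real_vector \<Rightarrow> 'w::real_vector \<Rightarrow> real"
  assumes u: "strongly_measurable T X N u" "AE t in lebesgue_on {0<..<T}. u t \<in> X"
    and v: "strongly_measurable T Y M v" "AE t in lebesgue_on {0<..<T}. v t \<in> Y"
    and B: "\<And>x y xn yn. x \<in> X \<Longrightarrow> y \<in> Y \<Longrightarrow> (\<And>n::nat. xn n \<in> X) \<Longrightarrow> (\<And>n. yn n \<in> Y) \<Longrightarrow>
      (\<lambda>n. N (xn n - x)) \<longlonglongrightarrow> 0 \<Longrightarrow> (\<lambda>n. M (yn n - y)) \<longlonglongrightarrow> 0 \<Longrightarrow> (\<lambda>n. B (xn n) (yn n)) \<longlonglongrightarrow> B x y"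
  shows "(\<lambda>t. B (u t) (v t)) \<in> borel_measurable (lebesgue_on {0<..<T})"
proof -
  obtain s where s: "\<And>n. simple_on T X (s n)" and sl: "AE t in lebesgue_on {0<..<T}. (\<lambda>n::nat. N (s n t - u t)) \<longlonglongrightarrow> 0"
    using u(1) by (auto simp: strongly_measurable_def)
  obtain r where r: "\<And>n. simple_on T Y (r n)" and rl: "AE t in lebesgue_on {0<..<T}. (\<lambda>n::nat. M (r n t - v t)) \<longlonglongrightarrow> 0"
    using v(1) by (auto simp: strongly_measurable_def)
  have m: "(\<lambda>t. B (s n t) (r n t)) \<in> borel_measurable (lebesgue_on {0<..<T})" for n
    using simple_on_measurable[OF simple_on_map2[OF s[of n] r[of n], of Pair UNIV], of "\<lambda>p. B (fst p) (snd p)"] by simp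
  have "AE t in lebesgue_on {0<..<T}. lim (\<lambda>n. B (s n t) (r n t)) = B (u t) (v t)"
    using sl rl u(2) v(2) AE_space
  proof eventually_elim
    case (elim t)
    have "s n t \<in> X" "r n t \<in> Y" for n
      using s[of n] r[of n] elim(5) by (auto simp: simple_on_def)
    then have "(\<lambda>n. B (s n t) (r n t)) \<longlonglongrightarrow> B (u t) (v t)"
      using elim by (intro B)
    then show ?case by (rule limI)
  qed
  then show ?thesis
    by (rule lebesgue_on_measurable_AE[OF interval_sets borel_measurable_lim_metric[OF m]])
qed

lemma strongly_measurable_map:
  assumes u: "strongly_measurable T X N u" "AE t in lebesgue_on {0<..<T}. u t \<in> X"
    and J: "\<And>x. x \<in> X \<Longrightarrow> J x \<in> Y"
      "\<And>x y. x \<in> X \<Longrightarrow> y \<in> X \<Longrightarrow> 0 \<le> M (J x - J y) \<and> M (J x - J y) \<le> C * N (x - y)"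
  shows "strongly_measurable T Y M (\<lambda>t. J (u t))"
proof -
  obtain s where s: "\<And>n. simple_on T X (s n)" and sl: "AE t in lebesgue_on {0<..<T}. (\<lambda>n::nat. N (s n t - u t)) \<longlonglongrightarrow> 0"
    using u(1) by (auto simp: strongly_measurable_def)
  have "AE t in lebesgue_on {0<..<T}. (\<lambda>n. M (J (s n t) - J (u t))) \<longlonglongrightarrow> 0"
    using sl u(2) AE_space
  proof eventually_elim
    case (elim t)
    have sX: "s n t \<in> X" for n using s[of n] elim(3) by (auto simp: simple_on_def)
    show ?case
    proof (rule tendsto_sandwich[OF _ _ tendsto_const tendsto_mult_right_zero[OF elim(1), of C]])
      show "\<forall>\<^sub>F n in sequentially. 0 \<le> M (J (s n t) - J (u t))"
        "\<forall>\<^sub>F n in sequentially. M (J (s n t) - J (u t)) \<le> C * N (s n t - u t)"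
        using J(2)[OF sX elim(2)] by auto
    qed
  qed
  moreover have "simple_on T Y (\<lambda>t. J (s n t))" for n
    by (rule simple_on_map[OF s J(1)])
  ultimately show ?thesis unfolding strongly_measurable_def
    by (intro exI[of _ "\<lambda>n t. J (s n t)"]) simp
qed

context seminorm_space
begin

lemma N_tendsto:
  assumes "x \<in> X" "\<And>n. xn n \<in> X" "(\<lambda>n. N (xn n - x)) \<longlonglongrightarrow> 0"
  shows "(\<lambda>n. N (xn n)) \<longlonglongrightarrow> N x"
proof -
  have "(\<lambda>n. N (xn n) - N x) \<longlonglongrightarrow> 0"
    by (rule Lim_null_comparison[OF _ assms(3)]) (use N_reverse assms in auto)
  then show ?thesis by (simp add: LIM_zero_iff)
qed

lemma norm_measurable:
  assumes u: "strongly_measurable T X N u" "AE t in lebesgue_on {0<..<T}. u t \<in> X"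
  shows "(\<lambda>t. N (u t)) \<in> borel_measurable (lebesgue_on {0<..<T})"
  using strongly_measurable_pair[OF u u, of "\<lambda>x y. N x"] N_tendsto by blast

lemma bochner_L2D:
  assumes "u \<in> bochner_L2 T X N"
  shows "strongly_measurable T X N u" "AE t in lebesgue_on {0<..<T}. u t \<in> X"
    "(\<lambda>t. N (u t)) \<in> borel_measurable (lebesgue_on {0<..<T})"
    "integrable (lebesgue_on {0<..<T}) (\<lambda>t. (N (u t))\<^sup>2)"
  using assms norm_measurable by (auto simp: bochner_L2_def)

lemma strongly_measurable_add_scale:
  assumes u: "strongly_measurable T X N u" "AE t in lebesgue_on {0<..<T}. u t \<in> X"
    and v: "strongly_measurable T X N v" "AE t in lebesgue_on {0<..<T}. v t \<in> X"
  shows "strongly_measurable T X N (\<lambda>t. u t + c *\<^sub>R v t)"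
proof -
  obtain s where s: "\<And>n. simple_on T X (s n)" and sl: "AE t in lebesgue_on {0<..<T}. (\<lambda>n::nat. N (s n t - u t)) \<longlonglongrightarrow> 0"
    using u(1) by (auto simp: strongly_measurable_def)
  obtain r where r: "\<And>n. simple_on T X (r n)" and rl: "AE t in lebesgue_on {0<..<T}. (\<lambda>n::nat. N (r n t - v t)) \<longlonglongrightarrow> 0"
    using v(1) by (auto simp: strongly_measurable_def)
  have "simple_on T X (\<lambda>t. s n t + c *\<^sub>R r n t)" for n
    by (rule simple_on_map2[OF s r]) (intro add_mem scale_mem)
  moreover have "AE t in lebesgue_on {0<..<T}. (\<lambda>n. N ((s n t + c *\<^sub>R r n t) - (u t + c *\<^sub>R v t))) \<longlonglongrightarrow> 0"
    using sl rl u(2) v(2) AE_space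
  proof eventually_elim
    case (elim t)
    have sX: "s n t \<in> X" "r n t \<in> X" for n using s[of n] r[of n] elim(5) by (auto simp: simple_on_def)
    have eq: "(s n t + c *\<^sub>R r n t) - (u t + c *\<^sub>R v t) = (s n t - u t) + c *\<^sub>R (r n t - v t)" for n
      by (simp add: algebra_simps)
    have "N ((s n t + c *\<^sub>R r n t) - (u t + c *\<^sub>R v t)) \<le> N (s n t - u t) + \<bar>c\<bar> * N (r n t - v t)" for n
      unfolding eq using triangle[OF diff_mem[OF sX(1) elim(3)] scale_mem[OF diff_mem[OF sX(2) elim(4)]], of n c n]
        homogeneous[OF diff_mem[OF sX(2) elim(4)]] by simp
    moreover have "0 \<le> N ((s n t + c *\<^sub>R r n t) - (u t + c *\<^sub>R v t))" for n
      by (intro N_nonneg diff_mem add_mem scale_mem sX elim)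
    moreover have "(\<lambda>n. N (s n t - u t) + \<bar>c\<bar> * N (r n t - v t)) \<longlonglongrightarrow> 0"
      using tendsto_add[OF elim(1) tendsto_mult_right_zero[OF elim(2), of "\<bar>c\<bar>"]] by simp
    ultimately show ?case
      using Lim_null_comparison[OF always_eventually[OF allI], of "\<lambda>n. N ((s n t + c *\<^sub>R r n t) - (u t + c *\<^sub>R v t))"
          "\<lambda>n. N (s n t - u t) + \<bar>c\<bar> * N (r n t - v t)"] by simp
  qed
  ultimately show ?thesis unfolding strongly_measurable_def
    by (intro exI[of _ "\<lambda>n t. s n t + c *\<^sub>R r n t"]) simp
qed

lemma bochner_L2_add_scale:
  assumes u: "u \<in> bochner_L2 T X N" and v: "v \<in> bochner_L2 T X N"
  shows "(\<lambda>t. u t + c *\<^sub>R v t) \<in> bochner_L2 T X N"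
    "bochner_L2_norm T N (\<lambda>t. u t + c *\<^sub>R v t) \<le> bochner_L2_norm T N u + \<bar>c\<bar> * bochner_L2_norm T N v"
proof -
  note uD = bochner_L2D[OF u] and vD = bochner_L2D[OF v]
  have sm: "strongly_measurable T X N (\<lambda>t. u t + c *\<^sub>R v t)"
    by (intro strongly_measurable_add_scale uD vD)
  have ae: "AE t in lebesgue_on {0<..<T}. u t + c *\<^sub>R v t \<in> X"
    using uD(2) vD(2) by eventually_elim (intro add_mem scale_mem)
  have le: "AE t in lebesgue_on {0<..<T}. 0 \<le> N (u t + c *\<^sub>R v t) \<and> N (u t + c *\<^sub>R v t) \<le> N (u t) + \<bar>c\<bar> * N (v t)"
    using uD(2) vD(2)
  proof eventually_elim
    case (elim t)
    then show ?case using triangle[OF elim(1) scale_mem[OF elim(2)], of c] homogeneous[OF elim(2), of c]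
        N_nonneg[OF add_mem[OF elim(1) scale_mem[OF elim(2)]], of c] by simp
  qed
  have cv: "(\<lambda>t. \<bar>c\<bar> * N (v t)) \<in> borel_measurable (lebesgue_on {0<..<T})"
    "integrable (lebesgue_on {0<..<T}) (\<lambda>t. (\<bar>c\<bar> * N (v t))\<^sup>2)"
    using vD by (auto simp: power_mult_distrib)
  have int: "integrable (lebesgue_on {0<..<T}) (\<lambda>t. (N (u t) + \<bar>c\<bar> * N (v t))\<^sup>2)"
    by (rule integrable_add_square[OF uD(3,4) cv])
  have sq: "AE t in lebesgue_on {0<..<T}. (N (u t + c *\<^sub>R v t))\<^sup>2 \<le> (N (u t) + \<bar>c\<bar> * N (v t))\<^sup>2"
    using le by eventually_elim (auto intro: power_mono)
  have int': "integrable (lebesgue_on {0<..<T}) (\<lambda>t. (N (u t + c *\<^sub>R v t))\<^sup>2)"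
  proof (rule Bochner_Integration.integrable_bound[OF int])
    show "(\<lambda>t. (N (u t + c *\<^sub>R v t))\<^sup>2) \<in> borel_measurable (lebesgue_on {0<..<T})"
      by (intro borel_measurable_power norm_measurable sm ae)
    show "AE t in lebesgue_on {0<..<T}. norm ((N (u t + c *\<^sub>R v t))\<^sup>2) \<le> norm ((N (u t) + \<bar>c\<bar> * N (v t))\<^sup>2)"
      using sq by simp
  qed
  show "(\<lambda>t. u t + c *\<^sub>R v t) \<in> bochner_L2 T X N"
    using sm ae int' by (simp add: bochner_L2_def)
  have "bochner_L2_norm T N (\<lambda>t. u t + c *\<^sub>R v t) \<le> sqrt (LINT t|lebesgue_on {0<..<T}. (N (u t) + \<bar>c\<bar> * N (v t))\<^sup>2)"
    unfolding bochner_L2_norm_def by (intro real_sqrt_le_mono integral_mono_AE int int' sq)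
  also have "\<dots> \<le> bochner_L2_norm T N u + sqrt (LINT t|lebesgue_on {0<..<T}. (\<bar>c\<bar> * N (v t))\<^sup>2)"
    unfolding bochner_L2_norm_def by (rule Minkowski_integral[OF uD(3,4) cv])
  also have "sqrt (LINT t|lebesgue_on {0<..<T}. (\<bar>c\<bar> * N (v t))\<^sup>2) = \<bar>c\<bar> * bochner_L2_norm T N v"
    by (simp add: bochner_L2_norm_def power_mult_distrib real_sqrt_mult)
  finally show "bochner_L2_norm T N (\<lambda>t. u t + c *\<^sub>R v t) \<le> bochner_L2_norm T N u + \<bar>c\<bar> * bochner_L2_norm T N v"
    by simp
qed

lemma bochner_L2_diff:
  assumes u: "u \<in> bochner_L2 T X N" and v: "v \<in> bochner_L2 T X N"
  shows "u - v \<in> bochner_L2 T X N"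
    "bochner_L2_norm T N (u - v) \<le> bochner_L2_norm T N u + bochner_L2_norm T N v"
proof -
  have "u - v = (\<lambda>t. u t + (-1) *\<^sub>R v t)" by (simp add: fun_eq_iff)
  then show "u - v \<in> bochner_L2 T X N"
    "bochner_L2_norm T N (u - v) \<le> bochner_L2_norm T N u + bochner_L2_norm T N v"
    using bochner_L2_add_scale[OF u v, of "-1"] by simp_all
qed

text \<open>Where \<open>s n t\<close> has more than twice the norm of \<open>u t\<close> it is replaced by 0. This does not affect
  the limit and makes \<open>3 N (u t)\<close> a majorant of the error.\<close>

lemma simple_dense:
  assumes u: "u \<in> bochner_L2 T X N" and \<epsilon>: "\<epsilon> > 0"
  obtains s where "simple_on T X s" "integrable (lebesgue_on {0<..<T}) (\<lambda>t. (N (u t - s t))\<^sup>2)"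
    "(\<lambda>t. N (u t - s t)) \<in> borel_measurable (lebesgue_on {0<..<T})"
    "(LINT t|lebesgue_on {0<..<T}. (N (u t - s t))\<^sup>2) < \<epsilon>"
    "integrable (lebesgue_on {0<..<T}) (\<lambda>t. (N (s t))\<^sup>2)"
proof -
  note uD = bochner_L2D[OF u]
  obtain s where s: "\<And>n. simple_on T X (s n)" and sl: "AE t in lebesgue_on {0<..<T}. (\<lambda>n::nat. N (s n t - u t)) \<longlonglongrightarrow> 0"
    using uD(1) by (auto simp: strongly_measurable_def)
  define M where "M = lebesgue_on {0<..<T}"
  define A where "A n = {t \<in> {0<..<T}. N (s n t) \<le> 2 * N (u t)}" for n
  have A: "A n \<in> sets lebesgue" for n
  proof -
    have "{t \<in> space M. N (s n t) \<le> 2 * N (u t)} \<in> sets M"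
      unfolding M_def by (intro borel_measurable_le simple_on_measurable[OF s] borel_measurable_times borel_measurable_const uD(3))
    then show ?thesis by (simp add: M_def A_def sets_restrict_space_iff)
  qed
  define r where "r n t = (if t \<in> A n then s n t else 0)" for n t
  have r: "simple_on T X (r n)" for n
  proof -
    have "simple_on T UNIV (\<lambda>t. t \<in> A n)"
      unfolding simple_on_def
    proof (intro conjI allI)
      show "{t \<in> {0<..<T}. (t \<in> A n) = y} \<in> sets lebesgue" for y
      proof (cases y)
        case True
        then have "{t \<in> {0<..<T}. (t \<in> A n) = y} = A n" by (auto simp: A_def)
        then show ?thesis using A by simp
      next
        case False
        then have "{t \<in> {0<..<T}. (t \<in> A n) = y} = {0<..<T} - A n" by auto
        then show ?thesis using sets.Diff[OF interval_sets A] by simp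
      qed
    qed auto
    then show ?thesis
      unfolding r_def by (rule simple_on_map2[OF s, where f = "\<lambda>x b. if b then x else 0"]) (auto simp: zero_mem)
  qed
  have rsm: "strongly_measurable T X N (r n)" for n
    unfolding strongly_measurable_def
    by (rule exI[of _ "\<lambda>_. r n"]) (simp add: r N_zero)
  have bnd: "AE t in M. N (r n t) \<le> 2 * N (u t) \<and> 0 \<le> N (u t - r n t) \<and> N (u t - r n t) \<le> 3 * N (u t)" for n
    using uD(2) AE_space[of M] unfolding M_def[symmetric]
  proof eventually_elim
    case (elim t)
    have rX: "r n t \<in> X" using r[of n] elim(2) by (auto simp: simple_on_def M_def)
    have "N (r n t) \<le> 2 * N (u t)" using N_nonneg[OF elim(1)] by (simp add: r_def A_def N_zero)
    then show ?case using N_diff_le[OF elim(1) rX] N_nonneg[OF diff_mem[OF elim(1) rX]] by simp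
  qed
  have meas: "(\<lambda>t. N (u t - r n t)) \<in> borel_measurable M" for n
  proof -
    have ae: "AE t in lebesgue_on {0<..<T}. u t + (-1) *\<^sub>R r n t \<in> X"
      using uD(2) simple_on_mem[OF r[of n]] by eventually_elim (simp add: diff_mem)
    have "strongly_measurable T X N (\<lambda>t. u t + (-1) *\<^sub>R r n t)"
      by (intro strongly_measurable_add_scale uD rsm simple_on_mem r)
    then show ?thesis using norm_measurable[OF _ ae] by (simp add: M_def)
  qed
  have dom: "integrable M (\<lambda>t. 9 * (N (u t))\<^sup>2)" using uD(4) by (simp add: M_def)
  have sqb: "AE t in M. norm ((N (u t - r n t))\<^sup>2) \<le> 9 * (N (u t))\<^sup>2" for n
    using bnd[of n]
  proof eventually_elim
    case (elim t)
    then have "(N (u t - r n t))\<^sup>2 \<le> (3 * N (u t))\<^sup>2" by (intro power_mono) auto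
    then show ?case by (simp add: power_mult_distrib)
  qed
  have "(\<lambda>n. LINT t|M. (N (u t - r n t))\<^sup>2) \<longlonglongrightarrow> (LINT t|M. 0)"
  proof (rule integral_dominated_convergence[OF _ _ dom _ sqb])
    show "(\<lambda>t. (N (u t - r n t))\<^sup>2) \<in> borel_measurable M" for n
      by (intro borel_measurable_power meas)
    show "AE t in M. (\<lambda>n. (N (u t - r n t))\<^sup>2) \<longlonglongrightarrow> 0"
      using uD(2) AE_space[of M] sl unfolding M_def[symmetric]
    proof eventually_elim
      case (elim t)
      have sX: "s n t \<in> X" and rX: "r n t \<in> X" for n
        using s[of n] r[of n] elim(2) by (auto simp: simple_on_def M_def)
      have "(\<lambda>n. N (u t - r n t)) \<longlonglongrightarrow> 0"
      proof (cases "N (u t) = 0")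
        case True
        have "N (r n t) \<le> 0" for n using True by (simp add: r_def A_def N_zero)
        then have "N (u t - r n t) = 0" for n
          using N_diff_le[OF elim(1) rX[of n]] N_nonneg[OF diff_mem[OF elim(1) rX[of n]]] True
          by (metis add_0 antisym order_trans)
        then show ?thesis by simp
      next
        case False
        then have "N (u t) < 2 * N (u t)" using N_nonneg[OF elim(1)] by simp
        then have "\<forall>\<^sub>F n in sequentially. N (s n t) < 2 * N (u t)"
          using order_tendstoD(2)[OF N_tendsto[OF elim(1) sX elim(3)]] by simp
        then have "\<forall>\<^sub>F n in sequentially. N (s n t - u t) = N (u t - r n t)"
        proof eventually_elim
          case (elim n)
          then show ?case
            using \<open>t \<in> space M\<close> N_commute[OF sX[of n] \<open>u t \<in> X\<close>] by (simp add: r_def A_def M_def)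
        qed
        then show ?thesis by (rule Lim_transform_eventually[OF elim(3)])
      qed
      then have "(\<lambda>n. (N (u t - r n t))\<^sup>2) \<longlonglongrightarrow> 0\<^sup>2" by (rule tendsto_power)
      then show ?case by simp
    qed
  qed simp
  then have "\<forall>\<^sub>F n in sequentially. (LINT t|M. (N (u t - r n t))\<^sup>2) < \<epsilon>"
    by (rule order_tendstoD(2)) (use \<epsilon> in simp)
  then obtain n where n: "(LINT t|M. (N (u t - r n t))\<^sup>2) < \<epsilon>"
    by (auto simp: eventually_sequentially)
  have i1: "integrable M (\<lambda>t. (N (u t - r n t))\<^sup>2)"
    by (rule Bochner_Integration.integrable_bound[OF dom]) (use meas sqb[of n] in auto)
  have i2: "integrable M (\<lambda>t. (N (r n t))\<^sup>2)"
  proof (rule Bochner_Integration.integrable_bound[OF dom])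
    show "(\<lambda>t. (N (r n t))\<^sup>2) \<in> borel_measurable M"
      unfolding M_def by (intro borel_measurable_power simple_on_measurable[OF r])
    show "AE t in M. norm ((N (r n t))\<^sup>2) \<le> norm (9 * (N (u t))\<^sup>2)"
      using bnd[of n] simple_on_mem[OF r[of n]] unfolding M_def[symmetric]
    proof eventually_elim
      case (elim t)
      have 0: "0 \<le> N (r n t)" by (rule N_nonneg[OF elim(2)])
      have "N (r n t) \<le> 3 * N (u t)" using 0 elim(1) by linarith
      then have "(N (r n t))\<^sup>2 \<le> (3 * N (u t))\<^sup>2" using 0 by (rule power_mono)
      then show ?case by (simp add: power_mult_distrib)
    qed
  qed
  show ?thesis
    by (rule that[OF r[of n] i1[unfolded M_def] meas[unfolded M_def] n[unfolded M_def] i2[unfolded M_def]])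
qed

lemma dual_bound:
  assumes l: "l \<in> dual_space X N" and x: "x \<in> X"
  shows "\<bar>l x\<bar> \<le> dual_norm X N l * N x"
proof -
  obtain K where K: "\<And>x. x \<in> X \<Longrightarrow> \<bar>l x\<bar> \<le> K * N x" and sc: "\<And>c x. x \<in> X \<Longrightarrow> l (c *\<^sub>R x) = c * l x"
    using l unfolding dual_space_def bounded_linear_between_def by fastforce
  have bdd: "bdd_above {\<bar>l x\<bar> | x. x \<in> X \<and> N x \<le> 1}"
  proof (rule bdd_aboveI[of _ "\<bar>K\<bar>"], safe)
    fix x assume "x \<in> X" "N x \<le> 1"
    then have "K * N x \<le> \<bar>K\<bar> * 1"
      using N_nonneg by (intro mult_mono) auto
    then show "\<bar>l x\<bar> \<le> \<bar>K\<bar>" using K[OF \<open>x \<in> X\<close>] by simp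
  qed
  show ?thesis
  proof (cases "N x = 0")
    case True then show ?thesis using K[OF x] by simp
  next
    case False
    then have pos: "N x > 0" using N_nonneg[OF x] by simp
    have "N (inverse (N x) *\<^sub>R x) \<le> 1" using homogeneous[OF x] pos by simp
    then have "\<bar>l (inverse (N x) *\<^sub>R x)\<bar> \<le> dual_norm X N l"
      unfolding dual_norm_def op_norm_def by (intro cSup_upper bdd) (use scale_mem[OF x] in auto)
    then show ?thesis using pos by (simp add: sc[OF x] abs_mult field_simps)
  qed
qed

lemma dual_linear:
  assumes "l \<in> dual_space X N"
  shows "x \<in> X \<Longrightarrow> y \<in> X \<Longrightarrow> l (x + y) = l x + l y" "x \<in> X \<Longrightarrow> l (c *\<^sub>R x) = c * l x"
    "x \<in> X \<Longrightarrow> y \<in> X \<Longrightarrow> l (x - y) = l x - l y" "l 0 = 0"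
proof -
  show a: "x \<in> X \<Longrightarrow> y \<in> X \<Longrightarrow> l (x + y) = l x + l y" for x y
    using assms by (auto simp: dual_space_def bounded_linear_between_def)
  show s: "x \<in> X \<Longrightarrow> l (c *\<^sub>R x) = c * l x" for x c
    using assms by (auto simp: dual_space_def bounded_linear_between_def)
  show "x \<in> X \<Longrightarrow> y \<in> X \<Longrightarrow> l (x - y) = l x - l y"
    using a[of x "- y"] s[of y "-1"] uminus_mem by simp
  show "l 0 = 0" using s[OF zero_mem, of 0] by simp
qed

lemma dual_memI:
  assumes "\<And>x y. x \<in> X \<Longrightarrow> y \<in> X \<Longrightarrow> l (x + y) = l x + l y" "\<And>c x. x \<in> X \<Longrightarrow> l (c *\<^sub>R x) = c * l x"
    "\<And>x. x \<in> X \<Longrightarrow> \<bar>l x\<bar> \<le> K * N x"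
  shows "l \<in> dual_space X N"
  using assms unfolding dual_space_def bounded_linear_between_def by (auto intro: exI[of _ K])

lemma dual_norm_leI:
  assumes "\<And>x. x \<in> X \<Longrightarrow> \<bar>l x\<bar> \<le> C * N x" "C \<ge> 0"
  shows "dual_norm X N l \<le> C"
  unfolding dual_norm_def op_norm_def
proof (rule cSup_least)
  show "{\<bar>l x\<bar> | x. x \<in> X \<and> N x \<le> 1} \<noteq> {}" using zero_mem N_zero by auto
  fix y assume "y \<in> {\<bar>l x\<bar> | x. x \<in> X \<and> N x \<le> 1}"
  then obtain x where x: "x \<in> X" "N x \<le> 1" "y = \<bar>l x\<bar>" by auto
  have "C * N x \<le> C * 1" using x assms by (intro mult_left_mono) auto
  then show "y \<le> C" using assms(1)[OF x(1)] x by simp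
qed

lemma dual_norm_nonneg:
  assumes "l \<in> dual_space X N"
  shows "0 \<le> dual_norm X N l"
proof -
  obtain K where K: "\<And>x. x \<in> X \<Longrightarrow> \<bar>l x\<bar> \<le> K * N x"
    using assms unfolding dual_space_def bounded_linear_between_def by fastforce
  have "bdd_above {\<bar>l x\<bar> | x. x \<in> X \<and> N x \<le> 1}"
  proof (rule bdd_aboveI[of _ "\<bar>K\<bar>"], safe)
    fix x assume "x \<in> X" "N x \<le> 1"
    then have "K * N x \<le> \<bar>K\<bar> * 1"
      using N_nonneg by (intro mult_mono) auto
    then show "\<bar>l x\<bar> \<le> \<bar>K\<bar>" using K[OF \<open>x \<in> X\<close>] by simp
  qed
  then have "\<bar>l 0\<bar> \<le> dual_norm X N l"
    unfolding dual_norm_def op_norm_def by (intro cSup_upper) (use zero_mem N_zero in auto)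
  then show ?thesis by simp
qed

lemma dual_seminorm_space: "seminorm_space (dual_space X N) (dual_norm X N)"
proof
  show "0 \<in> dual_space X N" by (rule dual_memI[where K = 0]) auto
  fix l m :: "'v \<Rightarrow> real" and c :: real
  assume l: "l \<in> dual_space X N"
  have mem: "c *\<^sub>R l \<in> dual_space X N" for c
    by (rule dual_memI[where K = "\<bar>c\<bar> * dual_norm X N l"])
      (use dual_linear[OF l] dual_bound[OF l] in
        \<open>auto simp: scaleR_fun_def algebra_simps abs_mult intro!: mult_left_mono\<close>)
  show "c *\<^sub>R l \<in> dual_space X N" by (rule mem)
  have le: "dual_norm X N (c *\<^sub>R l) \<le> \<bar>c\<bar> * dual_norm X N l" for c
    by (rule dual_norm_leI)
      (use dual_bound[OF l] dual_norm_nonneg[OF l] in \<open>auto simp: scaleR_fun_def abs_mult mult.assoc intro!: mult_left_mono\<close>)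
  show "dual_norm X N (c *\<^sub>R l) = \<bar>c\<bar> * dual_norm X N l"
  proof (cases "c = 0")
    case True
    then show ?thesis using le[of 0] dual_norm_nonneg[OF mem, of 0] by simp
  next
    case False
    have "dual_norm X N l \<le> \<bar>inverse c\<bar> * dual_norm X N (c *\<^sub>R l)"
    proof (rule dual_norm_leI)
      fix x assume x: "x \<in> X"
      have "\<bar>l x\<bar> = \<bar>inverse c\<bar> * \<bar>(c *\<^sub>R l) x\<bar>" using False by (simp add: scaleR_fun_def abs_mult)
      also have "\<dots> \<le> \<bar>inverse c\<bar> * (dual_norm X N (c *\<^sub>R l) * N x)"
        by (intro mult_left_mono dual_bound mem x) auto
      finally show "\<bar>l x\<bar> \<le> \<bar>inverse c\<bar> * dual_norm X N (c *\<^sub>R l) * N x" by (simp add: mult.assoc)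
    qed (use dual_norm_nonneg[OF mem] in auto)
    then have "\<bar>c\<bar> * dual_norm X N l \<le> dual_norm X N (c *\<^sub>R l)"
      using False by (simp add: field_simps)
    then show ?thesis using le[of c] by simp
  qed
  assume m: "m \<in> dual_space X N"
  have b: "\<bar>(l + m) x\<bar> \<le> (dual_norm X N l + dual_norm X N m) * N x" if "x \<in> X" for x
    using dual_bound[OF l that] dual_bound[OF m that] by (simp add: distrib_right)
  show "l + m \<in> dual_space X N"
    by (rule dual_memI[OF _ _ b]) (use dual_linear[OF l] dual_linear[OF m] in \<open>auto simp: algebra_simps\<close>)
  show "dual_norm X N (l + m) \<le> dual_norm X N l + dual_norm X N m"
    by (rule dual_norm_leI[OF b]) (use dual_norm_nonneg l m in auto)
qed

lemma pairing_measurable: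
  assumes g: "g \<in> bochner_L2 T (dual_space X N) (dual_norm X N)" and v: "v \<in> bochner_L2 T X N"
  shows "(\<lambda>t. g t (v t)) \<in> borel_measurable (lebesgue_on {0<..<T})"
    "integrable (lebesgue_on {0<..<T}) (\<lambda>t. g t (v t))"
    "AE t in lebesgue_on {0<..<T}. \<bar>g t (v t)\<bar> \<le> dual_norm X N (g t) * N (v t)"
    "\<bar>LINT t|lebesgue_on {0<..<T}. g t (v t)\<bar> \<le> bochner_L2_norm T (dual_norm X N) g * bochner_L2_norm T N v"
proof -
  interpret D: seminorm_space "dual_space X N" "dual_norm X N" by (rule dual_seminorm_space)
  note gD = D.bochner_L2D[OF g] and vD = bochner_L2D[OF v]
  show m: "(\<lambda>t. g t (v t)) \<in> borel_measurable (lebesgue_on {0<..<T})"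
  proof (rule strongly_measurable_pair[OF gD(1,2) vD(1,2), where B = "\<lambda>l x. l x"])
    fix l x and ln :: "nat \<Rightarrow> 'v \<Rightarrow> real" and xn
    assume a: "l \<in> dual_space X N" "x \<in> X" "\<And>n. ln n \<in> dual_space X N" "\<And>n. xn n \<in> X"
      "(\<lambda>n. dual_norm X N (ln n - l)) \<longlonglongrightarrow> 0" "(\<lambda>n. N (xn n - x)) \<longlonglongrightarrow> 0"
    have "(\<lambda>n. ln n (xn n) - l x) \<longlonglongrightarrow> 0"
    proof (rule Lim_null_comparison)
      show "\<forall>\<^sub>F n in sequentially. norm (ln n (xn n) - l x) \<le>
        dual_norm X N (ln n - l) * N (xn n) + dual_norm X N l * N (xn n - x)"
      proof (intro always_eventually allI)
        fix n
        have "ln n (xn n) - l x = (ln n - l) (xn n) + l (xn n - x)"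
          using dual_linear(3)[OF a(1) a(4) a(2)] by simp
        then show "norm (ln n (xn n) - l x) \<le> dual_norm X N (ln n - l) * N (xn n) + dual_norm X N l * N (xn n - x)"
          using dual_bound[OF D.diff_mem[OF a(3) a(1)] a(4), of n n] dual_bound[OF a(1) diff_mem[OF a(4) a(2)], of n]
          by simp
      qed
      have "(\<lambda>n. dual_norm X N (ln n - l) * N (xn n) + dual_norm X N l * N (xn n - x)) \<longlonglongrightarrow> 0 * N x + dual_norm X N l * 0"
        by (intro tendsto_intros a N_tendsto)
      then show "(\<lambda>n. dual_norm X N (ln n - l) * N (xn n) + dual_norm X N l * N (xn n - x)) \<longlonglongrightarrow> 0" by simp
    qed
    then show "(\<lambda>n. ln n (xn n)) \<longlonglongrightarrow> l x" by (simp add: LIM_zero_iff)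
  qed
  show b: "AE t in lebesgue_on {0<..<T}. \<bar>g t (v t)\<bar> \<le> dual_norm X N (g t) * N (v t)"
    using gD(2) vD(2) by eventually_elim (rule dual_bound)
  note CS = Cauchy_Schwarz_integral[OF gD(3,4) vD(3,4)]
  show i: "integrable (lebesgue_on {0<..<T}) (\<lambda>t. g t (v t))"
    by (rule Bochner_Integration.integrable_bound[OF CS(1) m]) (use b in \<open>auto elim!: eventually_mono\<close>)
  have "\<bar>LINT t|lebesgue_on {0<..<T}. g t (v t)\<bar> \<le> (LINT t|lebesgue_on {0<..<T}. \<bar>g t (v t)\<bar>)"
    by (rule integral_abs_bound)
  also have "\<dots> \<le> (LINT t|lebesgue_on {0<..<T}. dual_norm X N (g t) * N (v t))"
    by (intro integral_mono_AE CS(1) integrable_abs i b)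
  also have "\<dots> \<le> bochner_L2_norm T (dual_norm X N) g * bochner_L2_norm T N v"
    using CS(3) by (simp add: bochner_L2_norm_def)
  finally show "\<bar>LINT t|lebesgue_on {0<..<T}. g t (v t)\<bar> \<le> bochner_L2_norm T (dual_norm X N) g * bochner_L2_norm T N v" .
qed

end

section \<open>The spaces \<open>L\<^sup>2\<close>, \<open>H\<^sup>1\<close> and \<open>H\<^sup>1\<^sub>0\<close>\<close>

lemma L2D:
  assumes "f \<in> L2 \<Omega>"
  shows "f \<in> borel_measurable (lebesgue_on \<Omega>)" "integrable (lebesgue_on \<Omega>) (\<lambda>x. (f x)\<^sup>2)"
  using assms by (auto simp: L2_def)

lemma L2_norm_nonneg: "0 \<le> L2_norm \<Omega> f"
  by (simp add: L2_norm_def)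

lemma L2_norm_power2: "(L2_norm \<Omega> f)\<^sup>2 = (LINT x|lebesgue_on \<Omega>. (f x)\<^sup>2)"
  by (simp add: L2_norm_def)

lemma L2_inner:
  assumes "f \<in> L2 \<Omega>" "g \<in> L2 \<Omega>"
  shows "integrable (lebesgue_on \<Omega>) (\<lambda>x. f x * g x)"
    "\<bar>LINT x|lebesgue_on \<Omega>. f x * g x\<bar> \<le> L2_norm \<Omega> f * L2_norm \<Omega> g"
    "(LINT x|lebesgue_on \<Omega>. \<bar>f x * g x\<bar>) \<le> L2_norm \<Omega> f * L2_norm \<Omega> g"
  using Cauchy_Schwarz_integral[OF L2D[OF assms(1)] L2D[OF assms(2)]] by (auto simp: L2_norm_def)

lemma L2_add: "f \<in> L2 \<Omega> \<Longrightarrow> g \<in> L2 \<Omega> \<Longrightarrow> (\<lambda>x. f x + g x) \<in> L2 \<Omega>"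
  unfolding L2_def by (auto intro: integrable_add_square)

lemma L2_cmult: "f \<in> L2 \<Omega> \<Longrightarrow> (\<lambda>x. c * f x) \<in> L2 \<Omega>"
  unfolding L2_def by (auto simp: power_mult_distrib)

lemma L2_norm_triangle:
  "f \<in> L2 \<Omega> \<Longrightarrow> g \<in> L2 \<Omega> \<Longrightarrow> L2_norm \<Omega> (\<lambda>x. f x + g x) \<le> L2_norm \<Omega> f + L2_norm \<Omega> g"
  unfolding L2_norm_def by (rule Minkowski_integral) (auto simp: L2_def)

lemma L2_norm_cmult: "L2_norm \<Omega> (\<lambda>x. c * f x) = \<bar>c\<bar> * L2_norm \<Omega> f"
  by (simp add: L2_norm_def power_mult_distrib real_sqrt_mult)

interpretation L2: seminorm_space "L2 \<Omega>" "L2_norm \<Omega>" for \<Omega> :: "'a::euclidean_space set"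
proof
  show "0 \<in> L2 \<Omega>" by (simp add: L2_def zero_fun_def)
  show "f \<in> L2 \<Omega> \<Longrightarrow> g \<in> L2 \<Omega> \<Longrightarrow> f + g \<in> L2 \<Omega>" for f g
    using L2_add[of f \<Omega> g] by (simp add: plus_fun_def)
  show "f \<in> L2 \<Omega> \<Longrightarrow> c *\<^sub>R f \<in> L2 \<Omega>" for f c
    using L2_cmult[of f \<Omega> c] by (simp add: scaleR_fun_def)
  show "f \<in> L2 \<Omega> \<Longrightarrow> g \<in> L2 \<Omega> \<Longrightarrow> L2_norm \<Omega> (f + g) \<le> L2_norm \<Omega> f + L2_norm \<Omega> g" for f g
    using L2_norm_triangle[of f \<Omega> g] by (simp add: plus_fun_def)
  show "f \<in> L2 \<Omega> \<Longrightarrow> L2_norm \<Omega> (c *\<^sub>R f) = \<bar>c\<bar> * L2_norm \<Omega> f" for f c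
    using L2_norm_cmult[of \<Omega> c f] by (simp add: scaleR_fun_def)
qed

lemma L2_mono:
  assumes g: "g \<in> L2 \<Omega>" and f: "f \<in> borel_measurable (lebesgue_on \<Omega>)"
    and le: "AE x in lebesgue_on \<Omega>. \<bar>f x\<bar> \<le> \<bar>g x\<bar>"
  shows "f \<in> L2 \<Omega>" "L2_norm \<Omega> f \<le> L2_norm \<Omega> g"
proof -
  have sq: "AE x in lebesgue_on \<Omega>. (f x)\<^sup>2 \<le> (g x)\<^sup>2"
    using le by eventually_elim (simp add: abs_le_square_iff)
  have int: "integrable (lebesgue_on \<Omega>) (\<lambda>x. (f x)\<^sup>2)"
    by (rule Bochner_Integration.integrable_bound[OF L2D(2)[OF g]]) (use sq f in auto)
  then show "f \<in> L2 \<Omega>" using f by (simp add: L2_def)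
  show "L2_norm \<Omega> f \<le> L2_norm \<Omega> g"
    unfolding L2_norm_def by (intro real_sqrt_le_mono integral_mono_AE int L2D(2)[OF g] sq)
qed

lemma L2_AE_eq:
  assumes "f \<in> L2 \<Omega>" "g \<in> L2 \<Omega>" "AE x in lebesgue_on \<Omega>. f x = g x"
  shows "L2_norm \<Omega> f = L2_norm \<Omega> g"
proof (rule antisym)
  have "AE x in lebesgue_on \<Omega>. \<bar>f x\<bar> \<le> \<bar>g x\<bar>" using assms(3) by eventually_elim simp
  then show "L2_norm \<Omega> f \<le> L2_norm \<Omega> g" by (rule L2_mono(2)[OF assms(2) L2D(1)[OF assms(1)]])
  have "AE x in lebesgue_on \<Omega>. \<bar>g x\<bar> \<le> \<bar>f x\<bar>" using assms(3) by eventually_elim simp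
  then show "L2_norm \<Omega> g \<le> L2_norm \<Omega> f" by (rule L2_mono(2)[OF assms(1) L2D(1)[OF assms(2)]])
qed

lemma lebesgue_on_support:
  fixes f :: "'a::euclidean_space \<Rightarrow> real"
  assumes "S \<in> sets lebesgue" "\<And>x. x \<notin> S \<Longrightarrow> f x = 0"
  shows "integrable (lebesgue_on S) f = integrable lebesgue f"
    "(LINT x|lebesgue_on S. f x) = (LINT x|lebesgue. f x)"
proof -
  have eq: "(\<lambda>x. indicator S x * f x) = f" using assms(2) by (auto simp: fun_eq_iff indicator_def)
  show "integrable (lebesgue_on S) f = integrable lebesgue f"
    using integrable_restrict_space[of S lebesgue f] assms(1) by (simp add: eq)
  show "(LINT x|lebesgue_on S. f x) = (LINT x|lebesgue. f x)"
    using integral_restrict_space[of S lebesgue f] assms(1) by (simp add: eq)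
qed

lemma test_function_square_integrable:
  assumes \<psi>: "\<psi> \<in> test_functions \<Omega>"
  shows "integrable lborel (\<lambda>x. (\<psi> x)\<^sup>2)" "integrable lebesgue (\<lambda>x. (\<psi> x)\<^sup>2)"
proof -
  obtain a where a: "\<And>x. x \<notin> cbox (- a) a \<Longrightarrow> \<psi> x = 0" using test_functionD(3)[OF \<psi>] by blast
  have "integrable lborel (\<lambda>x. indicator (cbox (- a) a) x *\<^sub>R (\<psi> x)\<^sup>2)"
    by (rule borel_integrable_compact) (auto intro!: continuous_intros test_functionD(2)[OF \<psi>])
  moreover have "(\<lambda>x. indicator (cbox (- a) a) x *\<^sub>R (\<psi> x)\<^sup>2) = (\<lambda>x. (\<psi> x)\<^sup>2)"
    using a by (auto simp: fun_eq_iff indicator_def)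
  ultimately show 1: "integrable lborel (\<lambda>x. (\<psi> x)\<^sup>2)" by simp
  then show "integrable lebesgue (\<lambda>x. (\<psi> x)\<^sup>2)"
    by (subst integrable_completion) (auto dest: borel_measurable_integrable)
qed

lemma test_function_L2:
  assumes \<psi>: "\<psi> \<in> test_functions \<Omega>" and \<Omega>: "open \<Omega>"
  shows "\<psi> \<in> L2 \<Omega>"
proof -
  have "integrable (lebesgue_on \<Omega>) (\<lambda>x. (\<psi> x)\<^sup>2)"
    using \<Omega> test_functionD(4)[OF \<psi>] test_function_square_integrable(2)[OF \<psi>]
    by (subst lebesgue_on_support(1)) auto
  then show ?thesis
    using continuous_imp_lebesgue_measurable(2)[OF test_functionD(2)[OF \<psi>]] by (simp add: L2_def)
qed

lemma test_functions_add_scale: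
  assumes "\<phi> \<in> test_functions \<Omega>" "\<psi> \<in> test_functions \<Omega>"
  shows "(\<lambda>x. \<phi> x + c * \<psi> x) \<in> test_functions \<Omega>"
proof -
  have sub: "closure {x. \<phi> x + c * \<psi> x \<noteq> 0} \<subseteq> closure {x. \<phi> x \<noteq> 0} \<union> closure {x. \<psi> x \<noteq> 0}"
  proof (intro closure_minimal closed_Un closed_closure subsetI)
    fix x assume "x \<in> {x. \<phi> x + c * \<psi> x \<noteq> 0}"
    then have "x \<in> {x. \<phi> x \<noteq> 0} \<or> x \<in> {x. \<psi> x \<noteq> 0}" by auto
    then show "x \<in> closure {x. \<phi> x \<noteq> 0} \<union> closure {x. \<psi> x \<noteq> 0}"
      using closure_subset[of "{x. \<phi> x \<noteq> 0}"] closure_subset[of "{x. \<psi> x \<noteq> 0}"] by (metis UnI1 UnI2 subsetD)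
  qed
  have comp: "compact (closure {x. \<phi> x \<noteq> 0} \<union> closure {x. \<psi> x \<noteq> 0})"
    using assms by (intro compact_Un) (simp_all add: test_functions_def)
  have "compact (closure {x. \<phi> x + c * \<psi> x \<noteq> 0})"
    using compact_Int_closed[OF comp closed_closure[of "{x. \<phi> x + c * \<psi> x \<noteq> 0}"]]
    by (simp only: Int_absorb1[OF sub])
  moreover have "Ck k (\<lambda>x. \<phi> x + c * \<psi> x)" for k
    using assms by (intro Ck_add Ck_mult Ck_const) (auto simp: test_functions_def)
  moreover have "closure {x. \<phi> x + c * \<psi> x \<noteq> 0} \<subseteq> \<Omega>"
    by (rule order_trans[OF sub Un_least]) (use assms in \<open>simp_all add: test_functions_def\<close>)
  ultimately show ?thesis unfolding test_functions_def by blast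
qed

lemma L2_imp_locally_integrable:
  assumes \<Omega>: "\<Omega> \<in> sets lebesgue" and f: "f \<in> L2 \<Omega>"
  shows "set_integrable lebesgue (cbox a b) (\<lambda>x. indicator \<Omega> x * f x)"
  unfolding set_integrable_def
proof (rule Bochner_Integration.integrable_bound)
  have i: "integrable lebesgue (\<lambda>x. indicator \<Omega> x *\<^sub>R (f x)\<^sup>2)"
    using L2D(2)[OF f] \<Omega> by (subst (asm) integrable_restrict_space) auto
  show "integrable lebesgue (\<lambda>x. indicator (cbox a b) x + indicator \<Omega> x *\<^sub>R (f x)\<^sup>2)"
    by (intro Bochner_Integration.integrable_add i lmeasurable_iff_integrable[THEN iffD1] lmeasurable_cbox)
  have "(\<lambda>x. indicator \<Omega> x *\<^sub>R f x) \<in> borel_measurable lebesgue"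
    using L2D(1)[OF f] \<Omega> by (subst borel_measurable_restrict_space_iff[symmetric]) auto
  then show "(\<lambda>x. indicator (cbox a b) x *\<^sub>R (indicator \<Omega> x * f x)) \<in> borel_measurable lebesgue"
    by (intro borel_measurable_scaleR borel_measurable_indicator fmeasurableD[OF lmeasurable_cbox]) simp
  show "AE x in lebesgue. norm (indicator (cbox a b) x *\<^sub>R (indicator \<Omega> x * f x))
    \<le> norm (indicator (cbox a b) x + indicator \<Omega> x *\<^sub>R (f x)\<^sup>2)"
  proof (rule AE_I2)
    fix x
    have "\<bar>f x\<bar> \<le> 1 + (f x)\<^sup>2"
    proof -
      have "2 * \<bar>f x\<bar> \<le> 1 + (f x)\<^sup>2" using sum_squares_bound[of 1 "\<bar>f x\<bar>"] by simp
      then show ?thesis by linarith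
    qed
    then show "norm (indicator (cbox a b) x *\<^sub>R (indicator \<Omega> x * f x))
      \<le> norm (indicator (cbox a b) x + indicator \<Omega> x *\<^sub>R (f x)\<^sup>2)"
      by (auto simp: indicator_def)
  qed
qed

text \<open>This removes the choice of a representative from \<open>weak_grad\<close>: by it, \<open>H1_norm\<close> can be computed
  from any gradient and is a seminorm.\<close>

lemma is_L2_gradient_unique:
  assumes \<Omega>: "open \<Omega>" and G: "is_L2_gradient \<Omega> u G" and H: "is_L2_gradient \<Omega> u H"
  shows "AE x in lebesgue_on \<Omega>. G x = H x"
proof -
  have \<Omega>s: "\<Omega> \<in> sets lebesgue" using \<Omega> by simp
  have "AE x in lebesgue_on \<Omega>. G x \<bullet> i - H x \<bullet> i = 0" if i: "i \<in> Basis" for i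
  proof (rule test_orthogonal_imp_AE_0[OF \<Omega>])
    have Gi: "(\<lambda>x. G x \<bullet> i) \<in> L2 \<Omega>" and Hi: "(\<lambda>x. H x \<bullet> i) \<in> L2 \<Omega>"
      using G H i by (auto simp: is_L2_gradient_def)
    have "(\<lambda>x. G x \<bullet> i + (-1) * (H x \<bullet> i)) \<in> L2 \<Omega>"
      by (intro L2_add L2_cmult Gi Hi)
    then show "set_integrable lebesgue (cbox a b) (\<lambda>x. indicator \<Omega> x * (G x \<bullet> i - H x \<bullet> i))" for a b
      using L2_imp_locally_integrable[OF \<Omega>s] by simp
    fix \<psi> assume \<psi>: "\<psi> \<in> test_functions \<Omega>"
    have "(LINT x|lebesgue_on \<Omega>. (G x \<bullet> i) * \<psi> x) = (LINT x|lebesgue_on \<Omega>. (H x \<bullet> i) * \<psi> x)"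
      using G H i \<psi> by (auto simp: is_L2_gradient_def is_weak_partial_def)
    then show "(LINT x|lebesgue_on \<Omega>. (G x \<bullet> i - H x \<bullet> i) * \<psi> x) = 0"
      using L2_inner(1)[OF Gi test_function_L2[OF \<psi> \<Omega>]] L2_inner(1)[OF Hi test_function_L2[OF \<psi> \<Omega>]]
      by (simp add: left_diff_distrib)
  qed
  then have "AE x in lebesgue_on \<Omega>. \<forall>i\<in>Basis. G x \<bullet> i - H x \<bullet> i = 0"
    by (intro AE_finite_allI) auto
  then show ?thesis by eventually_elim (auto intro: euclidean_eqI)
qed

lemma is_L2_gradient_norm:
  assumes "is_L2_gradient \<Omega> u G"
  shows "G \<in> borel_measurable (lebesgue_on \<Omega>)" "(\<lambda>x. norm (G x)) \<in> L2 \<Omega>"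
proof -
  have Gi: "i \<in> Basis \<Longrightarrow> (\<lambda>x. G x \<bullet> i) \<in> L2 \<Omega>" for i
    using assms by (auto simp: is_L2_gradient_def)
  show m: "G \<in> borel_measurable (lebesgue_on \<Omega>)"
    using L2D(1)[OF Gi] by (subst borel_measurable_euclidean_space) auto
  have "integrable (lebesgue_on \<Omega>) (\<lambda>x. \<Sum>i\<in>Basis. (G x \<bullet> i)\<^sup>2)"
    by (intro Bochner_Integration.integrable_sum L2D(2) Gi)
  then show "(\<lambda>x. norm (G x)) \<in> L2 \<Omega>"
    using m by (simp add: L2_def euclidean_dist_l2[of _ 0, simplified] L2_set_def sum_nonneg)
qed

lemma is_L2_gradient_add_scale:
  assumes \<Omega>: "open \<Omega>" and u: "u \<in> L2 \<Omega>" "is_L2_gradient \<Omega> u G" and v: "v \<in> L2 \<Omega>" "is_L2_gradient \<Omega> v H"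
  shows "is_L2_gradient \<Omega> (\<lambda>x. u x + c * v x) (\<lambda>x. G x + c *\<^sub>R H x)"
  unfolding is_L2_gradient_def
proof (intro ballI conjI)
  fix i :: 'a assume i: "i \<in> Basis"
  have Gi: "(\<lambda>x. G x \<bullet> i) \<in> L2 \<Omega>" and Hi: "(\<lambda>x. H x \<bullet> i) \<in> L2 \<Omega>"
    and Gw: "is_weak_partial \<Omega> i u (\<lambda>x. G x \<bullet> i)" and Hw: "is_weak_partial \<Omega> i v (\<lambda>x. H x \<bullet> i)"
    using u v i by (auto simp: is_L2_gradient_def)
  show "(\<lambda>x. (G x + c *\<^sub>R H x) \<bullet> i) \<in> L2 \<Omega>"
    using L2_add[OF Gi L2_cmult[OF Hi, of c]] by (simp add: inner_add_left)
  show "is_weak_partial \<Omega> i (\<lambda>x. u x + c * v x) (\<lambda>x. (G x + c *\<^sub>R H x) \<bullet> i)"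
    unfolding is_weak_partial_def
  proof
    fix \<psi> assume \<psi>: "\<psi> \<in> test_functions \<Omega>"
    note \<psi>L = test_function_L2[OF \<psi> \<Omega>] and dL = test_function_L2[OF test_functionD(6)[OF \<psi> i] \<Omega>]
    have "(LINT x|lebesgue_on \<Omega>. (u x + c * v x) * frechet_derivative \<psi> (at x) i) =
      (LINT x|lebesgue_on \<Omega>. u x * frechet_derivative \<psi> (at x) i + c * (v x * frechet_derivative \<psi> (at x) i))"
      by (simp add: algebra_simps)
    also have "\<dots> = (LINT x|lebesgue_on \<Omega>. u x * frechet_derivative \<psi> (at x) i)
       + c * (LINT x|lebesgue_on \<Omega>. v x * frechet_derivative \<psi> (at x) i)"
      using L2_inner(1)[OF u(1) dL] L2_inner(1)[OF v(1) dL] by simp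
    also have "\<dots> = - ((LINT x|lebesgue_on \<Omega>. (G x \<bullet> i) * \<psi> x) + c * (LINT x|lebesgue_on \<Omega>. (H x \<bullet> i) * \<psi> x))"
      using Gw Hw \<psi> by (simp add: is_weak_partial_def)
    also have "(LINT x|lebesgue_on \<Omega>. (G x \<bullet> i) * \<psi> x) + c * (LINT x|lebesgue_on \<Omega>. (H x \<bullet> i) * \<psi> x)
      = (LINT x|lebesgue_on \<Omega>. (G x \<bullet> i) * \<psi> x + c * ((H x \<bullet> i) * \<psi> x))"
      using L2_inner(1)[OF Gi \<psi>L] L2_inner(1)[OF Hi \<psi>L] by simp
    also have "\<dots> = (LINT x|lebesgue_on \<Omega>. ((G x + c *\<^sub>R H x) \<bullet> i) * \<psi> x)"
      by (simp add: inner_add_left algebra_simps)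
    finally show "(LINT x|lebesgue_on \<Omega>. (u x + c * v x) * frechet_derivative \<psi> (at x) i) =
      - (LINT x|lebesgue_on \<Omega>. ((G x + c *\<^sub>R H x) \<bullet> i) * \<psi> x)" .
  qed
qed

lemma H1_norm_eq:
  assumes \<Omega>: "open \<Omega>" and G: "is_L2_gradient \<Omega> u G"
  shows "H1_norm \<Omega> u = sqrt ((L2_norm \<Omega> u)\<^sup>2 + (L2_norm \<Omega> (\<lambda>x. norm (G x)))\<^sup>2)"
proof -
  have W: "is_L2_gradient \<Omega> u (weak_grad \<Omega> u)" using G someI[of "is_L2_gradient \<Omega> u"] by (simp add: weak_grad_def)
  have "L2_norm \<Omega> (\<lambda>x. norm (weak_grad \<Omega> u x)) = L2_norm \<Omega> (\<lambda>x. norm (G x))"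
    by (rule L2_AE_eq[OF is_L2_gradient_norm(2)[OF W] is_L2_gradient_norm(2)[OF G]])
      (use is_L2_gradient_unique[OF \<Omega> W G] in \<open>auto elim: eventually_mono\<close>)
  then show ?thesis by (simp add: H1_norm_def L2_norm_power2[symmetric, of \<Omega> "\<lambda>x. norm (weak_grad \<Omega> u x)"])
qed

lemma L2_norm_le_H1_norm: "L2_norm \<Omega> u \<le> H1_norm \<Omega> u"
  unfolding H1_norm_def by (rule real_le_rsqrt) (auto intro: integral_nonneg_AE)

lemma H1_seminorm_space:
  assumes \<Omega>: "open \<Omega>"
  shows "seminorm_space (H1 \<Omega>) (H1_norm \<Omega>)"
proof
  show "0 \<in> H1 \<Omega>"
    using L2.zero_mem by (auto simp: H1_def is_L2_gradient_def is_weak_partial_def zero_fun_def intro!: exI[of _ "\<lambda>x. 0"])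
  fix u v :: "'a \<Rightarrow> real" and c :: real
  assume "u \<in> H1 \<Omega>"
  then obtain G where u: "u \<in> L2 \<Omega>" "is_L2_gradient \<Omega> u G" by (auto simp: H1_def)
  have z: "(\<lambda>x. 0) \<in> L2 \<Omega>" "is_L2_gradient \<Omega> (\<lambda>x. 0) (\<lambda>x. 0)"
    using L2.zero_mem by (auto simp: is_L2_gradient_def is_weak_partial_def zero_fun_def)
  have cu: "is_L2_gradient \<Omega> (c *\<^sub>R u) (\<lambda>x. c *\<^sub>R G x)"
    using is_L2_gradient_add_scale[OF \<Omega> z u, of c] by (simp add: scaleR_fun_def)
  then show "c *\<^sub>R u \<in> H1 \<Omega>" using u L2.scale_mem by (auto simp: H1_def)
  show "H1_norm \<Omega> (c *\<^sub>R u) = \<bar>c\<bar> * H1_norm \<Omega> u"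
  proof -
    have "(L2_norm \<Omega> (c *\<^sub>R u))\<^sup>2 + (L2_norm \<Omega> (\<lambda>x. norm (c *\<^sub>R G x)))\<^sup>2 =
        c\<^sup>2 * ((L2_norm \<Omega> u)\<^sup>2 + (L2_norm \<Omega> (\<lambda>x. norm (G x)))\<^sup>2)"
      using L2_norm_cmult[of \<Omega> "\<bar>c\<bar>" "\<lambda>x. norm (G x)"] L2.homogeneous[OF u(1), of c]
      by (simp add: power_mult_distrib algebra_simps)
    then show ?thesis
      by (simp add: H1_norm_eq[OF \<Omega> u(2)] H1_norm_eq[OF \<Omega> cu] real_sqrt_mult)
  qed
  assume "v \<in> H1 \<Omega>"
  then obtain H where v: "v \<in> L2 \<Omega>" "is_L2_gradient \<Omega> v H" by (auto simp: H1_def)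
  have uv: "is_L2_gradient \<Omega> (u + v) (\<lambda>x. G x + H x)"
    using is_L2_gradient_add_scale[OF \<Omega> u v, of 1] by (simp add: plus_fun_def)
  then show "u + v \<in> H1 \<Omega>" using u v L2.add_mem by (auto simp: H1_def)
  have "L2_norm \<Omega> (\<lambda>x. norm (G x + H x)) \<le> L2_norm \<Omega> (\<lambda>x. norm (G x) + norm (H x))"
    using is_L2_gradient_norm[OF u(2)] is_L2_gradient_norm[OF v(2)] is_L2_gradient_norm[OF uv]
    by (intro L2_mono(2) L2_add) (auto intro!: AE_I2 norm_triangle_ineq simp: L2_def)
  also have "\<dots> \<le> L2_norm \<Omega> (\<lambda>x. norm (G x)) + L2_norm \<Omega> (\<lambda>x. norm (H x))"
    by (rule L2_norm_triangle[OF is_L2_gradient_norm(2)[OF u(2)] is_L2_gradient_norm(2)[OF v(2)]])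
  finally have g: "L2_norm \<Omega> (\<lambda>x. norm (G x + H x)) \<le> L2_norm \<Omega> (\<lambda>x. norm (G x)) + L2_norm \<Omega> (\<lambda>x. norm (H x))" .
  have "H1_norm \<Omega> (u + v) \<le> sqrt ((L2_norm \<Omega> u + L2_norm \<Omega> v)\<^sup>2
      + (L2_norm \<Omega> (\<lambda>x. norm (G x)) + L2_norm \<Omega> (\<lambda>x. norm (H x)))\<^sup>2)"
    unfolding H1_norm_eq[OF \<Omega> uv]
    by (intro real_sqrt_le_mono add_mono power_mono g L2.triangle u v L2_norm_nonneg)
  also have "\<dots> \<le> H1_norm \<Omega> u + H1_norm \<Omega> v"
    unfolding H1_norm_eq[OF \<Omega> u(2)] H1_norm_eq[OF \<Omega> v(2)] by (rule real_sqrt_sum_squares_triangle_ineq)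
  finally show "H1_norm \<Omega> (u + v) \<le> H1_norm \<Omega> u + H1_norm \<Omega> v" .
qed

definition classical_grad :: "('a::euclidean_space \<Rightarrow> real) \<Rightarrow> 'a \<Rightarrow> 'a"
  where "classical_grad \<psi> x = (\<Sum>i\<in>Basis. frechet_derivative \<psi> (at x) i *\<^sub>R i)"

lemma classical_grad_inner:
  assumes "\<psi> \<in> test_functions \<Omega>"
  shows "classical_grad \<psi> x \<bullet> v = frechet_derivative \<psi> (at x) v"
proof -
  interpret linear "frechet_derivative \<psi> (at x)"
    using has_derivative_linear[OF test_functionD(1)[OF assms]] .
  have "frechet_derivative \<psi> (at x) v = frechet_derivative \<psi> (at x) (\<Sum>i\<in>Basis. (v \<bullet> i) *\<^sub>R i)"
    by (simp add: euclidean_representation)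
  also have "\<dots> = (\<Sum>i\<in>Basis. (v \<bullet> i) *\<^sub>R frechet_derivative \<psi> (at x) i)"
    by (simp add: sum scale)
  also have "\<dots> = classical_grad \<psi> x \<bullet> v"
    by (simp add: classical_grad_def inner_sum_left inner_sum_right inner_commute mult.commute)
  finally show ?thesis by simp
qed

lemma classical_grad_continuous:
  assumes "\<psi> \<in> test_functions \<Omega>"
  shows "continuous_on A (classical_grad \<psi>)"
  unfolding classical_grad_def
  by (intro continuous_on_sum continuous_on_scaleR continuous_on_const test_functionD(2)[OF test_functionD(6)[OF assms]])

lemma classical_grad_is_L2_gradient:
  assumes \<Omega>: "open \<Omega>" and \<psi>: "\<psi> \<in> test_functions \<Omega>"
  shows "is_L2_gradient \<Omega> \<psi> (classical_grad \<psi>)"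
  unfolding is_L2_gradient_def
proof (intro ballI conjI)
  fix i :: 'a assume i: "i \<in> Basis"
  have \<Omega>s: "\<Omega> \<in> sets lebesgue" using \<Omega> by simp
  have dt: "(\<lambda>x. frechet_derivative \<psi> (at x) i) \<in> test_functions \<Omega>" by (rule test_functionD(6)[OF \<psi> i])
  show "(\<lambda>x. classical_grad \<psi> x \<bullet> i) \<in> L2 \<Omega>"
    unfolding classical_grad_inner[OF \<psi>] by (rule test_function_L2[OF dt \<Omega>])
  show "is_weak_partial \<Omega> i \<psi> (\<lambda>x. classical_grad \<psi> x \<bullet> i)"
    unfolding is_weak_partial_def classical_grad_inner[OF \<psi>]
  proof
    fix \<eta> assume \<eta>: "\<eta> \<in> test_functions \<Omega>"
    note ibp = integral_by_parts_test[OF \<eta> i test_functionD(1)[OF \<psi>] test_functionD(2)[OF dt]]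
    have "(LINT x|lebesgue_on \<Omega>. \<psi> x * frechet_derivative \<eta> (at x) i) = (LINT x|lebesgue. \<psi> x * frechet_derivative \<eta> (at x) i)"
      by (rule lebesgue_on_support(2)[OF \<Omega>s]) (simp add: test_functionD(4)[OF \<psi>])
    also have "\<dots> = (LINT x|lborel. \<psi> x * frechet_derivative \<eta> (at x) i)"
      using ibp(2) by (intro integral_completion) (auto dest: borel_measurable_integrable)
    also have "\<dots> = - (LINT x|lborel. frechet_derivative \<psi> (at x) i * \<eta> x)" by (rule ibp(1))
    also have "(LINT x|lborel. frechet_derivative \<psi> (at x) i * \<eta> x) = (LINT x|lebesgue. frechet_derivative \<psi> (at x) i * \<eta> x)"
      using ibp(3) by (intro integral_completion[symmetric]) (auto dest: borel_measurable_integrable)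
    also have "\<dots> = (LINT x|lebesgue_on \<Omega>. frechet_derivative \<psi> (at x) i * \<eta> x)"
      by (rule lebesgue_on_support(2)[OF \<Omega>s, symmetric]) (simp add: test_functionD(4)[OF \<eta>])
    finally show "(LINT x|lebesgue_on \<Omega>. \<psi> x * frechet_derivative \<eta> (at x) i) =
      - (LINT x|lebesgue_on \<Omega>. frechet_derivative \<psi> (at x) i * \<eta> x)" .
  qed
qed

lemma H10_seminorm_space:
  assumes \<Omega>: "open \<Omega>"
  shows "seminorm_space (H10 \<Omega>) (H1_norm \<Omega>)"
proof -
  interpret H1: seminorm_space "H1 \<Omega>" "H1_norm \<Omega>" by (rule H1_seminorm_space[OF \<Omega>])
  have tH1: "\<psi> \<in> test_functions \<Omega> \<Longrightarrow> \<psi> \<in> H1 \<Omega>" for \<psi>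
    using test_function_L2[OF _ \<Omega>] classical_grad_is_L2_gradient[OF \<Omega>] by (auto simp: H1_def)
  have comb: "u + c *\<^sub>R v \<in> H10 \<Omega>" if u: "u \<in> H10 \<Omega>" and v: "v \<in> H10 \<Omega>" for u v c
  proof -
    have uH: "u \<in> H1 \<Omega>" and vH: "v \<in> H1 \<Omega>" using u v by (auto simp: H10_def)
    have "\<exists>\<psi>\<in>test_functions \<Omega>. H1_norm \<Omega> (u + c *\<^sub>R v - \<psi>) < \<epsilon>" if \<epsilon>: "\<epsilon> > 0" for \<epsilon>
    proof -
      define \<delta> where "\<delta> = \<epsilon> / (1 + \<bar>c\<bar>)"
      have \<delta>: "\<delta> > 0" using \<epsilon> by (simp add: \<delta>_def)
      obtain \<phi> where \<phi>: "\<phi> \<in> test_functions \<Omega>" "H1_norm \<Omega> (u - \<phi>) < \<delta>"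
        using u \<delta> unfolding H10_def by blast
      obtain \<psi> where \<psi>: "\<psi> \<in> test_functions \<Omega>" "H1_norm \<Omega> (v - \<psi>) < \<delta>"
        using v \<delta> unfolding H10_def by blast
      have eq: "u + c *\<^sub>R v - (\<phi> + c *\<^sub>R \<psi>) = (u - \<phi>) + c *\<^sub>R (v - \<psi>)" by (simp add: algebra_simps)
      have "H1_norm \<Omega> (u + c *\<^sub>R v - (\<phi> + c *\<^sub>R \<psi>)) \<le> H1_norm \<Omega> (u - \<phi>) + \<bar>c\<bar> * H1_norm \<Omega> (v - \<psi>)"
        unfolding eq using H1.triangle[OF H1.diff_mem[OF uH tH1[OF \<phi>(1)]] H1.scale_mem[OF H1.diff_mem[OF vH tH1[OF \<psi>(1)]]], of c]
          H1.homogeneous[OF H1.diff_mem[OF vH tH1[OF \<psi>(1)]]] by simp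
      also have "\<dots> < \<delta> + \<bar>c\<bar> * \<delta>"
        using \<phi> \<psi> by (intro add_less_le_mono mult_left_mono) auto
      also have "\<dots> = (1 + \<bar>c\<bar>) * \<delta>" by (simp add: algebra_simps)
      also have "\<dots> = \<epsilon>" using add_pos_nonneg[of 1 "\<bar>c\<bar>"] by (simp add: \<delta>_def)
      finally have "H1_norm \<Omega> (u + c *\<^sub>R v - (\<phi> + c *\<^sub>R \<psi>)) < \<epsilon>" .
      moreover have "\<phi> + c *\<^sub>R \<psi> \<in> test_functions \<Omega>"
        using test_functions_add_scale[OF \<phi>(1) \<psi>(1), of c] by (simp add: plus_fun_def scaleR_fun_def)
      ultimately show ?thesis by blast
    qed
    then show ?thesis using H1.add_mem[OF uH H1.scale_mem[OF vH]] by (simp add: H10_def)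
  qed
  have zt: "0 \<in> test_functions \<Omega>"
    by (simp add: test_functions_def zero_fun_def Ck_const del: Ck.simps)
  have z: "0 \<in> H10 \<Omega>"
    using H1.zero_mem H1.N_zero by (auto simp: H10_def intro!: bexI[OF _ zt])
  have sub: "u \<in> H10 \<Omega> \<Longrightarrow> u \<in> H1 \<Omega>" for u by (simp add: H10_def)
  show ?thesis
  proof
    show "0 \<in> H10 \<Omega>" by (rule z)
    show "u \<in> H10 \<Omega> \<Longrightarrow> v \<in> H10 \<Omega> \<Longrightarrow> u + v \<in> H10 \<Omega>" for u v using comb[of u v 1] by simp
    show "u \<in> H10 \<Omega> \<Longrightarrow> c *\<^sub>R u \<in> H10 \<Omega>" for u c using comb[OF z, of u c] by simp
  qed (auto intro: H1.triangle H1.homogeneous sub)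
qed

lemma H10D: "u \<in> H10 \<Omega> \<Longrightarrow> u \<in> L2 \<Omega>" "u \<in> H10 \<Omega> \<Longrightarrow> u \<in> H1 \<Omega>"
  by (auto simp: H10_def H1_def)

section \<open>Uniform integrability in \<open>H\<^sup>1\<^sub>0\<close>\<close>

lemma nn_integral_lborel_translation:
  assumes [measurable]: "f \<in> borel_measurable borel"
  shows "(\<integral>\<^sup>+x. f (x + c) \<partial>lborel) = (\<integral>\<^sup>+x. f x \<partial>(lborel :: 'a::euclidean_space measure))"
proof -
  have "(\<integral>\<^sup>+x. f x \<partial>(lborel :: 'a measure)) = (\<integral>\<^sup>+x. f x \<partial>distr lborel borel ((+) c))"
    by (simp add: lborel_distr_plus)
  also have "\<dots> = (\<integral>\<^sup>+x. f (c + x) \<partial>lborel)" by (subst nn_integral_distr) auto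
  finally show ?thesis by (simp add: add.commute)
qed

text \<open>The fundamental theorem of calculus along the segment from \<open>x\<close> to \<open>x + y\<close>, and
  Cauchy-Schwarz.\<close>

lemma test_function_translation:
  fixes \<psi> :: "'a::euclidean_space \<Rightarrow> real"
  assumes \<psi>: "\<psi> \<in> test_functions \<Omega>"
  shows "(\<integral>\<^sup>+x. ennreal ((\<psi> (x + y) - \<psi> x)\<^sup>2) \<partial>lborel) \<le>
    ennreal ((norm y)\<^sup>2) * (\<integral>\<^sup>+x. ennreal ((norm (classical_grad \<psi> x))\<^sup>2) \<partial>lborel)"
proof -
  define g where "g = classical_grad \<psi>"
  have gc: "continuous_on A g" for A unfolding g_def by (rule classical_grad_continuous[OF \<psi>])
  have gm [measurable]: "g \<in> borel_measurable borel" by (intro borel_measurable_continuous_onI gc)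
  define G where "G x = ennreal ((norm (g x))\<^sup>2)" for x
  have Gm [measurable]: "G \<in> borel_measurable borel" unfolding G_def by measurable
  have pw: "ennreal ((\<psi> (x + y) - \<psi> x)\<^sup>2) \<le>
      (\<integral>\<^sup>+\<tau>. indicator {0..1} \<tau> * (ennreal ((norm y)\<^sup>2) * G (x + \<tau> *\<^sub>R y)) \<partial>lborel)" for x
  proof -
    define k where "k \<tau> = g (x + \<tau> *\<^sub>R y) \<bullet> y" for \<tau> :: real
    have kc: "continuous_on A k" for A
      unfolding k_def by (intro continuous_intros continuous_on_compose2[OF gc[of UNIV]]) auto
    have D: "((\<lambda>r. \<psi> (x + r *\<^sub>R y)) has_real_derivative k r) (at r)" for r
    proof -
      have "((\<lambda>r. \<psi> (x + r *\<^sub>R y)) has_derivative (\<lambda>h. frechet_derivative \<psi> (at (x + r *\<^sub>R y)) (h *\<^sub>R y))) (at r)"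
        by (rule has_derivative_compose[OF _ test_functionD(1)[OF \<psi>]]) (auto intro!: derivative_eq_intros)
      moreover have "(\<lambda>h. frechet_derivative \<psi> (at (x + r *\<^sub>R y)) (h *\<^sub>R y)) = (*) (k r)"
        by (simp add: fun_eq_iff k_def g_def classical_grad_inner[OF \<psi>, symmetric])
      ultimately show ?thesis by (simp add: has_field_derivative_def)
    qed
    have kb: "k \<in> borel_measurable borel" by (intro borel_measurable_continuous_onI kc)
    have "(LINT r|lborel. k r * indicator {0..1} r) = \<psi> (x + 1 *\<^sub>R y) - \<psi> (x + 0 *\<^sub>R y)"
      by (rule integral_FTC_Icc_real) (use D kc[of UNIV] in \<open>auto simp: continuous_on_eq_continuous_at\<close>)
    moreover have "(\<lambda>r. indicator {0..1} r * (k r * indicator {0..1} r)) = (\<lambda>r. k r * indicator {0..1} r)"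
      by (auto simp: fun_eq_iff indicator_def)
    ultimately have eq: "\<psi> (x + y) - \<psi> x = (LINT r|lborel. indicator {0..1} r * (k r * indicator {0..1} r))"
      by simp
    have i1: "integrable lborel (\<lambda>r::real. (indicator {0..1} r :: real)\<^sup>2)"
      by (simp add: power2_eq_square flip: indicator_inter_arith)
    have "integrable lborel (\<lambda>r. indicator {0..1} r *\<^sub>R (k r)\<^sup>2)"
      by (rule borel_integrable_compact) (auto intro!: continuous_on_power kc)
    then have i2: "integrable lborel (\<lambda>r. (k r * indicator {0..1} r)\<^sup>2)"
      by (rule Bochner_Integration.integrable_cong[THEN iffD1, rotated -1]) (auto simp: indicator_def)
    have "(\<psi> (x + y) - \<psi> x)\<^sup>2 \<le> (sqrt (LINT r|(lborel :: real measure). (indicator {0..1} r)\<^sup>2) * sqrt (LINT r|lborel. (k r * indicator {0..1} r)\<^sup>2))\<^sup>2"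
      unfolding eq power2_abs[symmetric, of "LINT r|lborel. indicator {0..1} r * (k r * indicator {0..1} r)"]
      using Cauchy_Schwarz_integral(3)[OF _ i1 _ i2] kb by (intro power_mono) auto
    also have "\<dots> = (LINT r|lborel. (k r * indicator {0..1} r)\<^sup>2)"
      by (simp add: power_mult_distrib power2_eq_square[of "indicator _ _"] flip: indicator_inter_arith)
    finally have "ennreal ((\<psi> (x + y) - \<psi> x)\<^sup>2) \<le> ennreal (LINT r|lborel. (k r * indicator {0..1} r)\<^sup>2)"
      by (rule ennreal_leI)
    also have "\<dots> = (\<integral>\<^sup>+r. ennreal ((k r * indicator {0..1} r)\<^sup>2) \<partial>lborel)"
      by (rule nn_integral_eq_integral[OF i2, symmetric]) simp
    also have "\<dots> \<le> (\<integral>\<^sup>+\<tau>. indicator {0..1} \<tau> * (ennreal ((norm y)\<^sup>2) * G (x + \<tau> *\<^sub>R y)) \<partial>lborel)"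
    proof (rule nn_integral_mono)
      fix r :: real
      have "\<bar>k r\<bar> \<le> norm y * norm (g (x + r *\<^sub>R y))"
        unfolding k_def using Cauchy_Schwarz_ineq2[of "g (x + r *\<^sub>R y)" y] by (simp add: mult.commute)
      then have "(k r)\<^sup>2 \<le> (norm y * norm (g (x + r *\<^sub>R y)))\<^sup>2"
        by (metis abs_ge_zero power2_abs power_mono)
      then show "ennreal ((k r * indicator {0..1} r)\<^sup>2) \<le> indicator {0..1} r * (ennreal ((norm y)\<^sup>2) * G (x + r *\<^sub>R y))"
        by (auto simp: G_def indicator_def power_mult_distrib ennreal_mult[symmetric] intro!: ennreal_leI)
    qed
    finally show ?thesis .
  qed
  have "(\<integral>\<^sup>+x. ennreal ((\<psi> (x + y) - \<psi> x)\<^sup>2) \<partial>lborel) \<le>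
    (\<integral>\<^sup>+x. (\<integral>\<^sup>+\<tau>. indicator {0..1} \<tau> * (ennreal ((norm y)\<^sup>2) * G (x + \<tau> *\<^sub>R y)) \<partial>lborel) \<partial>lborel)"
    by (intro nn_integral_mono pw)
  also have "\<dots> = (\<integral>\<^sup>+\<tau>. (\<integral>\<^sup>+x. indicator {0..1} \<tau> * (ennreal ((norm y)\<^sup>2) * G (x + \<tau> *\<^sub>R y)) \<partial>lborel) \<partial>lborel)"
    by (rule lborel_pair.Fubini'[symmetric]) measurable
  also have "\<dots> = (\<integral>\<^sup>+\<tau>. indicator {0..1} \<tau> * (ennreal ((norm y)\<^sup>2) * (\<integral>\<^sup>+x. G x \<partial>lborel)) \<partial>(lborel :: real measure))"
    by (intro nn_integral_cong) (simp add: nn_integral_cmult nn_integral_lborel_translation)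
  also have "\<dots> = ennreal ((norm y)\<^sup>2) * (\<integral>\<^sup>+x. G x \<partial>lborel)"
    by (simp add: nn_integral_multc)
  finally show ?thesis by (simp add: G_def g_def)
qed

text \<open>For \<open>y\<close> in a cube \<open>Q\<close> of side \<open>\<rho>\<close>, \<open>(\<psi> x)\<^sup>2\<close> is at most
  \<open>2 (\<psi> (x + y) - \<psi> x)\<^sup>2 + 2 (\<psi> (x + y))\<^sup>2\<close>. Averaging over \<open>y\<close> bounds the second term by
  \<open>2 B / |Q|\<close> at every point \<open>x\<close>, while the integral over \<open>x\<close> of the first is of order
  \<open>\<rho>\<^sup>2\<close> by the translation estimate.\<close>

lemma test_function_local_mass:
  fixes \<psi> :: "'a::euclidean_space \<Rightarrow> real"
  assumes \<psi>: "\<psi> \<in> test_functions \<Omega>" and \<rho>: "\<rho> > 0" and E: "E \<in> sets lebesgue"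
  defines "A \<equiv> (\<integral>\<^sup>+x. ennreal ((norm (classical_grad \<psi> x))\<^sup>2) \<partial>lborel)"
    and "B \<equiv> (\<integral>\<^sup>+x. ennreal ((\<psi> x)\<^sup>2) \<partial>lborel)"
    and "d \<equiv> real DIM('a)"
  shows "ennreal (\<rho> ^ DIM('a)) * (\<integral>\<^sup>+x. indicator E x * ennreal ((\<psi> x)\<^sup>2) \<partial>lebesgue) \<le>
    2 * (ennreal (\<rho> ^ DIM('a)) * (ennreal (d * \<rho>\<^sup>2) * A)) + 2 * B * emeasure lebesgue E"
proof -
  define Q where "Q = cbox (0::'a) (\<rho> *\<^sub>R One)"
  have Qm [measurable]: "Q \<in> sets borel" by (simp add: Q_def)
  have Qe: "emeasure lborel Q = ennreal (\<rho> ^ DIM('a))"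
    using \<rho> by (simp add: Q_def emeasure_lborel_cbox)
  have Qn: "(norm y)\<^sup>2 \<le> d * \<rho>\<^sup>2" if "y \<in> Q" for y
  proof -
    have "(norm y)\<^sup>2 = (\<Sum>i\<in>Basis. (y \<bullet> i)\<^sup>2)"
      by (simp add: norm_eq_sqrt_inner euclidean_inner[of y y] power2_eq_square sum_nonneg)
    also have "\<dots> \<le> (\<Sum>i\<in>(Basis::'a set). \<rho>\<^sup>2)"
      using that by (intro sum_mono power_mono) (auto simp: Q_def mem_box)
    finally show ?thesis by (simp add: d_def)
  qed
  have \<psi>m [measurable]: "\<psi> \<in> borel_measurable borel" by (intro borel_measurable_continuous_onI test_functionD(2)[OF \<psi>])
  define K where "K x = (\<integral>\<^sup>+y. indicator Q y * ennreal ((\<psi> (x + y) - \<psi> x)\<^sup>2) \<partial>lborel)" for x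
  have Km [measurable]: "K \<in> borel_measurable borel" unfolding K_def by measurable
  have pw: "ennreal (\<rho> ^ DIM('a)) * ennreal ((\<psi> x)\<^sup>2) \<le> 2 * K x + 2 * B" for x
  proof -
    have "ennreal (\<rho> ^ DIM('a)) * ennreal ((\<psi> x)\<^sup>2) = (\<integral>\<^sup>+y. indicator Q y * ennreal ((\<psi> x)\<^sup>2) \<partial>lborel)"
      by (simp add: nn_integral_multc Qe)
    also have "\<dots> \<le> (\<integral>\<^sup>+y. 2 * (indicator Q y * ennreal ((\<psi> (x + y) - \<psi> x)\<^sup>2)) + 2 * ennreal ((\<psi> (y + x))\<^sup>2) \<partial>lborel)"
    proof (rule nn_integral_mono)
      fix y
      have "(\<psi> x)\<^sup>2 \<le> 2 * (\<psi> (x + y) - \<psi> x)\<^sup>2 + 2 * (\<psi> (y + x))\<^sup>2"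
        using zero_le_power2[of "2 * \<psi> (x + y) - \<psi> x"] by (simp add: power2_eq_square algebra_simps)
      then have "ennreal ((\<psi> x)\<^sup>2) \<le> ennreal (2 * (\<psi> (x + y) - \<psi> x)\<^sup>2 + 2 * (\<psi> (y + x))\<^sup>2)"
        by (rule ennreal_leI)
      also have "\<dots> = 2 * ennreal ((\<psi> (x + y) - \<psi> x)\<^sup>2) + 2 * ennreal ((\<psi> (y + x))\<^sup>2)"
        by (simp add: ennreal_mult)
      finally show "indicator Q y * ennreal ((\<psi> x)\<^sup>2) \<le>
        2 * (indicator Q y * ennreal ((\<psi> (x + y) - \<psi> x)\<^sup>2)) + 2 * ennreal ((\<psi> (y + x))\<^sup>2)"
        by (auto simp: indicator_def)
    qed
    also have "\<dots> = 2 * K x + 2 * (\<integral>\<^sup>+y. ennreal ((\<psi> (y + x))\<^sup>2) \<partial>lborel)"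
      by (simp add: nn_integral_add nn_integral_cmult K_def)
    also have "(\<integral>\<^sup>+y. ennreal ((\<psi> (y + x))\<^sup>2) \<partial>lborel) = B"
      unfolding B_def by (rule nn_integral_lborel_translation) measurable
    finally show ?thesis .
  qed
  have Kint: "(\<integral>\<^sup>+x. K x \<partial>lborel) \<le> ennreal (\<rho> ^ DIM('a)) * (ennreal (d * \<rho>\<^sup>2) * A)"
  proof -
    have "(\<integral>\<^sup>+x. K x \<partial>lborel) = (\<integral>\<^sup>+y. (\<integral>\<^sup>+x. indicator Q y * ennreal ((\<psi> (x + y) - \<psi> x)\<^sup>2) \<partial>lborel) \<partial>lborel)"
      unfolding K_def by (rule lborel_pair.Fubini'[symmetric]) measurable
    also have "\<dots> = (\<integral>\<^sup>+y. indicator Q y * (\<integral>\<^sup>+x. ennreal ((\<psi> (x + y) - \<psi> x)\<^sup>2) \<partial>lborel) \<partial>lborel)"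
      by (simp add: nn_integral_cmult)
    also have "\<dots> \<le> (\<integral>\<^sup>+y. indicator Q y * (ennreal (d * \<rho>\<^sup>2) * A) \<partial>lborel)"
    proof (rule nn_integral_mono)
      fix y
      show "indicator Q y * (\<integral>\<^sup>+x. ennreal ((\<psi> (x + y) - \<psi> x)\<^sup>2) \<partial>lborel) \<le> indicator Q y * (ennreal (d * \<rho>\<^sup>2) * A)"
      proof (cases "y \<in> Q")
        case True
        have "(\<integral>\<^sup>+x. ennreal ((\<psi> (x + y) - \<psi> x)\<^sup>2) \<partial>lborel) \<le> ennreal ((norm y)\<^sup>2) * A"
          unfolding A_def by (rule test_function_translation[OF \<psi>])
        also have "\<dots> \<le> ennreal (d * \<rho>\<^sup>2) * A" by (intro mult_right_mono ennreal_leI Qn True) simp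
        finally show ?thesis using True by simp
      qed simp
    qed
    also have "\<dots> = ennreal (\<rho> ^ DIM('a)) * (ennreal (d * \<rho>\<^sup>2) * A)"
      by (simp add: nn_integral_multc Qe)
    finally show ?thesis .
  qed
  have Kl: "K \<in> borel_measurable lebesgue" by (rule measurable_completion) simp
  have \<psi>l: "(\<lambda>x. ennreal ((\<psi> x)\<^sup>2)) \<in> borel_measurable lebesgue" by (rule measurable_completion) simp
  have El: "(\<lambda>x. indicator E x :: ennreal) \<in> borel_measurable lebesgue" using E by (rule borel_measurable_indicator)
  have "ennreal (\<rho> ^ DIM('a)) * (\<integral>\<^sup>+x. indicator E x * ennreal ((\<psi> x)\<^sup>2) \<partial>lebesgue)
     = (\<integral>\<^sup>+x. ennreal (\<rho> ^ DIM('a)) * (indicator E x * ennreal ((\<psi> x)\<^sup>2)) \<partial>lebesgue)"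
    by (rule nn_integral_cmult[symmetric]) (intro borel_measurable_times_ennreal El \<psi>l)
  also have "\<dots> \<le> (\<integral>\<^sup>+x. 2 * K x + 2 * B * indicator E x \<partial>lebesgue)"
  proof (rule nn_integral_mono)
    fix x
    show "ennreal (\<rho> ^ DIM('a)) * (indicator E x * ennreal ((\<psi> x)\<^sup>2)) \<le> 2 * K x + 2 * B * indicator E x"
      using pw[of x] by (simp add: indicator_def)
  qed
  also have "\<dots> = 2 * (\<integral>\<^sup>+x. K x \<partial>lebesgue) + 2 * B * emeasure lebesgue E"
    by (subst nn_integral_add) (use Kl El E in \<open>auto simp: nn_integral_cmult intro!: borel_measurable_times_ennreal\<close>)
  also have "(\<integral>\<^sup>+x. K x \<partial>lebesgue) = (\<integral>\<^sup>+x. K x \<partial>lborel)" by (rule nn_integral_completion)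
  also have "2 * (\<integral>\<^sup>+x. K x \<partial>lborel) + 2 * B * emeasure lebesgue E \<le>
     2 * (ennreal (\<rho> ^ DIM('a)) * (ennreal (d * \<rho>\<^sup>2) * A)) + 2 * B * emeasure lebesgue E"
    by (intro add_right_mono mult_left_mono Kint) simp
  finally show ?thesis .
qed

lemma test_function_nn_integral:
  assumes \<Omega>: "open \<Omega>" and \<psi>: "\<psi> \<in> test_functions \<Omega>"
  shows "(\<integral>\<^sup>+x. ennreal ((\<psi> x)\<^sup>2) \<partial>lborel) = ennreal ((L2_norm \<Omega> \<psi>)\<^sup>2)"
    "(\<integral>\<^sup>+x. ennreal ((norm (classical_grad \<psi> x))\<^sup>2) \<partial>lborel) = ennreal ((L2_norm \<Omega> (\<lambda>x. norm (classical_grad \<psi> x)))\<^sup>2)"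
proof -
  have gen: "(\<integral>\<^sup>+x. ennreal (f x) \<partial>lborel) = ennreal (LINT x|lebesgue_on \<Omega>. f x)"
    if "integrable lborel f" "\<And>x. 0 \<le> f x" "\<And>x. x \<notin> \<Omega> \<Longrightarrow> f x = 0" for f :: "'a \<Rightarrow> real"
  proof -
    have "(LINT x|lebesgue_on \<Omega>. f x) = (LINT x|lebesgue. f x)"
      using \<Omega> that by (intro lebesgue_on_support) auto
    also have "\<dots> = (LINT x|lborel. f x)"
      by (rule integral_completion) (use that(1) in \<open>auto dest: borel_measurable_integrable\<close>)
    finally show ?thesis using nn_integral_eq_integral[OF that(1)] that(2) by simp
  qed
  show "(\<integral>\<^sup>+x. ennreal ((\<psi> x)\<^sup>2) \<partial>lborel) = ennreal ((L2_norm \<Omega> \<psi>)\<^sup>2)"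
    unfolding L2_norm_power2
    by (rule gen) (use test_function_square_integrable[OF \<psi>] test_functionD(4)[OF \<psi>] in auto)
  have sq: "(norm (classical_grad \<psi> x))\<^sup>2 = (\<Sum>i\<in>Basis. (frechet_derivative \<psi> (at x) i)\<^sup>2)" for x
    unfolding power2_norm_eq_inner
    by (subst euclidean_inner) (simp add: classical_grad_inner[OF \<psi>] power2_eq_square)
  show "(\<integral>\<^sup>+x. ennreal ((norm (classical_grad \<psi> x))\<^sup>2) \<partial>lborel) = ennreal ((L2_norm \<Omega> (\<lambda>x. norm (classical_grad \<psi> x)))\<^sup>2)"
    unfolding L2_norm_power2 sq
    by (rule gen) (use test_function_square_integrable(1)[OF test_functionD(6)[OF \<psi>]]
        test_functionD(4)[OF test_functionD(6)[OF \<psi>]] in \<open>auto intro!: sum_nonneg\<close>)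
qed

text \<open>The squares of the functions in the unit ball of \<open>H\<^sup>1\<^sub>0\<close> are uniformly integrable. The side
  \<open>\<rho>\<close> of the cube over which functions are averaged is chosen first, to make the gradient term
  small; then \<open>\<delta>\<close> is chosen small against the volume of the cube. This takes the place of the
  Sobolev inequality.\<close>

lemma H10_uniformly_integrable:
  fixes \<Omega> :: "'a::euclidean_space set"
  assumes \<Omega>: "open \<Omega>" and \<epsilon>: "\<epsilon> > 0"
  obtains \<delta> where "\<delta> > 0" "\<And>z E. z \<in> H10 \<Omega> \<Longrightarrow> E \<in> sets lebesgue \<Longrightarrow> emeasure lebesgue E \<le> ennreal \<delta> \<Longrightarrow>
      L2_norm \<Omega> (\<lambda>x. indicator E x * z x) \<le> \<epsilon> * H1_norm \<Omega> z"
proof -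
  define d where "d = real DIM('a)"
  have d: "d > 0" by (simp add: d_def)
  define \<rho> where "\<rho> = \<epsilon> / (2 * sqrt d)"
  have \<rho>: "\<rho> > 0" using \<epsilon> d by (simp add: \<rho>_def)
  have \<rho>d: "2 * (d * \<rho>\<^sup>2) = \<epsilon>\<^sup>2 / 2" using d by (simp add: \<rho>_def power_divide power_mult_distrib)
  define R where "R = \<rho> ^ DIM('a)"
  have R: "R > 0" using \<rho> by (simp add: R_def)
  define \<delta> where "\<delta> = R * \<epsilon>\<^sup>2 / 4"
  have \<delta>: "\<delta> > 0" using R \<epsilon> by (simp add: \<delta>_def)
  interpret H10: seminorm_space "H10 \<Omega>" "H1_norm \<Omega>" by (rule H10_seminorm_space[OF \<Omega>])
  have indL: "(\<lambda>x. indicator E x * f x) \<in> L2 \<Omega>" "L2_norm \<Omega> (\<lambda>x. indicator E x * f x) \<le> L2_norm \<Omega> f"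
    if E: "E \<in> sets lebesgue" and f: "f \<in> L2 \<Omega>" for E f
  proof -
    have m: "(\<lambda>x. indicator E x * f x) \<in> borel_measurable (lebesgue_on \<Omega>)"
      by (intro borel_measurable_times L2D(1)[OF f] measurable_restrict_space1 borel_measurable_indicator E)
    show "(\<lambda>x. indicator E x * f x) \<in> L2 \<Omega>" "L2_norm \<Omega> (\<lambda>x. indicator E x * f x) \<le> L2_norm \<Omega> f"
      by (rule L2_mono[OF f m], simp add: indicator_def)+
  qed
  have test: "L2_norm \<Omega> (\<lambda>x. indicator E x * \<psi> x) \<le> \<epsilon> * H1_norm \<Omega> \<psi>"
    if \<psi>: "\<psi> \<in> test_functions \<Omega>" and E: "E \<in> sets lebesgue" and le: "emeasure lebesgue E \<le> ennreal \<delta>" for \<psi> E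
  proof -
    define a where "a = (L2_norm \<Omega> (\<lambda>x. norm (classical_grad \<psi> x)))\<^sup>2"
    define b where "b = (L2_norm \<Omega> \<psi>)\<^sup>2"
    define c where "c = (L2_norm \<Omega> (\<lambda>x. indicator E x * \<psi> x))\<^sup>2"
    have nn: "a \<ge> 0" "b \<ge> 0" "c \<ge> 0" by (simp_all add: a_def b_def c_def)
    have iE: "(\<lambda>x. indicator E x * \<psi> x) \<in> L2 \<Omega>" by (rule indL(1)[OF E test_function_L2[OF \<psi> \<Omega>]])
    have c_eq: "(\<integral>\<^sup>+x. indicator E x * ennreal ((\<psi> x)\<^sup>2) \<partial>lebesgue) = ennreal c"
    proof -
      have sqeq: "(indicator E x * \<psi> x)\<^sup>2 = indicator E x * (\<psi> x)\<^sup>2" for x by (simp add: indicator_def)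
      have i: "integrable lebesgue (\<lambda>x. (indicator E x * \<psi> x)\<^sup>2)"
        using L2D(2)[OF iE] \<Omega> test_functionD(4)[OF \<psi>] by (subst lebesgue_on_support(1)[symmetric]) auto
      have "c = (LINT x|lebesgue. (indicator E x * \<psi> x)\<^sup>2)"
        unfolding c_def L2_norm_power2 using \<Omega> test_functionD(4)[OF \<psi>] by (subst lebesgue_on_support(2)) auto
      then have "ennreal c = (\<integral>\<^sup>+x. ennreal ((indicator E x * \<psi> x)\<^sup>2) \<partial>lebesgue)"
        using nn_integral_eq_integral[OF i] by simp
      also have "\<dots> = (\<integral>\<^sup>+x. indicator E x * ennreal ((\<psi> x)\<^sup>2) \<partial>lebesgue)"
        by (intro nn_integral_cong) (simp add: indicator_def)
      finally show ?thesis by simp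
    qed
    have "ennreal (R * c) \<le> 2 * (ennreal R * (ennreal (d * \<rho>\<^sup>2) * ennreal a)) + 2 * ennreal b * emeasure lebesgue E"
      using test_function_local_mass[OF \<psi> \<rho> E] R
      by (simp add: c_eq test_function_nn_integral[OF \<Omega> \<psi>] a_def[symmetric] b_def[symmetric] R_def[symmetric] d_def[symmetric] ennreal_mult' nn)
    also have "\<dots> \<le> 2 * (ennreal R * (ennreal (d * \<rho>\<^sup>2) * ennreal a)) + 2 * ennreal b * ennreal \<delta>"
      by (intro add_left_mono mult_left_mono le) simp
    also have "\<dots> = ennreal (2 * (R * (d * \<rho>\<^sup>2 * a)) + 2 * b * \<delta>)"
      using nn R d \<delta> by (simp add: ennreal_mult ennreal_plus)
    finally have "R * c \<le> 2 * (R * (d * \<rho>\<^sup>2 * a)) + 2 * b * \<delta>"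
      using nn R d \<delta> by (subst (asm) ennreal_le_iff) auto
    also have "\<dots> = R * (2 * (d * \<rho>\<^sup>2) * a + \<epsilon>\<^sup>2 / 2 * b)" by (simp add: \<delta>_def algebra_simps)
    finally have "c \<le> \<epsilon>\<^sup>2 / 2 * a + \<epsilon>\<^sup>2 / 2 * b" using R by (simp add: \<rho>d)
    also have "\<dots> \<le> \<epsilon>\<^sup>2 * (b + a)"
      using mult_nonneg_nonneg[OF zero_le_power2[of \<epsilon>] nn(1)] mult_nonneg_nonneg[OF zero_le_power2[of \<epsilon>] nn(2)]
      by (simp add: algebra_simps)
    finally have "sqrt c \<le> sqrt (\<epsilon>\<^sup>2 * (b + a))" by (rule real_sqrt_le_mono)
    also have "\<dots> = \<epsilon> * H1_norm \<Omega> \<psi>"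
      using \<epsilon> by (simp add: H1_norm_eq[OF \<Omega> classical_grad_is_L2_gradient[OF \<Omega> \<psi>]] a_def b_def real_sqrt_mult)
    finally show ?thesis by (simp add: c_def L2_norm_nonneg)
  qed
  show ?thesis
  proof (rule that[OF \<delta>])
    fix z :: "'a \<Rightarrow> real" and E :: "'a set" assume z: "z \<in> H10 \<Omega>" and E: "E \<in> sets lebesgue" "emeasure lebesgue E \<le> ennreal \<delta>"
    have zL: "z \<in> L2 \<Omega>" by (rule H10D(1)[OF z])
    show "L2_norm \<Omega> (\<lambda>x. indicator E x * z x) \<le> \<epsilon> * H1_norm \<Omega> z"
    proof (rule field_le_epsilon)
      fix e :: real assume e: "e > 0"
      define \<eta> where "\<eta> = e / (1 + \<epsilon>)"
      have \<eta>: "\<eta> > 0" using e \<epsilon> by (simp add: \<eta>_def)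
      obtain \<psi> where \<psi>: "\<psi> \<in> test_functions \<Omega>" "H1_norm \<Omega> (z - \<psi>) < \<eta>"
        using z \<eta> unfolding H10_def by blast
      have \<psi>L: "\<psi> \<in> L2 \<Omega>" by (rule test_function_L2[OF \<psi>(1) \<Omega>])
      have \<psi>H: "\<psi> \<in> H10 \<Omega>"
      proof -
        have "\<psi> \<in> H1 \<Omega>" using \<psi>L classical_grad_is_L2_gradient[OF \<Omega> \<psi>(1)] by (auto simp: H1_def)
        moreover have "H1_norm \<Omega> (\<psi> - \<psi>) = 0" using H10.N_zero by simp
        ultimately show ?thesis using \<psi>(1) by (auto simp: H10_def intro!: bexI[of _ \<psi>])
      qed
      have dL: "(\<lambda>x. z x - \<psi> x) \<in> L2 \<Omega>" using L2.diff_mem[OF zL \<psi>L] by (simp add: fun_diff_def)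
      have "L2_norm \<Omega> (\<lambda>x. indicator E x * z x) = L2_norm \<Omega> (\<lambda>x. indicator E x * \<psi> x + indicator E x * (z x - \<psi> x))"
        by (simp add: algebra_simps)
      also have "\<dots> \<le> L2_norm \<Omega> (\<lambda>x. indicator E x * \<psi> x) + L2_norm \<Omega> (\<lambda>x. indicator E x * (z x - \<psi> x))"
        by (intro L2_norm_triangle indL E \<psi>L dL)
      also have "\<dots> \<le> \<epsilon> * H1_norm \<Omega> \<psi> + L2_norm \<Omega> (z - \<psi>)"
        using indL(2)[OF E(1) dL] by (intro add_mono test \<psi> E) (simp add: fun_diff_def)
      also have "\<dots> \<le> \<epsilon> * (H1_norm \<Omega> z + \<eta>) + \<eta>"
      proof (intro add_mono mult_left_mono)
        show "H1_norm \<Omega> \<psi> \<le> H1_norm \<Omega> z + \<eta>" using H10.N_reverse[OF z \<psi>H] \<psi>(2) by simp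
        show "L2_norm \<Omega> (z - \<psi>) \<le> \<eta>" using L2_norm_le_H1_norm[of \<Omega> "z - \<psi>"] \<psi>(2) by simp
      qed (use \<epsilon> in simp)
      also have "\<dots> = \<epsilon> * H1_norm \<Omega> z + (1 + \<epsilon>) * \<eta>" by (simp add: algebra_simps)
      also have "(1 + \<epsilon>) * \<eta> = e" using \<epsilon> by (simp add: \<eta>_def)
      finally show "L2_norm \<Omega> (\<lambda>x. indicator E x * z x) \<le> \<epsilon> * H1_norm \<Omega> z + e" .
    qed
  qed
qed

section \<open>Means in time\<close>

definition mean_shift :: "real \<Rightarrow> (real \<Rightarrow> real) \<Rightarrow> real \<Rightarrow> real"
  where "mean_shift h k t = (LINT \<theta>|lborel. indicator {0<..<1} \<theta> * k (t + \<theta> * h))"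

lemma mean_shift_eq:
  assumes "h \<noteq> 0"
  shows "mean_shift h k t = inverse \<bar>h\<bar> * (LINT r|lborel. indicator {min t (t + h)<..<max t (t + h)} r * k r)"
proof -
  have "(LINT r|lborel. indicator {min t (t + h)<..<max t (t + h)} r * k r) =
    \<bar>h\<bar> *\<^sub>R (LINT \<theta>|lborel. indicator {min t (t + h)<..<max t (t + h)} (t + h * \<theta>) * k (t + h * \<theta>))"
    by (rule lborel_integral_real_affine[OF assms])
  also have "(LINT \<theta>|lborel. indicator {min t (t + h)<..<max t (t + h)} (t + h * \<theta>) * k (t + h * \<theta>)) = mean_shift h k t"
    unfolding mean_shift_def
  proof (intro Bochner_Integration.integral_cong refl)
    fix \<theta> :: real
    have "t + h * \<theta> \<in> {min t (t + h)<..<max t (t + h)} \<longleftrightarrow> \<theta> \<in> {0<..<1}"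
    proof (cases "h > 0")
      case True
      then have "t + h * \<theta> < t + h \<longleftrightarrow> \<theta> < 1" by simp
      then show ?thesis using True by (simp add: min_def max_def zero_less_mult_iff)
    next
      case False
      then have "h < 0" using assms by simp
      moreover from this have "h < h * \<theta> \<longleftrightarrow> \<theta> < 1" using mult_less_cancel_left_neg[of h 1 \<theta>] by simp
      ultimately show ?thesis by (auto simp: min_def max_def mult_less_0_iff)
    qed
    then show "indicator {min t (t + h)<..<max t (t + h)} (t + h * \<theta>) * k (t + h * \<theta>) = indicator {0<..<1} \<theta> * k (t + \<theta> * h)"
      by (simp add: indicator_def mult.commute)
  qed
  finally show ?thesis using assms by simp
qed

text \<open>Lebesgue's differentiation theorem, for intervals to the right of the point; a reflection turns
  intervals to the left into intervals to the right.\<close>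

lemma mean_shift_AE_tendsto:
  assumes a: "integrable lborel a"
  shows "AE t in lborel. ((\<lambda>h. mean_shift h a t) \<longlongrightarrow> a t) (at 0)"
proof -
  have right: "\<exists>N. negligible N \<and> (\<forall>t. t \<notin> N \<longrightarrow> (\<forall>e>0. \<exists>d>0. \<forall>h. 0 < h \<and> h < d \<longrightarrow> \<bar>mean_shift h b t - b t\<bar> < e))"
    if b: "integrable lborel b" for b
  proof -
    have bi: "set_integrable lborel S b" if "S \<in> sets borel" for S
      using b that unfolding set_integrable_def by (intro integrable_mult_indicator) auto
    have "b integrable_on cbox x y" for x y
      using set_borel_integral_eq_integral(1)[OF bi[of "cbox x y"]] by simp
    then obtain N where N: "negligible N" "\<And>x e. x \<notin> N \<Longrightarrow> 0 < e \<Longrightarrow> \<exists>d>0. \<forall>h. 0 < h \<and> h < d \<longrightarrow>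
        norm (integral (cbox x (x + h *\<^sub>R One)) b /\<^sub>R h ^ DIM(real) - b x) < e"
      using integrable_ccontinuous_explicit[of b] by metis
    have "integral (cbox x (x + h *\<^sub>R One)) b /\<^sub>R h ^ DIM(real) = mean_shift h b x" if h: "h > 0" for x h
    proof -
      have "integral (cbox x (x + h *\<^sub>R One)) b = integral {x<..<x + h} b"
        using integral_open_interval[of x "x + h" b] by (simp add: box_real)
      also have "\<dots> = (LINT r:{x<..<x + h}|lborel. b r)"
        using set_borel_integral_eq_integral(2)[OF bi[of "{x<..<x + h}"]] by simp
      finally show ?thesis
        using mean_shift_eq[of h b x] h by (simp add: set_lebesgue_integral_def min_def max_def)
    qed
    then show ?thesis using N by (intro exI[of _ N]) (auto simp: simp del: scaleR_conv_of_real)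
  qed
  obtain N where N: "negligible N" "\<And>t e. t \<notin> N \<Longrightarrow> e > 0 \<Longrightarrow> \<exists>d>0. \<forall>h. 0 < h \<and> h < d \<longrightarrow> \<bar>mean_shift h a t - a t\<bar> < e"
    using right[OF a] by metis
  have "integrable lborel (\<lambda>x. a (- x))"
    using lborel_integrable_real_affine[OF a, of "-1" 0] by simp
  then obtain M where M: "negligible M" "\<And>t e. t \<notin> M \<Longrightarrow> e > 0 \<Longrightarrow> \<exists>d>0. \<forall>h. 0 < h \<and> h < d \<longrightarrow> \<bar>mean_shift h (\<lambda>x. a (- x)) t - a (- t)\<bar> < e"
    using right[of "\<lambda>x. a (- x)"] by metis
  have "M \<in> null_sets (distr lebesgue lebesgue uminus)"
    using M(1) by (simp add: lebesgue_uminus negligible_iff_null_sets)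
  then have "uminus -` M \<in> null_sets lebesgue"
    by (subst (asm) null_sets_distr_iff[OF uminus_lebesgue_measurable]) simp
  then have "N \<union> uminus -` M \<in> null_sets lebesgue"
    using N(1) by (intro null_sets.Un) (simp_all add: negligible_iff_null_sets)
  then have "AE t in lebesgue. t \<notin> N \<union> uminus -` M" by (rule AE_not_in)
  then have "AE t in lborel. t \<notin> N \<union> uminus -` M"
    by (simp add: AE_completion_iff)
  then show ?thesis
  proof eventually_elim
    case (elim t)
    then have tN: "t \<notin> N" and tM: "- t \<notin> M" by auto
    show ?case
    proof (rule tendstoI)
      fix e :: real assume e: "e > 0"
      obtain d1 where d1: "d1 > 0" "\<And>h. 0 < h \<Longrightarrow> h < d1 \<Longrightarrow> \<bar>mean_shift h a t - a t\<bar> < e" using N(2)[OF tN e] by auto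
      obtain d2 where d2: "d2 > 0" "\<And>h. 0 < h \<Longrightarrow> h < d2 \<Longrightarrow> \<bar>mean_shift h (\<lambda>x. a (- x)) (- t) - a t\<bar> < e" using M(2)[OF tM e] by auto
      have refl: "mean_shift (- h) (\<lambda>x. a (- x)) (- t) = mean_shift h a t" for h
        by (simp add: mean_shift_def add.commute)
      have "dist (mean_shift h a t) (a t) < e" if "h \<noteq> 0" "dist h 0 < min d1 d2" for h
        using d1(2)[of h] d2(2)[of "- h"] that refl[of h] by (cases "h > 0") (auto simp: dist_real_def)
      then show "\<forall>\<^sub>F h in at 0. dist (mean_shift h a t) (a t) < e"
        unfolding eventually_at using d1(1) d2(1) by (intro exI[of _ "min d1 d2"]) auto
    qed
  qed
qed

lemma integrable_pairI:
  fixes f :: "real \<Rightarrow> real \<Rightarrow> real"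
  assumes m: "case_prod f \<in> borel_measurable (borel \<Otimes>\<^sub>M borel)"
    and fin: "(\<integral>\<^sup>+y. (\<integral>\<^sup>+x. ennreal \<bar>f x y\<bar> \<partial>lborel) \<partial>lborel) < \<infinity>"
  shows "integrable (lborel \<Otimes>\<^sub>M lborel) (case_prod f)"
proof (rule integrableI_bounded)
  show m': "case_prod f \<in> borel_measurable (lborel \<Otimes>\<^sub>M lborel)"
    using m by (simp cong: measurable_cong_sets sets_pair_measure_cong)
  have "(\<integral>\<^sup>+p. ennreal (norm (case_prod f p)) \<partial>(lborel \<Otimes>\<^sub>M lborel)) =
    (\<integral>\<^sup>+y. (\<integral>\<^sup>+x. ennreal (norm (case_prod f (x, y))) \<partial>lborel) \<partial>lborel)"
    by (rule lborel_pair.nn_integral_snd[symmetric]) (use m' in measurable)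
  then show "(\<integral>\<^sup>+p. ennreal (norm (case_prod f p)) \<partial>(lborel \<Otimes>\<^sub>M lborel)) < \<infinity>"
    using fin by simp
qed

lemma mean_shift_measurable [measurable]:
  assumes [measurable]: "k \<in> borel_measurable borel"
  shows "mean_shift h k \<in> borel_measurable borel"
  unfolding mean_shift_def by measurable

lemma nn_integral_unit_interval: "(\<integral>\<^sup>+\<theta>. indicator {0<..<1::real} \<theta> * c \<partial>lborel) = c"
  by (simp add: nn_integral_multc)

text \<open>By Fubini and a translation the mean can be moved from \<open>k\<close> to the bounded function \<open>a\<close>, where
  Lebesgue's differentiation theorem and dominated convergence apply.\<close>

lemma mean_shift_weak_limit:
  fixes a k :: "real \<Rightarrow> real"
  assumes a [measurable]: "a \<in> borel_measurable borel" and a_bnd: "\<And>t. \<bar>a t\<bar> \<le> indicator {\<alpha><..<\<beta>} t"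
    and k: "integrable lborel k" and h: "h \<longlonglongrightarrow> 0" "\<And>n. h n \<noteq> 0"
  shows "(\<lambda>n. LINT t|lborel. a t * indicator {\<alpha><..<\<beta>} (t + h n) * mean_shift (h n) k t) \<longlonglongrightarrow> (LINT t|lborel. a t * k t)"
    "integrable lborel (\<lambda>t. a t * indicator {\<alpha><..<\<beta>} (t + h n) * mean_shift (h n) k t)"
proof -
  have km [measurable]: "k \<in> borel_measurable borel" using k by (simp add: borel_measurable_integrable)
  define J where "J = {\<alpha><..<\<beta>}"
  have Jm [measurable]: "J \<in> sets borel" by (simp add: J_def)
  have a1: "\<bar>a t\<bar> \<le> 1" and a0: "t \<notin> J \<Longrightarrow> a t = 0" for t
    using a_bnd[of t] by (cases "t \<in> {\<alpha><..<\<beta>}"; simp add: J_def)+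
  have kfin: "(\<integral>\<^sup>+x. ennreal \<bar>k x\<bar> \<partial>lborel) < \<infinity>" using k by (simp add: integrable_iff_bounded)
  define c where "c n s = (LINT \<theta>|lborel. indicator {0<..<1} \<theta> * (a (s - \<theta> * h n) * indicator J (s + (1 - \<theta>) * h n)))" for n s
  have cm [measurable]: "c n \<in> borel_measurable borel" for n unfolding c_def by measurable
  have int1: "integrable (lborel \<Otimes>\<^sub>M lborel) (\<lambda>(t, \<theta>). a t * indicator J (t + h n) * (indicator {0<..<1} \<theta> * k (t + \<theta> * h n)))" for n
  proof (rule integrable_pairI)
    have "(\<integral>\<^sup>+\<theta>. (\<integral>\<^sup>+t. ennreal \<bar>a t * indicator J (t + h n) * (indicator {0<..<1} \<theta> * k (t + \<theta> * h n))\<bar> \<partial>lborel) \<partial>lborel)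
      \<le> (\<integral>\<^sup>+\<theta>. (\<integral>\<^sup>+t. indicator {0<..<1} \<theta> * ennreal \<bar>k (t + \<theta> * h n)\<bar> \<partial>lborel) \<partial>lborel)"
    proof (intro nn_integral_mono)
      fix \<theta> t :: real
      have "\<bar>a t * indicator J (t + h n)\<bar> * \<bar>indicator {0<..<1} \<theta> * k (t + \<theta> * h n)\<bar> \<le> 1 * \<bar>indicator {0<..<1} \<theta> * k (t + \<theta> * h n)\<bar>"
        using a1[of t] by (intro mult_right_mono) (auto simp: indicator_def)
      then show "ennreal \<bar>a t * indicator J (t + h n) * (indicator {0<..<1} \<theta> * k (t + \<theta> * h n))\<bar>
         \<le> indicator {0<..<1} \<theta> * ennreal \<bar>k (t + \<theta> * h n)\<bar>"
        by (auto simp: abs_mult indicator_def intro!: ennreal_leI)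
    qed
    also have "\<dots> = (\<integral>\<^sup>+x. ennreal \<bar>k x\<bar> \<partial>lborel)"
      by (simp add: nn_integral_cmult nn_integral_lborel_translation[of "\<lambda>x. ennreal \<bar>k x\<bar>"] nn_integral_unit_interval)
    finally show "(\<integral>\<^sup>+\<theta>. (\<integral>\<^sup>+t. ennreal \<bar>a t * indicator J (t + h n) * (indicator {0<..<1} \<theta> * k (t + \<theta> * h n))\<bar> \<partial>lborel) \<partial>lborel) < \<infinity>"
      using kfin by (rule order.strict_trans1)
  qed measurable
  have int2: "integrable (lborel \<Otimes>\<^sub>M lborel) (\<lambda>(s, \<theta>). indicator {0<..<1} \<theta> * (a (s - \<theta> * h n) * indicator J (s + (1 - \<theta>) * h n)) * k s)" for n
  proof (rule integrable_pairI)
    have "(\<integral>\<^sup>+\<theta>. (\<integral>\<^sup>+s. ennreal \<bar>indicator {0<..<1} \<theta> * (a (s - \<theta> * h n) * indicator J (s + (1 - \<theta>) * h n)) * k s\<bar> \<partial>lborel) \<partial>lborel)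
      \<le> (\<integral>\<^sup>+\<theta>. (\<integral>\<^sup>+s. indicator {0<..<1::real} \<theta> * ennreal \<bar>k s\<bar> \<partial>lborel) \<partial>lborel)"
    proof (intro nn_integral_mono)
      fix \<theta> s :: real
      have "\<bar>a (s - \<theta> * h n) * indicator J (s + (1 - \<theta>) * h n)\<bar> * \<bar>k s\<bar> \<le> 1 * \<bar>k s\<bar>"
        using a1[of "s - \<theta> * h n"] by (intro mult_right_mono) (auto simp: indicator_def)
      then show "ennreal \<bar>indicator {0<..<1} \<theta> * (a (s - \<theta> * h n) * indicator J (s + (1 - \<theta>) * h n)) * k s\<bar>
        \<le> indicator {0<..<1} \<theta> * ennreal \<bar>k s\<bar>"
        by (auto simp: abs_mult indicator_def intro!: ennreal_leI)
    qed
    also have "\<dots> = (\<integral>\<^sup>+x. ennreal \<bar>k x\<bar> \<partial>lborel)"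
      by (simp add: nn_integral_cmult nn_integral_unit_interval)
    finally show "(\<integral>\<^sup>+\<theta>. (\<integral>\<^sup>+s. ennreal \<bar>indicator {0<..<1} \<theta> * (a (s - \<theta> * h n) * indicator J (s + (1 - \<theta>) * h n)) * k s\<bar> \<partial>lborel) \<partial>lborel) < \<infinity>"
      using kfin by (rule order.strict_trans1)
  qed measurable
  have fst_eq: "(LINT \<theta>|lborel. a t * indicator J (t + h n) * (indicator {0<..<1} \<theta> * k (t + \<theta> * h n))) = a t * indicator J (t + h n) * mean_shift (h n) k t" for n t
    unfolding mean_shift_def by (rule integral_mult_right_zero)
  show "integrable lborel (\<lambda>t. a t * indicator {\<alpha><..<\<beta>} (t + h n) * mean_shift (h n) k t)"
    using lborel_pair.integrable_fst[OF int1[of n]] unfolding fst_eq unfolding J_def .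
  have key: "(LINT t|lborel. a t * indicator J (t + h n) * mean_shift (h n) k t) = (LINT s|lborel. c n s * k s)" for n
  proof -
    have "(LINT t|lborel. a t * indicator J (t + h n) * mean_shift (h n) k t) =
      (LINT t|lborel. (LINT \<theta>|lborel. a t * indicator J (t + h n) * (indicator {0<..<1} \<theta> * k (t + \<theta> * h n))))"
      by (simp only: fst_eq)
    also have "\<dots> = (LINT \<theta>|lborel. (LINT t|lborel. a t * indicator J (t + h n) * (indicator {0<..<1} \<theta> * k (t + \<theta> * h n))))"
      by (rule lborel_pair.Fubini_integral[OF int1, symmetric])
    also have "\<dots> = (LINT \<theta>|lborel. (LINT s|lborel. indicator {0<..<1} \<theta> * (a (s - \<theta> * h n) * indicator J (s + (1 - \<theta>) * h n)) * k s))"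
    proof (rule Bochner_Integration.integral_cong[OF refl])
      fix \<theta> :: real
      have "(LINT t|lborel. a t * indicator J (t + h n) * (indicator {0<..<1} \<theta> * k (t + \<theta> * h n))) =
        \<bar>1\<bar> *\<^sub>R (LINT s|lborel. a (- \<theta> * h n + 1 * s) * indicator J (- \<theta> * h n + 1 * s + h n) * (indicator {0<..<1} \<theta> * k (- \<theta> * h n + 1 * s + \<theta> * h n)))"
        by (rule lborel_integral_real_affine) simp
      also have "\<dots> = (LINT s|lborel. indicator {0<..<1} \<theta> * (a (s - \<theta> * h n) * indicator J (s + (1 - \<theta>) * h n)) * k s)"
        by (simp add: algebra_simps)
      finally show "(LINT t|lborel. a t * indicator J (t + h n) * (indicator {0<..<1} \<theta> * k (t + \<theta> * h n))) =
         (LINT s|lborel. indicator {0<..<1} \<theta> * (a (s - \<theta> * h n) * indicator J (s + (1 - \<theta>) * h n)) * k s)" .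
    qed
    also have "\<dots> = (LINT s|lborel. (LINT \<theta>|lborel. indicator {0<..<1} \<theta> * (a (s - \<theta> * h n) * indicator J (s + (1 - \<theta>) * h n)) * k s))"
      by (rule lborel_pair.Fubini_integral[OF int2])
    also have "\<dots> = (LINT s|lborel. c n s * k s)"
      unfolding c_def by (simp only: integral_mult_left_zero)
    finally show ?thesis .
  qed
  have ai: "integrable lborel a"
  proof (rule Bochner_Integration.integrable_bound)
    show "integrable lborel (indicator J :: real \<Rightarrow> real)" by (rule integrable_real_indicator[OF _ emeasure_bounded_finite]) (auto simp: J_def)
    show "AE t in lborel. norm (a t) \<le> norm (indicator J t :: real)" using a_bnd by (simp add: J_def)
  qed simp
  have ne: "AE s in lborel. s \<noteq> \<alpha> \<and> s \<noteq> \<beta>"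
    using AE_lborel_singleton[of \<alpha>] AE_lborel_singleton[of \<beta>] by eventually_elim simp
  have c_lim: "AE s in lborel. (\<lambda>n. c n s) \<longlonglongrightarrow> a s"
    using mean_shift_AE_tendsto[OF ai] ne
  proof eventually_elim
    case (elim s)
    have small: "eventually (\<lambda>n. \<bar>h n\<bar> < e) sequentially" if "e > 0" for e
      using tendstoD[OF h(1) that] by (simp add: dist_real_def)
    show ?case
    proof (cases "s \<in> J")
      case True
      define e where "e = min (s - \<alpha>) (\<beta> - s)"
      have e: "e > 0" using True by (simp add: e_def J_def)
      have "filterlim (\<lambda>n. - h n) (at 0) sequentially"
        using tendsto_minus[OF h(1)] h(2) by (simp add: filterlim_at)
      then have "(\<lambda>n. mean_shift (- h n) a s) \<longlonglongrightarrow> a s" by (rule filterlim_compose[OF elim(1)])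
      moreover have "eventually (\<lambda>n. mean_shift (- h n) a s = c n s) sequentially"
        using small[OF e]
      proof eventually_elim
        case (elim n)
        show ?case
          unfolding mean_shift_def c_def
        proof (intro Bochner_Integration.integral_cong refl)
          fix \<theta> :: real
          have "s + (1 - \<theta>) * h n \<in> J" if "\<theta> \<in> {0<..<1}"
          proof -
            have "\<bar>(1 - \<theta>) * h n\<bar> \<le> 1 * \<bar>h n\<bar>" unfolding abs_mult using that by (intro mult_right_mono) auto
            then have "\<bar>(1 - \<theta>) * h n\<bar> < e" using elim by simp
            then show ?thesis by (auto simp: J_def e_def)
          qed
          then show "indicator {0<..<1} \<theta> * a (s + \<theta> * - h n) = indicator {0<..<1} \<theta> * (a (s - \<theta> * h n) * indicator J (s + (1 - \<theta>) * h n))"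
            by (cases "\<theta> \<in> {0<..<1}") auto
        qed
      qed
      ultimately show ?thesis by (rule Lim_transform_eventually)
    next
      case False
      define e where "e = max (\<alpha> - s) (s - \<beta>)"
      have e: "e > 0 \<or> J = {}" using False elim(2) by (auto simp: e_def J_def)
      have "eventually (\<lambda>n. c n s = 0) sequentially"
      proof (cases "J = {}")
        case True
        then have "a = (\<lambda>t. 0)" using a0 by auto
        then show ?thesis by (simp add: c_def)
      next
        case False
        then have "e > 0" using e by simp
        from small[OF this] show ?thesis
        proof eventually_elim
          case (elim n)
          have "indicator {0<..<1} \<theta> * (a (s - \<theta> * h n) * indicator J (s + (1 - \<theta>) * h n)) = 0" for \<theta>
          proof (cases "\<theta> \<in> {0<..<1}")
            case True
            have "\<bar>\<theta> * h n\<bar> \<le> 1 * \<bar>h n\<bar>" unfolding abs_mult using True by (intro mult_right_mono) auto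
            then have "\<bar>\<theta> * h n\<bar> < e" using elim by simp
            then have "s - \<theta> * h n \<notin> J" by (auto simp: J_def e_def)
            then show ?thesis using a0 by simp
          qed simp
          then show ?case unfolding c_def by (simp only: integral_zero)
        qed
      qed
      then show ?thesis using a0[OF False] by (simp add: tendsto_eventually)
    qed
  qed
  have c_bnd: "\<bar>c n s\<bar> \<le> 1" for n s
  proof -
    have "norm (c n s) \<le> (LINT \<theta>|lborel. indicator {0<..<1::real} \<theta>)"
      unfolding c_def
    proof (rule Bochner_Integration.integral_norm_bound_integral)
      have le: "\<bar>indicator {0<..<1} \<theta> * (a (s - \<theta> * h n) * indicator J (s + (1 - \<theta>) * h n))\<bar> \<le> indicator {0<..<1} \<theta>" for \<theta> :: real
        using a1[of "s - \<theta> * h n"] by (auto simp: indicator_def)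
      show ii: "integrable lborel (indicator {0<..<1::real} :: real \<Rightarrow> real)" by (intro integrable_real_indicator) auto
      show "integrable lborel (\<lambda>\<theta>. indicator {0<..<1} \<theta> * (a (s - \<theta> * h n) * indicator J (s + (1 - \<theta>) * h n)))"
        by (rule Bochner_Integration.integrable_bound[OF ii]) (measurable, use le in auto)
      show "norm (indicator {0<..<1} \<theta> * (a (s - \<theta> * h n) * indicator J (s + (1 - \<theta>) * h n))) \<le> indicator {0<..<1} \<theta>" for \<theta>
        using le by simp
    qed
    then show ?thesis by simp
  qed
  have "(\<lambda>n. LINT s|lborel. c n s * k s) \<longlonglongrightarrow> (LINT s|lborel. a s * k s)"
  proof (rule integral_dominated_convergence)
    show "integrable lborel (\<lambda>s. norm (k s))" using k by (rule integrable_norm)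
    show "AE s in lborel. (\<lambda>n. c n s * k s) \<longlonglongrightarrow> a s * k s"
      using c_lim by eventually_elim (intro tendsto_mult tendsto_const)
    show "AE s in lborel. norm (c n s * k s) \<le> norm (k s)" for n
      using c_bnd by (intro AE_I2) (simp add: abs_mult mult_left_le_one_le)
  qed measurable
  then show "(\<lambda>n. LINT t|lborel. a t * indicator {\<alpha><..<\<beta>} (t + h n) * mean_shift (h n) k t) \<longlonglongrightarrow> (LINT t|lborel. a t * k t)"
    by (simp add: key flip: J_def)
qed

text \<open>The bound is uniform in \<open>h\<close> because every translate of \<open>m\<close> has the same norm.\<close>

lemma mean_shift_Cauchy_Schwarz:
  fixes N m :: "real \<Rightarrow> real"
  assumes N [measurable]: "N \<in> borel_measurable borel" "\<And>t. 0 \<le> N t" "integrable lborel (\<lambda>t. (N t)\<^sup>2)"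
    and m [measurable]: "m \<in> borel_measurable borel" "\<And>t. 0 \<le> m t" "integrable lborel (\<lambda>t. (m t)\<^sup>2)"
  shows "integrable lborel (\<lambda>t. N t * mean_shift h m t)"
    "(LINT t|lborel. N t * mean_shift h m t) \<le> sqrt (LINT t|lborel. (N t)\<^sup>2) * sqrt (LINT t|lborel. (m t)\<^sup>2)"
proof -
  define C where "C = sqrt (LINT t|lborel. (N t)\<^sup>2) * sqrt (LINT t|lborel. (m t)\<^sup>2)"
  have C: "C \<ge> 0" by (simp add: C_def)
  have tr: "integrable lborel (\<lambda>t. (m (t + c))\<^sup>2)" "(LINT t|lborel. (m (t + c))\<^sup>2) = (LINT t|lborel. (m t)\<^sup>2)" for c
    using lborel_integrable_real_affine[OF m(3), of 1 c] lborel_integral_real_affine[of 1 "\<lambda>t. (m t)\<^sup>2" c]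
    by (simp_all add: add.commute)
  have CS: "integrable lborel (\<lambda>t. N t * m (t + c))" "(LINT t|lborel. N t * m (t + c)) \<le> C" for c
    using Cauchy_Schwarz_integral[OF _ N(3) _ tr(1)[of c]] tr(2)[of c] by (auto simp: C_def)
  have int: "integrable (lborel \<Otimes>\<^sub>M lborel) (\<lambda>(t, \<theta>). N t * (indicator {0<..<1} \<theta> * m (t + \<theta> * h)))"
  proof (rule integrable_pairI)
    have "(\<integral>\<^sup>+\<theta>. (\<integral>\<^sup>+t. ennreal \<bar>N t * (indicator {0<..<1} \<theta> * m (t + \<theta> * h))\<bar> \<partial>lborel) \<partial>lborel)
      \<le> (\<integral>\<^sup>+\<theta>. indicator {0<..<1::real} \<theta> * ennreal C \<partial>lborel)"
    proof (intro nn_integral_mono)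
      fix \<theta> :: real
      have "(\<integral>\<^sup>+t. ennreal (N t * m (t + \<theta> * h)) \<partial>lborel) = ennreal (LINT t|lborel. N t * m (t + \<theta> * h))"
        by (rule nn_integral_eq_integral[OF CS(1)]) (simp add: N m)
      also have "\<dots> \<le> ennreal C" by (intro ennreal_leI CS)
      finally show "(\<integral>\<^sup>+t. ennreal \<bar>N t * (indicator {0<..<1} \<theta> * m (t + \<theta> * h))\<bar> \<partial>lborel) \<le> indicator {0<..<1::real} \<theta> * ennreal C"
        by (cases "\<theta> \<in> {0<..<1}") (simp_all add: N m)
    qed
    also have "\<dots> < \<infinity>" by (simp add: nn_integral_unit_interval)
    finally show "(\<integral>\<^sup>+\<theta>. (\<integral>\<^sup>+t. ennreal \<bar>N t * (indicator {0<..<1} \<theta> * m (t + \<theta> * h))\<bar> \<partial>lborel) \<partial>lborel) < \<infinity>" .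
  qed measurable
  have eq: "(LINT \<theta>|lborel. N t * (indicator {0<..<1} \<theta> * m (t + \<theta> * h))) = N t * mean_shift h m t" for t
    unfolding mean_shift_def by (rule integral_mult_right_zero)
  show "integrable lborel (\<lambda>t. N t * mean_shift h m t)"
    using lborel_pair.integrable_fst[OF int] by (simp only: eq)
  have "(LINT t|lborel. N t * mean_shift h m t) = (LINT \<theta>|lborel. (LINT t|lborel. N t * (indicator {0<..<1} \<theta> * m (t + \<theta> * h))))"
    using lborel_pair.Fubini_integral[OF int] by (simp only: eq)
  also have "\<dots> \<le> (LINT \<theta>|lborel. indicator {0<..<1::real} \<theta> * C)"
  proof (rule integral_mono)
    show "integrable lborel (\<lambda>\<theta>. LINT t|lborel. N t * (indicator {0<..<1} \<theta> * m (t + \<theta> * h)))"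
      using lborel_pair.integrable_snd[OF int] by simp
    show "integrable lborel (\<lambda>\<theta>. indicator {0<..<1::real} \<theta> * C)"
      by (intro integrable_mult_left integrable_real_indicator) auto
    show "(LINT t|lborel. N t * (indicator {0<..<1} \<theta> * m (t + \<theta> * h))) \<le> indicator {0<..<1} \<theta> * C" for \<theta>
      using CS(2)[of "\<theta> * h"] by (cases "\<theta> \<in> {0<..<1}") simp_all
  qed
  also have "\<dots> = C" by simp
  finally show "(LINT t|lborel. N t * mean_shift h m t) \<le> sqrt (LINT t|lborel. (N t)\<^sup>2) * sqrt (LINT t|lborel. (m t)\<^sup>2)"
    by (simp add: C_def)
qed

lemma borel_version:
  fixes f :: "real \<Rightarrow> real"
  assumes f: "f \<in> borel_measurable (lebesgue_on {a<..<b})"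
  obtains f' where "f' \<in> borel_measurable borel" "AE x in lebesgue_on {a<..<b}. f' x = f x" "\<And>x. x \<notin> {a<..<b} \<Longrightarrow> f' x = 0"
proof -
  have "(\<lambda>x. if x \<in> {a<..<b} then f x else 0) \<in> borel_measurable (completion lborel)"
    using f by (subst borel_measurable_if) auto
  then obtain g where g: "g \<in> borel_measurable lborel" "AE x in lborel. (if x \<in> {a<..<b} then f x else 0) = g x"
    using completion_ex_borel_measurable_real by blast
  show ?thesis
  proof (rule that[of "\<lambda>x. indicator {a<..<b} x * g x"])
    have "g \<in> borel_measurable borel" using g(1) by simp
    then show "(\<lambda>x. indicator {a<..<b} x * g x) \<in> borel_measurable borel" by measurable
    have "AE x in lebesgue. (if x \<in> {a<..<b} then f x else 0) = g x"
      using g(2) by (rule AE_completion)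
    then show "AE x in lebesgue_on {a<..<b}. indicator {a<..<b} x * g x = f x"
      by (subst AE_restrict_space_iff) (auto elim!: eventually_mono)
  qed simp
qed

lemma interval_to_lborel:
  fixes f F :: "real \<Rightarrow> real"
  assumes F: "F \<in> borel_measurable borel" "AE x in lebesgue_on {a<..<b}. F x = f x" "\<And>x. x \<notin> {a<..<b} \<Longrightarrow> F x = 0"
  shows "integrable (lebesgue_on {a<..<b}) f = integrable lborel F" "(LINT x|lebesgue_on {a<..<b}. f x) = (LINT x|lborel. F x)"
    "f \<in> borel_measurable (lebesgue_on {a<..<b})"
proof -
  have Fl: "F \<in> borel_measurable (completion lborel)" by (rule measurable_completion) (use F in simp)
  have Fm: "F \<in> borel_measurable (lebesgue_on {a<..<b})" by (rule measurable_restrict_space1[OF Fl])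
  show fm: "f \<in> borel_measurable (lebesgue_on {a<..<b})"
    by (rule lebesgue_on_measurable_AE[OF _ Fm F(2)]) simp
  have "integrable (lebesgue_on {a<..<b}) f = integrable (lebesgue_on {a<..<b}) F"
    by (rule integrable_cong_AE[OF fm Fm]) (use F(2) in \<open>auto elim: eventually_mono\<close>)
  also have "\<dots> = integrable lebesgue F" by (rule lebesgue_on_support(1)) (use F(3) in auto)
  also have "\<dots> = integrable lborel F" by (rule integrable_completion) (use F in simp)
  finally show "integrable (lebesgue_on {a<..<b}) f = integrable lborel F" .
  have "(LINT x|lebesgue_on {a<..<b}. f x) = (LINT x|lebesgue_on {a<..<b}. F x)"
    by (rule integral_cong_AE[OF fm Fm]) (use F(2) in \<open>auto elim: eventually_mono\<close>)
  also have "\<dots> = (LINT x|lebesgue. F x)" by (rule lebesgue_on_support(2)) (use F(3) in auto)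
  also have "\<dots> = (LINT x|lborel. F x)" by (rule integral_completion) (use F in simp)
  finally show "(LINT x|lebesgue_on {a<..<b}. f x) = (LINT x|lborel. F x)" .
qed

lemma finite_measure_interval: "finite_measure (lebesgue_on {a<..<b::real})"
  by (rule finite_measure_lebesgue_on) (simp add: bounded_set_imp_lmeasurable)

lemma square_integrable_imp_integrable_interval:
  fixes f :: "real \<Rightarrow> real"
  assumes "f \<in> borel_measurable (lebesgue_on {a<..<b})" "integrable (lebesgue_on {a<..<b}) (\<lambda>t. (f t)\<^sup>2)"
  shows "integrable (lebesgue_on {a<..<b}) f"
proof -
  interpret finite_measure "lebesgue_on {a<..<b}" by (rule finite_measure_interval)
  show ?thesis using Cauchy_Schwarz_integral(1)[OF assms, of "\<lambda>_. 1"] by simp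
qed

context seminorm_space
begin

lemma constant_bochner_L2:
  assumes x: "x \<in> X"
  shows "(\<lambda>t. x) \<in> bochner_L2 T X N"
proof -
  interpret finite_measure "lebesgue_on {0<..<T}" by (rule finite_measure_interval)
  have "simple_on T X (\<lambda>t. x)"
    unfolding simple_on_def
  proof (intro conjI allI)
    show "finite ((\<lambda>t. x) ` {0<..<T})" by (rule finite_subset[of _ "{x}"]) auto
    show "{t \<in> {0<..<T}. x = y} \<in> sets lebesgue" for y by (cases "x = y") auto
  qed (use x in auto)
  then have "strongly_measurable T X N (\<lambda>t. x)"
    unfolding strongly_measurable_def by (intro exI[of _ "\<lambda>_ _. x"]) (simp add: N_zero)
  then show ?thesis using x by (simp add: bochner_L2_def)
qed

text \<open>The mean of \<open>g\<close> between \<open>t\<close> and \<open>t + h\<close>, evaluated at \<open>x\<close>. It is evaluated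
  after integration, so that only scalar functions are integrated.\<close>

definition increment_quotient :: "real \<Rightarrow> (real \<Rightarrow> 'v \<Rightarrow> real) \<Rightarrow> real \<Rightarrow> real \<Rightarrow> 'v \<Rightarrow> real"
  where "increment_quotient T g h t x =
    inverse \<bar>h\<bar> * (LINT r|lebesgue_on {0<..<T}. indicator {min t (t + h)<..<max t (t + h)} r * g r x)"

text \<open>Replacing \<open>v\<close> by a simple function, up to an error controlled by
  \<open>mean_shift_Cauchy_Schwarz\<close>, leaves finitely many scalar functions \<open>g(\<cdot>) y\<close>, to which
  \<open>mean_shift_weak_limit\<close> applies. The function \<open>D n\<close> is the quotient at \<open>v t\<close>; its
  measurability is assumed because in the application it is continuous.\<close>

lemma increment_quotient_limit:
  assumes g: "g \<in> bochner_L2 T (dual_space X N) (dual_norm X N)" and v: "v \<in> bochner_L2 T X N"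
    and \<beta>: "\<beta> \<le> T" and h: "h \<longlonglongrightarrow> 0" "\<And>n. h n \<noteq> 0"
    and D: "\<And>n. AE t in lebesgue_on {0<..<T}. t \<in> {0<..<\<beta>} \<longrightarrow> t + h n \<in> {0<..<\<beta>} \<longrightarrow> D n t = increment_quotient T g (h n) t (v t)"
    and Dm: "\<And>n. (\<lambda>t. indicator {0<..<\<beta>} t * indicator {0<..<\<beta>} (t + h n) * D n t) \<in> borel_measurable (lebesgue_on {0<..<T})"
  shows "(\<lambda>n. LINT t|lebesgue_on {0<..<T}. indicator {0<..<\<beta>} t * indicator {0<..<\<beta>} (t + h n) * D n t) \<longlonglongrightarrow>
    (LINT t|lebesgue_on {0<..<T}. indicator {0<..<\<beta>} t * g t (v t))"
proof -
  interpret Du: seminorm_space "dual_space X N" "dual_norm X N" by (rule dual_seminorm_space)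
  note gD = Du.bochner_L2D[OF g] and vD = bochner_L2D[OF v]
  define M where "M = lebesgue_on {0<..<T}"
  define J where "J = {0<..<\<beta>}"
  have JI: "J \<subseteq> {0<..<T}" using \<beta> by (auto simp: J_def)
  have Jm [measurable]: "J \<in> sets borel" by (simp add: J_def)
  define G where "G = bochner_L2_norm T (dual_norm X N) g"
  have G0: "G \<ge> 0" by (simp add: G_def bochner_L2_norm_def)
  \<comment> \<open>The Fubini arguments take place in the product of two Borel measures, hence Borel versions of
    all functions that are shifted in time.\<close>
  obtain m0 where m0: "m0 \<in> borel_measurable borel" "AE t in M. m0 t = dual_norm X N (g t)" "\<And>t. t \<notin> {0<..<T} \<Longrightarrow> m0 t = 0"
    using borel_version[OF gD(3)] unfolding M_def by metis
  define m where "m t = \<bar>m0 t\<bar>" for t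
  have m [measurable]: "m \<in> borel_measurable borel" and m_nn: "0 \<le> m t" and m_out: "t \<notin> {0<..<T} \<Longrightarrow> m t = 0" for t
    using m0 by (auto simp: m_def[abs_def])
  have m_ae: "AE t in M. m t = dual_norm X N (g t)"
    using m0(2) gD(2) unfolding M_def by eventually_elim (simp add: m_def Du.N_nonneg)
  have "AE t in M. (m t)\<^sup>2 = (dual_norm X N (g t))\<^sup>2" using m_ae by eventually_elim simp
  note m2 = interval_to_lborel[OF _ this[unfolded M_def]]
  have mi2: "integrable lborel (\<lambda>t. (m t)\<^sup>2)" "sqrt (LINT t|lborel. (m t)\<^sup>2) = G"
    using m2(1,2) gD(4) m_out by (auto simp: G_def bochner_L2_norm_def)
  have mi: "integrable lborel m"
  proof -
    have "integrable M (\<lambda>t. dual_norm X N (g t))"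
      unfolding M_def by (rule square_integrable_imp_integrable_interval[OF gD(3,4)])
    then show ?thesis using interval_to_lborel(1)[OF m m_ae[unfolded M_def] m_out] by (simp add: M_def)
  qed
  have gy: "(\<lambda>t. g t y) \<in> borel_measurable M" "integrable M (\<lambda>t. g t y)" if "y \<in> X" for y
    using pairing_measurable(1,2)[OF g constant_bochner_L2[OF that]] by (simp_all add: M_def)
  have "\<exists>k. k \<in> borel_measurable borel \<and> (AE t in M. k t = g t y) \<and> (\<forall>t. t \<notin> {0<..<T} \<longrightarrow> k t = 0)" if "y \<in> X" for y
    using borel_version[OF gy(1)[OF that, unfolded M_def]] unfolding M_def by metis
  then obtain k where k: "\<And>y. y \<in> X \<Longrightarrow> k y \<in> borel_measurable borel" "\<And>y. y \<in> X \<Longrightarrow> AE t in M. k y t = g t y"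
    "\<And>y t. y \<in> X \<Longrightarrow> t \<notin> {0<..<T} \<Longrightarrow> k y t = 0"
    by metis
  have ki: "integrable lborel (k y)" if "y \<in> X" for y
    using interval_to_lborel(1)[OF k(1)[OF that] k(2)[OF that, unfolded M_def] k(3)[OF that]] gy(2)[OF that] by (simp add: M_def)
  have ind_ae: "AE t in lebesgue_on {0<..<T}. indicator S t * k y t = indicator S t * g t y" if "y \<in> X" for y and S :: "real set"
    using k(2)[OF that] unfolding M_def by eventually_elim simp
  have A_eq: "increment_quotient T g e t y = mean_shift e (k y) t" if "y \<in> X" "e \<noteq> 0" for e t y
  proof -
    have "(LINT r|lebesgue_on {0<..<T}. indicator {min t (t + e)<..<max t (t + e)} r * g r y) =
      (LINT r|lborel. indicator {min t (t + e)<..<max t (t + e)} r * k y r)"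
      by (rule interval_to_lborel(2)[OF _ ind_ae[OF that(1)]]) (use k[OF that(1)] in auto)
    then show ?thesis using that(2) by (simp add: increment_quotient_def mean_shift_eq)
  qed
  have ind_int: "integrable M (\<lambda>r. indicator {x<..<y} r * f r)" if "integrable M f" for x y and f :: "real \<Rightarrow> real"
    using integrable_mult_indicator[OF _ that, of "{x<..<y} \<inter> {0<..<T}"]
    by (rule Bochner_Integration.integrable_cong[THEN iffD1, rotated -1])
      (auto simp: M_def sets_restrict_space indicator_def)
  have A_diff: "increment_quotient T g e t (x - y) = increment_quotient T g e t x - increment_quotient T g e t y"
    if "x \<in> X" "y \<in> X" for e t x y
  proof -
    have "(LINT r|M. indicator {min t (t + e)<..<max t (t + e)} r * g r (x - y)) =
      (LINT r|M. indicator {min t (t + e)<..<max t (t + e)} r * g r x - indicator {min t (t + e)<..<max t (t + e)} r * g r y)"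
    proof (rule integral_cong_AE)
      show "AE r in M. indicator {min t (t + e)<..<max t (t + e)} r * g r (x - y) =
          indicator {min t (t + e)<..<max t (t + e)} r * g r x - indicator {min t (t + e)<..<max t (t + e)} r * g r y"
        using gD(2) unfolding M_def by eventually_elim (simp add: dual_linear(3) that right_diff_distrib)
    qed (intro borel_measurable_integrable Bochner_Integration.integrable_diff ind_int gy that diff_mem)+
    then show ?thesis
      using ind_int[OF gy(2)[OF that(1)]] ind_int[OF gy(2)[OF that(2)]]
      by (simp add: increment_quotient_def M_def right_diff_distrib)
  qed
  have A_bnd: "\<bar>increment_quotient T g e t x\<bar> \<le> N x * mean_shift e m t" if x: "x \<in> X" and e: "e \<noteq> 0" for e t x
  proof -
    let ?S = "{min t (t + e)<..<max t (t + e)}"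
    have "\<bar>LINT r|M. indicator ?S r * g r x\<bar> \<le> (LINT r|M. \<bar>indicator ?S r * g r x\<bar>)" by (rule integral_abs_bound)
    also have "\<dots> \<le> (LINT r|M. N x * (indicator ?S r * dual_norm X N (g r)))"
    proof (rule integral_mono_AE)
      show "integrable M (\<lambda>r. \<bar>indicator ?S r * g r x\<bar>)" by (intro integrable_abs ind_int gy x)
      show "integrable M (\<lambda>r. N x * (indicator ?S r * dual_norm X N (g r)))"
        by (rule integrable_mult_right[OF ind_int[OF square_integrable_imp_integrable_interval[OF gD(3,4), folded M_def]]])
      show "AE r in M. \<bar>indicator ?S r * g r x\<bar> \<le> N x * (indicator ?S r * dual_norm X N (g r))"
        using gD(2) unfolding M_def by eventually_elim (use dual_bound[OF _ x] in \<open>simp add: indicator_def mult.commute\<close>)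
    qed
    also have "\<dots> = N x * (LINT r|M. indicator ?S r * dual_norm X N (g r))" by simp
    also have "(LINT r|M. indicator ?S r * dual_norm X N (g r)) = (LINT r|lborel. indicator ?S r * m r)"
      unfolding M_def
    proof (rule interval_to_lborel(2))
      show "AE r in lebesgue_on {0<..<T}. indicator ?S r * m r = indicator ?S r * dual_norm X N (g r)"
        using m_ae unfolding M_def by eventually_elim simp
    qed (use m_out in auto)
    finally show ?thesis
      using e by (simp add: increment_quotient_def mean_shift_eq abs_mult M_def field_simps)
  qed
  have "\<exists>n0. \<forall>n\<ge>n0. \<bar>(LINT t|M. indicator J t * indicator J (t + h n) * D n t) - (LINT t|M. indicator J t * g t (v t))\<bar> < \<epsilon>"
    if \<epsilon>: "\<epsilon> > 0" for \<epsilon>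
  proof -
    define c where "c = G + 1"
    have c: "c > 0" "G \<le> c" using G0 by (simp_all add: c_def)
    define \<delta> where "\<delta> = \<epsilon> / (4 * c)"
    have \<delta>: "\<delta> > 0" using \<epsilon> c by (simp add: \<delta>_def)
    have "\<delta> * G \<le> \<delta> * c" using \<delta> c by simp
    also have "\<dots> = \<epsilon> / 4" using c by (simp add: \<delta>_def)
    finally have \<delta>G: "\<delta> * G \<le> \<epsilon> / 4" .
    obtain s where s: "simple_on T X s" and s2: "integrable M (\<lambda>t. (N (v t - s t))\<^sup>2)"
      and sm: "(\<lambda>t. N (v t - s t)) \<in> borel_measurable M" and s_small: "(LINT t|M. (N (v t - s t))\<^sup>2) < \<delta>\<^sup>2"
      and sN: "integrable M (\<lambda>t. (N (s t))\<^sup>2)"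
      unfolding M_def by (rule simple_dense[OF v, of "\<delta>\<^sup>2"]) (use \<delta> in auto)
    have sX: "s t \<in> X" if "t \<in> {0<..<T}" for t using s that by (auto simp: simple_on_def)
    have norm_small: "sqrt (LINT t|M. (N (v t - s t))\<^sup>2) \<le> \<delta>"
      using s_small \<delta> by (intro real_le_lsqrt) auto
    have sB: "s \<in> bochner_L2 T X N"
    proof -
      have "strongly_measurable T X N s"
        unfolding strongly_measurable_def by (rule exI[of _ "\<lambda>_. s"]) (simp add: s N_zero)
      then show ?thesis using simple_on_mem[OF s] sN by (simp add: bochner_L2_def M_def)
    qed
    obtain n0 where n0: "n0 \<in> borel_measurable borel" "AE t in M. n0 t = N (v t - s t)" "\<And>t. t \<notin> {0<..<T} \<Longrightarrow> n0 t = 0"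
      using borel_version[OF sm[unfolded M_def]] unfolding M_def by metis
    define Ne where "Ne t = \<bar>n0 t\<bar>" for t
    have Ne [measurable]: "Ne \<in> borel_measurable borel" and Ne_nn: "0 \<le> Ne t" and Ne_out: "t \<notin> {0<..<T} \<Longrightarrow> Ne t = 0" for t
      using n0 by (auto simp: Ne_def[abs_def])
    have vs: "AE t in M. v t \<in> X \<and> s t \<in> X" using vD(2) simple_on_mem[OF s] unfolding M_def by eventually_elim simp
    have Ne_ae: "AE t in M. Ne t = N (v t - s t)"
      using n0(2) vs by eventually_elim (simp add: Ne_def N_nonneg diff_mem)
    have Ne2: "integrable lborel (\<lambda>t. (Ne t)\<^sup>2)" "sqrt (LINT t|lborel. (Ne t)\<^sup>2) \<le> \<delta>"
    proof -
      have ae: "AE t in lebesgue_on {0<..<T}. (Ne t)\<^sup>2 = (N (v t - s t))\<^sup>2" using Ne_ae unfolding M_def by eventually_elim simp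
      note tr = interval_to_lborel[OF _ ae]
      show "integrable lborel (\<lambda>t. (Ne t)\<^sup>2)" using tr(1) s2 Ne_out by (simp add: M_def)
      show "sqrt (LINT t|lborel. (Ne t)\<^sup>2) \<le> \<delta>" using tr(2) norm_small Ne_out by (simp add: M_def)
    qed
    define Y where "Y = s ` {0<..<T}"
    have Y: "finite Y" "Y \<subseteq> X" using s by (auto simp: simple_on_def Y_def)
    have lev: "{t \<in> {0<..<T}. s t = y} \<in> sets lebesgue" for y using s by (auto simp: simple_on_def)
    have "\<exists>a::real \<Rightarrow> real. a \<in> borel_measurable borel \<and> (\<forall>t. \<bar>a t\<bar> \<le> indicator J t) \<and> (AE t in M. a t = indicator {t \<in> {0<..<T}. s t = y} t * indicator J t)" for y
    proof -
      have "(indicator {t \<in> {0<..<T}. s t = y} :: real \<Rightarrow> real) \<in> borel_measurable (lebesgue_on {0<..<T})"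
        by (intro measurable_restrict_space1 borel_measurable_indicator lev)
      then obtain f :: "real \<Rightarrow> real" where f: "f \<in> borel_measurable borel" "AE t in lebesgue_on {0<..<T}. f t = indicator {t \<in> {0<..<T}. s t = y} t"
        by (rule borel_version)
      define a :: "real \<Rightarrow> real" where "a t = indicator {t. f t = 1} t * indicator J t" for t
      have "AE t in lebesgue_on {0<..<T}. a t = indicator {t \<in> {0<..<T}. s t = y} t * indicator J t"
        using f(2) by eventually_elim (auto simp: a_def indicator_def)
      moreover have "a \<in> borel_measurable borel" unfolding a_def[abs_def] using f(1) by measurable
      moreover have "\<bar>a t\<bar> \<le> indicator J t" for t by (simp add: a_def indicator_def)
      ultimately show ?thesis unfolding M_def by blast
    qed
    from choice[OF allI[OF this]] obtain a :: "'v \<Rightarrow> real \<Rightarrow> real" where aa: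
      "\<forall>y. a y \<in> borel_measurable borel \<and> (\<forall>t. \<bar>a y t\<bar> \<le> indicator J t) \<and> (AE t in M. a y t = indicator {t \<in> {0<..<T}. s t = y} t * indicator J t)"
      by (rule exE)
    have a1: "a y \<in> borel_measurable borel" for y using spec[OF aa, of y] by (elim conjE)
    have a2: "\<bar>a y t\<bar> \<le> indicator J t" for y t using spec[OF aa, of y] by (elim conjE) (erule spec)
    have a3: "AE t in M. a y t = indicator {t \<in> {0<..<T}. s t = y} t * indicator J t" for y
      using spec[OF aa, of y] by (elim conjE)
    note a = a1 a2 a3
    have a_out: "a y t = 0" if "t \<notin> {0<..<T}" for y t
    proof -
      have "t \<notin> J" using that JI by blast
      then show ?thesis using a(2)[of y t] by simp
    qed
    have sum_eq: "(\<Sum>y\<in>Y. indicator {t \<in> {0<..<T}. s t = y} t * c y) = c (s t)" if "t \<in> {0<..<T}" for t and c :: "'v \<Rightarrow> real"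
    proof -
      have "(\<Sum>y\<in>Y. indicator {t \<in> {0<..<T}. s t = y} t * c y) = (\<Sum>y\<in>Y. if y = s t then c y else 0)"
        using that by (intro sum.cong) (auto simp: indicator_def)
      also have "\<dots> = c (s t)" using Y(1) that by (simp add: Y_def)
      finally show ?thesis .
    qed
    define S where "S n t = (\<Sum>y\<in>Y. a y t * indicator J (t + h n) * mean_shift (h n) (k y) t)" for n t
    define S0 where "S0 t = (\<Sum>y\<in>Y. a y t * k y t)" for t
    have Jeq: "J = {0<..<\<beta>}" by (simp add: J_def)
    have S_lim: "(\<lambda>n. LINT t|lborel. S n t) \<longlonglongrightarrow> (LINT t|lborel. S0 t)" and S_int: "integrable lborel (S n)" for n
    proof -
      have lim: "(\<lambda>n. LINT t|lborel. a y t * indicator J (t + h n) * mean_shift (h n) (k y) t) \<longlonglongrightarrow> (LINT t|lborel. a y t * k y t)"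
        and int: "integrable lborel (\<lambda>t. a y t * indicator J (t + h n) * mean_shift (h n) (k y) t)" if "y \<in> Y" for y n
      proof -
        have yX: "y \<in> X" using that Y(2) by blast
        note lim = mean_shift_weak_limit[OF a(1) a(2)[unfolded Jeq] ki[OF yX] h]
        show "(\<lambda>n. LINT t|lborel. a y t * indicator J (t + h n) * mean_shift (h n) (k y) t) \<longlonglongrightarrow> (LINT t|lborel. a y t * k y t)"
          unfolding Jeq by (rule lim(1))
        show "integrable lborel (\<lambda>t. a y t * indicator J (t + h n) * mean_shift (h n) (k y) t)"
          unfolding Jeq by (rule lim(2))
      qed
      have int0: "integrable lborel (\<lambda>t. a y t * k y t)" if "y \<in> Y" for y
      proof (rule Bochner_Integration.integrable_bound[OF ki])
        show yX: "y \<in> X" using that Y(2) by blast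
        show "(\<lambda>t. a y t * k y t) \<in> borel_measurable lborel" using a(1)[of y] k(1)[OF yX] by measurable
        have "\<bar>a y t\<bar> \<le> 1" for t using a(2)[of y t] by (cases "t \<in> J") simp_all
        then show "AE t in lborel. norm (a y t * k y t) \<le> norm (k y t)"
          by (intro AE_I2) (simp add: abs_mult mult_left_le_one_le)
      qed
      show "integrable lborel (S n)" unfolding S_def by (intro Bochner_Integration.integrable_sum int)
      have "(\<lambda>n. \<Sum>y\<in>Y. LINT t|lborel. a y t * indicator J (t + h n) * mean_shift (h n) (k y) t) \<longlonglongrightarrow> (\<Sum>y\<in>Y. LINT t|lborel. a y t * k y t)"
        by (intro tendsto_sum lim)
      then show "(\<lambda>n. LINT t|lborel. S n t) \<longlonglongrightarrow> (LINT t|lborel. S0 t)"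
        unfolding S_def S0_def using int int0 by (simp add: Bochner_Integration.integral_sum)
    qed
    have aeY: "AE t in M. \<forall>y\<in>Y. a y t = indicator {t \<in> {0<..<T}. s t = y} t * indicator J t \<and> k y t = g t y"
    proof (rule AE_finite_allI[OF Y(1)])
      fix y assume "y \<in> Y"
      then have "y \<in> X" using Y(2) by blast
      from AE_conjI[OF a3 k(2)[OF this]]
      show "AE t in M. a y t = indicator {t \<in> {0<..<T}. s t = y} t * indicator J t \<and> k y t = g t y" .
    qed
    have S_ae: "AE t in lebesgue_on {0<..<T}. S n t = indicator J t * indicator J (t + h n) * increment_quotient T g (h n) t (s t)" for n
      using aeY AE_space[of M] unfolding M_def
    proof eventually_elim
      case (elim t)
      have "S n t = (\<Sum>y\<in>Y. indicator {t \<in> {0<..<T}. s t = y} t * (indicator J t * indicator J (t + h n) * increment_quotient T g (h n) t y))"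
        unfolding S_def using elim Y(2) h(2)[of n] by (intro sum.cong refl) (auto simp: A_eq subset_iff)
      then show ?case using sum_eq[of t] elim(2) by simp
    qed
    have S0_ae: "AE t in lebesgue_on {0<..<T}. S0 t = indicator J t * g t (s t)"
      using aeY AE_space[of M] unfolding M_def
    proof eventually_elim
      case (elim t)
      have "S0 t = (\<Sum>y\<in>Y. indicator {t \<in> {0<..<T}. s t = y} t * (indicator J t * g t y))"
        unfolding S0_def using elim by (intro sum.cong refl) auto
      then show ?case using sum_eq[of t] elim(2) by simp
    qed
    have Sm: "S n \<in> borel_measurable borel" for n using S_int by (simp add: borel_measurable_integrable)
    have S0m: "S0 \<in> borel_measurable borel"
      unfolding S0_def[abs_def] using a(1) k(1) Y(2) by (intro borel_measurable_sum borel_measurable_times) auto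
    have S_out: "S n t = 0" "S0 t = 0" if "t \<notin> {0<..<T}" for n t using a_out[OF that] by (simp_all add: S_def S0_def)
    note S_tr = interval_to_lborel[OF Sm S_ae S_out(1), folded M_def]
    note S0_tr = interval_to_lborel[OF S0m S0_ae S_out(2), folded M_def]
    have err: "\<bar>(LINT t|M. indicator J t * indicator J (t + h n) * D n t) - (LINT t|lborel. S n t)\<bar> \<le> \<delta> * G" for n
    proof -
      define P where "P t = indicator J t * indicator J (t + h n) * D n t" for t
      define Q where "Q t = indicator J t * indicator J (t + h n) * increment_quotient T g (h n) t (s t)" for t
      have Pm: "P \<in> borel_measurable M" using Dm[of n] by (simp add: P_def[abs_def] J_def M_def)
      have Qm: "Q \<in> borel_measurable M" "integrable M Q" "(LINT t|M. Q t) = (LINT t|lborel. S n t)"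
        using S_tr(1)[of n] S_tr(2)[of n] S_tr(3)[of n] S_int[of n] by (simp_all add: Q_def[abs_def])
      note CS = mean_shift_Cauchy_Schwarz[OF Ne Ne_nn Ne2(1) m m_nn mi2(1), of "h n"]
      have CSm: "integrable M (\<lambda>t. Ne t * mean_shift (h n) m t)" "(LINT t|M. Ne t * mean_shift (h n) m t) = (LINT t|lborel. Ne t * mean_shift (h n) m t)"
        unfolding M_def using interval_to_lborel(1,2)[where F = "\<lambda>t. Ne t * mean_shift (h n) m t" and f = "\<lambda>t. Ne t * mean_shift (h n) m t" and a = 0 and b = T] CS(1) Ne_out by simp_all
      have PQ: "AE t in M. \<bar>P t - Q t\<bar> \<le> Ne t * mean_shift (h n) m t"
        using D[of n] vs Ne_ae unfolding M_def[symmetric]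
      proof eventually_elim
        case (elim t)
        have ms: "mean_shift (h n) m t \<ge> 0" unfolding mean_shift_def by (rule integral_nonneg_AE) (simp add: m_nn)
        show ?case
        proof (cases "t \<in> J \<and> t + h n \<in> J")
          case True
          then have "P t - Q t = increment_quotient T g (h n) t (v t - s t)"
            using elim by (simp add: P_def Q_def A_diff J_def)
          then show ?thesis using A_bnd[OF diff_mem, of "v t" "s t" "h n" t] elim h(2)[of n] by simp
        next
          case False
          then have "P t - Q t = 0" by (auto simp: P_def Q_def)
          then show ?thesis using ms Ne_nn[of t] by simp
        qed
      qed
      have i: "integrable M (\<lambda>t. P t - Q t)"
        by (rule Bochner_Integration.integrable_bound[OF CSm(1)]) (use Pm Qm(1) PQ in \<open>auto elim!: eventually_mono\<close>)
      have Pi: "integrable M P" using Bochner_Integration.integrable_add[OF i Qm(2)] by simp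
      have "\<bar>(LINT t|M. P t) - (LINT t|M. Q t)\<bar> = \<bar>LINT t|M. P t - Q t\<bar>" using Pi Qm(2) by simp
      also have "\<dots> \<le> (LINT t|M. \<bar>P t - Q t\<bar>)" by (rule integral_abs_bound)
      also have "\<dots> \<le> (LINT t|M. Ne t * mean_shift (h n) m t)" by (intro integral_mono_AE integrable_abs i CSm(1) PQ)
      also have "\<dots> \<le> sqrt (LINT t|lborel. (Ne t)\<^sup>2) * G" unfolding CSm(2) using CS(2) by (simp add: mi2(2))
      also have "\<dots> \<le> \<delta> * G" by (intro mult_right_mono Ne2 G0)
      finally show ?thesis by (simp add: Qm(3) P_def)
    qed
    have err0: "\<bar>(LINT t|lborel. S0 t) - (LINT t|M. indicator J t * g t (v t))\<bar> \<le> \<delta> * G"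
    proof -
      note pv = pairing_measurable[OF g v, folded M_def] and ps = pairing_measurable[OF g sB, folded M_def]
      note pd = pairing_measurable[OF g bochner_L2_diff(1)[OF v sB], folded M_def]
      have indJ: "integrable M (\<lambda>t. indicator J t * f t)" if "integrable M f" for f :: "real \<Rightarrow> real"
        unfolding J_def by (rule ind_int[OF that])
      have "\<bar>(LINT t|M. indicator J t * g t (s t)) - (LINT t|M. indicator J t * g t (v t))\<bar> =
        \<bar>LINT t|M. indicator J t * g t (s t) - indicator J t * g t (v t)\<bar>"
        using indJ[OF pv(2)] indJ[OF ps(2)] by simp
      also have "\<dots> \<le> (LINT t|M. \<bar>indicator J t * g t (s t) - indicator J t * g t (v t)\<bar>)" by (rule integral_abs_bound)
      also have "\<dots> \<le> (LINT t|M. dual_norm X N (g t) * N (v t - s t))"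
      proof (rule integral_mono_AE)
        show "integrable M (\<lambda>t. \<bar>indicator J t * g t (s t) - indicator J t * g t (v t)\<bar>)"
          by (intro integrable_abs Bochner_Integration.integrable_diff indJ pv ps)
        show "integrable M (\<lambda>t. dual_norm X N (g t) * N (v t - s t))"
          using Cauchy_Schwarz_integral(1)[OF gD(3,4) sm[unfolded M_def] s2[unfolded M_def]] by (simp add: M_def)
        show "AE t in M. \<bar>indicator J t * g t (s t) - indicator J t * g t (v t)\<bar> \<le> dual_norm X N (g t) * N (v t - s t)"
          using vs gD(2) unfolding M_def[symmetric]
        proof eventually_elim
          case (elim t)
          have "\<bar>g t (s t) - g t (v t)\<bar> = \<bar>g t (v t - s t)\<bar>" using dual_linear(3)[OF elim(2)] elim(1) by simp
          then have "\<bar>g t (s t) - g t (v t)\<bar> \<le> dual_norm X N (g t) * N (v t - s t)"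
            using dual_bound[OF elim(2) diff_mem] elim(1) by simp
          then show ?case by (auto simp: indicator_def)
        qed
      qed
      also have "\<dots> \<le> \<bar>LINT t|M. dual_norm X N (g t) * N (v t - s t)\<bar>" by (rule abs_ge_self)
      also have "\<dots> \<le> G * sqrt (LINT t|M. (N (v t - s t))\<^sup>2)"
        using Cauchy_Schwarz_integral(3)[OF gD(3,4) sm[unfolded M_def] s2[unfolded M_def]] by (simp add: M_def G_def bochner_L2_norm_def)
      also have "\<dots> \<le> G * \<delta>" by (intro mult_left_mono norm_small G0)
      finally show ?thesis using S0_tr(2) by (simp add: mult.commute)
    qed
    obtain n0 where n0: "\<And>n. n \<ge> n0 \<Longrightarrow> \<bar>(LINT t|lborel. S n t) - (LINT t|lborel. S0 t)\<bar> < \<epsilon> / 4"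
      using LIMSEQ_D[OF S_lim, of "\<epsilon> / 4"] \<epsilon> by auto
    show ?thesis
    proof (intro exI[of _ n0] allI impI)
      fix n assume "n \<ge> n0"
      then show "\<bar>(LINT t|M. indicator J t * indicator J (t + h n) * D n t) - (LINT t|M. indicator J t * g t (v t))\<bar> < \<epsilon>"
        using n0[of n] err[of n] err0 \<delta>G \<epsilon> by linarith
    qed
  qed
  then show ?thesis unfolding M_def J_def by (intro LIMSEQ_I) simp
qed

end

section \<open>Continuous representatives\<close>

text \<open>As a function of its second argument, this is the functional that the pivot space \<open>L\<^sup>2\<close>
  assigns to \<open>f\<close>.\<close>

definition L2_prod :: "'a::euclidean_space set \<Rightarrow> ('a \<Rightarrow> real) \<Rightarrow> ('a \<Rightarrow> real) \<Rightarrow> real"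
  where "L2_prod \<Omega> f g = (LINT x|lebesgue_on \<Omega>. f x * g x)"

lemma L2_prod_commute: "L2_prod \<Omega> f g = L2_prod \<Omega> g f"
  by (simp add: L2_prod_def mult.commute)

lemma L2_prod_bound: "f \<in> L2 \<Omega> \<Longrightarrow> g \<in> L2 \<Omega> \<Longrightarrow> \<bar>L2_prod \<Omega> f g\<bar> \<le> L2_norm \<Omega> f * L2_norm \<Omega> g"
  unfolding L2_prod_def by (rule L2_inner(2))

lemma L2_prod_self: "L2_prod \<Omega> f f = (L2_norm \<Omega> f)\<^sup>2"
  unfolding L2_norm_power2 L2_prod_def by (simp add: power2_eq_square)

lemma L2_prod_add_scale:
  assumes "f \<in> L2 \<Omega>" "g \<in> L2 \<Omega>" "y \<in> L2 \<Omega>"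
  shows "L2_prod \<Omega> (f + c *\<^sub>R g) y = L2_prod \<Omega> f y + c * L2_prod \<Omega> g y"
proof -
  have "L2_prod \<Omega> (f + c *\<^sub>R g) y = (LINT x|lebesgue_on \<Omega>. f x * y x + c * (g x * y x))"
    by (simp add: L2_prod_def scaleR_fun_def algebra_simps)
  also have "\<dots> = L2_prod \<Omega> f y + c * L2_prod \<Omega> g y"
    using L2_inner(1)[OF assms(1,3)] L2_inner(1)[OF assms(2,3)] by (simp add: L2_prod_def)
  finally show ?thesis .
qed

lemma L2_prod_diff:
  assumes "f \<in> L2 \<Omega>" "g \<in> L2 \<Omega>" "y \<in> L2 \<Omega>"
  shows "L2_prod \<Omega> (f - g) y = L2_prod \<Omega> f y - L2_prod \<Omega> g y"
    "L2_prod \<Omega> y (f - g) = L2_prod \<Omega> y f - L2_prod \<Omega> y g"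
  using L2_prod_add_scale[OF assms, of "-1"] by (simp_all add: L2_prod_commute[of \<Omega> y])

lemma L2_prod_AE_eq:
  assumes "f \<in> L2 \<Omega>" "g \<in> L2 \<Omega>" "y \<in> L2 \<Omega>" "AE x in lebesgue_on \<Omega>. f x = g x"
  shows "L2_prod \<Omega> f y = L2_prod \<Omega> g y" "L2_prod \<Omega> y f = L2_prod \<Omega> y g"
proof -
  show 1: "L2_prod \<Omega> f y = L2_prod \<Omega> g y"
    unfolding L2_prod_def
    by (rule integral_cong_AE) (use assms L2D(1) in \<open>auto intro!: borel_measurable_times elim: eventually_mono\<close>)
  then show "L2_prod \<Omega> y f = L2_prod \<Omega> y g" by (simp add: L2_prod_commute[of \<Omega> y])
qed

definition L2_continuous_on :: "'a::euclidean_space set \<Rightarrow> real set \<Rightarrow> (real \<Rightarrow> 'a \<Rightarrow> real) \<Rightarrow> bool"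
  where "L2_continuous_on \<Omega> A w \<longleftrightarrow>
    (\<forall>t\<in>A. w t \<in> L2 \<Omega> \<and> ((\<lambda>\<tau>. L2_norm \<Omega> (w \<tau> - w t)) \<longlongrightarrow> 0) (at t within A))"

text \<open>\<open>w\<close> is a representative of \<open>u\<close> in \<open>C([0,T]; L\<^sup>2)\<close>.\<close>

definition time_rep :: "'a::euclidean_space set \<Rightarrow> real \<Rightarrow> (real \<Rightarrow> 'a \<Rightarrow> real) \<Rightarrow> (real \<Rightarrow> 'a \<Rightarrow> real) \<Rightarrow> bool"
  where "time_rep \<Omega> T u w \<longleftrightarrow> L2_continuous_on \<Omega> {0..T} w \<and>
    (AE t in lebesgue_on {0<..<T}. AE x in lebesgue_on \<Omega>. w t x = u t x)"

lemma has_time_value_iff: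
  "has_time_value \<Omega> T u t0 h \<longleftrightarrow> (\<exists>w. time_rep \<Omega> T u w \<and> (AE x in lebesgue_on \<Omega>. w t0 x = h x))"
  by (simp add: has_time_value_def time_rep_def L2_continuous_on_def conj_assoc)

lemma L2_continuous_on_shift:
  assumes w: "L2_continuous_on \<Omega> B w" and AB: "\<And>t. t \<in> A \<Longrightarrow> t + h \<in> B"
  shows "L2_continuous_on \<Omega> A (\<lambda>t. w (t + h))"
  unfolding L2_continuous_on_def
proof (intro ballI conjI)
  fix t assume t: "t \<in> A"
  show "w (t + h) \<in> L2 \<Omega>" using w AB[OF t] by (simp add: L2_continuous_on_def)
  have lim: "((\<lambda>\<tau>. L2_norm \<Omega> (w \<tau> - w (t + h))) \<longlongrightarrow> 0) (at (t + h) within B)"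
    using w AB[OF t] by (simp add: L2_continuous_on_def)
  have "((\<lambda>\<tau>. \<tau> + h) \<longlongrightarrow> t + h) (at t within A)" by (intro tendsto_intros)
  then have "filterlim (\<lambda>\<tau>. \<tau> + h) (at (t + h) within B) (at t within A)"
    unfolding filterlim_at using AB by (auto simp: eventually_at_filter)
  from filterlim_compose[OF lim this]
  show "((\<lambda>\<tau>. L2_norm \<Omega> (w (\<tau> + h) - w (t + h))) \<longlongrightarrow> 0) (at t within A)" .
qed

lemma L2_continuous_on_prod:
  assumes v: "L2_continuous_on \<Omega> A v" and w: "L2_continuous_on \<Omega> A w"
  shows "continuous_on A (\<lambda>t. L2_prod \<Omega> (v t) (w t))"
  unfolding continuous_on
proof
  fix t assume t: "t \<in> A"
  have mem: "v \<tau> \<in> L2 \<Omega>" "w \<tau> \<in> L2 \<Omega>" if "\<tau> \<in> A" for \<tau> using v w that by (auto simp: L2_continuous_on_def)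
  have lv: "((\<lambda>\<tau>. L2_norm \<Omega> (v \<tau> - v t)) \<longlongrightarrow> 0) (at t within A)"
    and lw: "((\<lambda>\<tau>. L2_norm \<Omega> (w \<tau> - w t)) \<longlongrightarrow> 0) (at t within A)"
    using v w t by (auto simp: L2_continuous_on_def)
  have "((\<lambda>\<tau>. L2_prod \<Omega> (v \<tau>) (w \<tau>) - L2_prod \<Omega> (v t) (w t)) \<longlongrightarrow> 0) (at t within A)"
  proof (rule Lim_null_comparison)
    have "norm (L2_prod \<Omega> (v \<tau>) (w \<tau>) - L2_prod \<Omega> (v t) (w t)) \<le>
      L2_norm \<Omega> (v \<tau> - v t) * (L2_norm \<Omega> (w t) + L2_norm \<Omega> (w \<tau> - w t)) + L2_norm \<Omega> (v t) * L2_norm \<Omega> (w \<tau> - w t)"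
      if "\<tau> \<in> A" for \<tau>
    proof -
      note m = mem[OF that] mem[OF t]
      have "L2_prod \<Omega> (v \<tau>) (w \<tau>) - L2_prod \<Omega> (v t) (w t) = L2_prod \<Omega> (v \<tau> - v t) (w \<tau>) + L2_prod \<Omega> (v t) (w \<tau> - w t)"
        using L2_prod_diff(1)[OF m(1) m(3) m(2)] L2_prod_diff(2)[OF m(2) m(4) m(3)] by simp
      moreover have "\<bar>L2_prod \<Omega> (v \<tau> - v t) (w \<tau>)\<bar> \<le> L2_norm \<Omega> (v \<tau> - v t) * L2_norm \<Omega> (w \<tau>)"
        by (intro L2_prod_bound L2.diff_mem m)
      moreover have "L2_norm \<Omega> (v \<tau> - v t) * L2_norm \<Omega> (w \<tau>) \<le> L2_norm \<Omega> (v \<tau> - v t) * (L2_norm \<Omega> (w t) + L2_norm \<Omega> (w \<tau> - w t))"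
        using L2.N_reverse[OF m(2) m(4)] by (intro mult_left_mono L2_norm_nonneg) simp
      moreover have "\<bar>L2_prod \<Omega> (v t) (w \<tau> - w t)\<bar> \<le> L2_norm \<Omega> (v t) * L2_norm \<Omega> (w \<tau> - w t)"
        by (intro L2_prod_bound L2.diff_mem m)
      ultimately show ?thesis by simp
    qed
    then show "\<forall>\<^sub>F \<tau> in at t within A. norm (L2_prod \<Omega> (v \<tau>) (w \<tau>) - L2_prod \<Omega> (v t) (w t)) \<le>
      L2_norm \<Omega> (v \<tau> - v t) * (L2_norm \<Omega> (w t) + L2_norm \<Omega> (w \<tau> - w t)) + L2_norm \<Omega> (v t) * L2_norm \<Omega> (w \<tau> - w t)"
      by (simp add: eventually_at_filter)
    have "((\<lambda>\<tau>. L2_norm \<Omega> (v \<tau> - v t) * (L2_norm \<Omega> (w t) + L2_norm \<Omega> (w \<tau> - w t)) + L2_norm \<Omega> (v t) * L2_norm \<Omega> (w \<tau> - w t))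
      \<longlongrightarrow> 0 * (L2_norm \<Omega> (w t) + 0) + L2_norm \<Omega> (v t) * 0) (at t within A)"
      by (intro tendsto_intros lv lw)
    then show "((\<lambda>\<tau>. L2_norm \<Omega> (v \<tau> - v t) * (L2_norm \<Omega> (w t) + L2_norm \<Omega> (w \<tau> - w t)) + L2_norm \<Omega> (v t) * L2_norm \<Omega> (w \<tau> - w t))
      \<longlongrightarrow> 0) (at t within A)" by simp
  qed
  then show "((\<lambda>\<tau>. L2_prod \<Omega> (v \<tau>) (w \<tau>)) \<longlongrightarrow> L2_prod \<Omega> (v t) (w t)) (at t within A)"
    by (rule LIM_zero_cancel)
qed

lemma L2_continuous_on_const: "y \<in> L2 \<Omega> \<Longrightarrow> L2_continuous_on \<Omega> A (\<lambda>t. y)"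
  by (simp add: L2_continuous_on_def L2.N_zero)

lemma L2_continuous_on_diff:
  assumes v: "L2_continuous_on \<Omega> A v" and w: "L2_continuous_on \<Omega> A w"
  shows "L2_continuous_on \<Omega> A (v - w)"
  unfolding L2_continuous_on_def
proof (intro ballI conjI)
  fix t assume t: "t \<in> A"
  have mem: "v \<tau> \<in> L2 \<Omega>" "w \<tau> \<in> L2 \<Omega>" if "\<tau> \<in> A" for \<tau> using v w that by (auto simp: L2_continuous_on_def)
  show "(v - w) t \<in> L2 \<Omega>" using mem[OF t] L2.diff_mem by simp
  have lv: "((\<lambda>\<tau>. L2_norm \<Omega> (v \<tau> - v t)) \<longlongrightarrow> 0) (at t within A)"
    and lw: "((\<lambda>\<tau>. L2_norm \<Omega> (w \<tau> - w t)) \<longlongrightarrow> 0) (at t within A)"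
    using v w t by (auto simp: L2_continuous_on_def)
  show "((\<lambda>\<tau>. L2_norm \<Omega> ((v - w) \<tau> - (v - w) t)) \<longlongrightarrow> 0) (at t within A)"
  proof (rule Lim_null_comparison)
    have "norm (L2_norm \<Omega> ((v - w) \<tau> - (v - w) t)) \<le> L2_norm \<Omega> (v \<tau> - v t) + L2_norm \<Omega> (w \<tau> - w t)" if "\<tau> \<in> A" for \<tau>
    proof -
      have eq: "(v - w) \<tau> - (v - w) t = (v \<tau> - v t) - (w \<tau> - w t)" by simp
      show ?thesis
        unfolding eq real_norm_def abs_of_nonneg[OF L2_norm_nonneg]
        by (intro L2.N_diff_le L2.diff_mem mem that t)
    qed
    then show "\<forall>\<^sub>F \<tau> in at t within A. norm (L2_norm \<Omega> ((v - w) \<tau> - (v - w) t)) \<le> L2_norm \<Omega> (v \<tau> - v t) + L2_norm \<Omega> (w \<tau> - w t)"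
      by (simp add: eventually_at_filter)
    show "((\<lambda>\<tau>. L2_norm \<Omega> (v \<tau> - v t) + L2_norm \<Omega> (w \<tau> - w t)) \<longlongrightarrow> 0) (at t within A)"
      using tendsto_add[OF lv lw] by simp
  qed
qed

lemma time_rep_diff:
  assumes "time_rep \<Omega> T u w" "time_rep \<Omega> T u' w'"
  shows "time_rep \<Omega> T (u - u') (w - w')"
proof -
  have "AE t in lebesgue_on {0<..<T}. (AE x in lebesgue_on \<Omega>. w t x = u t x) \<and> (AE x in lebesgue_on \<Omega>. w' t x = u' t x)"
    using assms by (auto simp: time_rep_def)
  then have "AE t in lebesgue_on {0<..<T}. AE x in lebesgue_on \<Omega>. (w - w') t x = (u - u') t x"
  proof eventually_elim
    case (elim t)
    from elim[THEN conjunct1] elim[THEN conjunct2] show ?case by eventually_elim simp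
  qed
  then show ?thesis using assms L2_continuous_on_diff by (auto simp: time_rep_def)
qed

section \<open>Integration by parts in time\<close>

lemma lebesgue_on_interval_integral:
  fixes c :: "real \<Rightarrow> real"
  assumes c: "continuous_on {p..q} c" and sub: "{p<..<q} \<subseteq> {0<..<T}"
  shows "(\<lambda>t. indicator {p<..<q} t * c t) \<in> borel_measurable (lebesgue_on {0<..<T})"
    "(LINT t|lebesgue_on {0<..<T}. indicator {p<..<q} t * c t) = integral {p..q} c"
proof -
  have Fm: "(\<lambda>t. indicator {p<..<q} t * c t) \<in> borel_measurable borel"
    using borel_measurable_continuous_on_indicator[OF _ continuous_on_subset[OF c], of "{p<..<q}"] by (simp add: subset_iff)
  note tr = interval_to_lborel[where F = "\<lambda>t. indicator {p<..<q} t * c t" and f = "\<lambda>t. indicator {p<..<q} t * c t" and a = 0 and b = T]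
  show "(\<lambda>t. indicator {p<..<q} t * c t) \<in> borel_measurable (lebesgue_on {0<..<T})"
    by (rule tr(3)[OF Fm]) (use sub in \<open>auto simp: indicator_def subset_iff\<close>)
  have si: "set_integrable lborel {p<..<q} c"
    by (rule set_integrable_subset[OF borel_integrable_atLeastAtMost'[OF c]]) auto
  have "(LINT t|lebesgue_on {0<..<T}. indicator {p<..<q} t * c t) = (LINT t|lborel. indicator {p<..<q} t * c t)"
    by (rule tr(2)[OF Fm]) (use sub in \<open>auto simp: indicator_def subset_iff\<close>)
  also have "\<dots> = integral {p<..<q} c"
    using set_borel_integral_eq_integral(2)[OF si] by (simp add: set_lebesgue_integral_def)
  also have "\<dots> = integral {p..q} c" using integral_open_interval[of p q c] by (simp add: box_real)
  finally show "(LINT t|lebesgue_on {0<..<T}. indicator {p<..<q} t * c t) = integral {p..q} c" .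
qed

lemma test_function_deriv:
  fixes \<psi> :: "real \<Rightarrow> real"
  assumes \<psi>: "\<psi> \<in> test_functions \<Omega>"
  shows "deriv \<psi> = (\<lambda>t. frechet_derivative \<psi> (at t) 1)"
proof
  fix t
  have "(\<psi> has_real_derivative frechet_derivative \<psi> (at t) 1) (at t)"
  proof -
    have "frechet_derivative \<psi> (at t) h = frechet_derivative \<psi> (at t) 1 * h" for h
    proof -
      have "frechet_derivative \<psi> (at t) (h *\<^sub>R 1) = h *\<^sub>R frechet_derivative \<psi> (at t) 1"
        by (rule linear_scale[OF has_derivative_linear[OF test_functionD(1)[OF \<psi>]]])
      then show ?thesis by (simp only: real_scaleR_def mult_1_right) (rule mult.commute)
    qed
    then have eq: "frechet_derivative \<psi> (at t) = (*) (frechet_derivative \<psi> (at t) 1)" by (rule ext)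
    show ?thesis unfolding has_field_derivative_def eq[symmetric] by (rule test_functionD(1)[OF \<psi>])
  qed
  then show "deriv \<psi> t = frechet_derivative \<psi> (at t) 1" by (rule DERIV_imp_deriv)
qed

locale evolution_domain =
  fixes \<Omega> :: "'a::euclidean_space set" and T :: real
  assumes \<Omega>: "open \<Omega>"

sublocale evolution_domain \<subseteq> H10: seminorm_space "H10 \<Omega>" "H1_norm \<Omega>"
  by (rule H10_seminorm_space[OF \<Omega>])

sublocale evolution_domain \<subseteq> dual: seminorm_space "H10_dual \<Omega>" "H10_dual_norm \<Omega>"
  by (rule H10.dual_seminorm_space)

context evolution_domain
begin

lemma L2_prod_H10_measurable:
  assumes u: "u \<in> U_space \<Omega> T" and y: "y \<in> H10 \<Omega>"
  shows "integrable (lebesgue_on {0<..<T}) (\<lambda>t. L2_prod \<Omega> (u t) y)"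
proof -
  have yL: "y \<in> L2 \<Omega>" by (rule H10D(1)[OF y])
  have "(\<lambda>v. L2_prod \<Omega> v y) \<in> H10_dual \<Omega>"
  proof (rule H10.dual_memI[where K = "L2_norm \<Omega> y"])
    fix v w assume "v \<in> H10 \<Omega>" "w \<in> H10 \<Omega>"
    then show "L2_prod \<Omega> (v + w) y = L2_prod \<Omega> v y + L2_prod \<Omega> w y"
      using L2_prod_add_scale[of v \<Omega> w y 1] H10D(1) yL by auto
  next
    fix c v assume v: "v \<in> H10 \<Omega>"
    show "L2_prod \<Omega> (c *\<^sub>R v) y = c * L2_prod \<Omega> v y"
      using L2_prod_add_scale[OF L2.zero_mem H10D(1)[OF v] yL, of c] by (simp add: L2_prod_def)
    have "\<bar>L2_prod \<Omega> v y\<bar> \<le> L2_norm \<Omega> v * L2_norm \<Omega> y" by (rule L2_prod_bound[OF H10D(1)[OF v] yL])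
    also have "\<dots> \<le> H1_norm \<Omega> v * L2_norm \<Omega> y" by (intro mult_right_mono L2_norm_le_H1_norm L2_norm_nonneg)
    finally show "\<bar>L2_prod \<Omega> v y\<bar> \<le> L2_norm \<Omega> y * H1_norm \<Omega> v" by (simp add: mult.commute)
  qed
  from H10.pairing_measurable(2)[OF dual.constant_bochner_L2[OF this] u] show ?thesis .
qed

lemma time_rep_prod:
  assumes u: "u \<in> U_space \<Omega> T" and w: "time_rep \<Omega> T u w"
  shows "AE t in lebesgue_on {0<..<T}. \<forall>y\<in>L2 \<Omega>. u t \<in> H10 \<Omega> \<and> L2_prod \<Omega> y (w t) = L2_prod \<Omega> y (u t) \<and> L2_norm \<Omega> (w t) = L2_norm \<Omega> (u t)"
proof -
  have "AE t in lebesgue_on {0<..<T}. AE x in lebesgue_on \<Omega>. w t x = u t x" using w by (simp add: time_rep_def)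
  with H10.bochner_L2D(2)[OF u] AE_space show ?thesis
  proof eventually_elim
    case (elim t)
    then have "w t \<in> L2 \<Omega>" using w by (simp add: time_rep_def L2_continuous_on_def)
    then show ?case using L2_prod_AE_eq(2) L2_AE_eq elim(1,3) H10D(1) by blast
  qed
qed

text \<open>The definition of \<open>is_time_deriv\<close> with a fixed \<open>y\<close> is a statement about weak derivatives of the
  scalar function \<open>t \<mapsto> \<langle>w(t), y\<rangle>\<close>.\<close>

lemma time_deriv_increment:
  assumes u: "u \<in> U_space \<Omega> T" and g: "is_time_deriv \<Omega> T u g" and w: "time_rep \<Omega> T u w" and y: "y \<in> H10 \<Omega>"
    and st: "0 \<le> s" "s \<le> t" "t \<le> T"
  shows "L2_prod \<Omega> (w t) y - L2_prod \<Omega> (w s) y = (LINT r|lebesgue_on {0<..<T}. indicator {s<..<t} r * g r y)"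
proof -
  have yL: "y \<in> L2 \<Omega>" by (rule H10D(1)[OF y])
  have gU: "g \<in> Udual_space \<Omega> T" using g by (simp add: is_time_deriv_def)
  have cont: "continuous_on {0..T} (\<lambda>t. L2_prod \<Omega> (w t) y)"
    using w L2_continuous_on_prod[OF _ L2_continuous_on_const[OF yL]] by (auto simp: time_rep_def)
  have ae: "AE t in lebesgue_on {0<..<T}. L2_prod \<Omega> (u t) y = L2_prod \<Omega> (w t) y"
    using time_rep_prod[OF u w] by eventually_elim (use yL in \<open>simp add: L2_prod_commute[of _ _ y]\<close>)
  show ?thesis
  proof (rule weak_derivative_imp_integral[OF cont _ _ st])
    show "integrable (lebesgue_on {0<..<T}) (\<lambda>r. g r y)"
      by (rule H10.pairing_measurable(2)[OF gU H10.constant_bochner_L2[OF y]])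
    fix \<psi> :: "real \<Rightarrow> real" assume \<psi>: "\<psi> \<in> test_functions {0<..<T}"
    have "(LINT t|lebesgue_on {0<..<T}. deriv \<psi> t * L2_prod \<Omega> (w t) y) =
      (LINT t|lebesgue_on {0<..<T}. deriv \<psi> t * L2_prod \<Omega> (u t) y)"
    proof (rule integral_cong_AE)
      have d: "deriv \<psi> = (\<lambda>t. frechet_derivative \<psi> (at t) 1)" by (rule test_function_deriv[OF \<psi>])
      have dm: "deriv \<psi> \<in> borel_measurable (lebesgue_on {0<..<T})"
        unfolding d by (intro continuous_imp_lebesgue_measurable test_functionD(2)[OF test_functionD(6)[OF \<psi>]]) simp
      have um: "(\<lambda>t. L2_prod \<Omega> (u t) y) \<in> borel_measurable (lebesgue_on {0<..<T})"
        using L2_prod_H10_measurable[OF u y] by (rule borel_measurable_integrable)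
      show "(\<lambda>t. deriv \<psi> t * L2_prod \<Omega> (u t) y) \<in> borel_measurable (lebesgue_on {0<..<T})"
        by (rule borel_measurable_times[OF dm um])
      show "(\<lambda>t. deriv \<psi> t * L2_prod \<Omega> (w t) y) \<in> borel_measurable (lebesgue_on {0<..<T})"
        by (rule borel_measurable_times[OF dm lebesgue_on_measurable_AE[OF interval_sets um ae]])
      show "AE t in lebesgue_on {0<..<T}. deriv \<psi> t * L2_prod \<Omega> (w t) y = deriv \<psi> t * L2_prod \<Omega> (u t) y"
        using ae by eventually_elim simp
    qed
    also have "\<dots> = - (LINT t|lebesgue_on {0<..<T}. \<psi> t * g t y)"
      using g \<psi> y by (simp add: is_time_deriv_def L2_prod_def)
    finally show "(LINT t|lebesgue_on {0<..<T}. deriv \<psi> t * L2_prod \<Omega> (w t) y) = - (LINT t|lebesgue_on {0<..<T}. \<psi> t * g t y)" .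
  qed
qed

text \<open>A discrete product rule: with \<open>F(t) = \<langle>u(t), v(t)\<rangle>\<close> and the difference quotients
  \<open>D1(t) = \<langle>u(t), v(t+h) - v(t)\<rangle> / h\<close> and \<open>D2(t) = \<langle>u(t) - u(t-h), v(t)\<rangle> / h\<close>, the sum of the
  integrals of \<open>D1\<close> over \<open>(0, \<beta>-h)\<close> and of \<open>D2\<close> over \<open>(h, \<beta>)\<close> telescopes to the
  difference of the means of \<open>F\<close> over \<open>(\<beta>-h, \<beta>)\<close> and \<open>(0, h)\<close>, which tends to
  \<open>F(\<beta>) - F(0)\<close> by continuity. The integrals themselves converge by
  \<open>increment_quotient_limit\<close>. No approximation of \<open>u\<close> and \<open>v\<close> by smooth functions of time is
  involved.\<close>

lemma integration_by_parts:
  assumes u: "u \<in> U_space \<Omega> T" "is_time_deriv \<Omega> T u gu" "time_rep \<Omega> T u wu"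
    and v: "v \<in> U_space \<Omega> T" "is_time_deriv \<Omega> T v gv" "time_rep \<Omega> T v wv"
    and \<beta>: "0 < \<beta>" "\<beta> \<le> T"
  shows "(LINT t|lebesgue_on {0<..<T}. indicator {0<..<\<beta>} t * gv t (u t)) + (LINT t|lebesgue_on {0<..<T}. indicator {0<..<\<beta>} t * gu t (v t))
    = L2_prod \<Omega> (wu \<beta>) (wv \<beta>) - L2_prod \<Omega> (wu 0) (wv 0)"
proof -
  define J where "J = {0<..<\<beta>}"
  define h where "h n = \<beta> / (real n + 2)" for n
  have h: "0 < h n" "h n < \<beta>" "h n \<noteq> 0" for n
  proof -
    show "0 < h n" "h n \<noteq> 0" using \<beta> by (simp_all add: h_def add_nonneg_eq_0_iff)
    have "\<beta> * 1 < \<beta> * (real n + 2)" using \<beta> by (intro mult_strict_left_mono) auto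
    then show "h n < \<beta>" by (simp add: h_def pos_divide_less_eq)
  qed
  have h0: "h \<longlonglongrightarrow> 0"
  proof -
    have "filterlim (\<lambda>n. real n + 2) at_top sequentially"
      using filterlim_tendsto_add_at_top[OF tendsto_const[of 2] filterlim_real_sequentially] by (simp add: add.commute)
    then show ?thesis unfolding h_def using tendsto_divide_0[OF tendsto_const[of \<beta>]] filterlim_at_top_imp_at_infinity by blast
  qed
  have cu: "L2_continuous_on \<Omega> {0..T} wu" and cv: "L2_continuous_on \<Omega> {0..T} wv" using u v by (auto simp: time_rep_def)
  have wL: "wu t \<in> L2 \<Omega>" "wv t \<in> L2 \<Omega>" if "t \<in> {0..T}" for t using cu cv that by (auto simp: L2_continuous_on_def)
  have gU: "gu \<in> Udual_space \<Omega> T" "gv \<in> Udual_space \<Omega> T" using u v by (auto simp: is_time_deriv_def)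
  define F where "F t = L2_prod \<Omega> (wu t) (wv t)" for t
  define G where "G n t = L2_prod \<Omega> (wu t) (wv (t + h n))" for n t
  define H where "H n t = L2_prod \<Omega> (wu (t + - h n)) (wv t)" for n t
  have Fc: "continuous_on {0..T} F" unfolding F_def by (rule L2_continuous_on_prod[OF cu cv])
  have sub_cu: "L2_continuous_on \<Omega> A wu" "L2_continuous_on \<Omega> A wv" if "A \<subseteq> {0..T}" for A
    using L2_continuous_on_shift[OF cu, of A 0] L2_continuous_on_shift[OF cv, of A 0] that by (auto simp: subset_iff)
  have Gc: "continuous_on {0..\<beta> - h n} (G n)" for n
    unfolding G_def using h(1,2)[of n] \<beta>
    by (intro L2_continuous_on_prod sub_cu L2_continuous_on_shift[OF cv]) auto
  have Hc: "continuous_on {h n..\<beta>} (H n)" for n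
    unfolding H_def using h(1,2)[of n] \<beta>
    by (intro L2_continuous_on_prod sub_cu L2_continuous_on_shift[OF cu]) auto
  define D1 where "D1 n t = inverse (h n) * (G n t - F t)" for n t
  define D2 where "D2 n t = inverse (h n) * (F t - H n t)" for n t
  have ind1: "indicator J t * indicator J (t + h n) = (indicator {0<..<\<beta> - h n} t :: real)" for n t
    using h(1)[of n] by (auto simp: J_def indicator_def)
  have ind2: "indicator J t * indicator J (t + - h n) = (indicator {h n<..<\<beta>} t :: real)" for n t
    using h(1)[of n] by (auto simp: J_def indicator_def)
  have D1c: "continuous_on {0..\<beta> - h n} (D1 n)" for n
    unfolding D1_def using h(1)[of n] \<beta> by (intro continuous_intros Gc continuous_on_subset[OF Fc]) auto
  have D2c: "continuous_on {h n..\<beta>} (D2 n)" for n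
    unfolding D2_def using h(1,2)[of n] \<beta> by (intro continuous_intros Hc continuous_on_subset[OF Fc]) auto
  have s1: "{0<..<\<beta> - h n} \<subseteq> {0<..<T}" and s2: "{h n<..<\<beta>} \<subseteq> {0<..<T}" for n
    using h(1)[of n] \<beta> by auto
  note I1 = lebesgue_on_interval_integral[OF D1c s1] and I2 = lebesgue_on_interval_integral[OF D2c s2]
  have lim1: "(\<lambda>n. integral {0..\<beta> - h n} (D1 n)) \<longlonglongrightarrow> (LINT t|lebesgue_on {0<..<T}. indicator {0<..<\<beta>} t * gv t (u t))"
  proof -
    have "(\<lambda>n. LINT t|lebesgue_on {0<..<T}. indicator {0<..<\<beta>} t * indicator {0<..<\<beta>} (t + h n) * D1 n t) \<longlonglongrightarrow>
      (LINT t|lebesgue_on {0<..<T}. indicator {0<..<\<beta>} t * gv t (u t))"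
    proof (rule H10.increment_quotient_limit[OF gU(2) u(1) \<beta>(2) h0 h(3)])
      show "(\<lambda>t. indicator {0<..<\<beta>} t * indicator {0<..<\<beta>} (t + h n) * D1 n t) \<in> borel_measurable (lebesgue_on {0<..<T})" for n
        unfolding J_def[symmetric] ind1 by (rule I1(1))
      show "AE t in lebesgue_on {0<..<T}. t \<in> {0<..<\<beta>} \<longrightarrow> t + h n \<in> {0<..<\<beta>} \<longrightarrow>
        D1 n t = H10.increment_quotient T gv (h n) t (u t)" for n
        using time_rep_prod[OF u(1,3)]
      proof eventually_elim
        case (elim t)
        show ?case
        proof (intro impI)
          assume t: "t \<in> {0<..<\<beta>}" "t + h n \<in> {0<..<\<beta>}"
          have tT: "t \<in> {0..T}" "t + h n \<in> {0..T}" using t \<beta> by auto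
          have uH: "u t \<in> H10 \<Omega>" using elim wL(1)[OF tT(1)] by blast
          have "G n t - F t = L2_prod \<Omega> (wv (t + h n)) (u t) - L2_prod \<Omega> (wv t) (u t)"
            using elim wL(2)[OF tT(1)] wL(2)[OF tT(2)] by (simp add: G_def F_def L2_prod_commute[of \<Omega> "wu t"])
          also have "\<dots> = (LINT r|lebesgue_on {0<..<T}. indicator {t<..<t + h n} r * gv r (u t))"
            by (rule time_deriv_increment[OF v uH]) (use t \<beta> h(1)[of n] in auto)
          finally show "D1 n t = H10.increment_quotient T gv (h n) t (u t)"
            using h(1)[of n] by (simp add: D1_def H10.increment_quotient_def min_def max_def)
        qed
      qed
    qed
    then show ?thesis unfolding J_def[symmetric] ind1 I1(2) .
  qed
  have lim2: "(\<lambda>n. integral {h n..\<beta>} (D2 n)) \<longlonglongrightarrow> (LINT t|lebesgue_on {0<..<T}. indicator {0<..<\<beta>} t * gu t (v t))"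
  proof -
    have h0': "(\<lambda>n. - h n) \<longlonglongrightarrow> 0" "\<And>n. - h n \<noteq> 0" using tendsto_minus[OF h0] h(3) by auto
    have "(\<lambda>n. LINT t|lebesgue_on {0<..<T}. indicator {0<..<\<beta>} t * indicator {0<..<\<beta>} (t + - h n) * D2 n t) \<longlonglongrightarrow>
      (LINT t|lebesgue_on {0<..<T}. indicator {0<..<\<beta>} t * gu t (v t))"
    proof (rule H10.increment_quotient_limit[OF gU(1) v(1) \<beta>(2) h0'])
      show "(\<lambda>t. indicator {0<..<\<beta>} t * indicator {0<..<\<beta>} (t + - h n) * D2 n t) \<in> borel_measurable (lebesgue_on {0<..<T})" for n
        unfolding J_def[symmetric] ind2 by (rule I2(1))
      show "AE t in lebesgue_on {0<..<T}. t \<in> {0<..<\<beta>} \<longrightarrow> t + - h n \<in> {0<..<\<beta>} \<longrightarrow>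
        D2 n t = H10.increment_quotient T gu (- h n) t (v t)" for n
        using time_rep_prod[OF v(1,3)]
      proof eventually_elim
        case (elim t)
        show ?case
        proof (intro impI)
          assume t: "t \<in> {0<..<\<beta>}" "t + - h n \<in> {0<..<\<beta>}"
          have tT: "t \<in> {0..T}" "t + - h n \<in> {0..T}" using t \<beta> by auto
          have vH: "v t \<in> H10 \<Omega>" using elim wL(1)[OF tT(1)] by blast
          have "F t - H n t = L2_prod \<Omega> (wu t) (v t) - L2_prod \<Omega> (wu (t + - h n)) (v t)"
            using elim wL(1)[OF tT(1)] wL(1)[OF tT(2)] by (simp add: H_def F_def)
          also have "\<dots> = (LINT r|lebesgue_on {0<..<T}. indicator {t + - h n<..<t} r * gu r (v t))"
            by (rule time_deriv_increment[OF u vH]) (use t \<beta> h(1)[of n] in auto)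
          finally show "D2 n t = H10.increment_quotient T gu (- h n) t (v t)"
            using h(1)[of n] by (simp add: D2_def H10.increment_quotient_def min_def max_def)
        qed
      qed
    qed
    then show ?thesis unfolding J_def[symmetric] ind2 I2(2) .
  qed
  define \<Phi> where "\<Phi> x = integral {0..x} F" for x
  have Fi: "F integrable_on {a..b}" if "0 \<le> a" "b \<le> T" for a b
    using that by (intro integrable_continuous_interval continuous_on_subset[OF Fc]) auto
  have sum: "integral {0..\<beta> - h n} (D1 n) + integral {h n..\<beta>} (D2 n) =
    (\<Phi> (\<beta> - h n) - \<Phi> \<beta>) / (- h n) - (\<Phi> (h n) - \<Phi> 0) / h n" for n
  proof -
    have Gi: "G n integrable_on {0..\<beta> - h n}" and Hi: "H n integrable_on {h n..\<beta>}"
      by (intro integrable_continuous_interval Gc Hc)+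
    have e1: "integral {0..\<beta> - h n} (D1 n) = inverse (h n) * (integral {0..\<beta> - h n} (G n) - integral {0..\<beta> - h n} F)"
      unfolding D1_def using Fi[of 0 "\<beta> - h n"] h(1)[of n] \<beta> Gi by (simp add: Henstock_Kurzweil_Integration.integral_diff)
    have e2: "integral {h n..\<beta>} (D2 n) = inverse (h n) * (integral {h n..\<beta>} F - integral {h n..\<beta>} (H n))"
      unfolding D2_def using Fi[of "h n" \<beta>] h(1)[of n] \<beta> Hi by (simp add: Henstock_Kurzweil_Integration.integral_diff)
    have e3: "integral {h n..\<beta>} (H n) = integral {0..\<beta> - h n} (G n)"
    proof -
      have "continuous_on {0 + h n..(\<beta> - h n) + h n} (H n)" using Hc[of n] by simp
      from integral_shift[OF this] have "integral {0..\<beta> - h n} (H n \<circ> (\<lambda>x. x + h n)) = integral {h n..\<beta>} (H n)" by simp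
      moreover have "H n \<circ> (\<lambda>x. x + h n) = G n" by (simp add: fun_eq_iff H_def G_def)
      ultimately show ?thesis by simp
    qed
    have e4: "integral {h n..\<beta>} F = \<Phi> \<beta> - \<Phi> (h n)"
      using Henstock_Kurzweil_Integration.integral_combine[of 0 "h n" \<beta> F] Fi[of 0 \<beta>] h(1,2)[of n] \<beta> by (simp add: \<Phi>_def)
    show ?thesis using h(3)[of n] unfolding e1 e2 e3 e4 by (simp add: \<Phi>_def field_simps)
  qed
  have "(\<lambda>n. (\<Phi> (\<beta> - h n) - \<Phi> \<beta>) / (- h n) - (\<Phi> (h n) - \<Phi> 0) / h n) \<longlonglongrightarrow> F \<beta> - F 0"
  proof (rule tendsto_diff)
    have D: "((\<lambda>y. (\<Phi> y - \<Phi> x) / (y - x)) \<longlongrightarrow> F x) (at x within {0..T})" if "x \<in> {0..T}" for x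
      using integral_has_real_derivative[OF Fc that] unfolding \<Phi>_def[symmetric] has_field_derivative_iff .
    have m1: "\<beta> - h n \<in> {0..T} \<and> \<beta> - h n \<noteq> \<beta>" and m2: "h n \<in> {0..T} \<and> h n \<noteq> 0" for n
      using h(1)[of n] h(2)[of n] \<beta> by auto
    have "(\<lambda>n. \<beta> - h n) \<longlonglongrightarrow> \<beta>" using tendsto_diff[OF tendsto_const[of \<beta>] h0] by simp
    then have "filterlim (\<lambda>n. \<beta> - h n) (at \<beta> within {0..T}) sequentially"
      unfolding filterlim_at using m1 by (simp add: always_eventually)
    from filterlim_compose[OF D[of \<beta>] this] show "(\<lambda>n. (\<Phi> (\<beta> - h n) - \<Phi> \<beta>) / (- h n)) \<longlonglongrightarrow> F \<beta>"
      using \<beta> by simp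
    have "filterlim h (at 0 within {0..T}) sequentially"
      unfolding filterlim_at using h0 m2 by (simp add: always_eventually)
    from filterlim_compose[OF D[of 0] this] show "(\<lambda>n. (\<Phi> (h n) - \<Phi> 0) / h n) \<longlonglongrightarrow> F 0"
      using \<beta> by simp
  qed
  moreover have "(\<lambda>n. (\<Phi> (\<beta> - h n) - \<Phi> \<beta>) / (- h n) - (\<Phi> (h n) - \<Phi> 0) / h n) \<longlonglongrightarrow>
    (LINT t|lebesgue_on {0<..<T}. indicator {0<..<\<beta>} t * gv t (u t)) + (LINT t|lebesgue_on {0<..<T}. indicator {0<..<\<beta>} t * gu t (v t))"
    using tendsto_add[OF lim1 lim2] unfolding sum .
  ultimately have "F \<beta> - F 0 = (LINT t|lebesgue_on {0<..<T}. indicator {0<..<\<beta>} t * gv t (u t)) +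
      (LINT t|lebesgue_on {0<..<T}. indicator {0<..<\<beta>} t * gu t (v t))"
    by (rule LIMSEQ_unique)
  then show ?thesis by (simp only: F_def)
qed

end

section \<open>The time derivative and the norm of \<open>V\<close>\<close>

lemma (in seminorm_space) almost_norming:
  assumes "l \<in> dual_space X N" "e > 0"
  shows "\<exists>v\<in>X. N v \<le> 1 \<and> dual_norm X N l - e < \<bar>l v\<bar>"
proof -
  have ne: "{\<bar>l x\<bar> | x. x \<in> X \<and> N x \<le> 1} \<noteq> {}" using zero_mem N_zero by auto
  have "dual_norm X N l - e < Sup {\<bar>l x\<bar> | x. x \<in> X \<and> N x \<le> 1}"
    using assms(2) by (simp add: dual_norm_def op_norm_def)
  from less_cSupD[OF ne this] show ?thesis by auto
qed

text \<open>For each \<open>y\<close> there is a null set outside which \<open>d t y = 0\<close>, but there are uncountably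
  many \<open>y\<close>. Strong measurability reduces the functionals to countably many,
  and each of these is normed by countably many \<open>y\<close>.\<close>

lemma (in seminorm_space) weakly_zero_imp_AE_zero:
  assumes d: "d \<in> bochner_L2 T (dual_space X N) (dual_norm X N)"
    and weak: "\<And>v. v \<in> X \<Longrightarrow> AE t in lebesgue_on {0<..<T}. d t v = 0"
  shows "AE t in lebesgue_on {0<..<T}. dual_norm X N (d t) = 0"
proof -
  interpret D: seminorm_space "dual_space X N" "dual_norm X N" by (rule dual_seminorm_space)
  note dD = D.bochner_L2D[OF d]
  obtain s where s: "\<And>n. simple_on T (dual_space X N) (s n)"
    and sl: "AE t in lebesgue_on {0<..<T}. (\<lambda>n::nat. dual_norm X N (s n t - d t)) \<longlonglongrightarrow> 0"
    using dD(1) by (auto simp: strongly_measurable_def)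
  have "\<forall>l m. \<exists>v. l \<in> dual_space X N \<longrightarrow> v \<in> X \<and> N v \<le> 1 \<and> dual_norm X N l - inverse (real (Suc m)) < \<bar>l v\<bar>"
    using almost_norming[of _ "inverse (real (Suc _))"] by (metis inverse_positive_iff_positive of_nat_0_less_iff zero_less_Suc)
  then obtain V where V: "\<And>l m. l \<in> dual_space X N \<Longrightarrow> V l m \<in> X \<and> N (V l m) \<le> 1 \<and> dual_norm X N l - inverse (real (Suc m)) < \<bar>l (V l m)\<bar>"
    by metis
  have "AE t in lebesgue_on {0<..<T}. \<forall>n m. \<forall>l \<in> s n ` {0<..<T}. d t (V l m) = 0"
    unfolding AE_all_countable
  proof (intro allI AE_finite_allI)
    fix n m l
    show "finite (s n ` {0<..<T})" using s[of n] by (simp add: simple_on_def)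
    assume "l \<in> s n ` {0<..<T}"
    then have "l \<in> dual_space X N" using s[of n] by (auto simp: simple_on_def)
    then show "AE t in lebesgue_on {0<..<T}. d t (V l m) = 0" using V by (intro weak) blast
  qed
  then show ?thesis using sl dD(2) AE_space
  proof eventually_elim
    case (elim t)
    have t: "t \<in> {0<..<T}" using elim(4) by simp
    have sD: "s n t \<in> dual_space X N" for n using s[of n] t by (auto simp: simple_on_def)
    have "dual_norm X N (d t) \<le> 2 * dual_norm X N (s n t - d t)" for n
    proof -
      define b where "b = dual_norm X N (s n t - d t)"
      have dm: "s n t - d t \<in> dual_space X N" by (rule D.diff_mem[OF sD elim(3)])
      have b0: "b \<ge> 0" unfolding b_def by (rule D.N_nonneg[OF dm])
      have step: "dual_norm X N (s n t) \<le> b + inverse (real (Suc m))" for m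
      proof -
        define v where "v = V (s n t) m"
        have v: "v \<in> X" "N v \<le> 1" "dual_norm X N (s n t) - inverse (real (Suc m)) < \<bar>s n t v\<bar>"
          using V[OF sD[of n], of m] by (auto simp: v_def)
        have "d t v = 0" using elim(1) t by (auto simp: v_def)
        then have "\<bar>s n t v\<bar> = \<bar>(s n t - d t) v\<bar>" by simp
        also have "\<dots> \<le> b * N v" unfolding b_def by (rule dual_bound[OF dm v(1)])
        also have "\<dots> \<le> b * 1" by (intro mult_left_mono v b0)
        finally show ?thesis using v(3) by simp
      qed
      have "(\<lambda>m. b + inverse (real (Suc m))) \<longlonglongrightarrow> b + 0"
        by (intro tendsto_intros LIMSEQ_inverse_real_of_nat)
      then have "dual_norm X N (s n t) \<le> b"
        using step by (intro LIMSEQ_le_const[of _ b]) auto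
      moreover have "dual_norm X N (d t) \<le> dual_norm X N (s n t) + dual_norm X N (s n t - d t)"
        using D.N_reverse[OF sD[of n] elim(3)] by simp
      ultimately show ?thesis by (simp add: b_def)
    qed
    moreover have "(\<lambda>n. 2 * dual_norm X N (s n t - d t)) \<longlonglongrightarrow> 0"
      using tendsto_mult_right_zero[OF elim(2), of 2] .
    ultimately have "dual_norm X N (d t) \<le> 0"
      using LIMSEQ_le_const[of "\<lambda>n. 2 * dual_norm X N (s n t - d t)" 0 "dual_norm X N (d t)"] by blast
    then show ?case using D.N_nonneg[OF elim(3)] by simp
  qed
qed

context evolution_domain
begin

lemma test_deriv_product_integrable:
  assumes \<psi>: "\<psi> \<in> test_functions {0<..<T}" and f: "integrable (lebesgue_on {0<..<T}) f"
  shows "integrable (lebesgue_on {0<..<T}) (\<lambda>t. \<psi> t * f t)"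
    "integrable (lebesgue_on {0<..<T}) (\<lambda>t. deriv \<psi> t * f t)"
proof -
  have gen: "integrable (lebesgue_on {0<..<T}) (\<lambda>t. k t * f t)" if k: "k \<in> test_functions {0<..<T}" for k
  proof -
    obtain a where a: "\<And>x. x \<notin> cbox (- a) a \<Longrightarrow> k x = 0" using test_functionD(3)[OF k] by blast
    have "compact (k ` cbox (- a) a)" by (intro compact_continuous_image test_functionD(2)[OF k]) auto
    then obtain C where C: "\<And>x. x \<in> cbox (- a) a \<Longrightarrow> \<bar>k x\<bar> \<le> C"
      unfolding compact_eq_bounded_closed bounded_iff by (metis image_eqI real_norm_def)
    have bnd: "\<bar>k x\<bar> \<le> max C 0" for x using a[of x] C[of x] by (cases "x \<in> cbox (- a) a") auto
    show ?thesis
    proof (rule Bochner_Integration.integrable_bound[OF integrable_mult_right[OF f, of "max C 0"]])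
      show "(\<lambda>t. k t * f t) \<in> borel_measurable (lebesgue_on {0<..<T})"
        by (intro borel_measurable_times borel_measurable_integrable[OF f] continuous_imp_lebesgue_measurable test_functionD(2)[OF k])
      show "AE t in lebesgue_on {0<..<T}. norm (k t * f t) \<le> norm (max C 0 * f t)"
        using bnd by (intro AE_I2) (simp add: abs_mult mult_right_mono)
    qed
  qed
  show "integrable (lebesgue_on {0<..<T}) (\<lambda>t. \<psi> t * f t)" by (rule gen[OF \<psi>])
  have "deriv \<psi> = (\<lambda>t. frechet_derivative \<psi> (at t) 1)"
    by (rule test_function_deriv[OF \<psi>])
  then show "integrable (lebesgue_on {0<..<T}) (\<lambda>t. deriv \<psi> t * f t)"
    using gen[OF test_functionD(6)[OF \<psi>, of 1]] by simp
qed

lemma pairing_integrable: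
  assumes "g \<in> Udual_space \<Omega> T" "y \<in> H10 \<Omega>"
  shows "integrable (lebesgue_on {0<..<T}) (\<lambda>t. g t y)"
  by (rule H10.pairing_measurable(2)[OF assms(1) H10.constant_bochner_L2[OF assms(2)]])

lemma is_time_deriv_diff:
  assumes u: "u \<in> U_space \<Omega> T" "is_time_deriv \<Omega> T u gu" and v: "v \<in> U_space \<Omega> T" "is_time_deriv \<Omega> T v gv"
  shows "is_time_deriv \<Omega> T (u - v) (gu - gv)"
  unfolding is_time_deriv_def
proof (intro conjI ballI)
  have gU: "gu \<in> Udual_space \<Omega> T" "gv \<in> Udual_space \<Omega> T" using u v by (auto simp: is_time_deriv_def)
  show "gu - gv \<in> Udual_space \<Omega> T" by (rule dual.bochner_L2_diff(1)[OF gU])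
  fix \<psi> :: "real \<Rightarrow> real" and y assume \<psi>: "\<psi> \<in> test_functions {0<..<T}" and y: "y \<in> H10 \<Omega>"
  let ?M = "lebesgue_on {0<..<T}"
  have yL: "y \<in> L2 \<Omega>" by (rule H10D(1)[OF y])
  note iu = test_deriv_product_integrable(2)[OF \<psi> L2_prod_H10_measurable[OF u(1) y]]
  note iv = test_deriv_product_integrable(2)[OF \<psi> L2_prod_H10_measurable[OF v(1) y]]
  note ju = test_deriv_product_integrable(1)[OF \<psi> pairing_integrable[OF gU(1) y]]
  note jv = test_deriv_product_integrable(1)[OF \<psi> pairing_integrable[OF gU(2) y]]
  have ae: "AE t in ?M. deriv \<psi> t * L2_prod \<Omega> ((u - v) t) y = deriv \<psi> t * L2_prod \<Omega> (u t) y - deriv \<psi> t * L2_prod \<Omega> (v t) y"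
    using H10.bochner_L2D(2)[OF u(1)] H10.bochner_L2D(2)[OF v(1)]
  proof eventually_elim
    case (elim t)
    then show ?case using L2_prod_diff(1)[OF H10D(1) H10D(1) yL, of "u t" "v t"] by (simp add: right_diff_distrib)
  qed
  have "(LINT t|?M. deriv \<psi> t * L2_prod \<Omega> ((u - v) t) y) = (LINT t|?M. deriv \<psi> t * L2_prod \<Omega> (u t) y - deriv \<psi> t * L2_prod \<Omega> (v t) y)"
  proof (rule integral_cong_AE[OF _ _ ae])
    show 1: "(\<lambda>t. deriv \<psi> t * L2_prod \<Omega> (u t) y - deriv \<psi> t * L2_prod \<Omega> (v t) y) \<in> borel_measurable ?M"
      using iu iv by (intro borel_measurable_integrable Bochner_Integration.integrable_diff)
    show "(\<lambda>t. deriv \<psi> t * L2_prod \<Omega> ((u - v) t) y) \<in> borel_measurable ?M"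
      by (rule lebesgue_on_measurable_AE[OF interval_sets 1]) (use ae in \<open>auto elim: eventually_mono\<close>)
  qed
  also have "\<dots> = (LINT t|?M. deriv \<psi> t * L2_prod \<Omega> (u t) y) - (LINT t|?M. deriv \<psi> t * L2_prod \<Omega> (v t) y)"
    by (rule Bochner_Integration.integral_diff[OF iu iv])
  also have "\<dots> = - (LINT t|?M. \<psi> t * gu t y) - - (LINT t|?M. \<psi> t * gv t y)"
    using u(2) v(2) \<psi> y by (simp add: is_time_deriv_def L2_prod_def)
  also have "\<dots> = - (LINT t|?M. \<psi> t * gu t y - \<psi> t * gv t y)"
    using Bochner_Integration.integral_diff[OF ju jv] by simp
  finally show "(LINT t|?M. deriv \<psi> t * (LINT x|lebesgue_on \<Omega>. (u - v) t x * y x)) = - (LINT t|?M. \<psi> t * (gu - gv) t y)"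
    by (simp add: L2_prod_def right_diff_distrib)
qed

text \<open>This makes \<open>V_norm\<close> independent of the choice in \<open>time_deriv\<close>, which is what its triangle
  inequality needs.\<close>

lemma is_time_deriv_unique:
  assumes g: "is_time_deriv \<Omega> T u g" and g': "is_time_deriv \<Omega> T u g'"
  shows "Udual_norm \<Omega> T g = Udual_norm \<Omega> T g'"
proof -
  let ?M = "lebesgue_on {0<..<T}"
  have gU: "g \<in> Udual_space \<Omega> T" "g' \<in> Udual_space \<Omega> T" using g g' by (auto simp: is_time_deriv_def)
  have dU: "g - g' \<in> Udual_space \<Omega> T" by (rule dual.bochner_L2_diff(1)[OF gU])
  have "AE t in ?M. H10_dual_norm \<Omega> ((g - g') t) = 0"
  proof (rule H10.weakly_zero_imp_AE_zero[OF dU])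
    fix y assume y: "y \<in> H10 \<Omega>"
    have i: "integrable ?M (\<lambda>t. (g - g') t y)" by (rule pairing_integrable[OF dU y])
    show "AE t in ?M. (g - g') t y = 0"
    proof (rule test_orthogonal_imp_AE_0[OF open_greaterThanLessThan])
      fix a b :: real
      have "integrable lebesgue (\<lambda>t. indicator {0<..<T} t *\<^sub>R (g - g') t y)"
        using i by (subst (asm) integrable_restrict_space) auto
      from integrable_mult_indicator[OF fmeasurableD[OF lmeasurable_cbox] this, of a b]
      show "set_integrable lebesgue (cbox a b) (\<lambda>t. indicator {0<..<T} t * (g - g') t y)"
        unfolding set_integrable_def real_scaleR_def .
    next
      fix \<psi> :: "real \<Rightarrow> real" assume \<psi>: "\<psi> \<in> test_functions {0<..<T}"
      note ju = test_deriv_product_integrable(1)[OF \<psi> pairing_integrable[OF gU(1) y]]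
      note jv = test_deriv_product_integrable(1)[OF \<psi> pairing_integrable[OF gU(2) y]]
      have "(LINT t|?M. \<psi> t * g t y) = (LINT t|?M. \<psi> t * g' t y)"
      proof -
        have "- (LINT t|?M. \<psi> t * g t y) = - (LINT t|?M. \<psi> t * g' t y)"
          using conjunct2[OF g[unfolded is_time_deriv_def], rule_format, OF \<psi> y]
            conjunct2[OF g'[unfolded is_time_deriv_def], rule_format, OF \<psi> y] by (rule trans[OF sym])
        then show ?thesis by (simp only: neg_equal_iff_equal)
      qed
      then show "(LINT t|?M. (g - g') t y * \<psi> t) = 0"
        using Bochner_Integration.integral_diff[OF ju jv] by (simp add: algebra_simps)
    qed
  qed
  then have "AE t in ?M. (H10_dual_norm \<Omega> (g t))\<^sup>2 = (H10_dual_norm \<Omega> (g' t))\<^sup>2"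
    using dual.bochner_L2D(2)[OF gU(1)] dual.bochner_L2D(2)[OF gU(2)]
  proof eventually_elim
    case (elim t)
    then show ?case using dual.N_reverse[OF elim(2,3)] by simp
  qed
  then have "(LINT t|?M. (H10_dual_norm \<Omega> (g t))\<^sup>2) = (LINT t|?M. (H10_dual_norm \<Omega> (g' t))\<^sup>2)"
    by (rule integral_cong_AE[rotated 2]) (intro borel_measurable_power dual.bochner_L2D gU)+
  then show ?thesis by (simp add: bochner_L2_norm_def)
qed

lemma V_norm_eq:
  assumes "is_time_deriv \<Omega> T u g"
  shows "V_norm \<Omega> T u = sqrt ((U_norm \<Omega> T u)\<^sup>2 + (Udual_norm \<Omega> T g)\<^sup>2)"
proof -
  have "is_time_deriv \<Omega> T u (time_deriv \<Omega> T u)"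
    unfolding time_deriv_def by (rule someI[of "is_time_deriv \<Omega> T u", OF assms])
  then show ?thesis unfolding V_norm_def using is_time_deriv_unique[OF assms] by simp
qed

lemma V_spaceD:
  assumes "u \<in> V_space \<Omega> T"
  shows "u \<in> U_space \<Omega> T" "is_time_deriv \<Omega> T u (time_deriv \<Omega> T u)"
  using assms someI_ex[of "is_time_deriv \<Omega> T u"] by (auto simp: V_space_def time_deriv_def)

lemma V_diff:
  assumes u: "u \<in> V_space \<Omega> T" and v: "v \<in> V_space \<Omega> T"
  shows "u - v \<in> V_space \<Omega> T" "V_norm \<Omega> T u \<le> V_norm \<Omega> T (u - v) + V_norm \<Omega> T v"
proof -
  note uD = V_spaceD[OF u] and vD = V_spaceD[OF v]
  have d: "is_time_deriv \<Omega> T (u - v) (time_deriv \<Omega> T u - time_deriv \<Omega> T v)" by (rule is_time_deriv_diff[OF uD vD])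
  have dU: "u - v \<in> U_space \<Omega> T" by (rule H10.bochner_L2_diff(1)[OF uD(1) vD(1)])
  show "u - v \<in> V_space \<Omega> T" using d dU by (auto simp: V_space_def)
  define gu where "gu = time_deriv \<Omega> T u"
  define gv where "gv = time_deriv \<Omega> T v"
  have gU: "gu \<in> Udual_space \<Omega> T" "gv \<in> Udual_space \<Omega> T" using uD(2) vD(2) by (auto simp: is_time_deriv_def gu_def gv_def)
  have gdU: "gu - gv \<in> Udual_space \<Omega> T" by (rule dual.bochner_L2_diff(1)[OF gU])
  have "u = (\<lambda>t. (u - v) t + 1 *\<^sub>R v t)" by (simp add: fun_eq_iff)
  then have 1: "U_norm \<Omega> T u \<le> U_norm \<Omega> T (u - v) + U_norm \<Omega> T v"
    using H10.bochner_L2_add_scale(2)[OF dU vD(1), of 1] by simp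
  have "gu = (\<lambda>t. (gu - gv) t + 1 *\<^sub>R gv t)" by (simp add: fun_eq_iff)
  then have 2: "Udual_norm \<Omega> T gu \<le> Udual_norm \<Omega> T (gu - gv) + Udual_norm \<Omega> T gv"
    using dual.bochner_L2_add_scale(2)[OF gdU gU(2), of 1] by simp
  have "V_norm \<Omega> T u \<le> sqrt ((U_norm \<Omega> T (u - v) + U_norm \<Omega> T v)\<^sup>2 + (Udual_norm \<Omega> T (gu - gv) + Udual_norm \<Omega> T gv)\<^sup>2)"
    unfolding V_norm_eq[OF uD(2)] gu_def[symmetric]
    by (intro real_sqrt_le_mono add_mono power_mono 1 2) (simp_all add: bochner_L2_norm_def)
  also have "\<dots> \<le> V_norm \<Omega> T (u - v) + V_norm \<Omega> T v"
    unfolding V_norm_eq[OF d] V_norm_eq[OF vD(2)] gu_def[symmetric] gv_def[symmetric]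
    by (rule real_sqrt_sum_squares_triangle_ineq)
  finally show "V_norm \<Omega> T u \<le> V_norm \<Omega> T (u - v) + V_norm \<Omega> T v" .
qed

lemma pairing_indicator_bound:
  assumes g: "g \<in> Udual_space \<Omega> T" and v: "v \<in> U_space \<Omega> T"
  shows "\<bar>LINT t|lebesgue_on {0<..<T}. indicator {0<..<\<beta>} t * g t (v t)\<bar> \<le> Udual_norm \<Omega> T g * U_norm \<Omega> T v"
proof -
  let ?M = "lebesgue_on {0<..<T}"
  note pv = H10.pairing_measurable[OF g v]
  note gD = dual.bochner_L2D[OF g] and vD = H10.bochner_L2D[OF v]
  note CS = Cauchy_Schwarz_integral[OF gD(3,4) vD(3,4)]
  have "(indicator {0<..<\<beta>} :: real \<Rightarrow> real) \<in> borel_measurable ?M"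
    by (intro measurable_restrict_space1 borel_measurable_indicator) simp
  then have m: "(\<lambda>t. indicator {0<..<\<beta>} t * g t (v t)) \<in> borel_measurable ?M" using pv(1) by (rule borel_measurable_times)
  have b: "AE t in ?M. \<bar>indicator {0<..<\<beta>} t * g t (v t)\<bar> \<le> H10_dual_norm \<Omega> (g t) * H1_norm \<Omega> (v t)"
    using pv(3)
  proof eventually_elim
    case (elim t)
    then show ?case using order_trans[OF abs_ge_zero elim] by (simp add: indicator_def)
  qed
  have i: "integrable ?M (\<lambda>t. indicator {0<..<\<beta>} t * g t (v t))"
    by (rule Bochner_Integration.integrable_bound[OF pv(2) m]) (auto simp: indicator_def)
  have "\<bar>LINT t|?M. indicator {0<..<\<beta>} t * g t (v t)\<bar> \<le> (LINT t|?M. \<bar>indicator {0<..<\<beta>} t * g t (v t)\<bar>)" by (rule integral_abs_bound)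
  also have "\<dots> \<le> (LINT t|?M. H10_dual_norm \<Omega> (g t) * H1_norm \<Omega> (v t))"
    by (rule integral_mono_AE[OF integrable_abs[OF i] CS(1) b])
  also have "\<dots> \<le> Udual_norm \<Omega> T g * U_norm \<Omega> T v" using CS(3) by (simp add: bochner_L2_norm_def)
  finally show ?thesis .
qed

text \<open>The energy identity, that is integration by parts of \<open>w\<close> with itself. A vanishing initial value
  makes the constant of the embedding into \<open>C([0,T]; L\<^sup>2)\<close> equal to 1.\<close>

lemma L2_norm_le_V_norm:
  assumes w: "w \<in> V_space \<Omega> T" and r: "time_rep \<Omega> T w r" and r0: "AE x in lebesgue_on \<Omega>. r 0 x = 0"
    and t: "0 < t" "t \<le> T"
  shows "L2_norm \<Omega> (r t) \<le> V_norm \<Omega> T w"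
proof -
  note wD = V_spaceD[OF w]
  define g where "g = time_deriv \<Omega> T w"
  have g: "is_time_deriv \<Omega> T w g" using wD(2) by (simp add: g_def)
  have gU: "g \<in> Udual_space \<Omega> T" using g by (simp add: is_time_deriv_def)
  have rL: "r \<tau> \<in> L2 \<Omega>" if "\<tau> \<in> {0..T}" for \<tau> using r that by (auto simp: time_rep_def L2_continuous_on_def)
  have "L2_norm \<Omega> (r 0) = L2_norm \<Omega> 0"
    by (rule L2_AE_eq[OF rL L2.zero_mem]) (use r0 t in auto)
  then have "L2_prod \<Omega> (r 0) (r 0) = 0" by (simp add: L2_prod_self L2.N_zero)
  then have "(L2_norm \<Omega> (r t))\<^sup>2 = 2 * (LINT \<tau>|lebesgue_on {0<..<T}. indicator {0<..<t} \<tau> * g \<tau> (w \<tau>))"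
    using integration_by_parts[OF wD(1) g r wD(1) g r t] by (simp add: L2_prod_self)
  also have "\<dots> \<le> 2 * (Udual_norm \<Omega> T g * U_norm \<Omega> T w)"
    using pairing_indicator_bound[OF gU wD(1), of t] by simp
  also have "\<dots> \<le> (U_norm \<Omega> T w)\<^sup>2 + (Udual_norm \<Omega> T g)\<^sup>2"
    using sum_squares_bound[of "U_norm \<Omega> T w" "Udual_norm \<Omega> T g"] by (simp add: mult.commute mult.left_commute)
  finally show ?thesis
    unfolding V_norm_eq[OF g] by (rule real_le_rsqrt)
qed

end

section \<open>The Taylor remainder of the reaction term\<close>

lemma elliptic_form_commute: "elliptic_form \<Omega> a b u v = elliptic_form \<Omega> a b v u"
  by (simp add: elliptic_form_def inner_commute mult.commute mult.left_commute)

lemma L2_comp_lipschitz: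
  assumes \<Omega>: "\<Omega> \<in> lmeasurable" and P: "\<And>x. (P has_real_derivative D x) (at x)" "\<And>x. \<bar>D x\<bar> \<le> M"
    and u: "u \<in> L2 \<Omega>"
  shows "(\<lambda>x. P (u x)) \<in> L2 \<Omega>"
proof -
  have lip: "\<bar>P x\<bar> \<le> \<bar>P 0\<bar> + M * \<bar>x\<bar>" for x
    using field_differentiable_bound[of UNIV P D M x 0] P by (auto intro: order_trans has_field_derivative_at_within)
  interpret finite_measure "lebesgue_on \<Omega>" by (rule finite_measure_lebesgue_on[OF \<Omega>])
  have c: "(\<lambda>x. c) \<in> L2 \<Omega>" for c by (simp add: L2_def)
  have "(\<lambda>x. \<bar>u x\<bar>) \<in> L2 \<Omega>" by (rule L2_mono(1)[OF u borel_measurable_abs[OF L2D(1)[OF u]]]) simp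
  then have "(\<lambda>x. \<bar>P 0\<bar> + M * \<bar>u x\<bar>) \<in> L2 \<Omega>" by (intro L2_add c L2_cmult)
  then show ?thesis
  proof (rule L2_mono(1))
    have "continuous_on UNIV P" using P(1) by (meson DERIV_isCont continuous_at_imp_continuous_on)
    then have "P \<in> borel_measurable borel" by (rule borel_measurable_continuous_onI)
    then show "(\<lambda>x. P (u x)) \<in> borel_measurable (lebesgue_on \<Omega>)" by (rule measurable_compose[OF L2D(1)[OF u]])
    show "AE x in lebesgue_on \<Omega>. \<bar>P (u x)\<bar> \<le> \<bar>\<bar>P 0\<bar> + M * \<bar>u x\<bar>\<bar>"
      using lip by (intro AE_I2) (meson abs_ge_self order_trans)
  qed
qed

lemma L2_comp_mult:
  assumes D: "continuous_on UNIV D" "\<And>x. \<bar>D x\<bar> \<le> M" and u: "u \<in> L2 \<Omega>" and v: "v \<in> L2 \<Omega>"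
  shows "(\<lambda>x. D (u x) * v x) \<in> L2 \<Omega>"
proof (rule L2_mono(1)[OF L2_cmult[OF v, of M]])
  have "D \<in> borel_measurable borel" by (rule borel_measurable_continuous_onI[OF D(1)])
  then show "(\<lambda>x. D (u x) * v x) \<in> borel_measurable (lebesgue_on \<Omega>)"
    by (intro borel_measurable_times L2D(1)[OF v] measurable_compose[OF L2D(1)[OF u]])
  show "AE x in lebesgue_on \<Omega>. \<bar>D (u x) * v x\<bar> \<le> \<bar>M * v x\<bar>"
    using D(2) by (intro AE_I2) (simp add: abs_mult mult_right_mono order_trans[OF _ abs_ge_self])
qed

text \<open>By the mean value theorem the left-hand side is \<open>(D' x - D \<xi>) (x - y)\<close> with \<open>\<xi>\<close> between \<open>x\<close>
  and \<open>y\<close>. The difference of the derivatives of \<open>P\<close> at \<open>x\<close> and \<open>\<xi>\<close> is at most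
  \<open>2 \<epsilon>\<close> if \<open>x\<close> and \<open>y\<close> are \<open>\<delta>\<close>-close, and at most \<open>2 M\<close> otherwise.\<close>

lemma taylor_remainder_bound:
  fixes P D D' :: "real \<Rightarrow> real"
  assumes P: "\<And>x. (P has_real_derivative D x) (at x)" and M: "\<And>x. \<bar>D x\<bar> \<le> M"
    and L: "\<And>x y. \<bar>D x - D y\<bar> \<le> \<epsilon> + L * \<bar>x - y\<bar>" and \<delta>: "L * \<delta> \<le> \<epsilon>" "L \<ge> 0"
    and \<kappa>: "\<And>x. \<bar>D' x - D x\<bar> \<le> \<kappa>" and \<epsilon>: "\<epsilon> \<ge> 0"
  shows "\<bar>P y - P x + D' x * (x - y)\<bar> \<le> (\<kappa> + 2 * \<epsilon> + 2 * M * (if \<delta> < \<bar>x - y\<bar> then 1 else 0)) * \<bar>x - y\<bar>"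
proof -
  have M0: "0 \<le> M" using M[of 0] by simp
  obtain \<xi> where \<xi>: "P y - P x = D \<xi> * (y - x)" "\<bar>x - \<xi>\<bar> \<le> \<bar>x - y\<bar>"
  proof -
    consider "x < y" | "x = y" | "y < x" by linarith
    then show ?thesis
    proof cases
      case 1
      from MVT2[OF 1, of P D] P obtain z where "x < z" "z < y" "P y - P x = (y - x) * D z" by blast
      then show ?thesis by (intro that[of z]) auto
    next
      case 2 then show ?thesis by (intro that[of x]) auto
    next
      case 3
      from MVT2[OF 3, of P D] P obtain z where "y < z" "z < x" "P x - P y = (x - y) * D z" by blast
      then show ?thesis by (intro that[of z]) (auto simp: algebra_simps)
    qed
  qed
  have "P y - P x + D' x * (x - y) = ((D' x - D x) + (D x - D \<xi>)) * (x - y)"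
    unfolding \<xi>(1) by (simp add: algebra_simps)
  then have "\<bar>P y - P x + D' x * (x - y)\<bar> = \<bar>(D' x - D x) + (D x - D \<xi>)\<bar> * \<bar>x - y\<bar>" by (simp add: abs_mult)
  also have "\<dots> \<le> (\<kappa> + \<bar>D x - D \<xi>\<bar>) * \<bar>x - y\<bar>"
    using \<kappa>[of x] by (intro mult_right_mono) auto
  also have "\<dots> \<le> (\<kappa> + 2 * \<epsilon> + 2 * M * (if \<delta> < \<bar>x - y\<bar> then 1 else 0)) * \<bar>x - y\<bar>"
  proof (intro mult_right_mono)
    show "\<kappa> + \<bar>D x - D \<xi>\<bar> \<le> \<kappa> + 2 * \<epsilon> + 2 * M * (if \<delta> < \<bar>x - y\<bar> then 1 else 0)"
    proof (cases "\<delta> < \<bar>x - y\<bar>")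
      case True
      then show ?thesis using M[of x] M[of \<xi>] \<epsilon> by auto
    next
      case False
      then have "L * \<bar>x - \<xi>\<bar> \<le> L * \<delta>" using \<xi>(2) \<delta>(2) by (intro mult_left_mono) auto
      then show ?thesis using L[of x \<xi>] \<delta>(1) False by auto
    qed
  qed simp
  finally show ?thesis .
qed

lemma superlevel_measure:
  assumes \<Omega>: "\<Omega> \<in> sets lebesgue" and w: "w \<in> L2 \<Omega>" and \<delta>: "\<delta> > 0"
  shows "{x \<in> \<Omega>. \<delta> < \<bar>w x\<bar>} \<in> sets lebesgue" "emeasure lebesgue {x \<in> \<Omega>. \<delta> < \<bar>w x\<bar>} \<le> ennreal ((L2_norm \<Omega> w / \<delta>)\<^sup>2)"
proof -
  let ?E = "{x \<in> \<Omega>. \<delta> < \<bar>w x\<bar>}"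
  have "{x \<in> space (lebesgue_on \<Omega>). \<delta> < \<bar>w x\<bar>} \<in> sets (lebesgue_on \<Omega>)"
    using L2D(1)[OF w] by measurable
  then have Er: "?E \<in> sets (lebesgue_on \<Omega>)" by simp
  then show E: "?E \<in> sets lebesgue" using \<Omega> by (simp add: sets_restrict_space_iff)
  have i: "integrable (lebesgue_on \<Omega>) (\<lambda>x. (w x)\<^sup>2 / \<delta>\<^sup>2)" using L2D(2)[OF w] by simp
  have "emeasure lebesgue ?E = emeasure (lebesgue_on \<Omega>) ?E"
    using \<Omega> by (subst emeasure_restrict_space) auto
  also have "\<dots> = (\<integral>\<^sup>+x. indicator ?E x \<partial>lebesgue_on \<Omega>)" using Er by simp
  also have "\<dots> \<le> (\<integral>\<^sup>+x. ennreal ((w x)\<^sup>2 / \<delta>\<^sup>2) \<partial>lebesgue_on \<Omega>)"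
  proof (rule nn_integral_mono)
    fix x
    show "indicator ?E x \<le> ennreal ((w x)\<^sup>2 / \<delta>\<^sup>2)"
    proof (cases "x \<in> ?E")
      case True
      then have "\<delta>\<^sup>2 \<le> \<bar>w x\<bar>\<^sup>2" using \<delta> by (intro power_mono) auto
      then have "1 \<le> (w x)\<^sup>2 / \<delta>\<^sup>2" using \<delta> by (simp add: field_simps)
      then have "ennreal 1 \<le> ennreal ((w x)\<^sup>2 / \<delta>\<^sup>2)" by (rule ennreal_leI)
      then show ?thesis using True by simp
    qed simp
  qed
  also have "\<dots> = ennreal (LINT x|lebesgue_on \<Omega>. (w x)\<^sup>2 / \<delta>\<^sup>2)" by (rule nn_integral_eq_integral[OF i]) simp
  also have "(LINT x|lebesgue_on \<Omega>. (w x)\<^sup>2 / \<delta>\<^sup>2) = (L2_norm \<Omega> w / \<delta>)\<^sup>2" by (simp add: power_divide L2_norm_power2)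
  finally show "emeasure lebesgue ?E \<le> ennreal ((L2_norm \<Omega> w / \<delta>)\<^sup>2)" .
qed

context evolution_domain
begin

text \<open>The difference \<open>u - u'\<close> is small in \<open>L\<^sup>2\<close> but not uniformly. On the set \<open>E\<close> where it exceeds
  \<open>\<delta>\<close>, the Taylor factor is merely bounded; but \<open>E\<close> has small measure by Chebyshev's inequality,
  so there the smallness comes from \<open>z\<close>, which is small in \<open>L\<^sup>2(E)\<close> relative to its
  \<open>H\<^sup>1\<close> norm.\<close>

lemma remainder_pairing_bound:
  assumes P: "\<And>x. (P has_real_derivative D x) (at x)" and M: "\<And>x. \<bar>D x\<bar> \<le> M"
    and L: "\<And>x y. \<bar>D x - D y\<bar> \<le> \<epsilon> + L * \<bar>x - y\<bar>" "L * \<delta> \<le> \<epsilon>" "L \<ge> 0"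
    and \<kappa>: "\<And>x. \<bar>D' x - D x\<bar> \<le> \<kappa>" "\<kappa> \<ge> 0" and \<epsilon>: "\<epsilon> \<ge> 0" and \<delta>: "\<delta> > 0"
    and small: "\<And>E. E \<in> sets lebesgue \<Longrightarrow> emeasure lebesgue E \<le> ennreal \<mu> \<Longrightarrow>
      L2_norm \<Omega> (\<lambda>x. indicator E x * z x) \<le> \<epsilon>' * H1_norm \<Omega> z"
    and u: "u \<in> L2 \<Omega>" "u' \<in> L2 \<Omega>" and z: "z \<in> H10 \<Omega>"
    and w: "(L2_norm \<Omega> (u - u') / \<delta>)\<^sup>2 \<le> \<mu>"
  shows "\<bar>LINT x|lebesgue_on \<Omega>. (P (u' x) - P (u x) + D' (u x) * (u x - u' x)) * z x\<bar>
    \<le> (\<kappa> + 2 * \<epsilon> + 2 * M * \<epsilon>') * (L2_norm \<Omega> (u - u') * H1_norm \<Omega> z)"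
proof -
  let ?M = "lebesgue_on \<Omega>"
  have \<Omega>s: "\<Omega> \<in> sets lebesgue" using \<Omega> by simp
  define W where "W = u - u'"
  have W: "W \<in> L2 \<Omega>" unfolding W_def by (rule L2.diff_mem[OF u])
  have zL: "z \<in> L2 \<Omega>" by (rule H10D(1)[OF z])
  define E where "E = {x \<in> \<Omega>. \<delta> < \<bar>W x\<bar>}"
  have E: "E \<in> sets lebesgue" and Em: "emeasure lebesgue E \<le> ennreal \<mu>"
    using superlevel_measure[OF \<Omega>s W \<delta>] w by (auto simp: E_def W_def intro: order_trans ennreal_leI)
  have M0: "0 \<le> M" using M[of 0] by simp
  define c where "c = \<kappa> + 2 * \<epsilon>"
  have c: "c \<ge> 0" using \<kappa>(2) \<epsilon> by (simp add: c_def)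
  have Ez: "(\<lambda>x. indicator E x * z x) \<in> L2 \<Omega>"
    by (rule L2_mono(1)[OF zL borel_measurable_times[OF
          measurable_restrict_space1[OF borel_measurable_indicator[OF E]] L2D(1)[OF zL]]])
      (simp add: indicator_def)
  note i1 = L2_inner[OF W zL] and i2 = L2_inner[OF W Ez]
  have "norm (LINT x|?M. (P (u' x) - P (u x) + D' (u x) * (u x - u' x)) * z x)
    \<le> (LINT x|?M. c * \<bar>W x * z x\<bar> + 2 * M * \<bar>W x * (indicator E x * z x)\<bar>)"
  proof (cases "integrable ?M (\<lambda>x. (P (u' x) - P (u x) + D' (u x) * (u x - u' x)) * z x)")
    case True
    show ?thesis
    proof (rule Bochner_Integration.integral_norm_bound_integral[OF True])
      show "integrable ?M (\<lambda>x. c * \<bar>W x * z x\<bar> + 2 * M * \<bar>W x * (indicator E x * z x)\<bar>)"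
        using i1(1) i2(1) by (intro Bochner_Integration.integrable_add integrable_mult_right integrable_abs)
      fix x assume "x \<in> space ?M"
      then have x: "x \<in> \<Omega>" by simp
      have ind: "(if \<delta> < \<bar>u x - u' x\<bar> then 1 else 0) = (indicator E x :: real)"
        using x by (simp add: E_def W_def indicator_def)
      have "\<bar>(P (u' x) - P (u x) + D' (u x) * (u x - u' x)) * z x\<bar> \<le> (c + 2 * M * indicator E x) * \<bar>W x\<bar> * \<bar>z x\<bar>"
        unfolding abs_mult using taylor_remainder_bound[OF P M L(1,2,3) \<kappa>(1) \<epsilon>, of "u' x" "u x"]
        by (intro mult_right_mono) (simp_all add: ind W_def c_def)
      also have "\<dots> = c * \<bar>W x * z x\<bar> + 2 * M * \<bar>W x * (indicator E x * z x)\<bar>"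
        by (simp add: abs_mult algebra_simps)
      finally show "norm ((P (u' x) - P (u x) + D' (u x) * (u x - u' x)) * z x) \<le> c * \<bar>W x * z x\<bar> + 2 * M * \<bar>W x * (indicator E x * z x)\<bar>"
        by simp
    qed
  next
    case False
    then show ?thesis using c M0
      by (simp add: not_integrable_integral_eq)
  qed
  also have "\<dots> = c * (LINT x|?M. \<bar>W x * z x\<bar>) + 2 * M * (LINT x|?M. \<bar>W x * (indicator E x * z x)\<bar>)"
    using integrable_abs[OF i1(1)] integrable_abs[OF i2(1)] by simp
  also have "\<dots> \<le> c * (L2_norm \<Omega> W * H1_norm \<Omega> z) + 2 * M * (L2_norm \<Omega> W * (\<epsilon>' * H1_norm \<Omega> z))"
  proof (intro add_mono mult_left_mono)
    show "(LINT x|?M. \<bar>W x * z x\<bar>) \<le> L2_norm \<Omega> W * H1_norm \<Omega> z"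
      by (rule order_trans[OF i1(3)]) (intro mult_left_mono L2_norm_le_H1_norm L2_norm_nonneg)
    show "(LINT x|?M. \<bar>W x * (indicator E x * z x)\<bar>) \<le> L2_norm \<Omega> W * (\<epsilon>' * H1_norm \<Omega> z)"
      by (rule order_trans[OF i2(3)]) (intro mult_left_mono small E Em L2_norm_nonneg)
  qed (use c M0 in auto)
  also have "\<dots> = (\<kappa> + 2 * \<epsilon> + 2 * M * \<epsilon>') * (L2_norm \<Omega> (u - u') * H1_norm \<Omega> z)"
    by (simp add: c_def W_def algebra_simps)
  finally show ?thesis by simp
qed

lemma U_space_imp_Y:
  assumes u: "u \<in> U_space \<Omega> T"
  shows "u \<in> bochner_L2 T (L2 \<Omega>) (L2_norm \<Omega>)"
proof -
  note uD = H10.bochner_L2D[OF u]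
  have ae: "AE t in lebesgue_on {0<..<T}. u t \<in> L2 \<Omega>" using uD(2) by eventually_elim (rule H10D(1))
  have sm: "strongly_measurable T (L2 \<Omega>) (L2_norm \<Omega>) u"
    using strongly_measurable_map[OF uD(1,2), of "\<lambda>x. x" "L2 \<Omega>" "L2_norm \<Omega>" 1]
    by (simp add: H10D(1) L2_norm_nonneg L2_norm_le_H1_norm)
  have "integrable (lebesgue_on {0<..<T}) (\<lambda>t. (L2_norm \<Omega> (u t))\<^sup>2)"
  proof (rule Bochner_Integration.integrable_bound[OF uD(4)])
    show "(\<lambda>t. (L2_norm \<Omega> (u t))\<^sup>2) \<in> borel_measurable (lebesgue_on {0<..<T})"
      by (intro borel_measurable_power L2.norm_measurable sm ae)
    show "AE t in lebesgue_on {0<..<T}. norm ((L2_norm \<Omega> (u t))\<^sup>2) \<le> norm ((H1_norm \<Omega> (u t))\<^sup>2)"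
      by (intro AE_I2) (simp add: L2_norm_le_H1_norm L2_norm_nonneg power_mono)
  qed
  then show ?thesis using sm ae by (simp add: bochner_L2_def)
qed

text \<open>An element of \<open>Y\<close>, read as a source in \<open>U\<^sup>*\<close> through the inner product of \<open>L\<^sup>2\<close>. The
  embedding has norm at most 1.\<close>

lemma L2_source:
  assumes r: "r \<in> bochner_L2 T (L2 \<Omega>) (L2_norm \<Omega>)"
  shows "(\<lambda>t. L2_prod \<Omega> (r t)) \<in> Udual_space \<Omega> T" "Udual_norm \<Omega> T (\<lambda>t. L2_prod \<Omega> (r t)) \<le> Y_norm \<Omega> T r"
proof -
  note rD = L2.bochner_L2D[OF r]
  have b: "\<bar>L2_prod \<Omega> f y\<bar> \<le> L2_norm \<Omega> f * H1_norm \<Omega> y" if "f \<in> L2 \<Omega>" "y \<in> H10 \<Omega>" for f y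
    by (rule order_trans[OF L2_prod_bound[OF that(1) H10D(1)[OF that(2)]]])
      (intro mult_left_mono L2_norm_le_H1_norm L2_norm_nonneg)
  have mem: "L2_prod \<Omega> f \<in> H10_dual \<Omega>" if f: "f \<in> L2 \<Omega>" for f
  proof (rule H10.dual_memI[OF _ _ b[OF f]])
    fix v w c assume v: "v \<in> H10 \<Omega>"
    show "L2_prod \<Omega> f (c *\<^sub>R v) = c * L2_prod \<Omega> f v"
      using L2_prod_add_scale[OF L2.zero_mem H10D(1)[OF v] f, of c] by (simp add: L2_prod_commute[of \<Omega> f]) (simp add: L2_prod_def)
    assume w: "w \<in> H10 \<Omega>"
    show "L2_prod \<Omega> f (v + w) = L2_prod \<Omega> f v + L2_prod \<Omega> f w"
      using L2_prod_add_scale[OF H10D(1)[OF v] H10D(1)[OF w] f, of 1] by (simp add: L2_prod_commute[of \<Omega> f])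
  qed
  have nle: "H10_dual_norm \<Omega> (L2_prod \<Omega> f) \<le> L2_norm \<Omega> f" if "f \<in> L2 \<Omega>" for f
    by (rule H10.dual_norm_leI[OF b[OF that] L2_norm_nonneg])
  have dle: "0 \<le> H10_dual_norm \<Omega> (L2_prod \<Omega> f - L2_prod \<Omega> g) \<and> H10_dual_norm \<Omega> (L2_prod \<Omega> f - L2_prod \<Omega> g) \<le> 1 * L2_norm \<Omega> (f - g)"
    if f: "f \<in> L2 \<Omega>" and g: "g \<in> L2 \<Omega>" for f g
  proof
    show "0 \<le> H10_dual_norm \<Omega> (L2_prod \<Omega> f - L2_prod \<Omega> g)"
      by (intro dual.N_nonneg dual.diff_mem mem f g)
    have "H10_dual_norm \<Omega> (L2_prod \<Omega> f - L2_prod \<Omega> g) \<le> L2_norm \<Omega> (f - g)"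
    proof (rule H10.dual_norm_leI[OF _ L2_norm_nonneg])
      fix y assume y: "y \<in> H10 \<Omega>"
      have "(L2_prod \<Omega> f - L2_prod \<Omega> g) y = L2_prod \<Omega> (f - g) y"
        using L2_prod_diff(1)[OF f g H10D(1)[OF y]] by simp
      then show "\<bar>(L2_prod \<Omega> f - L2_prod \<Omega> g) y\<bar> \<le> L2_norm \<Omega> (f - g) * H1_norm \<Omega> y"
        using b[OF L2.diff_mem[OF f g] y] by simp
    qed
    then show "H10_dual_norm \<Omega> (L2_prod \<Omega> f - L2_prod \<Omega> g) \<le> 1 * L2_norm \<Omega> (f - g)" by simp
  qed
  have sm: "strongly_measurable T (H10_dual \<Omega>) (H10_dual_norm \<Omega>) (\<lambda>t. L2_prod \<Omega> (r t))"
    using strongly_measurable_map[OF rD(1,2), of "L2_prod \<Omega>" "H10_dual \<Omega>" "H10_dual_norm \<Omega>" 1] mem dle by blast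
  have ae: "AE t in lebesgue_on {0<..<T}. L2_prod \<Omega> (r t) \<in> H10_dual \<Omega>"
    using rD(2) by eventually_elim (rule mem)
  have sq: "AE t in lebesgue_on {0<..<T}. (H10_dual_norm \<Omega> (L2_prod \<Omega> (r t)))\<^sup>2 \<le> (L2_norm \<Omega> (r t))\<^sup>2"
    using rD(2) by eventually_elim (intro power_mono nle H10.dual_norm_nonneg mem)
  have i: "integrable (lebesgue_on {0<..<T}) (\<lambda>t. (H10_dual_norm \<Omega> (L2_prod \<Omega> (r t)))\<^sup>2)"
  proof (rule Bochner_Integration.integrable_bound[OF rD(4)])
    show "(\<lambda>t. (H10_dual_norm \<Omega> (L2_prod \<Omega> (r t)))\<^sup>2) \<in> borel_measurable (lebesgue_on {0<..<T})"
      by (intro borel_measurable_power dual.norm_measurable sm ae)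
  qed (use sq in simp)
  show "(\<lambda>t. L2_prod \<Omega> (r t)) \<in> Udual_space \<Omega> T" using sm ae i by (simp add: bochner_L2_def)
  show "Udual_norm \<Omega> T (\<lambda>t. L2_prod \<Omega> (r t)) \<le> Y_norm \<Omega> T r"
    unfolding bochner_L2_norm_def by (intro real_sqrt_le_mono integral_mono_AE i rD(4) sq)
qed

end

section \<open>The error of the linearization\<close>

context evolution_domain
begin

text \<open>The three forward equations are tested with \<open>z\<close>, the adjoint equation with the three forward
  solutions. Each elliptic term of the adjoint equation is, by symmetry, literally a term of a forward
  equation, so they cancel without using linearity of \<open>elliptic_form\<close>; the terms with
  \<open>D(u) p z\<close> cancel too. There remains the Taylor remainder of \<open>P0\<close>, with \<open>D(u)\<close>, the derivative
  of \<open>P\<close>, in place of that of \<open>P0\<close>.\<close>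

lemma adjoint_pointwise_identity:
  assumes u: "gu z + elliptic_form \<Omega> a b u z + (LINT x|lebesgue_on \<Omega>. P (u x) * z x) = f"
    and v: "gv z + elliptic_form \<Omega> a b v z + (LINT x|lebesgue_on \<Omega>. P0 (v x) * z x) = f"
    and p: "gp z + elliptic_form \<Omega> a b p z + (LINT x|lebesgue_on \<Omega>. D (u x) * p x * z x)
      = - (LINT x|lebesgue_on \<Omega>. (P - P0) (u x) * z x)"
    and zu: "- gz u + elliptic_form \<Omega> a b z u + (LINT x|lebesgue_on \<Omega>. D (u x) * z x * u x) = L2_prod \<Omega> (u - v - p) u"
    and zv: "- gz v + elliptic_form \<Omega> a b z v + (LINT x|lebesgue_on \<Omega>. D (u x) * z x * v x) = L2_prod \<Omega> (u - v - p) v"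
    and zp: "- gz p + elliptic_form \<Omega> a b z p + (LINT x|lebesgue_on \<Omega>. D (u x) * z x * p x) = L2_prod \<Omega> (u - v - p) p"
    and L2: "u \<in> L2 \<Omega>" "v \<in> L2 \<Omega>" "p \<in> L2 \<Omega>" "z \<in> L2 \<Omega>"
    and P: "(\<lambda>x. P (u x)) \<in> L2 \<Omega>" "(\<lambda>x. P0 (u x)) \<in> L2 \<Omega>" "(\<lambda>x. P0 (v x)) \<in> L2 \<Omega>"
    and D: "(\<lambda>x. D (u x) * z x) \<in> L2 \<Omega>"
  shows "(L2_norm \<Omega> (u - v - p))\<^sup>2 + ((gu z + gz u) - (gv z + gz v) - (gp z + gz p))
    = (LINT x|lebesgue_on \<Omega>. (P0 (v x) - P0 (u x) + D (u x) * (u x - v x)) * z x)"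
proof -
  have "(LINT x|lebesgue_on \<Omega>. (P0 (v x) - P0 (u x) + D (u x) * (u x - v x)) * z x)
    = (LINT x|lebesgue_on \<Omega>. P0 (v x) * z x - P0 (u x) * z x + ((D (u x) * z x) * u x - (D (u x) * z x) * v x))"
    by (rule Bochner_Integration.integral_cong[OF refl]) (simp add: algebra_simps)
  also have "\<dots> = (LINT x|lebesgue_on \<Omega>. P0 (v x) * z x) - (LINT x|lebesgue_on \<Omega>. P0 (u x) * z x)
      + ((LINT x|lebesgue_on \<Omega>. (D (u x) * z x) * u x) - (LINT x|lebesgue_on \<Omega>. (D (u x) * z x) * v x))"
    by (simp add: L2_inner(1) L2 P D)
  finally have R: "(LINT x|lebesgue_on \<Omega>. (P0 (v x) - P0 (u x) + D (u x) * (u x - v x)) * z x)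
    = (LINT x|lebesgue_on \<Omega>. P0 (v x) * z x) - (LINT x|lebesgue_on \<Omega>. P0 (u x) * z x)
      + ((LINT x|lebesgue_on \<Omega>. (D (u x) * z x) * u x) - (LINT x|lebesgue_on \<Omega>. (D (u x) * z x) * v x))" .
  have X: "(LINT x|lebesgue_on \<Omega>. (P - P0) (u x) * z x) = (LINT x|lebesgue_on \<Omega>. P (u x) * z x) - (LINT x|lebesgue_on \<Omega>. P0 (u x) * z x)"
    using L2_inner(1)[OF P(1) L2(4)] L2_inner(1)[OF P(2) L2(4)] by (simp add: left_diff_distrib)
  have S: "(LINT x|lebesgue_on \<Omega>. D (u x) * p x * z x) = (LINT x|lebesgue_on \<Omega>. D (u x) * z x * p x)"
    by (simp add: mult.assoc mult.commute[of "p _"])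
  have r: "u - v - p \<in> L2 \<Omega>" by (intro L2.diff_mem L2)
  have N: "(L2_norm \<Omega> (u - v - p))\<^sup>2 = L2_prod \<Omega> (u - v - p) u - L2_prod \<Omega> (u - v - p) v - L2_prod \<Omega> (u - v - p) p"
    by (simp add: L2_prod_self[symmetric] L2_prod_diff(2) L2.diff_mem L2 r)
  show ?thesis
    using u v p zu zv zp
    unfolding N R X S elliptic_form_commute[of \<Omega> a b z] by linarith
qed

text \<open>Integrating the pointwise identity over time. Each of \<open>u\<close>, \<open>v\<close>, \<open>p\<close> contributes a term
  \<open>\<tau>\<close> that integrates, by parts, to the product of the initial value with that of \<open>z\<close>, because
  \<open>z(T) = 0\<close>; these products cancel since \<open>u\<close> and \<open>v\<close> start from the same value and \<open>p\<close> from
  0. As the pointwise identity is used in the form \<open>(norm of r)\<^sup>2 + \<tau> \<le> \<dots>\<close>, the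
  space integral of the remainder need not be measurable in time.\<close>

lemma linearization_error_bound:
  assumes T: "T > 0" and \<Omega>m: "\<Omega> \<in> lmeasurable"
    and P: "\<And>x. (P has_real_derivative D x) (at x)" "\<And>x. \<bar>D x\<bar> \<le> M" "continuous_on UNIV D"
    and P0: "\<And>x. (P0 has_real_derivative D0 x) (at x)" "\<And>x. \<bar>D0 x\<bar> \<le> M0"
    and u: "solves_state \<Omega> T a b \<phi> u0 P u" and v: "solves_state \<Omega> T a b \<phi> u0 P0 v"
    and p: "solves_linearized \<Omega> T a b P u (P - P0) p"
    and z: "solves_adjoint \<Omega> T a b P u (\<lambda>t. L2_prod \<Omega> ((u - v - p) t)) z"
    and rem: "AE t in lebesgue_on {0<..<T}.
      \<bar>LINT x|lebesgue_on \<Omega>. (P0 (v t x) - P0 (u t x) + D (u t x) * (u t x - v t x)) * z t x\<bar>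
        \<le> \<eta> * (L2_norm \<Omega> ((u - v) t) * H1_norm \<Omega> (z t))"
    and \<eta>: "\<eta> \<ge> 0"
  shows "(Y_norm \<Omega> T (u - v - p))\<^sup>2 \<le> \<eta> * (Y_norm \<Omega> T (u - v) * U_norm \<Omega> T z)"
proof -
  let ?I = "lebesgue_on {0<..<T}"
  have D: "deriv P = D" using P(1) by (auto simp: DERIV_imp_deriv)
  note uV = u[unfolded solves_state_def] and vV = v[unfolded solves_state_def]
    and pV = p[unfolded solves_linearized_def D] and zV = z[unfolded solves_adjoint_def D]
  obtain wu where wu: "time_rep \<Omega> T u wu" "AE x in lebesgue_on \<Omega>. wu 0 x = u0 x" using uV by (auto simp: has_time_value_iff)
  obtain wv where wv: "time_rep \<Omega> T v wv" "AE x in lebesgue_on \<Omega>. wv 0 x = u0 x" using vV by (auto simp: has_time_value_iff)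
  obtain wp where wp: "time_rep \<Omega> T p wp" "AE x in lebesgue_on \<Omega>. wp 0 x = 0" using pV by (auto simp: has_time_value_iff)
  obtain wz where wz: "time_rep \<Omega> T z wz" "AE x in lebesgue_on \<Omega>. wz T x = 0" using zV by (auto simp: has_time_value_iff)
  have uU: "u \<in> U_space \<Omega> T" "is_time_deriv \<Omega> T u (time_deriv \<Omega> T u)" using V_spaceD uV by auto
  have vU: "v \<in> U_space \<Omega> T" "is_time_deriv \<Omega> T v (time_deriv \<Omega> T v)" using V_spaceD vV by auto
  have pU: "p \<in> U_space \<Omega> T" "is_time_deriv \<Omega> T p (time_deriv \<Omega> T p)" using V_spaceD pV by auto
  have zU: "z \<in> U_space \<Omega> T" "is_time_deriv \<Omega> T z (time_deriv \<Omega> T z)" using V_spaceD zV by auto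
  have wL: "w t \<in> L2 \<Omega>" if "time_rep \<Omega> T y w" "t \<in> {0..T}" for y w t
    using that by (auto simp: time_rep_def L2_continuous_on_def)
  define \<tau> where "\<tau> y t = time_deriv \<Omega> T y t (z t) + time_deriv \<Omega> T z t (y t)" for y t
  have dual: "time_deriv \<Omega> T y \<in> Udual_space \<Omega> T" if "is_time_deriv \<Omega> T y (time_deriv \<Omega> T y)" for y
    using that by (simp add: is_time_deriv_def)
  have \<tau>: "integrable ?I (\<tau> y)" "(LINT t|?I. \<tau> y t) = - L2_prod \<Omega> (w 0) (wz 0)"
    if y: "y \<in> U_space \<Omega> T" "is_time_deriv \<Omega> T y (time_deriv \<Omega> T y)" "time_rep \<Omega> T y w" for y w
  proof -
    note i = H10.pairing_measurable(2)[OF dual[OF y(2)] zU(1)] H10.pairing_measurable(2)[OF dual[OF zU(2)] y(1)]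
    show "integrable ?I (\<tau> y)" unfolding \<tau>_def using i by simp
    have "(LINT t|?I. \<tau> y t) = (LINT t|?I. time_deriv \<Omega> T z t (y t)) + (LINT t|?I. time_deriv \<Omega> T y t (z t))"
      unfolding \<tau>_def using i by simp
    also have "\<dots> = (LINT t|?I. indicator {0<..<T} t * time_deriv \<Omega> T z t (y t)) + (LINT t|?I. indicator {0<..<T} t * time_deriv \<Omega> T y t (z t))"
      by (intro arg_cong2[where f = "(+)"] Bochner_Integration.integral_cong[OF refl]) auto
    also have "\<dots> = L2_prod \<Omega> (w T) (wz T) - L2_prod \<Omega> (w 0) (wz 0)"
      by (rule integration_by_parts[OF y zU wz(1) T order_refl])
    also have "L2_prod \<Omega> (w T) (wz T) = L2_prod \<Omega> (w T) (\<lambda>x. 0)"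
    proof (rule L2_prod_AE_eq(2)[OF wL[OF wz(1)] _ wL[OF y(3)] wz(2)])
      show "(\<lambda>x. 0) \<in> L2 \<Omega>" using L2.zero_mem by (simp add: zero_fun_def)
    qed (use T in auto)
    finally show "(LINT t|?I. \<tau> y t) = - L2_prod \<Omega> (w 0) (wz 0)" by (simp add: L2_prod_def)
  qed
  have "L2_prod \<Omega> (wu 0) (wz 0) = L2_prod \<Omega> (wv 0) (wz 0)"
  proof (rule L2_prod_AE_eq(1))
    show "AE x in lebesgue_on \<Omega>. wu 0 x = wv 0 x" using wu(2) wv(2) by eventually_elim simp
  qed (use T in \<open>auto intro: wL wu wv wz\<close>)
  moreover have "L2_prod \<Omega> (wp 0) (wz 0) = L2_prod \<Omega> (\<lambda>x. 0) (wz 0)"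
  proof (rule L2_prod_AE_eq(1)[OF wL[OF wp(1)] _ wL[OF wz(1)] wp(2)])
    show "(\<lambda>x. 0) \<in> L2 \<Omega>" using L2.zero_mem by (simp add: zero_fun_def)
  qed (use T in auto)
  ultimately have \<tau>0: "(LINT t|?I. \<tau> u t - \<tau> v t - \<tau> p t) = 0"
    using \<tau>[OF uU wu(1)] \<tau>[OF vU wv(1)] \<tau>[OF pU wp(1)] by (simp add: L2_prod_def)
  have \<tau>i: "integrable ?I (\<lambda>t. \<tau> u t - \<tau> v t - \<tau> p t)"
    using \<tau>(1)[OF uU wu(1)] \<tau>(1)[OF vU wv(1)] \<tau>(1)[OF pU wp(1)] by simp
  define r where "r = u - v - p"
  note Y = U_space_imp_Y[OF uU(1)] U_space_imp_Y[OF vU(1)] U_space_imp_Y[OF pU(1)]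
  note wY = L2.bochner_L2_diff(1)[OF Y(1,2)]
  have rY: "r \<in> bochner_L2 T (L2 \<Omega>) (L2_norm \<Omega>)"
    unfolding r_def by (intro L2.bochner_L2_diff(1) wY Y)
  note wD = L2.bochner_L2D(3,4)[OF wY] and zD = H10.bochner_L2D(3,4)[OF zU(1)] and rD = L2.bochner_L2D(3,4)[OF rY]
  have main: "AE t in ?I. (L2_norm \<Omega> (r t))\<^sup>2 + (\<tau> u t - \<tau> v t - \<tau> p t)
      \<le> \<eta> * \<bar>L2_norm \<Omega> ((u - v) t) * H1_norm \<Omega> (z t)\<bar>"
    using conjunct1[OF conjunct2[OF uV]] conjunct1[OF conjunct2[OF vV]] conjunct1[OF conjunct2[OF pV]] conjunct1[OF conjunct2[OF zV]]
      H10.bochner_L2D(2)[OF uU(1)] H10.bochner_L2D(2)[OF vU(1)] H10.bochner_L2D(2)[OF pU(1)] H10.bochner_L2D(2)[OF zU(1)] rem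
  proof eventually_elim
    case (elim t)
    note H = elim(5-8)
    note L = H[THEN H10D(1)]
    have rt: "(u - v - p) t = u t - v t - p t" by simp
    note zt = elim(4)[unfolded rt]
    have "(L2_norm \<Omega> (u t - v t - p t))\<^sup>2 + ((time_deriv \<Omega> T u t (z t) + time_deriv \<Omega> T z t (u t))
        - (time_deriv \<Omega> T v t (z t) + time_deriv \<Omega> T z t (v t)) - (time_deriv \<Omega> T p t (z t) + time_deriv \<Omega> T z t (p t)))
      = (LINT x|lebesgue_on \<Omega>. (P0 (v t x) - P0 (u t x) + D (u t x) * (u t x - v t x)) * z t x)"
      by (rule adjoint_pointwise_identity[where P = P and P0 = P0 and D = D and a = a and b = b
            and u = "u t" and v = "v t" and p = "p t" and z = "z t" and f = "\<phi> t (z t)"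
            and gu = "time_deriv \<Omega> T u t" and gv = "time_deriv \<Omega> T v t"
            and gp = "time_deriv \<Omega> T p t" and gz = "time_deriv \<Omega> T z t",
            OF bspec[OF elim(1) H(4)] bspec[OF elim(2) H(4)] bspec[OF elim(3) H(4)]
            bspec[OF zt H(1)] bspec[OF zt H(2)] bspec[OF zt H(3)] L
            L2_comp_lipschitz[OF \<Omega>m P(1,2) L(1)] L2_comp_lipschitz[OF \<Omega>m P0 L(1)] L2_comp_lipschitz[OF \<Omega>m P0 L(2)]
            L2_comp_mult[OF P(3,2) L(1,4)]])
    then have "(L2_norm \<Omega> (r t))\<^sup>2 + (\<tau> u t - \<tau> v t - \<tau> p t)
      = (LINT x|lebesgue_on \<Omega>. (P0 (v t x) - P0 (u t x) + D (u t x) * (u t x - v t x)) * z t x)"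
      by (simp add: r_def \<tau>_def)
    also have "\<dots> \<le> \<eta> * (L2_norm \<Omega> ((u - v) t) * H1_norm \<Omega> (z t))" using elim(9) by linarith
    also have "\<dots> \<le> \<eta> * \<bar>L2_norm \<Omega> ((u - v) t) * H1_norm \<Omega> (z t)\<bar>" by (intro mult_left_mono \<eta>) simp
    finally show ?case .
  qed
  have "(Y_norm \<Omega> T r)\<^sup>2 = (LINT t|?I. (L2_norm \<Omega> (r t))\<^sup>2)"
    by (simp add: bochner_L2_norm_def)
  also have "\<dots> = (LINT t|?I. (L2_norm \<Omega> (r t))\<^sup>2 + (\<tau> u t - \<tau> v t - \<tau> p t))"
    using Bochner_Integration.integral_add[OF rD(2) \<tau>i] \<tau>0 by simp
  also have "\<dots> \<le> (LINT t|?I. \<eta> * \<bar>L2_norm \<Omega> ((u - v) t) * H1_norm \<Omega> (z t)\<bar>)"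
    using Cauchy_Schwarz_integral(1)[OF wD zD]
    by (intro integral_mono_AE main Bochner_Integration.integrable_add[OF rD(2) \<tau>i] integrable_mult_right integrable_abs)
  also have "\<dots> = \<eta> * (LINT t|?I. \<bar>L2_norm \<Omega> ((u - v) t) * H1_norm \<Omega> (z t)\<bar>)" by simp
  also have "\<dots> \<le> \<eta> * (Y_norm \<Omega> T (u - v) * U_norm \<Omega> T z)"
    using Cauchy_Schwarz_integral(2)[OF wD zD] \<eta> by (intro mult_left_mono) (auto simp: bochner_L2_norm_def)
  finally show ?thesis unfolding r_def .
qed

end

section \<open>The tangential cone condition\<close>

theorem mainTheorem4:
  fixes \<Omega> :: "'a::euclidean_space set"
    and T s :: real
    and a b u0 :: "'a \<Rightarrow> real"
    and \<phi> :: "real \<Rightarrow> ('a \<Rightarrow> real) \<Rightarrow> real"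
    and S :: "(real \<Rightarrow> real) \<Rightarrow> real \<Rightarrow> 'a \<Rightarrow> real"
    and S' :: "(real \<Rightarrow> real) \<Rightarrow> (real \<Rightarrow> real) \<Rightarrow> real \<Rightarrow> 'a \<Rightarrow> real"
    and P0 :: "real \<Rightarrow> real"
    and \<rho>X \<rho>V M_S C_f :: real
  assumes dim: "DIM('a) \<in> {1, 2, 3}"
    and domain: "lipschitz_domain \<Omega>" "bounded \<Omega>"
    and T: "T > 0"
    and s: "s > 1"
    and embedding: "continuously_embedded (Hs s) (Hs_norm s) W1inf W1inf_norm"
    and a: "a \<in> Linf \<Omega>" "AE x in lebesgue_on \<Omega>. a x > 0"
    and b: "b \<in> L2 \<Omega>"
    and \<phi>: "\<phi> \<in> Udual_space \<Omega> T"
    and u0: "u0 \<in> L2 \<Omega>"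
    and S_solves: "\<And>P. P \<in> Hs s \<Longrightarrow> solves_state \<Omega> T a b \<phi> u0 P (S P)"
    and S_frechet: "\<And>P. P \<in> Hs s \<Longrightarrow>
      has_frechet_derivative_at (Hs s) (Hs_norm s) (V_space \<Omega> T) (V_norm \<Omega> T) S (S' P) P"
    and S'_solves: "\<And>P \<xi>. P \<in> Hs s \<Longrightarrow> \<xi> \<in> Hs s \<Longrightarrow>
      solves_linearized \<Omega> T a b P (S P) \<xi> (S' P \<xi>)"
    and P0: "P0 \<in> Hs s \<inter> W2inf"
    and constants: "\<rho>X > 0" "\<rho>V > 0" "M_S > 0" "C_f > 0"
    and S'_bound: "\<And>P. P \<in> ball_in (Hs s) (Hs_norm s) P0 \<rho>X \<Longrightarrow>
      op_norm (Hs s) (Hs_norm s) (V_norm \<Omega> T) (S' P) \<le> M_S"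
    and adjoint_exists: "\<And>P u h. P \<in> ball_in (Hs s) (Hs_norm s) P0 \<rho>X \<Longrightarrow>
      u \<in> ball_in (V_space \<Omega> T) (V_norm \<Omega> T) (S P0) \<rho>V \<Longrightarrow> h \<in> Udual_space \<Omega> T \<Longrightarrow>
      \<exists>z. solves_adjoint \<Omega> T a b P u h z"
    and adjoint_bound: "\<And>P u h z z0. P \<in> ball_in (Hs s) (Hs_norm s) P0 \<rho>X \<Longrightarrow>
      u \<in> ball_in (V_space \<Omega> T) (V_norm \<Omega> T) (S P0) \<rho>V \<Longrightarrow> h \<in> Udual_space \<Omega> T \<Longrightarrow>
      solves_adjoint \<Omega> T a b P u h z \<Longrightarrow> has_time_value \<Omega> T z 0 z0 \<Longrightarrow>
      U_norm \<Omega> T z + L2_norm \<Omega> z0 \<le> C_f * Udual_norm \<Omega> T h"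
  shows "\<exists>R0>0. \<forall>R. 0 < R \<and> R \<le> R0 \<longrightarrow>
    (\<exists>C_tc<1. \<forall>P \<in> ball_in (Hs s) (Hs_norm s) P0 R.
      Y_norm \<Omega> T (S P - S P0 - S' P (P - P0)) \<le> C_tc * Y_norm \<Omega> T (S P - S P0))"
  proof -
  have \<Omega>_open: "open \<Omega>" using domain(1) by (simp add: lipschitz_domain_def)
  interpret evolution_domain \<Omega> T by standard (rule \<Omega>_open)
  have \<Omega>m: "\<Omega> \<in> lmeasurable" by (rule lmeasurable_open[OF domain(2) \<Omega>_open])
  have P0H: "P0 \<in> Hs s" using P0 by simp
  obtain K where K: "K \<ge> 0" "\<And>f. f \<in> Hs s \<Longrightarrow> f \<in> W1inf" "\<And>f. f \<in> Hs s \<Longrightarrow> W1inf_norm f \<le> K * Hs_norm s f"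
    using W1inf_norm_nonneg_bound[OF embedding] by metis
  have deriv_bound: "\<bar>D x\<bar> \<le> K * Hs_norm s f"
    if "f \<in> Hs s" "\<And>x. (f has_real_derivative D x) (at x)" "continuous_on UNIV D" for f D x
    by (rule order_trans[OF C1_deriv_le_W1inf_norm[OF K(2)[OF that(1)] that(2,3)] K(3)[OF that(1)]])
  obtain D0 where D0: "\<And>x. (P0 has_real_derivative D0 x) (at x)" "continuous_on UNIV D0"
      "\<And>\<epsilon>. \<epsilon> > 0 \<Longrightarrow> \<exists>L. \<forall>x y. \<bar>D0 x - D0 y\<bar> \<le> \<epsilon> + L * \<bar>x - y\<bar>"
    using Hs_imp_C1[OF s embedding P0H] by metis
  define M where "M = K * Hs_norm s P0"
  have M: "\<And>x. \<bar>D0 x\<bar> \<le> M" unfolding M_def by (rule deriv_bound[OF P0H D0(1,2)])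
  then have M0: "M \<ge> 0" by (rule order_trans[OF abs_ge_zero])
  \<comment> \<open>\<open>\<eta> * C_f = 1/2\<close> will be the constant of the cone condition. The three terms
    \<open>\<kappa>\<close>, \<open>2 * \<epsilon>\<close> and \<open>2 * M * \<epsilon>'\<close> of \<open>remainder_pairing_bound\<close> get a third of
    \<open>\<eta>\<close> each.\<close>
  define \<eta> where "\<eta> = 1 / (2 * C_f)"
  have \<eta>: "\<eta> > 0" using constants by (simp add: \<eta>_def)
  define \<epsilon> where "\<epsilon> = \<eta> / 6"
  have \<epsilon>: "\<epsilon> > 0" using \<eta> by (simp add: \<epsilon>_def)
  obtain L where L: "L \<ge> 0" "\<And>x y. \<bar>D0 x - D0 y\<bar> \<le> \<epsilon> + L * \<bar>x - y\<bar>"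
  proof -
    obtain L' where L': "\<And>x y. \<bar>D0 x - D0 y\<bar> \<le> \<epsilon> + L' * \<bar>x - y\<bar>" using D0(3)[OF \<epsilon>] by blast
    have "\<bar>D0 x - D0 y\<bar> \<le> \<epsilon> + \<bar>L'\<bar> * \<bar>x - y\<bar>" for x y
      using L'[of x y] mult_right_mono[OF abs_ge_self[of L'] abs_ge_zero[of "x - y"]] by linarith
    then show ?thesis by (intro that[of "\<bar>L'\<bar>"]) auto
  qed
  define \<delta> where "\<delta> = \<epsilon> / (L + 1)"
  have \<delta>: "\<delta> > 0" "L * \<delta> \<le> \<epsilon>" using L(1) \<epsilon> by (simp_all add: \<delta>_def field_simps)
  define \<epsilon>' where "\<epsilon>' = \<eta> / (6 * (M + 1))"
  have \<epsilon>': "\<epsilon>' > 0" "2 * M * \<epsilon>' \<le> \<eta> / 3" using M0 \<eta> by (simp_all add: \<epsilon>'_def field_simps)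
  obtain \<mu> where \<mu>: "\<mu> > 0" "\<And>z E. z \<in> H10 \<Omega> \<Longrightarrow> E \<in> sets lebesgue \<Longrightarrow> emeasure lebesgue E \<le> ennreal \<mu> \<Longrightarrow>
      L2_norm \<Omega> (\<lambda>x. indicator E x * z x) \<le> \<epsilon>' * H1_norm \<Omega> z"
    using H10_uniformly_integrable[OF \<Omega>_open \<epsilon>'(1)] by metis
  \<comment> \<open>Differentiability at \<open>P0\<close> alone makes \<open>S\<close> Lipschitz at \<open>P0\<close>, with constant \<open>c\<close>.\<close>
  obtain K1 \<delta>1 where K1: "\<And>h. h \<in> Hs s \<Longrightarrow> S' P0 h \<in> V_space \<Omega> T" "\<And>h. h \<in> Hs s \<Longrightarrow> V_norm \<Omega> T (S' P0 h) \<le> K1 * Hs_norm s h"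
      and \<delta>1: "\<delta>1 > 0" "\<And>h. h \<in> Hs s \<Longrightarrow> Hs_norm s h < \<delta>1 \<Longrightarrow> V_norm \<Omega> T (S (P0 + h) - S P0 - S' P0 h) \<le> 1 * Hs_norm s h"
  proof -
    note F = S_frechet[OF P0H, unfolded has_frechet_derivative_at_def bounded_linear_between_def]
    obtain K1 where "\<forall>h\<in>Hs s. V_norm \<Omega> T (S' P0 h) \<le> K1 * Hs_norm s h" using F by blast
    moreover obtain \<delta>1 where "\<delta>1 > 0" "\<forall>h\<in>Hs s. Hs_norm s h < \<delta>1 \<longrightarrow> V_norm \<Omega> T (S (P0 + h) - S P0 - S' P0 h) \<le> 1 * Hs_norm s h"
      using F zero_less_one by blast
    ultimately show ?thesis using F by (intro that[of K1 \<delta>1]) blast+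
  qed
  define c where "c = 1 + \<bar>K1\<bar>"
  have c: "c > 0" by (simp add: c_def)
  \<comment> \<open>The minimum keeps \<open>S P\<close> in the ball where the adjoint estimate holds, and the set where
    \<open>S P - S P0\<close> exceeds \<open>\<delta>\<close> below measure \<open>\<mu>\<close> at every time.\<close>
  define \<sigma> where "\<sigma> = min \<rho>V (\<delta> * sqrt \<mu>)"
  have \<sigma>: "\<sigma> > 0" using constants \<delta> \<mu> by (simp add: \<sigma>_def)
  define R0 where "R0 = min (min \<rho>X \<delta>1) (min (\<sigma> / c) (\<eta> / (3 * (K + 1))))"
  have R0: "R0 > 0" using constants \<delta>1 \<sigma> c \<eta> K(1) by (simp add: R0_def)
  have tcc: "Y_norm \<Omega> T (S P - S P0 - S' P (P - P0)) \<le> 1 / 2 * Y_norm \<Omega> T (S P - S P0)"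
    if P: "P \<in> Hs s" "Hs_norm s (P - P0) < R0" for P
  proof -
    define n where "n = Hs_norm s (P - P0)"
    have hH: "P - P0 \<in> Hs s" by (rule Hs_diff[OF s P(1) P0H])
    have n: "0 \<le> n" "n < \<rho>X" "n < \<delta>1" "n < \<sigma> / c" "n < \<eta> / (3 * (K + 1))"
      using P(2) Hs_norm_nonneg[OF hH] by (simp_all add: n_def R0_def)
    define u where "u = S P"
    define v where "v = S P0"
    define p where "p = S' P (P - P0)"
    have uS: "solves_state \<Omega> T a b \<phi> u0 P u" and vS: "solves_state \<Omega> T a b \<phi> u0 P0 v"
      and pS: "solves_linearized \<Omega> T a b P u (P - P0) p"
      unfolding u_def v_def p_def by (intro S_solves S'_solves P(1) P0H hH)+
    have uV: "u \<in> V_space \<Omega> T" and vV: "v \<in> V_space \<Omega> T" and pV: "p \<in> V_space \<Omega> T"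
      using uS vS pS by (auto simp: solves_state_def solves_linearized_def)
    have wV: "u - v \<in> V_space \<Omega> T" by (rule V_diff(1)[OF uV vV])
    have "V_norm \<Omega> T (u - v) \<le> V_norm \<Omega> T (u - v - S' P0 (P - P0)) + V_norm \<Omega> T (S' P0 (P - P0))"
      by (rule V_diff(2)[OF wV K1(1)[OF hH]])
    also have "\<dots> \<le> 1 * n + K1 * n"
      using \<delta>1(2)[OF hH] K1(2)[OF hH] n(3) by (intro add_mono) (simp_all add: n_def u_def v_def)
    also have "\<dots> \<le> c * n" using n(1) by (simp add: c_def distrib_right mult_right_mono)
    also have "\<dots> < \<sigma>" using n(4) c by (simp add: field_simps)
    finally have w: "V_norm \<Omega> T (u - v) < \<sigma>" .
    obtain D where D: "\<And>x. (P has_real_derivative D x) (at x)" "continuous_on UNIV D"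
      using Hs_imp_C1[OF s embedding P(1)] by metis
    have \<kappa>: "\<bar>D x - D0 x\<bar> \<le> K * n" for x
      unfolding n_def
    proof (rule deriv_bound[where D = "\<lambda>x. D x - D0 x", OF hH])
      show "((P - P0) has_real_derivative D x - D0 x) (at x)" for x
        using DERIV_diff[OF D(1) D0(1)] by (simp add: fun_diff_def)
      show "continuous_on UNIV (\<lambda>x. D x - D0 x)" by (intro continuous_on_diff D(2) D0(2))
    qed
    have Kn: "K * n \<le> \<eta> / 3"
    proof -
      have "K * n \<le> K * (\<eta> / (3 * (K + 1)))" using n(5) K(1) by (intro mult_left_mono) auto
      also have "\<dots> \<le> \<eta> / 3" using K(1) \<eta> by (simp add: field_simps)
      finally show ?thesis .
    qed
    have rY: "u - v - p \<in> bochner_L2 T (L2 \<Omega>) (L2_norm \<Omega>)"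
      by (intro L2.bochner_L2_diff(1) U_space_imp_Y V_spaceD(1) uV vV pV)
    have Pball: "P \<in> ball_in (Hs s) (Hs_norm s) P0 \<rho>X" using P(1) n(2) by (simp add: ball_in_def n_def)
    have uball: "u \<in> ball_in (V_space \<Omega> T) (V_norm \<Omega> T) (S P0) \<rho>V"
      using uV w by (simp add: ball_in_def \<sigma>_def v_def)
    obtain z where z: "solves_adjoint \<Omega> T a b P u (\<lambda>t. L2_prod \<Omega> ((u - v - p) t)) z"
      using adjoint_exists[OF Pball uball L2_source(1)[OF rY]] by blast
    have zV: "z \<in> V_space \<Omega> T" using z by (simp add: solves_adjoint_def)
    obtain wz where wz: "time_rep \<Omega> T z wz" using z by (auto simp: solves_adjoint_def has_time_value_iff)
    have "has_time_value \<Omega> T z 0 (wz 0)" using wz by (auto simp: has_time_value_iff)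
    from adjoint_bound[OF Pball uball L2_source(1)[OF rY] z this]
    have "U_norm \<Omega> T z \<le> C_f * Udual_norm \<Omega> T (\<lambda>t. L2_prod \<Omega> ((u - v - p) t))"
      using L2_norm_nonneg[of \<Omega> "wz 0"] by linarith
    also have "\<dots> \<le> C_f * Y_norm \<Omega> T (u - v - p)"
      using constants(4) by (intro mult_left_mono L2_source(2)[OF rY]) simp
    finally have zb: "U_norm \<Omega> T z \<le> C_f * Y_norm \<Omega> T (u - v - p)" .
    obtain wu wv where wu: "time_rep \<Omega> T u wu" "AE x in lebesgue_on \<Omega>. wu 0 x = u0 x"
      and wv: "time_rep \<Omega> T v wv" "AE x in lebesgue_on \<Omega>. wv 0 x = u0 x"
      using uS vS by (auto simp: solves_state_def has_time_value_iff)
    note wr = time_rep_diff[OF wu(1) wv(1)]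
    have w0: "AE x in lebesgue_on \<Omega>. (wu - wv) 0 x = 0" using wu(2) wv(2) by eventually_elim simp
    have rem: "AE t in lebesgue_on {0<..<T}.
      \<bar>LINT x|lebesgue_on \<Omega>. (P0 (v t x) - P0 (u t x) + D (u t x) * (u t x - v t x)) * z t x\<bar>
        \<le> \<eta> * (L2_norm \<Omega> ((u - v) t) * H1_norm \<Omega> (z t))"
      using H10.bochner_L2D(2)[OF V_spaceD(1)[OF uV]] H10.bochner_L2D(2)[OF V_spaceD(1)[OF vV]]
        H10.bochner_L2D(2)[OF V_spaceD(1)[OF zV]] time_rep_prod[OF V_spaceD(1)[OF wV] wr] AE_space
    proof eventually_elim
      case (elim t)
      have t: "0 < t" "t \<le> T" using elim(5) by auto
      have "L2_norm \<Omega> ((u - v) t) = L2_norm \<Omega> ((wu - wv) t)" using elim(4) L2.zero_mem[of \<Omega>] by metis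
      also have "\<dots> \<le> V_norm \<Omega> T (u - v)" by (rule L2_norm_le_V_norm[OF wV wr w0 t])
      also have "\<dots> \<le> \<delta> * sqrt \<mu>" using w by (simp add: \<sigma>_def)
      finally have "L2_norm \<Omega> (u t - v t) / \<delta> \<le> sqrt \<mu>" using \<delta>(1) by (simp add: field_simps)
      then have "(L2_norm \<Omega> (u t - v t) / \<delta>)\<^sup>2 \<le> (sqrt \<mu>)\<^sup>2"
        using \<delta>(1) L2_norm_nonneg[of \<Omega> "u t - v t"] by (intro power_mono) auto
      then have s: "(L2_norm \<Omega> (u t - v t) / \<delta>)\<^sup>2 \<le> \<mu>" using \<mu>(1) by simp
      have "\<bar>LINT x|lebesgue_on \<Omega>. (P0 (v t x) - P0 (u t x) + D (u t x) * (u t x - v t x)) * z t x\<bar>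
        \<le> (K * n + 2 * \<epsilon> + 2 * M * \<epsilon>') * (L2_norm \<Omega> (u t - v t) * H1_norm \<Omega> (z t))"
        using K(1) n(1) \<epsilon>
        by (intro remainder_pairing_bound[OF D0(1) M L(2) \<delta>(2) L(1) \<kappa> _ _ \<delta>(1) \<mu>(2)[OF elim(3)]
              H10D(1)[OF elim(1)] H10D(1)[OF elim(2)] elim(3) s]) auto
      also have "\<dots> \<le> \<eta> * (L2_norm \<Omega> (u t - v t) * H1_norm \<Omega> (z t))"
      proof (rule mult_right_mono)
        show "K * n + 2 * \<epsilon> + 2 * M * \<epsilon>' \<le> \<eta>" using Kn \<epsilon>'(2) by (simp add: \<epsilon>_def)
        show "0 \<le> L2_norm \<Omega> (u t - v t) * H1_norm \<Omega> (z t)"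
          by (intro mult_nonneg_nonneg L2_norm_nonneg H10.N_nonneg elim(3))
      qed
      finally show ?case by simp
    qed
    have "(Y_norm \<Omega> T (u - v - p))\<^sup>2 \<le> \<eta> * (Y_norm \<Omega> T (u - v) * U_norm \<Omega> T z)"
      by (rule linearization_error_bound[OF T \<Omega>m D(1) deriv_bound[OF P(1) D] D(2) D0(1) M uS vS pS z rem less_imp_le[OF \<eta>]])
    also have "\<dots> \<le> \<eta> * (Y_norm \<Omega> T (u - v) * (C_f * Y_norm \<Omega> T (u - v - p)))"
      using \<eta> zb by (intro mult_left_mono) (simp_all add: bochner_L2_norm_def)
    also have "\<dots> = (1 / 2 * Y_norm \<Omega> T (u - v)) * Y_norm \<Omega> T (u - v - p)"
      using constants(4) by (simp add: \<eta>_def)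
    finally have sq: "Y_norm \<Omega> T (u - v - p) * Y_norm \<Omega> T (u - v - p)
      \<le> (1 / 2 * Y_norm \<Omega> T (u - v)) * Y_norm \<Omega> T (u - v - p)"
      by (simp add: power2_eq_square)
    have nonneg: "0 \<le> Y_norm \<Omega> T y" for y :: "real \<Rightarrow> 'a \<Rightarrow> real" by (simp add: bochner_L2_norm_def)
    have "Y_norm \<Omega> T (u - v - p) \<le> 1 / 2 * Y_norm \<Omega> T (u - v)"
    proof (cases "Y_norm \<Omega> T (u - v - p) = 0")
      case True
      then show "Y_norm \<Omega> T (u - v - p) \<le> 1 / 2 * Y_norm \<Omega> T (u - v)" using nonneg[of "u - v"] by simp
    next
      case False
      then have "0 < Y_norm \<Omega> T (u - v - p)" using nonneg[of "u - v - p"] by linarith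
      with sq show "Y_norm \<Omega> T (u - v - p) \<le> 1 / 2 * Y_norm \<Omega> T (u - v)" by (rule mult_right_le_imp_le)
    qed
    then show ?thesis by (simp only: u_def v_def p_def)
  qed
  show ?thesis
  proof (rule exI[of _ R0], intro conjI R0 allI impI)
    fix R assume "0 < R \<and> R \<le> R0"
    then show "\<exists>C_tc<1. \<forall>P \<in> ball_in (Hs s) (Hs_norm s) P0 R.
      Y_norm \<Omega> T (S P - S P0 - S' P (P - P0)) \<le> C_tc * Y_norm \<Omega> T (S P - S P0)"
      using tcc by (intro exI[of _ "1 / 2"]) (auto simp: ball_in_def)
  qed
qed

end
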